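(* Let $L>0$ with $L\notin\mathcal N$, where $\mathcal N=\left\{2\pi\sqrt{\frac{k^2+kl+l^2}{3}}:\ k,l\in\mathbb N,\ k,l\ge 1\right\}$. For $T>0$, $y_0\in L^2(0,L)$ and $u\in L^2(0,T)$, let $y\in X_T$ denote the unique weak solution of the linearized KdV control system $$ \begin{cases} y_t+y_x+y_{xxx}=0 & \text{in }(0,T)\times(0,L),\\ y(\cdot,0)=y(\cdot,L)=0 & \text{in }(0,T),\\ y_x(\cdot,L)=u & \text{in }(0,T),\\ y(0,\cdot)=y_0 & \text{in }(0,L). \end{cases} $$ Then the following hold. (a) For every $T_0>0$ there exist positive constants $c_1,C_1$ depending only on $L$ and $T_0$ such that for every $0<T<T_0$ and every $y_0\in L^2(0,L)$ there exists $u\in L^2(0,T)$ such that $y(T,\cdot)=0$ and $$\|u\|_{L^2(0,T)}\le C_1e^{\frac{c_1}{T^{1/2}}}\|y_0\|_{L^2(0,L)}.$$ (b) If $T_0>0$ is sufficiently small (the smallness depending only on $L$), then there exist positive constants $c_2,C_2$ depending only on $L$ and $T_0$ such that for every $0<T<T_0$ there exists $y_0\in H^1_0(0,L)$, $y_0\neq 0$, with the following property: every $u\in L^2(0,T)$ for which $y(T,\cdot)=0$ satisfies $$\|u\|_{L^2(0,T)}\ge C_2e^{\frac{c_2}{T^{1/2}}}\|y_0\|_{L^2(0,L)}.$$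
   Context: $X_T=C([0,T];L^2(0,L))\cap L^2((0,T);H^1_0(0,L))$, with norm $\|y\|_{X_T}=\|y\|_{C([0,T];L^2(0,L))}+\|y\|_{L^2((0,T);H^1(0,L))}$. A weak solution $y\in X_T$ of the system is understood in the usual (transposition) sense: for every $\phi\in C^3([0,T]\times[0,L])$ with $\phi(\cdot,0)=\phi(\cdot,L)=\phi_x(\cdot,0)=0$ on $[0,T]$ and $\phi(T,\cdot)=0$, $$-\int_0^T\!\!\int_0^L y(\phi_t+\phi_x+\phi_{xxx})\,dx\,dt-\int_0^L y_0(x)\phi(0,x)\,dx-\int_0^T u(t)\phi_x(t,L)\,dt=0.$$ It is known that for all $y_0\in L^2(0,L)$ and $u\in L^2(0,T)$ there is a unique weak solution $y\in X_T$. *)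

theory Defs
  imports "HOL-Analysis.Analysis"
begin

text \<open>
  Elements of \<open>L\<^sup>2\<close> and of the Sobolev spaces are represented by functions on the whole real line.
  Only the values on the indicated set matter, and only up to null sets.
\<close>

definition L2 :: "real set \<Rightarrow> (real \<Rightarrow> real) set" where
  "L2 S = {f \<in> borel_measurable (lebesgue_on S). integrable (lebesgue_on S) (\<lambda>x. (f x)\<^sup>2)}"

definition L2_norm :: "real set \<Rightarrow> (real \<Rightarrow> real) \<Rightarrow> real" where
  "L2_norm S f = sqrt (LINT x|lebesgue_on S. (f x)\<^sup>2)"

text \<open>The test functions \<open>C\<^sub>c\<^sup>\<infinity>(0,L)\<close>, extended by zero.\<close>

definition test_functions :: "real \<Rightarrow> (real \<Rightarrow> real) set" where
  "test_functions L =
     {\<phi>. (\<forall>n. (deriv ^^ n) \<phi> differentiable_on UNIV) \<and> closure {x. \<phi> x \<noteq> 0} \<subseteq> {0<..<L}}"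

definition is_weak_deriv :: "real \<Rightarrow> (real \<Rightarrow> real) \<Rightarrow> (real \<Rightarrow> real) \<Rightarrow> bool" where
  "is_weak_deriv L f g \<longleftrightarrow>
     (\<forall>\<phi>\<in>test_functions L.
        (LINT x|lebesgue_on {0<..<L}. f x * deriv \<phi> x) =
        - (LINT x|lebesgue_on {0<..<L}. g x * \<phi> x))"

definition H1 :: "real \<Rightarrow> (real \<Rightarrow> real) set" where
  "H1 L = {f \<in> L2 {0<..<L}. \<exists>g\<in>L2 {0<..<L}. is_weak_deriv L f g}"

text \<open>Weak derivatives are unique almost everywhere, so the choice does not affect norms.\<close>

definition weak_deriv :: "real \<Rightarrow> (real \<Rightarrow> real) \<Rightarrow> real \<Rightarrow> real" where
  "weak_deriv L f = (SOME g. g \<in> L2 {0<..<L} \<and> is_weak_deriv L f g)"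

definition H1_norm :: "real \<Rightarrow> (real \<Rightarrow> real) \<Rightarrow> real" where
  "H1_norm L f = sqrt ((L2_norm {0<..<L} f)\<^sup>2 + (L2_norm {0<..<L} (weak_deriv L f))\<^sup>2)"

text \<open>\<open>H\<^sup>1\<^sub>0(0,L)\<close> is the closure of the test functions in \<open>H\<^sup>1(0,L)\<close>.\<close>

definition H10 :: "real \<Rightarrow> (real \<Rightarrow> real) set" where
  "H10 L = {f \<in> H1 L. \<forall>\<epsilon>>0. \<exists>\<phi>\<in>test_functions L. H1_norm L (\<lambda>x. f x - \<phi> x) < \<epsilon>}"

text \<open>
  \<open>X\<^sub>T = C([0,T]; L\<^sup>2(0,L)) \<inter> L\<^sup>2((0,T); H\<^sup>1\<^sub>0(0,L))\<close>, where \<open>y t\<close> represents the state at time \<open>t\<close>.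
  No measurability of \<open>y\<close> in \<open>(t,x)\<close> jointly is imposed: the representatives at different times are
  chosen independently. Continuity into \<open>L\<^sup>2(0,L)\<close> already makes \<open>t \<mapsto> y t\<close> strongly measurable,
  also as an \<open>H\<^sup>1\<^sub>0(0,L)\<close>-valued map.
\<close>

definition XT :: "real \<Rightarrow> real \<Rightarrow> (real \<Rightarrow> real \<Rightarrow> real) set" where
  "XT L T = {y.
     (\<forall>t\<in>{0..T}. y t \<in> L2 {0<..<L}) \<and>
     (\<forall>s\<in>{0..T}. ((\<lambda>t. L2_norm {0<..<L} (\<lambda>x. y t x - y s x)) \<longlongrightarrow> 0) (at s within {0..T})) \<and>
     (AE t in lebesgue_on {0<..<T}. y t \<in> H10 L) \<and>
     integrable (lebesgue_on {0<..<T}) (\<lambda>t. (H1_norm L (y t))\<^sup>2)}"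

text \<open>Partial derivatives on \<open>[0,T] \<times> [0,L]\<close>, one-sided on the boundary.\<close>

definition Dt :: "real \<Rightarrow> (real \<Rightarrow> real \<Rightarrow> real) \<Rightarrow> real \<Rightarrow> real \<Rightarrow> real" where
  "Dt T \<phi> t x = vector_derivative (\<lambda>s. \<phi> s x) (at t within {0..T})"

definition Dx :: "real \<Rightarrow> (real \<Rightarrow> real \<Rightarrow> real) \<Rightarrow> real \<Rightarrow> real \<Rightarrow> real" where
  "Dx L \<phi> t x = vector_derivative (\<phi> t) (at x within {0..L})"

text \<open>The functions of class \<open>C\<^sup>k\<close> on \<open>[0,T] \<times> [0,L]\<close>.\<close>

fun Ck_on_rect :: "nat \<Rightarrow> real \<Rightarrow> real \<Rightarrow> (real \<Rightarrow> real \<Rightarrow> real) \<Rightarrow> bool" where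
  "Ck_on_rect 0 T L \<phi> \<longleftrightarrow> continuous_on ({0..T} \<times> {0..L}) (\<lambda>(t, x). \<phi> t x)"
| "Ck_on_rect (Suc k) T L \<phi> \<longleftrightarrow>
     continuous_on ({0..T} \<times> {0..L}) (\<lambda>(t, x). \<phi> t x) \<and>
     (\<forall>t\<in>{0..T}. \<forall>x\<in>{0..L}.
        (\<lambda>s. \<phi> s x) differentiable (at t within {0..T}) \<and>
        \<phi> t differentiable (at x within {0..L})) \<and>
     Ck_on_rect k T L (Dt T \<phi>) \<and> Ck_on_rect k T L (Dx L \<phi>)"

text \<open>
  The weak (transposition) solutions of \<open>y\<^sub>t + y\<^sub>x + y\<^sub>x\<^sub>x\<^sub>x = 0\<close> with \<open>y(\<cdot>,0) = y(\<cdot>,L) = 0\<close>,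
  \<open>y\<^sub>x(\<cdot>,L) = u\<close> and \<open>y(0,\<cdot>) = y\<^sub>0\<close>. The time integrand of the first term is continuous on \<open>[0,T]\<close>
  for \<open>y \<in> XT L T\<close>, so the iterated integral is meaningful without joint measurability of \<open>y\<close>.
\<close>

definition kdv_weak_solution ::
  "real \<Rightarrow> real \<Rightarrow> (real \<Rightarrow> real) \<Rightarrow> (real \<Rightarrow> real) \<Rightarrow> (real \<Rightarrow> real \<Rightarrow> real) \<Rightarrow> bool" where
  "kdv_weak_solution L T y0 u y \<longleftrightarrow>
     y \<in> XT L T \<and>
     (\<forall>\<phi>. Ck_on_rect 3 T L \<phi> \<and>
          (\<forall>t\<in>{0..T}. \<phi> t 0 = 0 \<and> \<phi> t L = 0 \<and> Dx L \<phi> t 0 = 0) \<and>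
          (\<forall>x\<in>{0..L}. \<phi> T x = 0) \<longrightarrow>
        - (LINT t|lebesgue_on {0<..<T}. LINT x|lebesgue_on {0<..<L}.
             y t x * (Dt T \<phi> t x + Dx L \<phi> t x + Dx L (Dx L (Dx L \<phi>)) t x))
        - (LINT x|lebesgue_on {0<..<L}. y0 x * \<phi> 0 x)
        - (LINT t|lebesgue_on {0<..<T}. u t * Dx L \<phi> t L) = 0)"

definition critical_lengths :: "real set" where
  "critical_lengths =
     {2 * pi * sqrt ((real k ^ 2 + real k * real l + real l ^ 2) / 3) | k l :: nat. k \<ge> 1 \<and> l \<ge> 1}"

end

theory Submission
  imports Defs "HOL-Complex_Analysis.Complex_Analysis"
begin

text \<open>
  Both parts use smooth solutions of \<open>p\<^sub>t + p\<^sub>x + p\<^sub>x\<^sub>x\<^sub>x = 0\<close> that vanish at \<open>x = 0, L\<close>, without a condition on \<open>p\<^sub>x\<close>: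
  the traces \<open>p\<^sub>x(\<cdot>,0)\<close> and \<open>p\<^sub>x(\<cdot>,L)\<close> enter the duality identity symmetrically, and the skew-adjoint boundary
  conditions \<open>w(0) = w(L) = 0\<close>, \<open>w'(0) = w'(L)\<close> become available.

  Part (a). Observability of \<open>p(0)\<close> by both traces costs \<open>e\<^sup>c\<^sup>/\<^sup>\<surd>\<^sup>T\<close>: test \<open>p(\<tau>)\<close> with solutions of \<open>W''' + W' + sW = 0\<close>,
  \<open>W(0) = W(L) = 0\<close>. For \<open>Re s\<close> of order \<open>T\<^sup>-\<^sup>3\<^sup>/\<^sup>2\<close> the past is damped by \<open>e\<^sup>-\<^sup>s\<^sup>\<tau>\<close>; three circles carry the bound to the
  imaginary axis, where \<open>W\<close> yields the low eigenfunctions of the skew-adjoint problem (nondegenerate because the length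
  is not critical); the high modes are absorbed by Kato smoothing. Riesz' theorem then provides two
  controls \<open>(u,v)\<close>, one per trace. The weak solution driven by \<open>u\<close> alone has its own trace at \<open>x = 0\<close>, and it vanishes at
  time \<open>T\<close> because the pairs \<open>(p(T), p\<^sub>x(\<cdot>,0))\<close> are dense, by Liouville's theorem for a Laplace transform.

  Part (b). Combine \<open>M + 1\<close> eigenfunctions, with eigenvalues \<open>O(M\<^sup>3)\<close>, so that the common trace at both ends vanishes to
  order \<open>M\<close> at \<open>t = 0\<close>. For \<open>M\<close> of order \<open>T\<^sup>-\<^sup>1\<^sup>/\<^sup>2\<close> the Taylor remainder \<open>(C M\<^sup>2 T)\<^sup>M\<close> is exponentially small, and
  duality forces a large control. Weak solutions are unique by the same Liouville argument.
\<close>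

section \<open>Solutions of the characteristic equation\<close>

text \<open>The exponent T^(-1/2) comes from a balance. At spectral size |s| = y^3 the solutions
  \<open>Wk\<close> are bounded by e^(C y), the scaling of a third-order equation, while data at
  time 0 are damped by e^(-c y^3 T). With y = k / sqrt T the two exponents are C k / sqrt T and c
  k^3 / sqrt T, so a large fixed k makes the damping win, at the price e^(k^3 / sqrt T). The lower
  bound meets the same scaling: frequencies of size M^3 turn the Taylor remainder into (C M^3 T)^M /
  M!, that is (C M^2 T)^M. With w'(L) = 0 as third boundary condition the generator is not
  skew-adjoint and its eigenfunctions are not orthogonal. Leaving both traces free allows an
  orthonormal family instead. The obstacle is then that this family lives at imaginary s, where
  nothing is damped. Interpolating one entire function of s, the pairing of the state with
  \<open>Wk\<close>, bridges the gap. Continuous functions are kept wherever possible;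
  square-integrable limits enter only through Riesz representation and through weak
  solutions.\<close>

definition eser :: "(nat => complex) => complex => complex" where
  "eser a z = (\<Sum>m. a m / fact m * z ^ m)"

lemma exp_bound_summable:
  fixes c :: "nat => complex"
  assumes "!!m. norm (c m) <= C * r ^ m"
  shows "summable (%m. norm (c m / fact m))" "norm (\<Sum>m. c m / fact m) <= C * exp r"
proof -
  have s: "(%m. C * (r ^ m /\<^sub>R fact m)) sums (C * exp r)"
    by (intro sums_mult exp_converges)
  have b: "norm (norm (c m / fact m)) <= C * (r ^ m /\<^sub>R fact m)" for m
    using assms[of m] by (simp add: norm_divide divide_simps)
  show 1: "summable (%m. norm (c m / fact m))"
    by (rule summable_comparison_test'[OF sums_summable[OF s]]) (use b in simp)
  have "norm (\<Sum>m. c m / fact m) <= (\<Sum>m. norm (c m / fact m))"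
    by (rule summable_norm[OF 1])
  also have "\<dots> <= (\<Sum>m. C * (r ^ m /\<^sub>R fact m))"
    by (rule suminf_le) (use b 1 sums_summable[OF s] in \<open>auto simp: real_norm_def\<close>)
  also have "\<dots> = C * exp r" using s by (simp add: sums_iff)
  finally show "norm (\<Sum>m. c m / fact m) <= C * exp r" .
qed

lemma eser_term_bound:
  fixes a :: "nat => complex"
  assumes "!!m. norm (a m) <= C * r ^ m"
  shows "norm (a m * z ^ m) <= C * (r * norm z) ^ m"
proof -
  have "norm (a m) * norm z ^ m <= (C * r ^ m) * norm z ^ m"
    using assms by (intro mult_right_mono) auto
  then show ?thesis by (simp add: norm_mult norm_power power_mult_distrib mult_ac)
qed

lemma eser_summable:
  fixes a :: "nat => complex"
  assumes "!!m. norm (a m) <= C * r ^ m"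
  shows "summable (%m. a m / fact m * z ^ m)"
  using summable_norm_cancel[OF exp_bound_summable(1)[OF eser_term_bound[OF assms]]]
  by (simp add: mult_ac)

lemma eser_bound:
  assumes "!!m. norm (a m) <= C * r ^ m"
  shows "norm (eser a z) <= C * exp (r * norm z)"
  using exp_bound_summable(2)[OF eser_term_bound[OF assms], of z]
  by (simp add: eser_def mult_ac)

lemma eser_deriv:
  assumes "!!m. norm (a m) <= C * r ^ m"
  shows "(eser a has_field_derivative eser (%m. a (Suc m)) z) (at z)"
proof -
  have "((%z. \<Sum>m. a m / fact m * z ^ m) has_field_derivative
      (\<Sum>m. diffs (%m. a m / fact m) m * z ^ m)) (at z)"
    by (rule termdiffs_strong_converges_everywhere) (rule eser_summable[OF assms])
  moreover have "diffs (%m. a m / fact m) = (%m. a (Suc m) / fact m)"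
    by (auto simp: diffs_def fun_eq_iff divide_simps simp del: of_nat_Suc)
  ultimately show ?thesis by (simp add: eser_def[abs_def])
qed

lemma eser_0 [simp]: "eser a 0 = a 0"
proof -
  have "(%m. a m / fact m * 0 ^ m) = (%m. if m = 0 then a 0 else 0)" by auto
  then show ?thesis unfolding eser_def using sums_single[of 0 "%_. a 0"] by (simp add: sums_iff)
qed

lemma eser_add:
  assumes "!!m. norm (a m) <= C * r ^ m" "!!m. norm (b m) <= D * s ^ m"
  shows "eser (%m. u * a m + v * b m) z = u * eser a z + v * eser b z"
proof -
  have 1: "summable (%m. a m / fact m * z ^ m)" "summable (%m. b m / fact m * z ^ m)"
    by (rule eser_summable[OF assms(1)], rule eser_summable[OF assms(2)])
  show ?thesis unfolding eser_def
    using sums_unique[OF sums_add[OF sums_mult[OF summable_sums[OF 1(1)], of u]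
        sums_mult[OF summable_sums[OF 1(2)], of v]], symmetric]
    by (simp add: field_simps)
qed

lemma eser_power: "eser (%m. r ^ m) z = exp (r * z)"
  by (simp add: eser_def exp_def scaleR_conv_of_real power_mult_distrib divide_simps mult_ac)

text \<open>Derivatives at 0 of the solution with Cauchy data (0, 0, 1): the recurrence is the
  equation differentiated m times. Using these polynomials in \<open>p\<close> instead of
  exponentials of the characteristic roots makes holomorphy in \<open>p\<close> immediate and treats
  multiple roots without a case distinction.\<close>

fun gcoef :: "complex => nat => complex" where
  "gcoef p 0 = 0"
| "gcoef p (Suc 0) = 0"
| "gcoef p (Suc (Suc 0)) = 1"
| "gcoef p (Suc (Suc (Suc m))) = - gcoef p (Suc m) - p * gcoef p m"

text \<open>The cube root is the growth order of solutions of a third-order equation with spectral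
  parameter \<open>p\<close>, and the exponent of the control cost goes back to it. The added 1 lets
  \<open>rho p ^ 3\<close> dominate \<open>rho p + norm p\<close>, which closes the induction for
  the coefficients.\<close>

definition rho :: "complex => real" where "rho p = 1 + root 3 (norm p)"

lemma rho_ge_1: "rho p >= 1" by (simp add: rho_def)

lemma rho_cube: "rho p + norm p <= rho p ^ 3"
proof -
  let ?q = "root 3 (norm p)"
  have q: "?q ^ 3 = norm p" "?q >= 0" by simp_all
  have "1 + ?q + ?q ^ 3 <= (1 + ?q) ^ 3"
    using q(2) by (simp add: power3_eq_cube algebra_simps)
  then show ?thesis using q by (simp add: rho_def)
qed

lemma gcoef_bound: "norm (gcoef p m) <= rho p ^ m"
proof (induction p m rule: gcoef.induct)
  case (3 p)
  then show ?case using power_mono[OF rho_ge_1[of p], of 2] by (simp add: power2_eq_square)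
next
  case (4 p m)
  have "norm (gcoef p (Suc (Suc (Suc m)))) <= norm (gcoef p (Suc m)) + norm p * norm (gcoef p m)"
    using norm_triangle_ineq4[of "- gcoef p (Suc m)" "p * gcoef p m"] by (simp add: norm_mult)
  also have "\<dots> <= rho p ^ Suc m + norm p * rho p ^ m"
    by (intro add_mono mult_left_mono 4) auto
  also have "\<dots> = rho p ^ m * (rho p + norm p)" by (simp add: algebra_simps)
  also have "\<dots> <= rho p ^ m * rho p ^ 3"
    using rho_cube[of p] rho_ge_1[of p] by (intro mult_left_mono) auto
  also have "\<dots> = rho p ^ Suc (Suc (Suc m))" by (simp add: power3_eq_cube mult_ac)
  finally show ?case .
qed (auto simp: rho_def)

lemma gcoef_bound': "norm (gcoef p (m + k)) <= rho p ^ k * rho p ^ m"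
  using gcoef_bound[of p "m + k"] by (simp add: power_add mult_ac)

text \<open>The \<open>k\<close>-th derivative of the solution of \<open>w''' + w' + pw = 0\<close>, \<open>w(0) = w'(0) = 0\<close>, \<open>w''(0) = 1\<close>.\<close>

definition gk :: "nat => complex => real => complex" where
  "gk k p x = eser (%m. gcoef p (m + k)) (of_real x)"

lemma gk_deriv: "(gk k p has_vector_derivative gk (Suc k) p x) (at x within S)"
proof -
  have "(eser (%m. gcoef p (m + k)) has_field_derivative
      eser (%m. gcoef p (Suc m + k)) (of_real x)) (at (of_real x))"
    by (rule eser_deriv[OF gcoef_bound'])
  from has_vector_derivative_real_field[OF this, of S]
  show ?thesis unfolding gk_def[abs_def] by simp
qed

lemma gk_at_0 [simp]: "gk k p 0 = gcoef p k" by (simp add: gk_def)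

lemma gk_bound: "norm (gk k p x) <= rho p ^ k * exp (rho p * \<bar>x\<bar>)"
  unfolding gk_def using eser_bound[OF gcoef_bound', of p k "of_real x"] by simp

lemma gk_ode: "gk (k + 3) p x = - gk (k + 1) p x - p * gk k p x"
proof -
  have "gk (k + 3) p x = eser (%m. (-1) * gcoef p (m + (k + 1)) + (-p) * gcoef p (m + k)) (of_real x)"
    unfolding gk_def by (intro arg_cong2[of _ _ _ _ eser]) (auto simp: numeral_3_eq_3)
  also have "\<dots> = (-1) * gk (k + 1) p x + (-p) * gk k p x"
    unfolding gk_def by (rule eser_add[OF gcoef_bound' gcoef_bound'])
  finally show ?thesis by simp
qed

lemma gk_continuous [continuous_intros]:
  "continuous_on A f ==> continuous_on A (%x. gk k p (f x))"
proof -
  have "continuous_on UNIV (gk k p)"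
    using gk_deriv[of k p _ UNIV] by (metis continuous_at_imp_continuous_on has_vector_derivative_continuous)
  then show "continuous_on A f ==> continuous_on A (%x. gk k p (f x))"
    by (rule continuous_on_compose2) auto
qed

lemma gcoef_holomorphic: "(%p. gcoef p m) holomorphic_on A"
proof -
  have "(%p. gcoef p m) holomorphic_on A & (%p. gcoef p (Suc m)) holomorphic_on A
      & (%p. gcoef p (Suc (Suc m))) holomorphic_on A"
    by (induction m) (auto intro!: holomorphic_intros)
  then show ?thesis by blast
qed

text \<open>Partial sums are polynomials in \<open>p\<close>, and the factorials beat both growth
  rates locally uniformly. The sequence \<open>c\<close> stays free because it is used twice: powers
  of x give \<open>gk\<close>, and moments of a square-integrable function give its pairing with
  \<open>gk\<close>.\<close>

lemma gcoef_series_holomorphic: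
  assumes "!!m. norm (c m) <= C * X ^ m" "X >= 0"
  shows "(%p. \<Sum>m. gcoef p (m + k) / fact m * c m) holomorphic_on UNIV"
proof (rule holomorphic_uniform_sequence[where f = "%n p. \<Sum>m<n. gcoef p (m + k) / fact m * c m"])
  show "open (UNIV :: complex set)" by simp
  show "(%p. \<Sum>m<n. gcoef p (m + k) / fact m * c m) holomorphic_on UNIV" for n
    by (intro holomorphic_intros gcoef_holomorphic) auto
  fix q :: complex
  \<comment> \<open>An upper bound for \<open>rho\<close> on the whole unit disc about
    \<open>q\<close>, so that one exponential series majorises the terms there.\<close>
  define R where "R = 1 + root 3 (norm q + 1)"
  have R1: "R >= 1" by (simp add: R_def)
  have C: "C >= 0" using order_trans[OF norm_ge_zero assms(1)[of 0]] by simp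
  have "uniform_limit (cball q 1) (%n p. \<Sum>m<n. gcoef p (m + k) / fact m * c m)
     (%p. \<Sum>m. gcoef p (m + k) / fact m * c m) sequentially"
  proof (rule Weierstrass_m_test[where M = "%m. R ^ k * C * ((R * X) ^ m /\<^sub>R fact m)"])
    fix m p assume "p \<in> cball q 1"
    then have "norm p <= norm q + 1"
      by (smt (verit) dist_norm mem_cball norm_triangle_ineq3 dist_commute)
    then have "rho p <= R" by (simp add: rho_def R_def)
    then have "rho p ^ (m + k) <= R ^ (m + k)" using rho_ge_1[of p] by (intro power_mono) auto
    then have "norm (gcoef p (m + k)) <= R ^ (m + k)"
      using gcoef_bound[of p "m + k"] by linarith
    then have "norm (gcoef p (m + k)) * norm (c m) <= R ^ (m + k) * (C * X ^ m)"
      using assms R1 by (intro mult_mono) auto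
    then show "norm (gcoef p (m + k) / fact m * c m) <= R ^ k * C * ((R * X) ^ m /\<^sub>R fact m)"
      by (simp add: norm_mult norm_divide divide_simps power_add power_mult_distrib mult_ac)
  next
    show "summable (%m. R ^ k * C * ((R * X) ^ m /\<^sub>R fact m))"
      by (intro summable_mult summable_exp_generic)
  qed
  then show "\<exists>d>0. cball q d \<subseteq> UNIV & uniform_limit (cball q d)
      (%n p. \<Sum>m<n. gcoef p (m + k) / fact m * c m)
      (%p. \<Sum>m. gcoef p (m + k) / fact m * c m) sequentially"
    by (intro exI[of _ 1]) auto
qed

lemma gk_holomorphic: "(%p. gk k p x) holomorphic_on UNIV"
  unfolding gk_def eser_def
  by (rule gcoef_series_holomorphic[where C = 1 and X = "\<bar>x\<bar>"]) (auto simp: norm_power)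

text \<open>For a root \<open>r\<close> of the characteristic polynomial, \<open>r ^ m\<close> and, at a double root, \<open>m * r ^ (m - 1)\<close>
  satisfy the recurrence of the Taylor coefficients.\<close>

lemma gcoef_rec:
  "gcoef p (m + 3) = - gcoef p (m + 1) - p * gcoef p m"
  "gcoef p (m + 3 + 1) = - gcoef p (m + 2) - p * gcoef p (m + 1)"
  "gcoef p (m + 3 + 2) = - gcoef p (m + 3) - p * gcoef p (m + 2)"
  by (simp_all add: numeral_eq_Suc)

lemma char_root_power:
  assumes "r ^ 3 + r + p = 0"
  shows "r ^ m = (gcoef p (m + 2) + gcoef p m) + r * gcoef p (m + 1) + r\<^sup>2 * gcoef p m"
proof -
  have r3: "r ^ 3 = - r - p" using assms by (simp add: eq_neg_iff_add_eq_0 add.assoc algebra_simps)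
  define P where "P m \<longleftrightarrow> r ^ m = (gcoef p (m + 2) + gcoef p m) + r * gcoef p (m + 1) + r\<^sup>2 * gcoef p m" for m
  have step: "P (m + 3)" if "P m" "P (m + 1)" for m
  proof -
    have "r ^ (m + 3) = - (r ^ (m + 1)) - p * r ^ m"
      unfolding power_add r3 by (simp add: algebra_simps)
    also have "\<dots> = (gcoef p (m + 3 + 2) + gcoef p (m + 3)) + r * gcoef p (m + 3 + 1) + r\<^sup>2 * gcoef p (m + 3)"
      using that unfolding P_def gcoef_rec by (simp add: add.assoc one_add_one del: gcoef.simps) (simp add: gcoef_rec algebra_simps)
    finally show ?thesis unfolding P_def .
  qed
  have "P m & P (m + 1) & P (m + 2)"
  proof (induction m)
    case 0
    show ?case unfolding P_def by (simp add: numeral_eq_Suc)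
  next
    case (Suc m)
    then show ?case using step[of m] by (simp add: numeral_eq_Suc)
  qed
  then show ?thesis unfolding P_def by blast
qed

text \<open>The exponential has Cauchy data (1, r, r^2), while \<open>gk 2 + gk 0\<close>,
  \<open>gk 1\<close> and \<open>gk 0\<close> have data (1,0,0), (0,1,0) and (0,0,1). This turns
  information on the roots into information on \<open>gk 0 p L\<close> and
  \<open>gk 1 p L\<close>.\<close>

lemma char_root_exp:
  assumes "r ^ 3 + r + p = 0"
  shows "exp (r * of_real x) = (gk 2 p x + gk 0 p x) + r * gk 1 p x + r\<^sup>2 * gk 0 p x"
proof -
  have "exp (r * of_real x) = eser (%m. 1 * (1 * gcoef p (m + 2) + 1 * gcoef p (m + 0))
      + 1 * (r * gcoef p (m + 1) + r\<^sup>2 * gcoef p (m + 0))) (of_real x)"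
    unfolding eser_power[symmetric]
    by (intro arg_cong2[of _ _ _ _ eser] ext refl, subst char_root_power[OF assms]) simp
  also have "\<dots> = 1 * eser (%m. 1 * gcoef p (m + 2) + 1 * gcoef p (m + 0)) (of_real x)
      + 1 * eser (%m. r * gcoef p (m + 1) + r\<^sup>2 * gcoef p (m + 0)) (of_real x)"
  proof (rule eser_add[where C = "rho p ^ 2 + rho p ^ 0" and r = "rho p" and s = "rho p"
        and D = "norm r * rho p ^ 1 + norm (r\<^sup>2) * rho p ^ 0"])
    fix m
    show "norm (1 * gcoef p (m + 2) + 1 * gcoef p (m + 0)) <= (rho p ^ 2 + rho p ^ 0) * rho p ^ m"
      using norm_triangle_ineq[of "gcoef p (m + 2)" "gcoef p (m + 0)"]
        gcoef_bound'[of p m 2] gcoef_bound'[of p m 0] by (simp add: algebra_simps)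
    have "norm (r * gcoef p (m + 1) + r\<^sup>2 * gcoef p (m + 0))
       <= norm r * norm (gcoef p (m + 1)) + norm (r\<^sup>2) * norm (gcoef p (m + 0))"
      by (metis norm_mult norm_triangle_ineq)
    also have "\<dots> <= norm r * (rho p ^ 1 * rho p ^ m) + norm (r\<^sup>2) * (rho p ^ 0 * rho p ^ m)"
      by (intro add_mono mult_left_mono gcoef_bound') auto
    finally show "norm (r * gcoef p (m + 1) + r\<^sup>2 * gcoef p (m + 0))
       <= (norm r * rho p ^ 1 + norm (r\<^sup>2) * rho p ^ 0) * rho p ^ m" by (simp add: algebra_simps)
  qed
  also have "\<dots> = gk 2 p x + gk 0 p x + (r * gk 1 p x + r\<^sup>2 * gk 0 p x)"
    unfolding gk_def by (subst (1 2) eser_add[OF gcoef_bound' gcoef_bound']) simp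
  finally show ?thesis by simp
qed

lemma char_double_root_power:
  assumes "r ^ 3 + r + p = 0" "3 * r\<^sup>2 + 1 = 0"
  shows "of_nat (Suc m) * r ^ m = gcoef p (m + 2) + 2 * r * gcoef p (m + 1)"
proof -
  have p: "p = - (r ^ 3) - r" using assms(1) by (simp add: eq_neg_iff_add_eq_0 algebra_simps)
  define P where "P m \<longleftrightarrow> of_nat (Suc m) * r ^ m = gcoef p (m + 2) + 2 * r * gcoef p (m + 1)" for m
  have step: "P (m + 3)" if "P m" "P (m + 1)" for m
  proof -
    have "of_nat (Suc (m + 3)) * r ^ (m + 3) = - (of_nat (Suc (m + 1)) * r ^ (m + 1))
        - p * (of_nat (Suc m) * r ^ m) + r ^ (m + 1) * (3 * r\<^sup>2 + 1)"
      unfolding p by (simp add: power_add power2_eq_square power3_eq_cube algebra_simps)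
    also have "\<dots> = gcoef p (m + 3 + 2) + 2 * r * gcoef p (m + 3 + 1)"
      using that unfolding P_def gcoef_rec assms(2) by (simp add: add.assoc one_add_one del: gcoef.simps of_nat_Suc) (simp add: gcoef_rec algebra_simps del: of_nat_Suc)
    finally show ?thesis unfolding P_def .
  qed
  have "P m & P (m + 1) & P (m + 2)"
  proof (induction m)
    case 0
    have "3 * r\<^sup>2 = -1" using assms(2) by (simp add: eq_neg_iff_add_eq_0)
    then show ?case unfolding P_def by (simp add: numeral_eq_Suc)
  next
    case (Suc m)
    then show ?case using step[of m] by (simp add: numeral_eq_Suc)
  qed
  then show ?thesis unfolding P_def by blast
qed

text \<open>At a double root x e^(rx) is a further solution, with data (0, 1, 2r). Since it is
  nonzero at L, a double root prevents \<open>gk 0 p L\<close> and \<open>gk 1 p L\<close> from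
  vanishing together.\<close>

lemma char_double_root_exp:
  assumes "r ^ 3 + r + p = 0" "3 * r\<^sup>2 + 1 = 0"
  shows "of_real x * exp (r * of_real x) = gk 1 p x + 2 * r * gk 0 p x"
proof -
  \<comment> \<open>The Taylor coefficients of x e^(rx); index 0 is separate because
    \<open>m - 1\<close> is truncated there.\<close>
  define b where "b m = (if m = 0 then 0 else of_nat m * r ^ (m - 1))" for m
  have b: "b m = 1 * gcoef p (m + 1) + (2 * r) * gcoef p (m + 0)" for m
    using char_double_root_power[OF assms, of "m - 1"] by (cases m) (auto simp: b_def)
  have "gk 1 p x + 2 * r * gk 0 p x = eser b (of_real x)"
    unfolding gk_def b[abs_def] by (subst eser_add[OF gcoef_bound' gcoef_bound']) simp
  also have "\<dots> = of_real x * exp (r * of_real x)"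
  proof -
    have "(%m. of_real x * ((r * of_real x) ^ m /\<^sub>R fact m)) sums (of_real x * exp (r * of_real x))"
      by (intro sums_mult exp_converges)
    then have "(%m. b (Suc m) / fact (Suc m) * of_real x ^ Suc m) sums (of_real x * exp (r * of_real x))"
      by (rule sums_cong[THEN iffD1, rotated])
         (simp add: b_def scaleR_conv_of_real power_mult_distrib divide_simps mult_ac del: of_nat_Suc)
    then have "(%m. b m / fact m * of_real x ^ m) sums (of_real x * exp (r * of_real x))"
      by (subst (asm) sums_Suc_iff) (simp add: b_def)
    then show ?thesis by (simp add: eser_def sums_iff)
  qed
  finally show ?thesis ..
qed

section \<open>Square-integrable functions\<close>

text \<open>Over an arbitrary measure, since the same facts serve on (0,L), on (0,T) and on the
  glued domain that encodes pairs. Functions are not identified modulo null sets, so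
  \<open>nm\<close> is only a seminorm.\<close>

definition l2 :: "'a measure => ('a => real) set" where
  "l2 M = {f \<in> borel_measurable M. integrable M (%x. (f x)\<^sup>2)}"

definition ip :: "'a measure => ('a => real) => ('a => real) => real" where
  "ip M f g = (LINT x|M. f x * g x)"

definition nm :: "'a measure => ('a => real) => real" where
  "nm M f = sqrt (ip M f f)"

lemma L2_eq: "L2 S = l2 (lebesgue_on S)" by (simp add: L2_def l2_def)

lemma L2_norm_eq: "L2_norm S f = nm (lebesgue_on S) f"
  by (simp add: L2_norm_def nm_def ip_def power2_eq_square)

lemma l2_meas: "f \<in> l2 M ==> f \<in> borel_measurable M" by (simp add: l2_def)

lemma l2_integrable_mult:
  assumes "f \<in> l2 M" "g \<in> l2 M"
  shows "integrable M (%x. f x * g x)"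
proof (rule Bochner_Integration.integrable_bound)
  show "integrable M (%x. (f x)\<^sup>2 + (g x)\<^sup>2)" using assms by (auto simp: l2_def)
  show "(%x. f x * g x) \<in> borel_measurable M" using assms by (auto simp: l2_def)
  have "\<bar>a * b\<bar> <= a\<^sup>2 + b\<^sup>2" for a b :: real
  proof -
    have "2 * (\<bar>a\<bar> * \<bar>b\<bar>) <= a\<^sup>2 + b\<^sup>2"
      using sum_squares_bound[of "\<bar>a\<bar>" "\<bar>b\<bar>"] by (simp add: mult.assoc)
    moreover have "0 <= \<bar>a\<bar> * \<bar>b\<bar>" by simp
    ultimately show ?thesis unfolding abs_mult by linarith
  qed
  then show "AE x in M. norm (f x * g x) <= norm ((f x)\<^sup>2 + (g x)\<^sup>2)" by auto
qed

lemma l2_lin [intro]: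
  assumes "f \<in> l2 M" "g \<in> l2 M"
  shows "(%x. a * f x + b * g x) \<in> l2 M"
proof -
  have "integrable M (%x. a\<^sup>2 * (f x)\<^sup>2 + 2 * a * b * (f x * g x) + b\<^sup>2 * (g x)\<^sup>2)"
    using assms l2_integrable_mult[OF assms] by (auto simp: l2_def)
  moreover have "(a * f x + b * g x)\<^sup>2 = a\<^sup>2 * (f x)\<^sup>2 + 2 * a * b * (f x * g x) + b\<^sup>2 * (g x)\<^sup>2" for x
    by (simp add: power2_eq_square algebra_simps)
  ultimately show ?thesis
    using assms by (auto simp: l2_def intro!: borel_measurable_add borel_measurable_times)
qed

lemma l2_diff [intro]: "f \<in> l2 M ==> g \<in> l2 M ==> (%x. f x - g x) \<in> l2 M"
  using l2_lin[of f M g 1 "-1"] by simp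

lemma l2_add [intro]: "f \<in> l2 M ==> g \<in> l2 M ==> (%x. f x + g x) \<in> l2 M"
  using l2_lin[of f M g 1 1] by simp

lemma l2_scale [intro]: "f \<in> l2 M ==> (%x. a * f x) \<in> l2 M"
  using l2_lin[of f M f a 0] by simp

lemma ip_commute: "ip M f g = ip M g f" by (simp add: ip_def mult.commute)

lemma ip_lin_left:
  assumes "f \<in> l2 M" "g \<in> l2 M" "h \<in> l2 M"
  shows "ip M (%x. a * f x + b * g x) h = a * ip M f h + b * ip M g h"
proof -
  have "ip M (%x. a * f x + b * g x) h = (LINT x|M. a * (f x * h x) + b * (g x * h x))"
    by (simp add: ip_def algebra_simps)
  then show ?thesis
    using l2_integrable_mult[OF assms(1,3)] l2_integrable_mult[OF assms(2,3)] by (simp add: ip_def)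
qed

lemma ip_lin_right:
  assumes "f \<in> l2 M" "g \<in> l2 M" "h \<in> l2 M"
  shows "ip M h (%x. a * f x + b * g x) = a * ip M h f + b * ip M h g"
  using ip_lin_left[OF assms] by (simp add: ip_commute)

lemma ip_diff_left: "f \<in> l2 M ==> g \<in> l2 M ==> h \<in> l2 M ==> ip M (%x. f x - g x) h = ip M f h - ip M g h"
  by (drule (2) ip_lin_left[of f M g h 1 "-1"]) simp

lemma ip_nonneg: "ip M f f >= 0" by (simp add: ip_def)

lemma nm_nonneg [simp]: "nm M f >= 0" by (simp add: nm_def ip_nonneg)

lemma nm_sq: "(nm M f)\<^sup>2 = ip M f f" by (simp add: nm_def ip_nonneg)

lemma nm_lin_sq:
  assumes "f \<in> l2 M" "g \<in> l2 M"
  shows "(nm M (%x. a * f x + b * g x))\<^sup>2 = a\<^sup>2 * (nm M f)\<^sup>2 + 2 * a * b * ip M f g + b\<^sup>2 * (nm M g)\<^sup>2"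
  unfolding nm_sq using assms
  by (simp add: ip_lin_left ip_lin_right l2_lin ip_commute[of M g f] power2_eq_square algebra_simps)

text \<open>Cauchy-Schwarz from the nonnegativity of a quadratic form in (s, t). As
  \<open>nm\<close> is a seminorm, \<open>?a = 0\<close> is a genuine case: if the inner product
  were nonzero, a suitable multiple of \<open>f\<close> would give the form a negative
  value.\<close>

lemma ip_le_nm:
  assumes "f \<in> l2 M" "g \<in> l2 M"
  shows "\<bar>ip M f g\<bar> <= nm M f * nm M g"
proof -
  let ?a = "nm M f" and ?b = "nm M g"
  have *: "0 <= s\<^sup>2 * ?a\<^sup>2 + 2 * s * t * ip M f g + t\<^sup>2 * ?b\<^sup>2" for s t
    using nm_lin_sq[OF assms, of s t] by (metis zero_le_power2)
  have "(ip M f g)\<^sup>2 <= ?a\<^sup>2 * ?b\<^sup>2"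
  proof (cases "?a = 0")
    case True
    have "ip M f g = 0"
    proof (rule ccontr)
      assume n: "ip M f g ~= 0"
      have "0 <= 2 * (- (?b\<^sup>2 + 1) / (2 * ip M f g)) * ip M f g + ?b\<^sup>2"
        using *[of "- (?b\<^sup>2 + 1) / (2 * ip M f g)" 1] True by simp
      also have "\<dots> = - 1" using n by (simp add: field_simps)
      finally show False by simp
    qed
    then show ?thesis by simp
  next
    case False
    have "0 <= (- ip M f g)\<^sup>2 * ?a\<^sup>2 + 2 * (- ip M f g) * ?a\<^sup>2 * ip M f g + (?a\<^sup>2)\<^sup>2 * ?b\<^sup>2"
      by (rule *)
    also have "\<dots> = ?a\<^sup>2 * (?a\<^sup>2 * ?b\<^sup>2 - (ip M f g)\<^sup>2)"
      by (simp add: power2_eq_square algebra_simps)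
    finally show ?thesis using False by (simp add: zero_le_mult_iff)
  qed
  then show ?thesis
    by (metis abs_le_square_iff abs_mult abs_of_nonneg nm_nonneg power_mult_distrib)
qed

lemma nm_triangle:
  assumes "f \<in> l2 M" "g \<in> l2 M"
  shows "nm M (%x. f x + g x) <= nm M f + nm M g"
proof (rule power2_le_imp_le)
  have "(nm M (%x. f x + g x))\<^sup>2 = (nm M f)\<^sup>2 + 2 * ip M f g + (nm M g)\<^sup>2"
    using nm_lin_sq[OF assms, of 1 1] by simp
  also have "\<dots> <= (nm M f + nm M g)\<^sup>2"
    using ip_le_nm[OF assms] by (simp add: power2_eq_square algebra_simps)
  finally show "(nm M (%x. f x + g x))\<^sup>2 <= (nm M f + nm M g)\<^sup>2" .
qed simp

lemma nm_scale: "nm M (%x. a * f x) = \<bar>a\<bar> * nm M f"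
proof -
  have "ip M (%x. a * f x) (%x. a * f x) = a\<^sup>2 * ip M f f"
    unfolding ip_def by (simp add: power2_eq_square mult_ac)
  then show ?thesis by (simp add: nm_def real_sqrt_mult)
qed

lemma nm_minus_commute: "nm M (%x. f x - g x) = nm M (%x. g x - f x)"
  using nm_scale[of M "-1" "%x. f x - g x"] by simp

lemma nm_triangle_diff:
  assumes "f \<in> l2 M" "g \<in> l2 M" "h \<in> l2 M"
  shows "nm M (%x. f x - h x) <= nm M (%x. f x - g x) + nm M (%x. g x - h x)"
  using nm_triangle[of "%x. f x - g x" M "%x. g x - h x"] assms by auto

lemma nm_reverse_triangle:
  assumes "f \<in> l2 M" "g \<in> l2 M"
  shows "\<bar>nm M f - nm M g\<bar> <= nm M (%x. f x - g x)"
  using nm_triangle[OF l2_diff[OF assms] assms(2)] nm_triangle[OF l2_diff[OF assms(2,1)] assms(1)]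
    nm_minus_commute[of M f g] by simp

lemma nm_AE_cong:
  assumes "AE x in M. f x = g x" "f \<in> borel_measurable M" "g \<in> borel_measurable M"
  shows "nm M f = nm M g"
  unfolding nm_def ip_def using assms by (intro arg_cong[of _ _ sqrt] integral_cong_AE) auto

lemma nm_0_AE:
  assumes "f \<in> l2 M" "nm M f = 0"
  shows "AE x in M. f x = 0"
proof -
  have "(LINT x|M. (f x)\<^sup>2) = 0"
    using assms(2) by (simp add: nm_def ip_def power2_eq_square)
  then show ?thesis
    using assms integral_nonneg_eq_0_iff_AE[of M "%x. (f x)\<^sup>2"] by (auto simp: l2_def)
qed

lemma ip_tendsto:
  assumes "!!n. f n \<in> l2 M" "g \<in> l2 M" "h \<in> l2 M" "(%n. nm M (%x. f n x - g x)) \<longlonglongrightarrow> 0"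
  shows "(%n. ip M (f n) h) \<longlonglongrightarrow> ip M g h"
proof (rule Lim_null[THEN iffD2], rule tendsto_rabs_zero_cancel,
    rule tendsto_sandwich[where f = "%_. 0" and h = "%n. nm M (%x. f n x - g x) * nm M h"])
  show "\<forall>\<^sub>F n in sequentially. \<bar>ip M (f n) h - ip M g h\<bar> <= nm M (%x. f n x - g x) * nm M h"
    using ip_le_nm[of "%x. f _ x - g x" M h] assms by (auto simp: ip_diff_left[symmetric] intro!: always_eventually)
  show "(%n. nm M (%x. f n x - g x) * nm M h) \<longlonglongrightarrow> 0"
    using tendsto_mult_right[OF assms(4), of "nm M h"] by simp
qed auto

lemma nm_tendsto:
  assumes "!!n. f n \<in> l2 M" "g \<in> l2 M" "(%n. nm M (%x. f n x - g x)) \<longlonglongrightarrow> 0"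
  shows "(%n. nm M (f n)) \<longlonglongrightarrow> nm M g"
proof (rule Lim_null[THEN iffD2], rule tendsto_rabs_zero_cancel,
    rule tendsto_sandwich[where f = "%_. 0" and h = "%n. nm M (%x. f n x - g x)"])
  show "\<forall>\<^sub>F n in sequentially. \<bar>nm M (f n) - nm M g\<bar> <= nm M (%x. f n x - g x)"
    using nm_reverse_triangle[of "f _" M g] assms by (auto intro!: always_eventually)
qed (use assms in auto)

text \<open>Decay 16^(-k) of the integrals leaves room for the weight 4^k: the weighted sum is still
  integrable, so almost everywhere \<open>D k x\<close> is at most a constant times 4^(-k), and the
  square roots form a geometric series. Serves both completeness and the convergence of
  x-derivatives at almost every time.\<close>

lemma AE_summable_sqrt:
  fixes D :: "nat => 'a => real"
  assumes "!!k. D k \<in> borel_measurable M" "!!k x. D k x >= 0"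
    "!!k. (\<integral>\<^sup>+x. ennreal (D k x) \<partial>M) <= ennreal ((1/16) ^ k)"
  shows "AE x in M. summable (%k. sqrt (D k x))"
proof -
  let ?F = "%k x. ennreal (4 ^ k * D k x)"
  have m [measurable]: "D k \<in> borel_measurable M" for k by fact
  have "(\<integral>\<^sup>+x. (\<Sum>k. ?F k x) \<partial>M) = (\<Sum>k. \<integral>\<^sup>+x. ?F k x \<partial>M)"
    by (rule nn_integral_suminf) simp
  also have "\<dots> <= (\<Sum>k. ennreal ((1/4) ^ k))"
  proof (intro suminf_le)
    fix k
    have "(\<integral>\<^sup>+x. ?F k x \<partial>M) = ennreal (4 ^ k) * (\<integral>\<^sup>+x. ennreal (D k x) \<partial>M)"
      using assms(2) by (subst nn_integral_cmult[symmetric]) (auto simp: ennreal_mult)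
    also have "\<dots> <= ennreal (4 ^ k) * ennreal ((1/16) ^ k)"
      by (intro mult_left_mono assms) auto
    also have "\<dots> = ennreal ((1/4) ^ k)"
      by (simp add: ennreal_mult[symmetric] power_mult_distrib[symmetric])
    finally show "(\<integral>\<^sup>+x. ?F k x \<partial>M) <= ennreal ((1/4) ^ k)" .
  qed auto
  also have "\<dots> = ennreal (\<Sum>k. (1/4) ^ k)"
    by (rule suminf_ennreal2) (auto intro: summable_geometric)
  finally have "(\<integral>\<^sup>+x. (\<Sum>k. ?F k x) \<partial>M) ~= \<infinity>" by (auto simp: top_unique)
  then have "AE x in M. (\<Sum>k. ?F k x) ~= \<infinity>"
    by (intro nn_integral_PInf_AE) auto
  then show ?thesis
  proof eventually_elim
    case (elim x)
    then obtain c where c: "(\<Sum>k. ?F k x) = ennreal c" "c >= 0"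
      by (cases "\<Sum>k. ?F k x") auto
    have "4 ^ k * D k x <= c" for k
    proof -
      have "?F k x <= (\<Sum>k. ?F k x)"
        using sum_le_suminf[of "%k. ?F k x" "{k}"] by simp
      then show ?thesis using c assms(2)[of k x] by (simp add: ennreal_le_iff)
    qed
    then have le: "sqrt (D k x) <= sqrt c * (1/2) ^ k" for k
    proof -
      have "D k x <= c * (1/4) ^ k" using \<open>4 ^ k * D k x <= c\<close> by (simp add: power_divide field_simps)
      then have "sqrt (D k x) <= sqrt (c * (1/4) ^ k)" by (rule real_sqrt_le_mono)
      also have "\<dots> = sqrt c * (1/2) ^ k"
        by (simp add: real_sqrt_mult real_sqrt_power real_sqrt_divide power_divide)
      finally show ?thesis .
    qed
    show ?case
    proof (rule summable_comparison_test'[where g = "%k. sqrt c * (1/2) ^ k" and N = 0])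
      show "summable (%k. sqrt c * (1/2) ^ k)" by (intro summable_mult summable_geometric) simp
      show "norm (sqrt (D k x)) <= sqrt c * (1/2) ^ k" for k
        using le[of k] real_sqrt_ge_zero[OF assms(2)[of k x]] unfolding real_norm_def by linarith
    qed
  qed
qed

lemma nn_integral_sq_nm:
  assumes "f \<in> l2 M"
  shows "(\<integral>\<^sup>+x. ennreal ((f x)\<^sup>2) \<partial>M) = ennreal ((nm M f)\<^sup>2)"
  unfolding nm_sq ip_def using assms
  by (subst nn_integral_eq_integral) (auto simp: l2_def power2_eq_square)

lemma l2_complete_fast:
  assumes f: "!!n. f n \<in> l2 M" and c: "!!n. nm M (%x. f (Suc n) x - f n x) <= (1/4) ^ n"
  obtains g where "g \<in> l2 M" "(%n. nm M (%x. f n x - g x)) \<longlonglongrightarrow> 0" "AE x in M. (%n. f n x) \<longlonglongrightarrow> g x"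
proof -
  have [measurable]: "f n \<in> borel_measurable M" for n using f by (rule l2_meas)
  have "AE x in M. summable (%k. sqrt ((f (Suc k) x - f k x)\<^sup>2))"
  proof (rule AE_summable_sqrt)
    fix k
    have "(\<integral>\<^sup>+x. ennreal ((f (Suc k) x - f k x)\<^sup>2) \<partial>M) = ennreal ((nm M (%x. f (Suc k) x - f k x))\<^sup>2)"
      by (rule nn_integral_sq_nm) (use f in auto)
    also have "\<dots> <= ennreal (((1/4) ^ k)\<^sup>2)" by (intro ennreal_leI power_mono c) auto
    also have "((1/4) ^ k)\<^sup>2 = ((1/4)\<^sup>2 :: real) ^ k"
      by (simp only: power_mult[symmetric] mult.commute)
    also have "(1/4)\<^sup>2 = (1/16 :: real)" by (simp add: power2_eq_square)
    finally show "(\<integral>\<^sup>+x. ennreal ((f (Suc k) x - f k x)\<^sup>2) \<partial>M) <= ennreal ((1/16) ^ k)" .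
  qed auto
  then have cv: "AE x in M. convergent (%n. f n x)"
  proof eventually_elim
    case (elim x)
    then have "summable (%k. f (Suc k) x - f k x)"
      by - (rule summable_norm_cancel, simp)
    then have "convergent (%n. \<Sum>k<n. f (Suc k) x - f k x)"
      using summable_iff_convergent by blast
    moreover have "(%n. \<Sum>k<n. f (Suc k) x - f k x) = (%n. f n x - f 0 x)"
      using sum_lessThan_telescope[of "%k. f k x"] by (intro ext) simp
    ultimately have "convergent (%n. f n x - f 0 x)" by simp
    from convergent_add[OF this convergent_const[of "f 0 x"]] show ?case by simp
  qed
  define g where "g x = lim (%n. f n x)" for x
  have gm [measurable]: "g \<in> borel_measurable M" unfolding g_def by (rule borel_measurable_lim_metric) simp
  have cg: "AE x in M. (%n. f n x) \<longlonglongrightarrow> g x"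
    using cv by eventually_elim (simp add: g_def convergent_LIMSEQ_iff)
  have bd: "nm M (%x. f (n + k) x - f n x) <= 2 * (1/4) ^ n" for n k
  proof -
    have "nm M (%x. f (n + k) x - f n x) <= (\<Sum>j<k. (1/4) ^ (n + j))"
    proof (induction k)
      case 0
      then show ?case by (simp add: nm_def ip_def)
    next
      case (Suc k)
      then show ?case
        using nm_triangle_diff[OF f[of "n + Suc k"] f[of "n + k"] f[of n]] c[of "n + k"] by simp
    qed
    also have "\<dots> = (1/4) ^ n * (\<Sum>j<k. (1/4) ^ j)" by (simp add: power_add sum_distrib_left)
    also have "\<dots> <= (1/4) ^ n * 2"
    proof (intro mult_left_mono)
      have "(\<Sum>j<k. (1/4) ^ j :: real) <= 2 - 2 * (1/4) ^ k"
      proof (induction k)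
        case (Suc k)
        have "(0 :: real) <= (1/4) ^ k" by simp
        with Suc show ?case unfolding sum.lessThan_Suc power_Suc by linarith
      qed simp
      then show "(\<Sum>j<k. (1/4) ^ j :: real) <= 2"
        by (rule order_trans) simp
    qed simp
    finally show ?thesis by simp
  qed
  \<comment> \<open>Fatou's lemma along the pointwise limit gives the rate, and with it the
    square-integrability of \<open>f n - g\<close> and of \<open>g\<close>.\<close>
  have fat: "(\<integral>\<^sup>+x. ennreal ((f n x - g x)\<^sup>2) \<partial>M) <= ennreal ((2 * (1/4) ^ n)\<^sup>2)" for n
  proof -
    have "(\<integral>\<^sup>+x. ennreal ((f n x - g x)\<^sup>2) \<partial>M) = (\<integral>\<^sup>+x. liminf (%k. ennreal ((f (n + k) x - f n x)\<^sup>2)) \<partial>M)"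
    proof (rule nn_integral_cong_AE, use cg in eventually_elim)
      case (elim x)
      have "(%k. f (k + n) x) \<longlonglongrightarrow> g x" by (rule LIMSEQ_ignore_initial_segment[OF elim])
      then have "(%k. ennreal ((f (n + k) x - f n x)\<^sup>2)) \<longlonglongrightarrow> ennreal ((g x - f n x)\<^sup>2)"
        by (intro tendsto_intros) (simp add: add.commute)
      then show ?case
        using lim_imp_Liminf[OF sequentially_bot] by (metis power2_commute)
    qed
    also have "\<dots> <= liminf (%k. \<integral>\<^sup>+x. ennreal ((f (n + k) x - f n x)\<^sup>2) \<partial>M)"
      by (rule nn_integral_liminf) simp
    also have "\<dots> <= liminf (%k::nat. ennreal ((2 * (1/4) ^ n)\<^sup>2))"
    proof (intro Liminf_mono always_eventually allI)
      fix k
      have "(\<integral>\<^sup>+x. ennreal ((f (n + k) x - f n x)\<^sup>2) \<partial>M) = ennreal ((nm M (%x. f (n + k) x - f n x))\<^sup>2)"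
        by (rule nn_integral_sq_nm) (use f in auto)
      then show "(\<integral>\<^sup>+x. ennreal ((f (n + k) x - f n x)\<^sup>2) \<partial>M) <= ennreal ((2 * (1/4) ^ n)\<^sup>2)"
        by (metis bd ennreal_leI nm_nonneg power_mono)
    qed
    finally show ?thesis by (simp add: Liminf_const)
  qed
  have "integrable M (%x. (f n x - g x)\<^sup>2)" for n
    by (intro integrableI_bounded) (use fat[of n] in \<open>auto simp: top_unique intro: le_less_trans\<close>)
  then have d: "(%x. f n x - g x) \<in> l2 M" for n by (simp add: l2_def)
  have g: "g \<in> l2 M" using l2_diff[OF f d, of 0 0] by simp
  have a: "nm M (%x. f n x - g x) <= 2 * (1/4) ^ n" for n
  proof (rule power2_le_imp_le)
    show "(nm M (%x. f n x - g x))\<^sup>2 <= (2 * (1/4) ^ n)\<^sup>2"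
      using fat[of n] unfolding nn_integral_sq_nm[OF d] by (subst (asm) ennreal_le_iff) auto
  qed simp
  have b: "(%n. 2 * (1/4) ^ n :: real) \<longlonglongrightarrow> 0"
  proof -
    have "(%n. (1/4 :: real) ^ n) \<longlonglongrightarrow> 0" by (rule LIMSEQ_power_zero) simp
    from tendsto_mult_right_zero[OF this, of 2] show ?thesis .
  qed
  have "(%n. nm M (%x. f n x - g x)) \<longlonglongrightarrow> 0"
    by (rule real_tendsto_sandwich[OF always_eventually always_eventually tendsto_const b]) (auto intro: a)
  then show ?thesis using that g cg by blast
qed

lemma l2_complete:
  assumes f: "!!n. f n \<in> l2 M"
    and c: "!!e. e > 0 ==> \<exists>N. \<forall>m\<ge>N. \<forall>n\<ge>N. nm M (%x. f m x - f n x) < e"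
  obtains g where "g \<in> l2 M" "(%n. nm M (%x. f n x - g x)) \<longlonglongrightarrow> 0"
proof -
  have "\<forall>k. \<exists>N. \<forall>m\<ge>N. \<forall>n\<ge>N. nm M (%x. f m x - f n x) < (1/4) ^ k" using c by simp
  then obtain N where N: "!!k m n. m >= N k ==> n >= N k ==> nm M (%x. f m x - f n x) < (1/4) ^ k"
    by metis
  define r where "r k = (\<Sum>j\<le>k. N j) + k" for k
  have r: "r k >= N k" "r k >= k" "r (Suc k) >= r k" for k
    using member_le_sum[of k "{..k}" N] by (auto simp: r_def)
  obtain g where g: "g \<in> l2 M" "(%k. nm M (%x. f (r k) x - g x)) \<longlonglongrightarrow> 0"
  proof (rule l2_complete_fast[of "%k. f (r k)" M])
    show "nm M (%x. f (r (Suc k)) x - f (r k) x) <= (1/4) ^ k" for k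
      using N[of k "r (Suc k)" "r k"] r[of k] by simp
  qed (use f in auto)
  have "(%n. nm M (%x. f n x - g x)) \<longlonglongrightarrow> 0"
  proof (rule LIMSEQ_I)
    fix e :: real assume e: "e > 0"
    obtain K where K: "\<forall>m\<ge>K. \<forall>n\<ge>K. nm M (%x. f m x - f n x) < e / 2" using c[of "e / 2"] e by auto
    obtain k where k: "k >= K" "nm M (%x. f (r k) x - g x) < e / 2"
      using LIMSEQ_D[OF g(2), of "e / 2"] e by (metis abs_of_nonneg diff_zero half_gt_zero nm_nonneg real_norm_def nat_le_linear)
    have "nm M (%x. f n x - g x) < e" if "n >= K" for n
    proof -
      have "nm M (%x. f n x - f (r k) x) < e / 2" using K that k r(2)[of k] by auto
      then show ?thesis using nm_triangle_diff[OF f f g(1), of n "r k"] k by linarith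
    qed
    then show "\<exists>no. \<forall>n\<ge>no. norm (nm M (%x. f n x - g x) - 0) < e" by auto
  qed
  then show ?thesis using that g by blast
qed

lemma quadratic_nonneg_linear_zero:
  fixes a b :: real
  assumes "!!t. 0 <= t * a + t\<^sup>2 * b"
  shows "a = 0"
proof (rule ccontr)
  assume a: "a ~= 0"
  define B where "B = \<bar>b\<bar> + 1"
  have B: "b <= B" "B > 0" by (auto simp: B_def)
  have "0 <= (- a / (2 * B)) * a + (- a / (2 * B))\<^sup>2 * b" by (rule assms)
  also have "\<dots> <= (- a / (2 * B)) * a + (- a / (2 * B))\<^sup>2 * B"
    using B by (intro add_left_mono mult_left_mono) auto
  also have "\<dots> = - (a\<^sup>2 / (4 * B))"
    using B by (simp add: power2_eq_square field_simps)
  also have "\<dots> < 0" using a B by (simp add: divide_pos_pos)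
  finally show False by simp
qed

text \<open>Riesz by minimising |d|^2 / 2 - r over the subspace. The functional is given by its
  graph \<open>D\<close>, so it never has to be turned into a function of \<open>d\<close>. The
  minimising sequence \<open>ds\<close> is returned because it places \<open>u\<close> in the
  closure of the subspace; all later density results are read off from that.\<close>

lemma l2_riesz:
  fixes D :: "(('a => real) \<times> real) set"
  assumes ne: "D ~= {}" and dl: "!!d r. (d, r) \<in> D ==> d \<in> l2 M"
    and lin: "!!d r e s a b. (d, r) \<in> D ==> (e, s) \<in> D ==> ((%x. a * d x + b * e x), a * r + b * s) \<in> D"
    and bd: "!!d r. (d, r) \<in> D ==> \<bar>r\<bar> <= K * nm M d"
  obtains u ds where "u \<in> l2 M" "nm M u <= K | nm M u = 0" "!!d r. (d, r) \<in> D ==> ip M u d = r"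
    "!!n. ds n \<in> fst ` D" "(%n. nm M (%x. ds n x - u x)) \<longlonglongrightarrow> 0"
proof -
  define J where "J = (%(d, r). (nm M d)\<^sup>2 / 2 - r)"
  have Jb: "J z >= - (K\<^sup>2 / 2)" if "z \<in> D" for z
  proof -
    obtain d r where z: "z = (d, r)" by force
    have "0 <= (nm M d - K)\<^sup>2" by simp
    then have "K * nm M d <= (nm M d)\<^sup>2 / 2 + K\<^sup>2 / 2" by (simp add: power2_eq_square algebra_simps)
    then show ?thesis using bd[of d r] that z by (auto simp: J_def)
  qed
  define m where "m = Inf (J ` D)"
  have bb: "bdd_below (J ` D)" using Jb by (auto intro!: bdd_belowI2)
  have mle: "m <= J z" if "z \<in> D" for z unfolding m_def using that bb by (auto intro: cInf_lower)
  have "\<exists>z\<in>D. J z < m + 1 / Suc n" for n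
    using cInf_lessD[of "J ` D" "m + 1 / Suc n"] ne by (force simp: m_def)
  then obtain z where z: "!!n. z n \<in> D" "!!n. J (z n) < m + 1 / Suc n" by metis
  define ds where "ds n = fst (z n)" for n
  define rs where "rs n = snd (z n)" for n
  have zz: "z n = (ds n, rs n)" for n by (simp add: ds_def rs_def)
  have dsl: "ds n \<in> l2 M" for n using dl z(1)[of n] zz by metis
  \<comment> \<open>Parallelogram law: the midpoint of two near-minimisers cannot fall below the
    infimum, so they are close to each other.\<close>
  have par: "(nm M (%x. ds i x - ds j x))\<^sup>2 <= 4 * (1 / Suc i + 1 / Suc j)" for i j
  proof -
    have "m <= J ((%x. (1/2) * ds i x + (1/2) * ds j x), (1/2) * rs i + (1/2) * rs j)"
      by (rule mle, rule lin) (use z(1) zz in metis)+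
    moreover have "(nm M (%x. ds i x - ds j x))\<^sup>2 = (nm M (ds i))\<^sup>2 - 2 * ip M (ds i) (ds j) + (nm M (ds j))\<^sup>2"
      using nm_lin_sq[OF dsl dsl, of 1 i "-1" j] by simp
    ultimately show ?thesis
      using z(2)[of i] z(2)[of j] unfolding zz J_def prod.case
      by (subst (asm) nm_lin_sq[OF dsl dsl]) (simp add: power2_eq_square algebra_simps)
  qed
  obtain u where u: "u \<in> l2 M" "(%n. nm M (%x. ds n x - u x)) \<longlonglongrightarrow> 0"
  proof (rule l2_complete[of ds M])
    fix e :: real assume "e > 0"
    then obtain N where N: "8 / e\<^sup>2 < real N" using reals_Archimedean2 by blast
    show "\<exists>N. \<forall>m\<ge>N. \<forall>n\<ge>N. nm M (%x. ds m x - ds n x) < e"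
    proof (intro exI allI impI)
      fix i j assume ij: "N <= i" "N <= j"
      have N0: "real N > 0" using N \<open>e > 0\<close> by (smt (verit) divide_pos_pos zero_less_power)
      have "1 / Suc i <= 1 / real N" "1 / Suc j <= 1 / real N"
        using ij N0 by (auto intro!: divide_left_mono)
      then have "(nm M (%x. ds i x - ds j x))\<^sup>2 <= 8 / real N" using par[of i j] by simp
      also have "\<dots> < e\<^sup>2" using N N0 \<open>e > 0\<close> by (simp add: field_simps)
      finally show "nm M (%x. ds i x - ds j x) < e"
        using \<open>e > 0\<close> by (simp add: power2_less_imp_less)
    qed
  qed (use dsl in auto)
  have eu: "ip M u d = r" if dr: "(d, r) \<in> D" for d r
  proof -
    have d: "d \<in> l2 M" using dl dr .
    \<comment> \<open>First variation at the limit: perturbing \<open>ds n\<close> by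
      \<open>t * d\<close> costs at most 1 / (n + 1), and the linear term in t has to
      vanish.\<close>
    have "0 <= t * (ip M u d - r) + t\<^sup>2 * ((nm M d)\<^sup>2 / 2)" for t
    proof (rule LIMSEQ_le_const)
      show "(%n. 1 / Suc n + t * (ip M (ds n) d - r) + t\<^sup>2 * ((nm M d)\<^sup>2 / 2))
          \<longlonglongrightarrow> t * (ip M u d - r) + t\<^sup>2 * ((nm M d)\<^sup>2 / 2)"
        using tendsto_add[OF tendsto_add[OF lim_1_over_n[THEN LIMSEQ_Suc]
           tendsto_mult[OF tendsto_const tendsto_diff[OF ip_tendsto[OF dsl u(1) d u(2)] tendsto_const]]]
           tendsto_const, of t r "t\<^sup>2 * ((nm M d)\<^sup>2 / 2)"] by simp
      have "0 <= 1 / Suc n + t * (ip M (ds n) d - r) + t\<^sup>2 * ((nm M d)\<^sup>2 / 2)" for n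
      proof -
        have "m <= J ((%x. 1 * ds n x + t * d x), 1 * rs n + t * r)"
          by (rule mle, rule lin) (use z(1) zz dr in metis)+
        then show ?thesis
          using z(2)[of n] unfolding zz J_def prod.case
          by (subst (asm) nm_lin_sq[OF dsl d]) (simp add: algebra_simps power2_eq_square)
      qed
      then show "\<exists>N. \<forall>n\<ge>N. 0 <= 1 / Suc n + t * (ip M (ds n) d - r) + t\<^sup>2 * ((nm M d)\<^sup>2 / 2)" by blast
    qed
    then have "ip M u d - r = 0" by (rule quadratic_nonneg_linear_zero)
    then show ?thesis by simp
  qed
  have "(nm M u)\<^sup>2 <= K * nm M u"
  proof (rule LIMSEQ_le)
    show "(%n. ip M (ds n) u) \<longlonglongrightarrow> (nm M u)\<^sup>2"
      unfolding nm_sq by (rule ip_tendsto[OF dsl u(1) u(1) u(2)])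
    show "(%n. K * nm M (ds n)) \<longlonglongrightarrow> K * nm M u"
      by (intro tendsto_mult tendsto_const nm_tendsto[OF dsl u])
    have "ip M (ds n) u <= K * nm M (ds n)" for n
      using eu[of "ds n" "rs n"] bd[of "ds n" "rs n"] z(1)[of n] zz[of n] by (auto simp: ip_commute)
    then show "\<exists>N. \<forall>n\<ge>N. ip M (ds n) u <= K * nm M (ds n)" by blast
  qed
  then have "nm M u <= K | nm M u = 0"
    using nm_nonneg[of M u] less_eq_real_def[of 0 "nm M u"]
    by (auto simp: power2_eq_square mult_le_cancel_right)
  moreover have "ds n \<in> fst ` D" for n using z(1)[of n] zz[of n] by force
  ultimately show ?thesis using that u eu by blast
qed

section \<open>The skew-adjoint boundary conditions\<close>

abbreviation leb :: "real => real measure" where "leb L \<equiv> lebesgue_on {0<..<L}"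

lemma leb_cont_integrable:
  fixes f :: "real => 'b::euclidean_space"
  assumes "continuous_on {0..L} f"
  shows "integrable (leb L) f"
proof -
  have "integrable (lebesgue_on {0..L}) f" by (rule continuous_imp_integrable_real[OF assms])
  then have "set_integrable lebesgue {0..L} f"
    by (simp add: integrable_restrict_space set_integrable_def)
  then have "set_integrable lebesgue {0<..<L} f"
    by (rule set_integrable_subset) auto
  then show ?thesis by (simp add: integrable_restrict_space set_integrable_def)
qed

lemma leb_cont_integral:
  fixes f :: "real => 'b::euclidean_space"
  assumes "continuous_on {0..L} f"
  shows "(LINT x|leb L. f x) = integral {0..L} f"
  by (subst lebesgue_integral_eq_integral[OF leb_cont_integrable[OF assms]])
     (auto simp: integral_open_interval_real)

lemma cont_l2: "continuous_on {0..L} f ==> f \<in> l2 (leb L)"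
  unfolding l2_def by (auto intro!: leb_cont_integrable borel_measurable_integrable continuous_intros)

lemma ip_cont:
  assumes "continuous_on {0..L} f" "continuous_on {0..L} g"
  shows "ip (leb L) f g = integral {0..L} (%x. f x * g x)"
  unfolding ip_def by (rule leb_cont_integral) (use assms in \<open>auto intro!: continuous_intros\<close>)

lemma ip_cong_on:
  assumes "!!x. x \<in> {0..L} ==> f x = f' x" "!!x. x \<in> {0..L} ==> g x = g' x"
  shows "ip (leb L) f g = ip (leb L) f' g'"
  unfolding ip_def using assms by (intro Bochner_Integration.integral_cong) auto

lemma nm_cong_on:
  assumes "!!x. x \<in> {0..L} ==> f x = f' x"
  shows "nm (leb L) f = nm (leb L) f'"
  unfolding nm_def using ip_cong_on[OF assms assms] by simp

lemma nm_le_sup: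
  assumes "continuous_on {0..L} f" "!!x. x \<in> {0..L} ==> \<bar>f x\<bar> <= B" "L >= 0"
  shows "nm (leb L) f <= sqrt L * B"
proof -
  have "integral {0..L} (%x. f x * f x) <= integral {0..L} (%x. B\<^sup>2)"
  proof (rule integral_le)
    fix x assume "x \<in> {0..L}"
    then have "\<bar>f x\<bar>\<^sup>2 <= B\<^sup>2" by (intro power_mono assms) auto
    then show "f x * f x <= B\<^sup>2" by (simp add: power2_eq_square)
  qed (auto intro!: integrable_continuous_real continuous_intros assms)
  then have "ip (leb L) f f <= L * B\<^sup>2" using assms by (simp add: ip_cont)
  then have "nm (leb L) f <= sqrt (L * B\<^sup>2)" unfolding nm_def by (rule real_sqrt_le_mono)
  moreover have "0 <= B" using assms(2)[of 0] assms(3) by auto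
  ultimately show ?thesis by (simp add: real_sqrt_mult)
qed

lemma cont_integral_le_nm:
  assumes "continuous_on {0..L} h" "continuous_on {0..L} k" "!!s. s \<in> {0..L} ==> \<bar>k s\<bar> <= 1" "x \<in> {0..L}"
  shows "\<bar>integral {0..x} (%s. k s * h s)\<bar> <= sqrt L * nm (leb L) h"
proof -
  have sub: "{0..x} \<subseteq> {0..L}" using assms(4) by auto
  have c: "continuous_on {0..x} h" "continuous_on {0..x} k" using assms sub continuous_on_subset by blast+
  have "\<bar>integral {0..x} (%s. k s * h s)\<bar> <= integral {0..x} (%s. \<bar>h s\<bar>)"
    unfolding real_norm_def[symmetric]
  proof (rule integral_norm_bound_integral)
    fix s assume "s \<in> {0..x}"
    then have "\<bar>k s\<bar> <= 1" using assms(3) sub by auto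
    then show "norm (k s * h s) <= norm (h s)" by (simp add: abs_mult mult_left_le_one_le)
  qed (auto intro!: integrable_continuous_real continuous_intros c)
  also have "\<dots> <= integral {0..L} (%s. \<bar>h s\<bar>)"
    by (rule integral_subset_le[OF sub]) (auto intro!: integrable_continuous_real continuous_intros c assms)
  also have "\<dots> = ip (leb L) (%s. 1) (%s. \<bar>h s\<bar>)"
    by (subst ip_cont) (auto intro!: continuous_intros assms)
  also have "\<dots> <= nm (leb L) (%s. 1) * nm (leb L) (%s. \<bar>h s\<bar>)"
    by (rule order_trans[OF abs_ge_self ip_le_nm]) (auto intro!: cont_l2 continuous_intros assms)
  also have "nm (leb L) (%s. \<bar>h s\<bar>) = nm (leb L) h" by (simp add: nm_def ip_def)
  also have "nm (leb L) (%s. 1) <= sqrt L * 1"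
    by (rule nm_le_sup) (use assms(4) in auto)
  finally show ?thesis by (simp add: mult_right_mono)
qed

text \<open>The derivatives are carried as explicit functions, one-sided at the end points, so that
  boundary values such as \<open>w1 0\<close> make sense in the integrations by parts.\<close>

definition c3 :: "real => (real => real) => (real => real) => (real => real) => (real => real) => bool" where
  "c3 L w w1 w2 w3 \<longleftrightarrow> continuous_on {0..L} w3 & (\<forall>x\<in>{0..L}.
     (w has_real_derivative w1 x) (at x within {0..L}) &
     (w1 has_real_derivative w2 x) (at x within {0..L}) &
     (w2 has_real_derivative w3 x) (at x within {0..L}))"

lemma c3_deriv:
  assumes "c3 L w w1 w2 w3" "x \<in> {0..L}"
  shows "(w has_real_derivative w1 x) (at x within {0..L})"
     "(w1 has_real_derivative w2 x) (at x within {0..L})"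
     "(w2 has_real_derivative w3 x) (at x within {0..L})"
  using assms by (auto simp: c3_def)

lemma c3_cont:
  assumes "c3 L w w1 w2 w3"
  shows "continuous_on {0..L} w" "continuous_on {0..L} w1" "continuous_on {0..L} w2" "continuous_on {0..L} w3"
  using c3_deriv[OF assms] assms unfolding c3_def
  by (auto intro: DERIV_continuous_on)

lemma ftc:
  fixes f g :: "real => real"
  assumes "a <= b" "!!x. x \<in> {a..b} ==> (f has_real_derivative g x) (at x within {a..b})"
  shows "integral {a..b} g = f b - f a"
  by (rule integral_unique, rule fundamental_theorem_of_calculus)
     (use assms in \<open>auto simp: has_real_derivative_iff_has_vector_derivative[symmetric]\<close>)

lemma c3_by_parts:
  assumes "c3 L w w1 w2 w3" "c3 L v v1 v2 v3" "L > 0"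
  shows "integral {0..L} (%x. (w3 x + w1 x) * v x + w x * (v3 x + v1 x)) =
     (w2 L * v L - w1 L * v1 L + w L * v2 L + w L * v L)
     - (w2 0 * v 0 - w1 0 * v1 0 + w 0 * v2 0 + w 0 * v 0)"
proof -
  have "((%x. w2 x * v x - w1 x * v1 x + w x * v2 x + w x * v x) has_real_derivative
      (w3 x + w1 x) * v x + w x * (v3 x + v1 x)) (at x within {0..L})" if "x \<in> {0..L}" for x
    by (rule derivative_eq_intros c3_deriv[OF assms(1) that] c3_deriv[OF assms(2) that] refl)+
       (simp add: algebra_simps)
  then show ?thesis using assms by (subst ftc) auto
qed

locale noncritical =
  fixes L :: real
  assumes L_pos: "L > 0" and L_nc: "L \<notin> critical_lengths"
begin

text \<open>A length 2 pi n is critical with k = l = n. The number \<open>1 - cos L\<close> is, up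
  to a factor -2, the determinant of the linear system that adjusts the Cauchy data to the boundary
  conditions, so 0 is not an eigenvalue of the skew-adjoint problem.\<close>

lemma cos_L: "cos L ~= 1"
proof
  assume "cos L = 1"
  then obtain n :: int where n: "L = of_int n * 2 * pi" by (auto simp: cos_one_2pi_int)
  then have "n > 0" using L_pos by (metis mult_less_cancel_right2 mult_eq_0_iff not_less_iff_gr_or_eq of_int_0_less_iff pi_gt_zero zero_less_mult_iff zero_less_numeral)
  then obtain k :: nat where k: "n = int k" "k >= 1" by (metis int_one_le_iff_zero_less nonneg_int_cases of_nat_1 of_nat_le_iff zero_less_imp_eq_int linorder_not_le order_less_imp_le)
  have "L = 2 * pi * sqrt ((real k ^ 2 + real k * real k + real k ^ 2) / 3)"
    unfolding n k(1) by (simp add: power2_eq_square real_sqrt_mult)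
  then have "L \<in> critical_lengths" unfolding critical_lengths_def using k(2) by blast
  then show False using L_nc by simp
qed

text \<open>Variation of constants for w''' + w' = h has the kernel 1 - cos (x - s). The addition
  formulas split it into three integrals whose integrands are free of x, so that differentiating
  \<open>V0\<close>, \<open>V1\<close>, \<open>V2\<close> takes only the fundamental
  theorem.\<close>

definition Ih where "Ih h x = integral {0..x} h" for h :: "real => real"
definition Ic where "Ic h x = integral {0..x} (%s. cos s * h s)" for h :: "real => real"
definition Is where "Is h x = integral {0..x} (%s. sin s * h s)" for h :: "real => real"
definition V0 where "V0 h x = Ih h x - cos x * Ic h x - sin x * Is h x"
definition V1 where "V1 h x = sin x * Ic h x - cos x * Is h x"
definition V2 where "V2 h x = cos x * Ic h x + sin x * Is h x"
text \<open>Cramer's rule for the conditions w(L) = 0 and w'(L) = w'(0), with determinant -2 (1 -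
  cos L).\<close>

definition Ga where "Ga h = - (V0 h L * (1 - cos L) + sin L * V1 h L) / (2 * (1 - cos L))"
definition Gb where "Gb h = ((1 - cos L) * V1 h L - sin L * V0 h L) / (2 * (1 - cos L))"

text \<open>\<open>G0 h\<close> is the solution \<open>w\<close> of \<open>w''' + w' = h\<close>, \<open>w(0) = w(L) = 0\<close>, \<open>w'(0) = w'(L)\<close>, and
  \<open>Ga h\<close>, \<open>Gb h\<close> are its Cauchy data \<open>w''(0)\<close>, \<open>w'(0)\<close>.\<close>

definition G0 where "G0 h x = Ga h * (1 - cos x) + Gb h * sin x + V0 h x"
definition G1 where "G1 h x = Ga h * sin x + Gb h * cos x + V1 h x"
definition G2 where "G2 h x = Ga h * cos x - Gb h * sin x + V2 h x"

lemma I_deriv: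
  assumes "continuous_on {0..L} h" "x \<in> {0..L}"
  shows "(Ih h has_real_derivative h x) (at x within {0..L})"
    "(Ic h has_real_derivative cos x * h x) (at x within {0..L})"
    "(Is h has_real_derivative sin x * h x) (at x within {0..L})"
  unfolding Ih_def[abs_def] Ic_def[abs_def] Is_def[abs_def] has_real_derivative_iff_has_vector_derivative
  by (rule integral_has_vector_derivative; use assms in \<open>auto intro!: continuous_intros\<close>)+

lemma V_deriv:
  assumes "continuous_on {0..L} h" "x \<in> {0..L}"
  shows "(V0 h has_real_derivative V1 h x) (at x within {0..L})"
    "(V1 h has_real_derivative V2 h x) (at x within {0..L})"
    "(V2 h has_real_derivative h x - V1 h x) (at x within {0..L})"
proof -
  have sc: "sin x * (sin x * h x) = h x - cos x * (cos x * h x)"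
  proof -
    have "(sin x)\<^sup>2 * h x = h x - (cos x)\<^sup>2 * h x" by (simp add: sin_squared_eq algebra_simps)
    then show ?thesis by (simp add: power2_eq_square mult.assoc)
  qed
  show "(V0 h has_real_derivative V1 h x) (at x within {0..L})"
    unfolding V0_def[abs_def] V1_def
    by (rule derivative_eq_intros I_deriv[OF assms] refl)+ (simp add: sc algebra_simps)
  show "(V1 h has_real_derivative V2 h x) (at x within {0..L})"
    unfolding V1_def[abs_def] V2_def
    by (rule derivative_eq_intros I_deriv[OF assms] refl)+ (simp add: algebra_simps)
  show "(V2 h has_real_derivative h x - V1 h x) (at x within {0..L})"
    unfolding V2_def[abs_def] V1_def
    by (rule derivative_eq_intros I_deriv[OF assms] refl)+ (simp add: sc algebra_simps)
qed

lemma V_at_0 [simp]: "V0 h 0 = 0" "V1 h 0 = 0" "V2 h 0 = 0"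
  by (simp_all add: V0_def V1_def V2_def Ih_def Ic_def Is_def)

lemma G_c3:
  assumes "continuous_on {0..L} h"
  shows "c3 L (G0 h) (G1 h) (G2 h) (%x. h x - G1 h x)"
proof -
  have 1: "(G0 h has_real_derivative G1 h x) (at x within {0..L})"
    "(G1 h has_real_derivative G2 h x) (at x within {0..L})"
    "(G2 h has_real_derivative h x - G1 h x) (at x within {0..L})" if "x \<in> {0..L}" for x
    unfolding G0_def[abs_def] G1_def[abs_def] G2_def[abs_def]
    by (rule derivative_eq_intros V_deriv[OF assms that] refl | simp)+
  have "continuous_on {0..L} (G1 h)" by (rule DERIV_continuous_on[OF 1(2)])
  then show ?thesis unfolding c3_def using 1 assms by (auto intro!: continuous_intros)
qed

lemma G_bc: "G0 h 0 = 0" "G0 h L = 0" "G1 h L = G1 h 0" "G1 h 0 = Gb h" "G2 h 0 = Ga h"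
proof -
  have d: "1 - cos L ~= 0" using cos_L by simp
  have s2: "sin L * sin L = (1 - cos L) * (1 + cos L)"
    using sin_cos_squared_add[of L] by (simp add: power2_eq_square algebra_simps)
  show "G0 h 0 = 0" "G1 h 0 = Gb h" "G2 h 0 = Ga h" by (simp_all add: G0_def G1_def G2_def)
  have a: "Ga h * (2 * (1 - cos L)) = - (V0 h L * (1 - cos L) + sin L * V1 h L)"
    by (rule iffD1[OF nonzero_eq_divide_eq Ga_def]) (use d in simp)
  have b: "Gb h * (2 * (1 - cos L)) = (1 - cos L) * V1 h L - sin L * V0 h L"
    by (rule iffD1[OF nonzero_eq_divide_eq Gb_def]) (use d in simp)
  have "(1 - cos L) * (2 * G0 h L) = (1 - cos L) * (Ga h * (2 * (1 - cos L))) + sin L * (Gb h * (2 * (1 - cos L)))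
      + 2 * (1 - cos L) * V0 h L" by (simp add: G0_def algebra_simps)
  also have "\<dots> = V0 h L * ((1 - cos L) * (1 + cos L) - sin L * sin L)" unfolding a b by (simp add: algebra_simps del: sin_cos_squared_add sin_cos_squared_add2 sin_cos_squared_add3)
  finally show "G0 h L = 0" using d s2 by simp
  have "(1 - cos L) * (2 * (G1 h L - Gb h)) = sin L * (Ga h * (2 * (1 - cos L))) - (1 - cos L) * (Gb h * (2 * (1 - cos L)))
      + 2 * (1 - cos L) * V1 h L" by (simp add: G1_def algebra_simps)
  also have "\<dots> = V1 h L * ((1 - cos L) * (1 + cos L) - sin L * sin L)" unfolding a b by (simp add: algebra_simps del: sin_cos_squared_add sin_cos_squared_add2 sin_cos_squared_add3)
  finally show "G1 h L = G1 h 0" using d s2 \<open>G1 h 0 = Gb h\<close> by simp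
qed

text \<open>The difference from \<open>G0 h\<close> solves the homogeneous equation, is thus
  determined by two constants, and the boundary conditions at L annihilate both because
  \<open>cos L\<close> is not 1.\<close>

lemma G_unique:
  assumes "c3 L w w1 w2 w3" "w 0 = 0" "w L = 0" "w1 L = w1 0" "!!x. x \<in> {0..L} ==> w3 x + w1 x = h x"
    "x \<in> {0..L}"
  shows "w x = G0 h x"
proof -
  have hc: "continuous_on {0..L} h"
    using c3_cont[OF assms(1)] assms(5) by (subst continuous_on_cong[OF refl assms(5)[symmetric]])
      (auto intro!: continuous_intros)
  define d where "d x = w x - G0 h x" for x
  define d1 where "d1 x = w1 x - G1 h x" for x
  define d2 where "d2 x = w2 x - G2 h x" for x
  have D: "(d has_real_derivative d1 x) (at x within {0..L})" "(d1 has_real_derivative d2 x) (at x within {0..L})"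
    "(d2 has_real_derivative - d1 x) (at x within {0..L})" if "x \<in> {0..L}" for x
    unfolding d_def[abs_def] d1_def[abs_def] d2_def[abs_def]
    by ((rule derivative_eq_intros c3_deriv[OF assms(1) that] c3_deriv[OF G_c3[OF hc] that] refl)+;
      use assms(5)[OF that] in simp)+
  have const: "f y = f 0" if "y \<in> {0..L}" "!!x. x \<in> {0..L} ==> (f has_real_derivative 0) (at x within {0..L})" for f :: "real => real" and y
  proof -
    have "\<exists>c. \<forall>x\<in>{0..L}. f x = c" by (rule has_field_derivative_zero_constant) (use that in auto)
    then show ?thesis using that(1) L_pos by force
  qed
  define A where "A = d2 0"
  define B where "B = d1 0"
  \<comment> \<open>First integrals of d''' + d' = 0: the sum of d'' and d, and the vector (d'', d')
    rotated by the angle y.\<close>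
  have e1: "d2 y + d y = A" if "y \<in> {0..L}" for y
  proof -
    have "(%y. d2 y + d y) y = (%y. d2 y + d y) 0"
      by (rule const[OF that]) (rule derivative_eq_intros D refl | assumption | simp)+
    then show ?thesis by (simp add: A_def d_def assms G_bc)
  qed
  have e2: "cos y * d2 y + sin y * d1 y = A" if "y \<in> {0..L}" for y
  proof -
    have "(%y. cos y * d2 y + sin y * d1 y) y = (%y. cos y * d2 y + sin y * d1 y) 0"
      by (rule const[OF that]) (rule derivative_eq_intros D refl | assumption | simp)+
    then show ?thesis by (simp add: A_def)
  qed
  have e3: "cos y * d1 y - sin y * d2 y = B" if "y \<in> {0..L}" for y
  proof -
    have "(%y. cos y * d1 y - sin y * d2 y) y = (%y. cos y * d1 y - sin y * d2 y) 0"
      by (rule const[OF that]) (rule derivative_eq_intros D refl | assumption | simp)+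
    then show ?thesis by (simp add: B_def)
  qed
  have sol: "d2 y = A * cos y - B * sin y" "d1 y = A * sin y + B * cos y" if "y \<in> {0..L}" for y
  proof -
    have "d2 y * ((sin y)\<^sup>2 + (cos y)\<^sup>2) = cos y * (cos y * d2 y + sin y * d1 y) - sin y * (cos y * d1 y - sin y * d2 y)"
      by (simp add: power2_eq_square algebra_simps del: sin_cos_squared_add sin_cos_squared_add2 sin_cos_squared_add3)
    then show "d2 y = A * cos y - B * sin y" using e2[OF that] e3[OF that] by (simp add: mult.commute)
    have "d1 y * ((sin y)\<^sup>2 + (cos y)\<^sup>2) = sin y * (cos y * d2 y + sin y * d1 y) + cos y * (cos y * d1 y - sin y * d2 y)"
      by (simp add: power2_eq_square algebra_simps del: sin_cos_squared_add sin_cos_squared_add2 sin_cos_squared_add3)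
    then show "d1 y = A * sin y + B * cos y" using e2[OF that] e3[OF that] by (simp add: mult.commute)
  qed
  have L: "L \<in> {0..L}" using L_pos by simp
  have dL: "d L = 0" "d1 L = B" by (simp_all add: d_def d1_def B_def assms G_bc)
  have q1: "A * (1 - cos L) + B * sin L = 0" using e1[OF L] sol(1)[OF L] dL by (simp add: algebra_simps)
  have q2: "A * sin L - B * (1 - cos L) = 0" using sol(2)[OF L] dL by (simp add: algebra_simps)
  have s2: "(1 - cos L)\<^sup>2 + (sin L)\<^sup>2 > 0" using cos_L by (simp add: sum_power2_gt_zero_iff)
  have "A * ((1 - cos L)\<^sup>2 + (sin L)\<^sup>2) = (1 - cos L) * (A * (1 - cos L) + B * sin L) + sin L * (A * sin L - B * (1 - cos L))"
    by (simp add: power2_eq_square algebra_simps del: sin_cos_squared_add sin_cos_squared_add2 sin_cos_squared_add3)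
  then have A: "A = 0" using q1 q2 s2 cos_L by simp
  have "B * ((1 - cos L)\<^sup>2 + (sin L)\<^sup>2) = sin L * (A * (1 - cos L) + B * sin L) - (1 - cos L) * (A * sin L - B * (1 - cos L))"
    by (simp add: power2_eq_square algebra_simps del: sin_cos_squared_add sin_cos_squared_add2 sin_cos_squared_add3)
  then have B: "B = 0" using q1 q2 s2 cos_L by simp
  show ?thesis using e1[OF assms(6)] sol(1)[OF assms(6)] A B by (simp add: d_def)
qed

text \<open>A rough constant: the numerators of \<open>Ga\<close> and \<open>Gb\<close> are at most
  8 sqrt L times the norm of \<open>h\<close>. The slack also gives sqrt L <= \<open>CG\<close>,
  which absorbs the bounds for \<open>V0\<close>, \<open>V1\<close>, \<open>V2\<close>.\<close>

definition CG where "CG = 10 * sqrt L / (1 - cos L)"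

lemma CG_nonneg: "CG >= 0" using cos_le_one[of L] L_pos by (simp add: CG_def)

lemma G_bound:
  assumes "continuous_on {0..L} h" "x \<in> {0..L}"
  shows "\<bar>Ga h\<bar> <= CG * nm (leb L) h" "\<bar>Gb h\<bar> <= CG * nm (leb L) h"
    "\<bar>G0 h x\<bar> <= 6 * CG * nm (leb L) h" "\<bar>G1 h x\<bar> <= 6 * CG * nm (leb L) h" "\<bar>G2 h x\<bar> <= 6 * CG * nm (leb L) h"
proof -
  let ?N = "sqrt L * nm (leb L) h"
  have N: "?N >= 0" using L_pos by simp
  have mb: "\<bar>a * b\<bar> <= B" if "\<bar>a\<bar> <= 1" "\<bar>b\<bar> <= B" for a b B :: real
    unfolding abs_mult using that mult_mono[of "\<bar>a\<bar>" 1 "\<bar>b\<bar>" B] by auto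
  have I: "\<bar>Ih h y\<bar> <= ?N" "\<bar>Ic h y\<bar> <= ?N" "\<bar>Is h y\<bar> <= ?N" if "y \<in> {0..L}" for y
    using cont_integral_le_nm[OF assms(1), of "%_. 1" y] cont_integral_le_nm[OF assms(1), of cos y]
      cont_integral_le_nm[OF assms(1), of sin y] that
      continuous_at_imp_continuous_on[of "{0..L}" cos] continuous_at_imp_continuous_on[of "{0..L}" sin]
    by (auto simp: Ih_def Ic_def Is_def)
  have V: "\<bar>V0 h y\<bar> <= 3 * ?N" "\<bar>V1 h y\<bar> <= 2 * ?N" "\<bar>V2 h y\<bar> <= 2 * ?N" if "y \<in> {0..L}" for y
    using I[OF that] mb[of "cos y" "Ic h y" ?N] mb[of "sin y" "Ic h y" ?N]
      mb[of "cos y" "Is h y" ?N] mb[of "sin y" "Is h y" ?N]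
    unfolding V0_def V1_def V2_def by auto
  have d: "1 - cos L > 0" using cos_L cos_le_one[of L] by (simp add: less_le)
  have d2: "1 - cos L <= 2" using cos_ge_minus_one[of L] by simp
  have LL: "L \<in> {0..L}" using L_pos by simp
  have mb2: "\<bar>a * b\<bar> <= 2 * B" if "\<bar>a\<bar> <= 2" "\<bar>b\<bar> <= B" for a b B :: real
    unfolding abs_mult using that mult_mono[of "\<bar>a\<bar>" 2 "\<bar>b\<bar>" B] by auto
  have aa: "\<bar>V0 h L * (1 - cos L)\<bar> <= 6 * ?N" "\<bar>sin L * V1 h L\<bar> <= 2 * ?N"
    "\<bar>(1 - cos L) * V1 h L\<bar> <= 4 * ?N" "\<bar>sin L * V0 h L\<bar> <= 3 * ?N"
    using V[OF LL] d d2 mb[of "sin L" "V1 h L"] mb[of "sin L" "V0 h L"]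
      mb2[of "1 - cos L" "V0 h L" "3 * ?N"] mb2[of "1 - cos L" "V1 h L" "2 * ?N"]
    by (auto simp: mult.commute)
  have CGN: "CG * nm (leb L) h = 20 * ?N / (2 * (1 - cos L))" using d by (simp add: CG_def field_simps)
  show a: "\<bar>Ga h\<bar> <= CG * nm (leb L) h"
    unfolding CGN Ga_def abs_divide using aa d N by (auto intro!: divide_right_mono)
  show b: "\<bar>Gb h\<bar> <= CG * nm (leb L) h"
    unfolding CGN Gb_def abs_divide using aa d N by (auto intro!: divide_right_mono)
  have N2: "?N <= CG * nm (leb L) h"
  proof -
    have "?N * (1 - cos L) <= ?N * 10" by (rule mult_left_mono[OF _ N]) (use d2 in linarith)
    then show ?thesis using d by (simp add: CG_def field_simps)
  qed
  show "\<bar>G0 h x\<bar> <= 6 * CG * nm (leb L) h"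
    using mb2[of "1 - cos x" "Ga h", OF _ a] mb[of "sin x" "Gb h", OF _ b] V(1)[OF assms(2)] N2
      cos_le_one[of x] cos_ge_minus_one[of x] unfolding G0_def
    by (auto simp: mult.commute)
  show "\<bar>G1 h x\<bar> <= 6 * CG * nm (leb L) h"
    using mb[of "sin x" "Ga h", OF _ a] mb[of "cos x" "Gb h", OF _ b] V(2)[OF assms(2)] N2 N
    unfolding G1_def by (auto simp: mult.commute)
  show "\<bar>G2 h x\<bar> <= 6 * CG * nm (leb L) h"
    using mb[of "cos x" "Ga h", OF _ a] mb[of "sin x" "Gb h", OF _ b] V(3)[OF assms(2)] N2 N
    unfolding G2_def by (auto simp: mult.commute)
qed

end

section \<open>Orthonormal families and the spectrum of the skew-adjoint problem\<close>

lemma l2_zero [simp]: "(%x. 0) \<in> l2 M" by (simp add: l2_def)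

lemma l2_sum: "(!!j. j < n ==> f j \<in> l2 M) ==> (%x. \<Sum>j<(n::nat). c j * f j x) \<in> l2 M"
proof (induction n)
  case (Suc n)
  then show ?case using l2_lin[of "%x. \<Sum>j<n. c j * f j x" M "f n" 1 "c n"] by simp
qed simp

lemma ip_sum_left:
  assumes "!!j. j < n ==> f j \<in> l2 M" "g \<in> l2 M"
  shows "ip M (%x. \<Sum>j<(n::nat). c j * f j x) g = (\<Sum>j<n. c j * ip M (f j) g)"
  using assms(1)
proof (induction n)
  case 0
  show ?case by (simp add: ip_def)
next
  case (Suc n)
  then show ?case
    using ip_lin_left[OF l2_sum, of n f M "f n" g 1 c "c n"] assms(2) by simp
qed

lemma orthonormal_ip:
  assumes "!!j. j < n ==> e j \<in> l2 M" "!!i j. i < n ==> j < n ==> ip M (e i) (e j) = (if i = j then 1 else 0)"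
    and "k < n"
  shows "ip M (%x. \<Sum>j<(n::nat). c j * e j x) (e k) = c k"
proof -
  have "ip M (%x. \<Sum>j<n. c j * e j x) (e k) = (\<Sum>j<n. c j * ip M (e j) (e k))"
    by (rule ip_sum_left) (use assms in auto)
  also have "\<dots> = (\<Sum>j<n. if j = k then c k else 0)"
    by (rule sum.cong) (use assms in auto)
  finally show ?thesis using assms(3) by simp
qed

lemma orthonormal_nm:
  assumes "!!j. j < n ==> e j \<in> l2 M" "!!i j. i < n ==> j < n ==> ip M (e i) (e j) = (if i = j then 1 else 0)"
  shows "(nm M (%x. \<Sum>j<(n::nat). c j * e j x))\<^sup>2 = (\<Sum>j<n. (c j)\<^sup>2)"
proof -
  let ?f = "%x. \<Sum>j<n. c j * e j x"
  have "ip M ?f ?f = (\<Sum>j<n. c j * ip M (e j) ?f)"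
    by (rule ip_sum_left) (use assms l2_sum[of n e M c] in auto)
  also have "\<dots> = (\<Sum>j<n. c j * c j)"
    by (rule sum.cong) (auto simp: ip_commute[of M "e _"] intro!: orthonormal_ip assms)
  finally show ?thesis unfolding nm_sq by (simp add: power2_eq_square)
qed

lemma cont_nm_zero:
  assumes "continuous_on {0..L} f" "nm (leb L) f = 0" "L > 0" "x \<in> {0..L}"
  shows "f x = 0"
proof -
  have "integral {0..L} (%x. f x * f x) = 0" using assms by (simp add: nm_def ip_cont)
  moreover have "continuous_on {0..L} (%x. f x * f x)" using assms by (intro continuous_intros)
  ultimately have "\<forall>x\<in>{0..L}. f x * f x = 0"
    using integral_eq_0_iff[of 0 L "%x. f x * f x"] assms(3) by simp
  then show ?thesis using assms(4) by auto
qed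

lemma c3_lin:
  assumes "c3 L w w1 w2 w3" "c3 L v v1 v2 v3"
  shows "c3 L (%x. a * w x + b * v x) (%x. a * w1 x + b * v1 x) (%x. a * w2 x + b * v2 x) (%x. a * w3 x + b * v3 x)"
  unfolding c3_def
proof (intro conjI ballI)
  show "continuous_on {0..L} (%x. a * w3 x + b * v3 x)"
    using c3_cont[OF assms(1)] c3_cont[OF assms(2)] by (intro continuous_intros)
qed (rule derivative_eq_intros c3_deriv[OF assms(1)] c3_deriv[OF assms(2)] refl | assumption | simp)+

context noncritical
begin

abbreviation "ipL \<equiv> ip (leb L)"
abbreviation "nmL \<equiv> nm (leb L)"
abbreviation "contL \<equiv> continuous_on {0..L}"

lemma G0_cont [intro]: "contL h ==> contL (G0 h)" using c3_cont(1)[OF G_c3] .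

lemma G0_lin:
  assumes "contL f" "contL g" "x \<in> {0..L}"
  shows "G0 (%x. a * f x + b * g x) x = a * G0 f x + b * G0 g x"
  by (rule G_unique[OF c3_lin[OF G_c3 G_c3], symmetric]) (use assms G_bc in \<open>auto simp: algebra_simps\<close>)

lemma G0_cong:
  assumes "contL f" "!!x. x \<in> {0..L} ==> f x = g x" "x \<in> {0..L}"
  shows "G0 g x = G0 f x"
  by (rule G_unique[OF G_c3[OF assms(1)], symmetric]) (use assms G_bc in auto)

lemma G0_sum:
  assumes "!!j. j < n ==> contL (f j)" "x \<in> {0..L}"
  shows "G0 (%x. \<Sum>j<(n::nat). c j * f j x) x = (\<Sum>j<n. c j * G0 (f j) x)"
  using assms(1)
proof (induction n)
  case 0
  show ?case using G0_lin[of "%_. 0" "%_. 0" x 0 0] assms(2) by simp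
next
  case (Suc n)
  have "contL (%x. \<Sum>j<n. c j * f j x)" using Suc.prems by (auto intro!: continuous_intros)
  then show ?case
    using G0_lin[of "%x. \<Sum>j<n. c j * f j x" "f n" x 1 "c n"] Suc assms(2) by simp
qed

text \<open>In Green's identity the products of first derivatives at 0 and L cancel because both
  functions take the same slope at the two ends; the other boundary terms contain a vanishing
  factor.\<close>

lemma G0_skew:
  assumes "contL f" "contL g"
  shows "ipL (G0 f) g = - ipL f (G0 g)"
proof -
  have c: "contL (G0 f)" "contL (G0 g)" using assms by auto
  have "integral {0..L} (%x. f x * G0 g x + G0 f x * g x) = 0"
    using c3_by_parts[OF G_c3[OF assms(1)] G_c3[OF assms(2)] L_pos] by (simp add: G_bc algebra_simps)
  moreover have "integral {0..L} (%x. f x * G0 g x + G0 f x * g x) = ipL f (G0 g) + ipL (G0 f) g"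
    unfolding ip_cont[OF assms(1) c(2)] ip_cont[OF c(1) assms(2)]
    by (rule Henstock_Kurzweil_Integration.integral_add) (auto intro!: integrable_continuous_real continuous_intros assms c)
  ultimately show ?thesis by simp
qed

definition KG where "KG = sqrt L * (6 * CG)"

lemma KG_nonneg: "KG >= 0" using CG_nonneg L_pos by (simp add: KG_def)

lemma nm_G0: "contL h ==> nmL (G0 h) <= KG * nmL h"
  using nm_le_sup[of L "G0 h" "6 * CG * nmL h"] G_bound(3)[of h] L_pos by (auto simp: KG_def mult_ac)

lemma nm_G0_diff:
  assumes "contL f" "contL g"
  shows "nmL (%x. G0 f x - G0 g x) <= KG * nmL (%x. f x - g x)"
proof -
  have "nmL (%x. G0 f x - G0 g x) = nmL (G0 (%x. 1 * f x + (-1) * g x))"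
    by (rule nm_cong_on) (use G0_lin[OF assms, of _ 1 "-1"] in simp)
  also have "\<dots> <= KG * nmL (%x. 1 * f x + (-1) * g x)"
    by (rule nm_G0) (use assms in \<open>auto intro!: continuous_intros\<close>)
  finally show ?thesis by simp
qed

text \<open>Real encoding of a skew-adjoint spectrum: the eigenvalues of \<open>G0\<close> are
  imaginary and come in conjugate pairs, and the real eigenspace of a pair is described by
  \<open>G0\<close> squared being \<open>-(m j)^2\<close>. The frequencies of the differential
  operator are \<open>1 / m j\<close>, so \<epsilon> bounds them by 1 / \<epsilon>.\<close>

definition eigfam :: "real => nat => (nat => real => real) => (nat => real) => bool" where
  "eigfam \<epsilon> n e m \<longleftrightarrow> (\<forall>j<n. contL (e j) & m j >= \<epsilon> & (\<forall>x\<in>{0..L}. G0 (G0 (e j)) x = - (m j)\<^sup>2 * e j x)) &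
     (\<forall>i<n. \<forall>j<n. ipL (e i) (e j) = (if i = j then 1 else 0))"

lemma eigfamD:
  assumes "eigfam \<epsilon> n e m" "j < n"
  shows "contL (e j)" "m j >= \<epsilon>" "x \<in> {0..L} ==> G0 (G0 (e j)) x = - (m j)\<^sup>2 * e j x"
    "i < n ==> ipL (e i) (e j) = (if i = j then 1 else 0)" "e j \<in> l2 (leb L)"
  using assms by (auto simp: eigfam_def intro: cont_l2)

lemma eig_ip_G:
  assumes "eigfam \<epsilon> n e m" "j < n" "contL f"
  shows "ipL (G0 (G0 f)) (e j) = - (m j)\<^sup>2 * ipL f (e j)"
proof -
  have c: "contL (e j)" using eigfamD[OF assms(1,2)] by blast
  have "ipL (G0 (G0 f)) (e j) = ipL f (G0 (G0 (e j)))"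
    using G0_skew[OF G0_cont[OF assms(3)] c] G0_skew[OF assms(3) G0_cont[OF c]] by simp
  also have "\<dots> = ipL f (%x. - (m j)\<^sup>2 * e j x)"
    by (rule ip_cong_on) (use eigfamD[OF assms(1,2)] in auto)
  also have "\<dots> = - (m j)\<^sup>2 * ipL f (e j)"
    using ip_lin_right[of "e j" "leb L" "e j" f "- (m j)\<^sup>2" 0] cont_l2 c assms(3) by simp
  finally show ?thesis .
qed

text \<open>A Hilbert-Schmidt bound. Point evaluation of \<open>G0 f\<close> is a bounded functional
  of \<open>f\<close>, so Bessel's inequality controls the sum of the squares
  \<open>(G0 (e j) x)^2\<close> for each x; integrated over x, every term contributes at least
  \<epsilon>^2. It ends the construction of \<open>spectral\<close> and later counts the low
  modes.\<close>

lemma eig_count: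
  assumes "eigfam \<epsilon> n e m" "\<epsilon> > 0"
  shows "real n * \<epsilon>\<^sup>2 <= L * (6 * CG)\<^sup>2"
proof -
  note E = eigfamD[OF assms(1)]
  have pt: "(\<Sum>j<n. (G0 (e j) x)\<^sup>2) <= (6 * CG)\<^sup>2" if x: "x \<in> {0..L}" for x
  proof -
    define Q where "Q = (\<Sum>j<n. (G0 (e j) x)\<^sup>2)"
    \<comment> \<open>The projection onto the family of the vector that represents evaluation of
      \<open>G0\<close> at x, up to sign; on it the evaluation returns the sum \<open>Q\<close>
      itself.\<close>
    let ?f = "%y. \<Sum>j<n. G0 (e j) x * e j y"
    have Q0: "Q >= 0" unfolding Q_def by (intro sum_nonneg) auto
    have "G0 ?f x = Q"
      unfolding Q_def using G0_sum[of n e x "%j. G0 (e j) x"] E(1) x by (simp add: power2_eq_square)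
    moreover have "nmL ?f = sqrt Q"
    proof -
      have "(nmL ?f)\<^sup>2 = Q"
        unfolding Q_def by (rule orthonormal_nm) (use E in auto)
      then show ?thesis using real_sqrt_unique[of "nmL ?f" Q] by simp
    qed
    moreover have "contL ?f" using E(1) by (auto intro!: continuous_intros)
    ultimately have "Q <= 6 * CG * sqrt Q" using G_bound(3)[of ?f x] x by auto
    then have "sqrt Q * sqrt Q <= 6 * CG * sqrt Q" using Q0 by simp
    have "sqrt Q <= 6 * CG"
    proof (cases "Q = 0")
      case False
      then have "sqrt Q > 0" using Q0 by simp
      then show ?thesis using \<open>sqrt Q * sqrt Q <= 6 * CG * sqrt Q\<close> by (rule mult_right_le_imp_le[rotated])
    qed (use CG_nonneg in simp)
    then have "(sqrt Q)\<^sup>2 <= (6 * CG)\<^sup>2" using Q0 by (intro power_mono) auto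
    then show ?thesis using Q0 by (simp add: Q_def)
  qed
  have one: "ipL (G0 (e j)) (G0 (e j)) >= \<epsilon>\<^sup>2" if "j < n" for j
  proof -
    have "ipL (G0 (e j)) (G0 (e j)) = (m j)\<^sup>2"
      using G0_skew[of "G0 (e j)" "e j"] eig_ip_G[OF assms(1) that E(1)[OF that]] E(1,4)[OF that] that
        G0_cont[OF E(1)[OF that]] by (auto simp: ip_commute)
    then show ?thesis using E(2)[OF that] assms(2) by (simp add: power_mono)
  qed
  have "real n * \<epsilon>\<^sup>2 <= (\<Sum>j<n. ipL (G0 (e j)) (G0 (e j)))"
    using sum_mono[of "{..<n}" "%_. \<epsilon>\<^sup>2" "%j. ipL (G0 (e j)) (G0 (e j))"] one by simp
  also have "\<dots> = (\<Sum>j<n. integral {0..L} (%x. (G0 (e j) x)\<^sup>2))"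
    by (rule sum.cong) (auto simp: ip_cont[OF G0_cont[OF E(1)] G0_cont[OF E(1)]] power2_eq_square)
  also have "\<dots> = integral {0..L} (%x. \<Sum>j<n. (G0 (e j) x)\<^sup>2)"
    by (rule Henstock_Kurzweil_Integration.integral_sum[symmetric])
       (use E(1) in \<open>auto intro!: integrable_continuous_real continuous_intros\<close>)
  also have "\<dots> <= integral {0..L} (%x. (6 * CG)\<^sup>2)"
    by (rule integral_le) (use E(1) pt in \<open>auto intro!: integrable_continuous_real continuous_intros\<close>)
  also have "\<dots> = L * (6 * CG)\<^sup>2" using L_pos by simp
  finally show ?thesis .
qed

lemma G0_lipschitz:
  assumes "contL f" "x \<in> {0..L}" "y \<in> {0..L}"
  shows "\<bar>G0 f x - G0 f y\<bar> <= 6 * CG * nmL f * \<bar>x - y\<bar>"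
  using field_differentiable_bound[of "{0..L}" "G0 f" "G1 f" "6 * CG * nmL f" x y]
    c3_deriv(1)[OF G_c3[OF assms(1)]] G_bound(4)[OF assms(1)] assms(2,3)
  by (auto simp: real_norm_def)

text \<open>Maximise \<open>nmL (G0 f)\<close> on the unit sphere of the orthogonal complement. The
  images \<open>G0 f\<close> are equi-Lipschitz, so Arzela-Ascoli supplies a limit of the images;
  near-maximisers are near-eigenvectors, and this transfers convergence from the images to the
  maximisers themselves.\<close>

lemma eig_extend:
  assumes fam: "eigfam \<epsilon> n e m" and eps: "\<epsilon> > 0" and h: "contL h" "!!j. j < n ==> ipL h (e j) = 0"
    and big: "nmL (G0 h) > \<epsilon> * nmL h"
  shows "\<exists>e' m'. eigfam \<epsilon> (Suc n) e' m'"
proof -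
  note E = eigfamD[OF fam]
  define V where "V = {f. contL f & (\<forall>j<n. ipL f (e j) = 0)}"
  have Vc: "contL f" "f \<in> l2 (leb L)" if "f \<in> V" for f using that by (auto simp: V_def cont_l2)
  define S where "S = {nmL (G0 f) |f. f \<in> V & nmL f = 1}"
  define s where "s = Sup S"
  have bdd: "bdd_above S"
  proof (rule bdd_aboveI[of _ KG])
    fix v assume "v \<in> S"
    then obtain f where "v = nmL (G0 f)" "f \<in> V" "nmL f = 1" unfolding S_def by blast
    then show "v <= KG" using nm_G0[OF Vc(1)] by fastforce
  qed
  have scale: "(%x. c * f x) \<in> V" if "f \<in> V" for c f
  proof -
    have "ipL (%x. c * f x) (e j) = 0" if "j < n" for j
      using ip_lin_left[of f "leb L" f "e j" c 0] \<open>f \<in> V\<close> that E(5) by (auto simp: V_def cont_l2)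
    then show ?thesis using that by (auto simp: V_def intro!: continuous_intros)
  qed
  have Gscale: "nmL (G0 (%x. c * f x)) = \<bar>c\<bar> * nmL (G0 f)" if "contL f" for c f
  proof -
    have "nmL (G0 (%x. c * f x)) = nmL (%x. c * G0 f x)"
      by (rule nm_cong_on) (use G0_lin[OF that that, of _ c 0] in auto)
    then show ?thesis by (simp add: nm_scale)
  qed
  have le_s: "nmL (G0 f) <= s * nmL f" if f: "f \<in> V" for f
  proof (cases "nmL f = 0")
    case True
    then show ?thesis using nm_G0[OF Vc(1)[OF f]] by simp
  next
    case False
    let ?g = "%x. (1 / nmL f) * f x"
    have "nmL ?g = \<bar>1 / nmL f\<bar> * nmL f" by (rule nm_scale)
    then have "nmL ?g = 1" using False by simp
    then have "nmL (G0 ?g) \<in> S" using scale[OF f] unfolding S_def by blast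
    then have le: "nmL (G0 ?g) <= s" unfolding s_def by (rule cSup_upper[OF _ bdd])
    have "nmL (G0 ?g) = \<bar>1 / nmL f\<bar> * nmL (G0 f)" by (rule Gscale[OF Vc(1)[OF f]])
    then have "nmL (G0 ?g) * nmL f = nmL (G0 f)" using False by simp
    then show ?thesis using mult_right_mono[OF le nm_nonneg[of "leb L" f]] by linarith
  qed
  have hV: "h \<in> V" using h by (auto simp: V_def)
  have hpos: "nmL h > 0"
  proof -
    have "nmL h ~= 0" using big nm_G0[OF h(1)] by auto
    then show ?thesis using nm_nonneg[of "leb L" h] by linarith
  qed
  have se: "s > \<epsilon>" using le_s[OF hV] big hpos by (smt (verit) mult_le_cancel_right_pos)
  have s0: "s > 0" using se eps by simp
  have "S ~= {}"
  proof -
    have "nmL (%x. (1 / nmL h) * h x) = \<bar>1 / nmL h\<bar> * nmL h" by (rule nm_scale)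
    then have "nmL (%x. (1 / nmL h) * h x) = 1" using hpos by simp
    then show ?thesis using scale[OF hV] unfolding S_def by blast
  qed
  then have "\<exists>f. f \<in> V & nmL f = 1 & nmL (G0 f) > s - 1 / Suc k" for k
    using less_cSupD[of S "s - 1 / Suc k"] unfolding S_def s_def by fastforce
  then obtain f where f: "!!k. f k \<in> V" "!!k. nmL (f k) = 1" "!!k. nmL (G0 (f k)) > s - 1 / Suc k" by metis
  have fc: "contL (f k)" "f k \<in> l2 (leb L)" for k using f(1) Vc by auto
  have gs: "nmL (G0 (f k)) <= s" for k using le_s[OF f(1)] f(2) by (metis mult.right_neutral)
  \<comment> \<open>The symmetric nonnegative operator whose largest eigenvalue on \<open>V\<close>
    is to be attained; \<open>V\<close> is invariant under it.\<close>
  define B where "B g x = - G0 (G0 g) x" for g x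
  have Bc: "contL (B g)" if "contL g" for g unfolding B_def[abs_def] using that by (auto intro!: continuous_intros)
  have BV: "B g \<in> V" if "g \<in> V" for g
  proof -
    have "ipL (B g) (e j) = 0" if "j < n" for j
    proof -
      have "ipL (B g) (e j) = - ipL (G0 (G0 g)) (e j)" unfolding ip_def B_def by simp
      then show ?thesis using eig_ip_G[OF fam that Vc(1)[OF \<open>g \<in> V\<close>]] \<open>g \<in> V\<close> that by (simp add: V_def)
    qed
    then show ?thesis using Bc[OF Vc(1)[OF that]] by (auto simp: V_def)
  qed
  have ipB: "ipL (B g) k = ipL (G0 g) (G0 k)" if "contL g" "contL k" for g k
  proof -
    have "ipL (B g) k = - ipL (G0 (G0 g)) k" unfolding ip_def B_def by simp
    then show ?thesis using G0_skew[OF G0_cont[OF that(1)] that(2)] by simp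
  qed
  have nB: "nmL (B g) <= s * nmL (G0 g)" if g: "g \<in> V" for g
  proof (cases "nmL (B g) = 0")
    case True
    then show ?thesis using s0 by simp
  next
    case False
    have c: "contL g" "contL (B g)" using Vc Bc g by auto
    have "nmL (B g) * nmL (B g) = ipL (G0 g) (G0 (B g))"
      using ipB[OF c] nm_sq[of "leb L" "B g"] by (simp add: power2_eq_square)
    also have "\<dots> <= nmL (G0 g) * nmL (G0 (B g))"
      using ip_le_nm[OF cont_l2[OF G0_cont[OF c(1)]] cont_l2[OF G0_cont[OF c(2)]]] by linarith
    also have "\<dots> <= nmL (G0 g) * (s * nmL (B g))" by (intro mult_left_mono le_s BV g) simp
    finally have "nmL (B g) * nmL (B g) <= (s * nmL (G0 g)) * nmL (B g)" by (simp add: mult_ac)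
    then show ?thesis using False nm_nonneg[of "leb L" "B g"] by (simp add: mult_le_cancel_right)
  qed
  \<comment> \<open>Expanding the square shows that the defect in the eigenvalue equation is
    controlled by the gap s - \<open>nmL (G0 (f k))\<close>, which is below 1 / (k + 1).\<close>
  have Bd: "(nmL (%x. B (f k) x - s\<^sup>2 * f k x))\<^sup>2 <= 2 * s ^ 3 / Suc k" for k
  proof -
    let ?g = "nmL (G0 (f k))"
    have "(nmL (%x. B (f k) x - s\<^sup>2 * f k x))\<^sup>2 = (nmL (B (f k)))\<^sup>2 - 2 * s\<^sup>2 * ?g\<^sup>2 + s ^ 4"
      using nm_lin_sq[OF cont_l2[OF Bc[OF fc(1)[of k]]] fc(2)[of k], of 1 "- s\<^sup>2"] ipB[OF fc(1) fc(1), of k k] f(2)[of k]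
      by (simp add: nm_sq)
    also have "(nmL (B (f k)))\<^sup>2 <= (s * ?g)\<^sup>2" by (intro power_mono nB f(1)) simp
    also have "(s * ?g)\<^sup>2 - 2 * s\<^sup>2 * ?g\<^sup>2 + s ^ 4 = s\<^sup>2 * ((s - ?g) * (s + ?g))"
      by (simp add: power2_eq_square eval_nat_numeral algebra_simps)
    also have "\<dots> <= s\<^sup>2 * ((1 / Suc k) * (2 * s))"
      using f(3)[of k] gs[of k] s0 by (intro mult_left_mono mult_mono) auto
    also have "\<dots> = 2 * s ^ 3 / Suc k" by (simp add: power2_eq_square eval_nat_numeral)
    finally show ?thesis by simp
  qed
  obtain u r where u: "contL u" "strict_mono (r :: nat => nat)"
    "!!e. 0 < e ==> \<exists>N. \<forall>k x. k >= N & x \<in> {0..L} --> norm (G0 (f (r k)) x - u x) < e"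
  proof (rule Arzela_Ascoli[of "{0..L}" "%k. G0 (f k)" "6 * CG"])
    show "norm (G0 (f k) x) <= 6 * CG" if "x \<in> {0..L}" for k x
      using G_bound(3)[OF fc(1) that] f(2) by simp
    fix x d :: real assume x: "x \<in> {0..L}" and d: "0 < d"
    show "\<exists>\<delta>. 0 < \<delta> & (\<forall>k y. y \<in> {0..L} & norm (x - y) < \<delta> --> norm (G0 (f k) x - G0 (f k) y) < d)"
    proof (intro exI[of _ "d / (6 * CG + 1)"] conjI allI impI)
      show "0 < d / (6 * CG + 1)" using d CG_nonneg by simp
      fix k y assume y: "y \<in> {0..L} & norm (x - y) < d / (6 * CG + 1)"
      have "\<bar>G0 (f k) x - G0 (f k) y\<bar> <= 6 * CG * \<bar>x - y\<bar>"
        using G0_lipschitz[OF fc(1) x, of y] y f(2) by auto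
      also have "\<dots> <= (6 * CG + 1) * \<bar>x - y\<bar>" by (intro mult_right_mono) auto
      also have "\<dots> < d" using y CG_nonneg by (simp add: field_simps)
      finally show "norm (G0 (f k) x - G0 (f k) y) < d" by simp
    qed
  qed (auto intro: that)
  have Gu: "(%k. nmL (%x. G0 (f (r k)) x - u x)) \<longlonglongrightarrow> 0"
  proof (rule LIMSEQ_I)
    fix d :: real assume d: "0 < d"
    have q: "d / (2 * sqrt L) > 0" using d L_pos by simp
    obtain N where N: "\<forall>k x. k >= N & x \<in> {0..L} --> norm (G0 (f (r k)) x - u x) < d / (2 * sqrt L)"
      using u(3)[OF q] by blast
    have "nmL (%x. G0 (f (r k)) x - u x) <= sqrt L * (d / (2 * sqrt L))" if "k >= N" for k
      by (rule nm_le_sup) (use N that fc u(1) L_pos in \<open>auto intro!: continuous_intros less_imp_le\<close>)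
    then have "nmL (%x. G0 (f (r k)) x - u x) < d" if "k >= N" for k
    proof -
      have "sqrt L * (d / (2 * sqrt L)) = d / 2" using L_pos by simp
      then show ?thesis using \<open>!!k. N <= k ==> nmL (%x. G0 (f (r k)) x - u x) <= sqrt L * (d / (2 * sqrt L))\<close>[OF that] d
        by linarith
    qed
    then show "\<exists>no. \<forall>k\<ge>no. norm (nmL (%x. G0 (f (r k)) x - u x) - 0) < d" by auto
  qed
  \<comment> \<open>From f = -\<open>G0 (G0 f)\<close> / s^2 in the limit, with u the limit of the
    images. Writing the limit as an image under \<open>G0\<close> keeps it continuous, although
    continuous functions are not complete in the norm.\<close>
  define w where "w x = - (1 / s\<^sup>2) * G0 u x" for x
  have wc: "contL w" unfolding w_def[abs_def] using u(1) s0 by (auto intro!: continuous_intros)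
  have fw: "(%k. nmL (%x. f (r k) x - w x)) \<longlonglongrightarrow> 0"
  proof (rule real_tendsto_sandwich[OF always_eventually always_eventually tendsto_const])
    let ?b = "%k. 1 / s\<^sup>2 * (sqrt (2 * s ^ 3 * (1 / Suc k)) + KG * nmL (%x. G0 (f (r k)) x - u x))"
    have "(%k. 1 / real (Suc k)) \<longlonglongrightarrow> 0" by (rule lim_1_over_n[THEN LIMSEQ_Suc])
    from tendsto_real_sqrt[OF tendsto_mult_right_zero[OF this, of "2 * s ^ 3"]]
    have sq: "(%k. sqrt (2 * s ^ 3 * (1 / real (Suc k)))) \<longlonglongrightarrow> 0" unfolding real_sqrt_zero .
    show "?b \<longlonglongrightarrow> 0"
      by (rule tendsto_mult_right_zero[OF tendsto_add_zero[OF sq tendsto_mult_right_zero[OF Gu]]])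
    show "\<forall>k. nmL (%x. f (r k) x - w x) <= ?b k"
    proof
      fix k
      let ?f = "f (r k)"
      have c: "contL (%x. B ?f x - s\<^sup>2 * ?f x)" "contL (%x. G0 (G0 ?f) x - G0 u x)"
        using Bc[OF fc(1)[of "r k"]] fc(1)[of "r k"] u(1) by (auto intro!: continuous_intros)
      have "nmL (%x. ?f x - w x) = nmL (%x. - (1 / s\<^sup>2) * ((B ?f x - s\<^sup>2 * ?f x) + (G0 (G0 ?f) x - G0 u x)))"
        by (rule arg_cong[of _ _ "nmL"]) (use s0 in \<open>auto simp: B_def w_def field_simps\<close>)
      also have "\<dots> = 1 / s\<^sup>2 * nmL (%x. (B ?f x - s\<^sup>2 * ?f x) + (G0 (G0 ?f) x - G0 u x))"
        by (subst nm_scale) simp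
      also have "\<dots> <= 1 / s\<^sup>2 * (nmL (%x. B ?f x - s\<^sup>2 * ?f x) + nmL (%x. G0 (G0 ?f) x - G0 u x))"
        by (intro mult_left_mono nm_triangle cont_l2 c) simp
      also have "\<dots> <= ?b k"
      proof (intro mult_left_mono add_mono)
        have "nmL (%x. B ?f x - s\<^sup>2 * ?f x) <= sqrt (2 * s ^ 3 / Suc (r k))"
          using real_sqrt_le_mono[OF Bd[of "r k"]] by simp
        also have "\<dots> <= sqrt (2 * s ^ 3 * (1 / Suc k))"
          using seq_suble[OF u(2), of k] s0 by (intro real_sqrt_le_mono) (auto intro!: divide_left_mono)
        finally show "nmL (%x. B ?f x - s\<^sup>2 * ?f x) <= sqrt (2 * s ^ 3 * (1 / Suc k))" .
        show "nmL (%x. G0 (G0 ?f) x - G0 u x) <= KG * nmL (%x. G0 ?f x - u x)"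
          by (rule nm_G0_diff) (use fc u(1) in auto)
      qed simp
      finally show "nmL (%x. ?f x - w x) <= ?b k" .
    qed
  qed auto
  have w2: "w \<in> l2 (leb L)" by (rule cont_l2[OF wc])
  have nw: "nmL w = 1"
    using nm_tendsto[OF fc(2) w2 fw] unfolding f(2) by (simp add: LIMSEQ_const_iff)
  have we: "ipL w (e j) = 0" if "j < n" for j
    using ip_tendsto[OF fc(2) w2 E(5)[OF that] fw] f(1) that by (simp add: V_def LIMSEQ_const_iff)
  have uG: "u x = G0 w x" if "x \<in> {0..L}" for x
  proof -
    have "(%k. nmL (%x. G0 (f (r k)) x - G0 w x)) \<longlonglongrightarrow> 0"
      by (rule real_tendsto_sandwich[OF always_eventually always_eventually tendsto_const tendsto_mult_right_zero[OF fw, of KG]])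
         (use nm_G0_diff[OF fc(1) wc] in auto)
    then have z: "(%k. nmL (%x. G0 (f (r k)) x - u x) + nmL (%x. G0 (f (r k)) x - G0 w x)) \<longlonglongrightarrow> 0"
      using tendsto_add[OF Gu] by fastforce
    have "nmL (%x. u x - G0 w x) <= 0"
    proof (rule LIMSEQ_le_const[OF z])
      show "\<exists>N. \<forall>k\<ge>N. nmL (%x. u x - G0 w x) <= nmL (%x. G0 (f (r k)) x - u x) + nmL (%x. G0 (f (r k)) x - G0 w x)"
        using nm_triangle_diff[OF cont_l2[OF u(1)] cont_l2[OF G0_cont[OF fc(1)]] cont_l2[OF G0_cont[OF wc]]]
          nm_minus_commute[of "leb L" u] by (intro exI allI impI) metis
    qed
    then have "nmL (%x. u x - G0 w x) = 0" by (simp add: order_antisym)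
    from cont_nm_zero[OF _ this L_pos that] show ?thesis using u(1) wc by (auto intro!: continuous_intros)
  qed
  have eig: "G0 (G0 w) x = - s\<^sup>2 * w x" if "x \<in> {0..L}" for x
  proof -
    have "G0 (G0 w) x = G0 u x" by (rule G0_cong[OF u(1) uG that])
    then show ?thesis using s0 by (simp add: w_def)
  qed
  have "eigfam \<epsilon> (Suc n) (e(n := w)) (m(n := s))"
    unfolding eigfam_def
  proof (intro conjI allI impI ballI)
    fix j assume "j < Suc n"
    then show "contL ((e(n := w)) j)" using E(1) wc by (auto simp: less_Suc_eq)
    show "\<epsilon> <= (m(n := s)) j" using E(2) se \<open>j < Suc n\<close> by (auto simp: less_Suc_eq)
    show "G0 (G0 ((e(n := w)) j)) x = - ((m(n := s)) j)\<^sup>2 * (e(n := w)) j x" if "x \<in> {0..L}" for x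
      using E(3) eig that \<open>j < Suc n\<close> by (auto simp: less_Suc_eq)
  next
    fix i j assume "i < Suc n" "j < Suc n"
    then show "ipL ((e(n := w)) i) ((e(n := w)) j) = (if i = j then 1 else 0)"
      using E(4) we nw nm_sq[of "leb L" w] by (auto simp: less_Suc_eq ip_commute)
  qed
  then show ?thesis by blast
qed

text \<open>As long as the estimate on the complement fails, \<open>eig_extend\<close> adds another
  eigenfunction, and \<open>eig_count\<close> bounds their number. Only a finite family and an
  operator bound on its complement are produced; later arguments choose \<epsilon> according to the
  cut-off frequency.\<close>

theorem spectral:
  assumes "\<epsilon> > 0"
  obtains n e m where "eigfam \<epsilon> n e m"
    "!!h. contL h ==> (!!j. j < n ==> ipL h (e j) = 0) ==> nmL (G0 h) <= \<epsilon> * nmL h"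
proof (rule ccontr)
  assume no: "\<not> thesis"
  note concl = that
  have "\<exists>e m. eigfam \<epsilon> n e m" for n
  proof (induction n)
    case 0
    show ?case by (auto simp: eigfam_def)
  next
    case (Suc n)
    then obtain e m where em: "eigfam \<epsilon> n e m" by blast
    then obtain h where "contL h" "!!j. j < n ==> ipL h (e j) = 0" "\<not> nmL (G0 h) <= \<epsilon> * nmL h"
      using no concl[OF em] by metis
    then show ?case using eig_extend[OF em assms] by fastforce
  qed
  moreover obtain n where "L * (6 * CG)\<^sup>2 / \<epsilon>\<^sup>2 < real n" using reals_Archimedean2 by blast
  ultimately show False using eig_count[of \<epsilon> n] assms by (auto simp: field_simps)
qed

end

text \<open>The \<open>k\<close>-th derivative of the solution of \<open>W''' + W' + pW = 0\<close> that vanishes at \<open>0\<close> and \<open>L\<close>.\<close>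

definition Wk :: "real => nat => complex => real => complex" where
  "Wk L k p x = gk 0 p L * gk (Suc k) p x - gk 1 p L * gk k p x"

lemma Wk_deriv: "(Wk L k p has_vector_derivative Wk L (Suc k) p x) (at x within S)"
  unfolding Wk_def[abs_def]
  by (intro has_vector_derivative_diff bounded_linear.has_vector_derivative[OF bounded_linear_mult_right] gk_deriv)

lemma Wk_ode: "Wk L (k + 3) p x = - Wk L (k + 1) p x - p * Wk L k p x"
proof -
  have a: "gk (Suc (k + 3)) p x = - gk (Suc (k + 1)) p x - p * gk (Suc k) p x"
    using gk_ode[of "Suc k" p x] by simp
  show ?thesis unfolding Wk_def a gk_ode by (simp add: algebra_simps)
qed

lemma Wk_bdry [simp]: "Wk L 0 p 0 = 0" "Wk L 0 p L = 0" "Wk L (Suc 0) p 0 = gk 0 p L"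
  by (simp_all add: Wk_def)

lemma Wk_continuous [continuous_intros]:
  "continuous_on A f ==> continuous_on A (%x. Wk L k p (f x))"
  unfolding Wk_def by (intro continuous_intros)

lemma Wk_bound:
  assumes "x \<in> {0..L}"
  shows "norm (Wk L k p x) <= 2 * rho p ^ (k + 1) * exp (2 * rho p * L)"
proof -
  let ?r = "rho p"
  have r: "?r >= 1" by (rule rho_ge_1)
  have b: "norm (gk j p y) <= ?r ^ j * exp (?r * L)" if "y \<in> {0..L}" for j y
  proof -
    have "exp (?r * \<bar>y\<bar>) <= exp (?r * L)" using that r by simp
    then show ?thesis using gk_bound[of j p y] r
      by (meson mult_left_mono order_trans zero_le_power order_trans zero_le_one)
  qed
  have L: "L \<in> {0..L}" using assms by auto
  have "norm (Wk L k p x) <= norm (gk 0 p L) * norm (gk (Suc k) p x) + norm (gk 1 p L) * norm (gk k p x)"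
    unfolding Wk_def by (metis norm_mult norm_triangle_ineq4)
  also have "\<dots> <= (?r ^ 0 * exp (?r * L)) * (?r ^ Suc k * exp (?r * L)) + (?r ^ 1 * exp (?r * L)) * (?r ^ k * exp (?r * L))"
    using r by (intro add_mono mult_mono b L assms) auto
  also have "\<dots> = 2 * ?r ^ (k + 1) * (exp (?r * L) * exp (?r * L))" by simp
  also have "exp (?r * L) * exp (?r * L) = exp (2 * ?r * L)" by (simp flip: exp_add)
  finally show ?thesis .
qed

section \<open>Energy identity and the pairing with solutions vanishing at both ends\<close>

lemma Wk_real_deriv:
  "((%x. Re (c * Wk L k p x)) has_real_derivative Re (c * Wk L (Suc k) p x)) (at x within S)"
  unfolding has_real_derivative_iff_has_vector_derivative
  by (intro bounded_linear.has_vector_derivative[OF bounded_linear_Re]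
      bounded_linear.has_vector_derivative[OF bounded_linear_mult_right] Wk_deriv)

text \<open>The real part of the equation multiplied by the conjugate of z, integrated. It is stated
  for an indexed family of derivatives because it is applied both to \<open>Wk\<close> and, when its
  end values vanish, to \<open>gk\<close>.\<close>

lemma ode_energy:
  fixes z :: "nat => real => complex"
  assumes d: "!!k x. (z k has_vector_derivative z (Suc k) x) (at x within {0..L})"
    and o: "!!x. z 3 x = - z 1 x - p * z 0 x" and b: "z 0 0 = 0" "z 0 L = 0" and L: "L >= 0"
  shows "Re p * integral {0..L} (%x. (norm (z 0 x))\<^sup>2) + (norm (z 1 0))\<^sup>2 / 2 = (norm (z 1 L))\<^sup>2 / 2"
proof -
  define u where "u k x = Re (z k x)" for k x
  define v where "v k x = Im (z k x)" for k x
  have du: "(u k has_real_derivative u (Suc k) x) (at x within {0..L})"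
    and dv: "(v k has_real_derivative v (Suc k) x) (at x within {0..L})" for k x
    unfolding u_def[abs_def] v_def[abs_def] has_real_derivative_iff_has_vector_derivative
    by (rule bounded_linear.has_vector_derivative[OF bounded_linear_Re d] bounded_linear.has_vector_derivative[OF bounded_linear_Im d])+
  have n: "(norm (z k x))\<^sup>2 = (u k x)\<^sup>2 + (v k x)\<^sup>2" for k x by (simp add: u_def v_def cmod_power2)
  have o3: "u 3 x = - u 1 x - (Re p * u 0 x - Im p * v 0 x)" "v 3 x = - v 1 x - (Re p * v 0 x + Im p * u 0 x)" for x
    using o[of x] by (simp_all add: u_def v_def complex_eq_iff)
  let ?E = "%x. u 2 x * u 0 x + v 2 x * v 0 x - 1 / 2 * (u 1 x * u 1 x + v 1 x * v 1 x) + 1 / 2 * (u 0 x * u 0 x + v 0 x * v 0 x)"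
  have "integral {0..L} (%x. - Re p * (norm (z 0 x))\<^sup>2) = ?E L - ?E 0"
  proof (rule ftc[OF L])
    fix x
    show "(?E has_real_derivative - Re p * (norm (z 0 x))\<^sup>2) (at x within {0..L})"
      by (rule derivative_eq_intros du dv refl)+
         (unfold n, simp add: o3 numeral_3_eq_3[symmetric] numeral_2_eq_2[symmetric] power2_eq_square algebra_simps)
  qed
  moreover have z0: "u 0 0 = 0" "v 0 0 = 0" "u 0 L = 0" "v 0 L = 0" by (simp_all add: u_def v_def b)
  moreover define J where "J = integral {0..L} (%x. (norm (z 0 x))\<^sup>2)"
  ultimately have "- Re p * J = ?E L - ?E 0" by (simp only: integral_mult_right)
  then show ?thesis unfolding J_def[symmetric] n[of 1] using z0 by (simp add: power2_eq_square field_simps)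
qed

lemma Wk_energy:
  assumes "L >= 0"
  shows "Re p * integral {0..L} (%x. (norm (Wk L 0 p x))\<^sup>2) + (norm (Wk L 1 p 0))\<^sup>2 / 2
     = (norm (Wk L 1 p L))\<^sup>2 / 2"
  by (rule ode_energy[where z = "%k. Wk L k p"]) (use Wk_ode[of L 0 p] assms in \<open>auto intro: Wk_deriv\<close>)

lemma l2_leb_integrable:
  assumes "f \<in> l2 (leb L)"
  shows "integrable (leb L) f"
  using l2_integrable_mult[OF assms cont_l2[of L "%x. 1"]] by simp

lemma l2_integrable_mult_bounded:
  fixes h :: "real => complex"
  assumes "f \<in> l2 (leb L)" "continuous_on {0..L} h"
  shows "integrable (leb L) (%x. of_real (f x) * h x)"
proof (rule Bochner_Integration.integrable_bound[where f = "%x. f x * norm (h x)"])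
  show "integrable (leb L) (%x. f x * norm (h x))"
    by (rule l2_integrable_mult[OF assms(1) cont_l2]) (intro continuous_intros assms)
  have "h \<in> borel_measurable (leb L)"
    by (rule borel_measurable_integrable[OF leb_cont_integrable[OF assms(2)]])
  then show "(%x. of_real (f x) * h x) \<in> borel_measurable (leb L)"
    using l2_meas[OF assms(1)] by simp
qed (auto simp: norm_mult)

text \<open>A spectral transform of \<open>f\<close>: entire in \<open>p\<close>, and at
  \<open>p\<close> = i / \<open>m j\<close> it determines the coefficient of \<open>f\<close> on the
  mode \<open>e j\<close> up to a controlled factor.\<close>

definition pair :: "real => (real => real) => complex => complex" where
  "pair L f p = (LINT x|leb L. of_real (f x) * Wk L 0 p x)"

text \<open>Integrating the Taylor series in x term by term replaces x^m by the m-th moment of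
  \<open>f\<close>, which grows at most like L^m. The claim is then the general series lemma with
  the moments as coefficients.\<close>

lemma gk_pair_holomorphic:
  assumes "f \<in> l2 (leb L)" "L >= 0"
  shows "(%p. LINT x|leb L. of_real (f x) * gk k p x) holomorphic_on UNIV"
proof -
  define c :: "nat => complex" where "c m = (LINT x|leb L. of_real (f x) * of_real x ^ m)" for m
  define C where "C = (LINT x|leb L. \<bar>f x\<bar>)"
  have fi: "integrable (leb L) (%x. \<bar>f x\<bar>)" using l2_leb_integrable[OF assms(1)] by simp
  have im: "integrable (leb L) (%x. complex_of_real (f x) * of_real x ^ m)" for m
    by (rule l2_integrable_mult_bounded[OF assms(1)]) (intro continuous_intros)
  have nb: "norm (complex_of_real (f x) * of_real x ^ m) <= \<bar>f x\<bar> * L ^ m" if "x \<in> {0<..<L}" for x m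
    using that by (auto simp: norm_mult norm_power intro!: mult_left_mono power_mono)
  have cb: "norm (c m) <= C * L ^ m" for m
  proof -
    have "norm (c m) <= (LINT x|leb L. norm (complex_of_real (f x) * of_real x ^ m))"
      unfolding c_def by simp
    also have "\<dots> <= (LINT x|leb L. \<bar>f x\<bar> * L ^ m)"
      by (rule integral_mono[OF integrable_norm[OF im]]) (use nb fi in auto)
    finally show ?thesis by (simp add: C_def)
  qed
  have eq: "(LINT x|leb L. of_real (f x) * gk k p x) = (\<Sum>m. gcoef p (m + k) / fact m * c m)" for p
  proof -
    let ?F = "%m x. gcoef p (m + k) / fact m * (complex_of_real (f x) * of_real x ^ m)"
    have s: "summable (%m. norm (gcoef p (m + k) / fact m) * (L ^ m))"
      using exp_bound_summable(1)[OF eser_term_bound[OF gcoef_bound'[of p _ k], where z = "of_real L"]] assms(2)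
      by (simp add: norm_mult norm_divide norm_power)
    have s1: "(LINT x|leb L. (\<Sum>m. ?F m x)) = (\<Sum>m. LINT x|leb L. ?F m x)"
    proof (rule integral_suminf)
      show "integrable (leb L) (?F m)" for m using im by simp
      have "summable (%m. norm (?F m x))" if "x \<in> {0<..<L}" for x
      proof (rule summable_comparison_test'[OF summable_mult[OF s, of "\<bar>f x\<bar>"], of 0])
        fix m
        have "norm (?F m x) <= norm (gcoef p (m + k) / fact m) * (\<bar>f x\<bar> * L ^ m)"
          unfolding norm_mult[of "gcoef p (m + k) / fact m"] by (intro mult_left_mono nb that) simp
        then show "norm (norm (?F m x)) <= \<bar>f x\<bar> * (norm (gcoef p (m + k) / fact m) * L ^ m)" by (simp add: mult_ac)
      qed
      then show "AE x in leb L. summable (%m. norm (?F m x))" by (intro AE_I2) simp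
      show "summable (%m. LINT x|leb L. norm (?F m x))"
      proof (rule summable_comparison_test'[OF summable_mult[OF s, of C], of 0])
        fix m
        have "(LINT x|leb L. norm (?F m x)) <= (LINT x|leb L. norm (gcoef p (m + k) / fact m) * (\<bar>f x\<bar> * L ^ m))"
        proof (rule integral_mono)
          show "integrable (leb L) (%x. norm (?F m x))" using im by (intro integrable_norm) simp
          fix x assume "x \<in> space (leb L)"
          then show "norm (?F m x) <= norm (gcoef p (m + k) / fact m) * (\<bar>f x\<bar> * L ^ m)"
            unfolding norm_mult[of "gcoef p (m + k) / fact m"] by (intro mult_left_mono nb) auto
        qed (use fi in simp)
        then show "norm (LINT x|leb L. norm (?F m x)) <= C * (norm (gcoef p (m + k) / fact m) * L ^ m)"
          by (simp add: C_def mult_ac)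
      qed
    qed
    have s2: "(\<Sum>m. ?F m x) = of_real (f x) * gk k p x" for x
      unfolding gk_def eser_def
      by (subst suminf_mult[symmetric, OF eser_summable[OF gcoef_bound']]) (simp add: mult_ac)
    have s3: "(LINT x|leb L. ?F m x) = gcoef p (m + k) / fact m * c m" for m
      unfolding c_def by (rule integral_mult_right_zero)
    show ?thesis using s1 unfolding s2 s3 .
  qed
  show ?thesis unfolding eq by (rule gcoef_series_holomorphic[OF cb assms(2)])
qed

lemma pair_holomorphic:
  assumes "f \<in> l2 (leb L)" "L >= 0"
  shows "pair L f holomorphic_on UNIV"
proof -
  have i: "integrable (leb L) (%x. of_real (f x) * gk k p x)" for k p
    by (rule l2_integrable_mult_bounded[OF assms(1)]) (intro continuous_intros)
  have "pair L f p = gk 0 p L * (LINT x|leb L. of_real (f x) * gk 1 p x) - gk 1 p L * (LINT x|leb L. of_real (f x) * gk 0 p x)" for p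
  proof -
    have "pair L f p = (LINT x|leb L. gk 0 p L * (of_real (f x) * gk 1 p x) - gk 1 p L * (of_real (f x) * gk 0 p x))"
      unfolding pair_def Wk_def by (simp add: algebra_simps)
    then show ?thesis using i by simp
  qed
  then have "pair L f = (%p. gk 0 p L * (LINT x|leb L. of_real (f x) * gk 1 p x) - gk 1 p L * (LINT x|leb L. of_real (f x) * gk 0 p x))"
    by auto
  then show ?thesis by (auto intro!: holomorphic_intros gk_holomorphic gk_pair_holomorphic assms)
qed

lemma pair_bound:
  assumes "f \<in> l2 (leb L)" "continuous_on {0..L} h"
  shows "norm (LINT x|leb L. of_real (f x) * h x) <= nm (leb L) f * nm (leb L) (%x. norm (h x :: complex))"
proof -
  have hl: "(%x. norm (h x)) \<in> l2 (leb L)" by (intro cont_l2 continuous_intros assms)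
  have fl: "(%x. \<bar>f x\<bar>) \<in> l2 (leb L)" using assms(1) by (auto simp: l2_def)
  have "norm (LINT x|leb L. of_real (f x) * h x) <= (LINT x|leb L. norm (of_real (f x) * h x))" by simp
  also have "\<dots> = ip (leb L) (%x. \<bar>f x\<bar>) (%x. norm (h x))" by (simp add: ip_def norm_mult)
  also have "\<dots> <= nm (leb L) (%x. \<bar>f x\<bar>) * nm (leb L) (%x. norm (h x))"
    using ip_le_nm[OF fl hl] by linarith
  also have "nm (leb L) (%x. \<bar>f x\<bar>) = nm (leb L) f" by (simp add: nm_def ip_def)
  finally show ?thesis .
qed

text \<open>Uniqueness for the Cauchy problem without Gronwall: the expression \<open>?F\<close>,
  the bilinear concomitant of z with the reflected solution \<open>gk 0 p (x - s)\<close>, is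
  constant in s. Its value at s = x is z(x), and its value at s = 0 is the claimed
  combination.\<close>

lemma variation_id:
  fixes z z1 z2 z3 :: "real => complex"
  assumes "!!s. s \<in> {0..x} ==> (z has_vector_derivative z1 s) (at s within {0..x})"
    "!!s. s \<in> {0..x} ==> (z1 has_vector_derivative z2 s) (at s within {0..x})"
    "!!s. s \<in> {0..x} ==> (z2 has_vector_derivative z3 s) (at s within {0..x})"
    "!!s. s \<in> {0..x} ==> z3 s + z1 s + p * z s = 0" "z 0 = 0" "x >= 0"
  shows "z x = z1 0 * gk 1 p x + z2 0 * gk 0 p x"
proof -
  have dg: "((%s. gk k p (x - s)) has_vector_derivative - gk (Suc k) p (x - s)) (at s within {0..x})" for k s
  proof -
    have "((%s. x - s) has_vector_derivative -1) (at s within {0..x})"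
      by (auto intro!: derivative_eq_intros)
    from vector_diff_chain_within[OF this gk_deriv[of k p "x - s" "(%s. x - s) ` {0..x}"]]
    show ?thesis by (simp add: o_def)
  qed
  have dg': "((%s. gk 0 p (x - s)) has_vector_derivative - gk 1 p (x - s)) (at s within {0..x})"
    "((%s. gk 1 p (x - s)) has_vector_derivative - gk 2 p (x - s)) (at s within {0..x})"
    "((%s. gk 2 p (x - s)) has_vector_derivative - gk 3 p (x - s)) (at s within {0..x})" for s
    using dg[of 0 s] dg[of 1 s] dg[of 2 s] by (simp_all add: eval_nat_numeral)
  let ?F = "%s. z2 s * gk 0 p (x - s) + z1 s * gk 1 p (x - s) + z s * (gk 2 p (x - s) + gk 0 p (x - s))"
  have "(?F has_vector_derivative 0) (at s within {0..x})" if "s \<in> {0..x}" for s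
  proof -
    have "(?F has_vector_derivative
      ((z2 s * (- gk 1 p (x - s)) + z3 s * gk 0 p (x - s))
      + (z1 s * (- gk 2 p (x - s)) + z2 s * gk 1 p (x - s))
      + (z s * ((- gk 3 p (x - s)) + (- gk 1 p (x - s))) + z1 s * (gk 2 p (x - s) + gk 0 p (x - s)))))
        (at s within {0..x})"
      by (intro has_vector_derivative_add has_vector_derivative_mult dg' assms(1-3) that)
    moreover have g3: "gk 3 p (x - s) = - gk 1 p (x - s) - p * gk 0 p (x - s)"
      using gk_ode[of 0 p "x - s"] by simp
    moreover have "z3 s * gk 0 p (x - s) + z1 s * gk 0 p (x - s) + z s * (p * gk 0 p (x - s)) = 0"
      using arg_cong[OF assms(4)[OF that], of "%w. w * gk 0 p (x - s)"] by (simp add: algebra_simps)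
    then have "((z2 s * (- gk 1 p (x - s)) + z3 s * gk 0 p (x - s))
      + (z1 s * (- gk 2 p (x - s)) + z2 s * gk 1 p (x - s))
      + (z s * ((- gk 3 p (x - s)) + (- gk 1 p (x - s))) + z1 s * (gk 2 p (x - s) + gk 0 p (x - s)))) = 0"
      unfolding g3 by (simp add: algebra_simps)
    ultimately show ?thesis by (simp only:)
  qed
  then obtain c where c: "!!s. s \<in> {0..x} ==> ?F s = c"
    using has_vector_derivative_zero_constant[of "{0..x}" ?F] by auto
  have "?F x = ?F 0" using c[of x] c[of 0] assms(6) by simp
  then show ?thesis using assms(5) by (simp add: eval_nat_numeral)
qed

text \<open>For p = i (a^3 - a) one root of the characteristic cubic is i a. For 3 a^2 > 4 this
  describes the other two, a pair with opposite real parts.\<close>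

lemma cubic_complex_root:
  assumes "\<tau>\<^sup>2 = 3 * a\<^sup>2 / 4 - 1"
  shows "(Complex \<tau> (- a / 2)) ^ 3 + Complex \<tau> (- a / 2) + \<i> * of_real (a ^ 3 - a) = 0"
proof -
  have "Re (Complex \<tau> (- a / 2) ^ 3 + Complex \<tau> (- a / 2) + \<i> * of_real (a ^ 3 - a)) = \<tau> * (\<tau>\<^sup>2 - (3 * a\<^sup>2 / 4 - 1))"
    by (simp add: power3_eq_cube power2_eq_square algebra_simps)
  moreover have "Im (Complex \<tau> (- a / 2) ^ 3 + Complex \<tau> (- a / 2) + \<i> * of_real (a ^ 3 - a)) = - 3 * a / 2 * (\<tau>\<^sup>2 - (3 * a\<^sup>2 / 4 - 1))"
    by (simp add: power3_eq_cube power2_eq_square algebra_simps)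
  ultimately show ?thesis using assms by (simp add: complex_eq_iff)
qed

section \<open>Nondegeneracy of the end values at a noncritical length\<close>

context noncritical
begin

text \<open>The exponentials of the two roots with real parts \<tau> and -\<tau> have different
  moduli at L and cannot cancel. Dividing by the distance 2 \<tau> of the roots keeps the bound
  uniform as \<tau> tends to 0.\<close>

lemma gk_lower_complex:
  assumes "a\<^sup>2 > 4 / 3" "p = \<i> * of_real (a ^ 3 - a)"
  shows "norm (gk 1 p L) + \<bar>a\<bar> * norm (gk 0 p L) >= L / 2"
proof -
  define \<tau> where "\<tau> = sqrt (3 * a\<^sup>2 / 4 - 1)"
  have t: "\<tau>\<^sup>2 = 3 * a\<^sup>2 / 4 - 1" "\<tau> > 0" using assms(1) by (auto simp: \<tau>_def)
  have t': "(- \<tau>)\<^sup>2 = 3 * a\<^sup>2 / 4 - 1" using t by simp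
  define r s where "r = Complex \<tau> (- a / 2)" and "s = Complex (- \<tau>) (- a / 2)"
  have rs: "r ^ 3 + r + p = 0" "s ^ 3 + s + p = 0"
    using cubic_complex_root[OF t(1)] cubic_complex_root[OF t'] by (simp_all add: r_def s_def assms(2))
  have "exp (r * L) - exp (s * L) = (r - s) * (gk 1 p L + (r + s) * gk 0 p L)"
    unfolding char_root_exp[OF rs(1)] char_root_exp[OF rs(2)] by (simp add: power2_eq_square algebra_simps)
  moreover have "r - s = of_real (2 * \<tau>)" "r + s = - \<i> * of_real a"
    by (simp_all add: r_def s_def complex_eq_iff)
  ultimately have e: "exp (r * L) - exp (s * L) = of_real (2 * \<tau>) * (gk 1 p L - \<i> * of_real a * gk 0 p L)" by simp
  have "\<tau> * L <= exp (\<tau> * L) - 1" using exp_ge_add_one_self[of "\<tau> * L"] by linarith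
  also have "\<dots> <= exp (\<tau> * L) - exp (- \<tau> * L)" using t(2) L_pos by simp
  also have "\<dots> = norm (exp (r * L)) - norm (exp (s * L))" by (simp add: norm_exp_eq_Re r_def s_def)
  also have "\<dots> <= norm (exp (r * L) - exp (s * L))" by (rule norm_triangle_ineq2)
  also have "\<dots> = 2 * \<tau> * norm (gk 1 p L - \<i> * of_real a * gk 0 p L)"
    unfolding e norm_mult using t(2) by simp
  finally have "L / 2 <= norm (gk 1 p L - \<i> * of_real a * gk 0 p L)" using t(2) by (simp add: field_simps)
  also have "\<dots> <= norm (gk 1 p L) + norm (\<i> * of_real a * gk 0 p L)" by (rule norm_triangle_ineq4)
  finally show ?thesis by (simp add: norm_mult)
qed

text \<open>Simultaneous vanishing would give a nontrivial solution with w = w' = 0 at both ends,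
  the overdetermined problem behind the critical lengths. For three imaginary roots, the
  exponentials of all roots then agree at L, so root differences times L are multiples of 2 pi;
  Vieta's relations turn this into the critical form of L.\<close>

lemma gk_nonvanishing:
  assumes "p = \<i> * of_real (a ^ 3 - a)"
  shows "gk 0 p L ~= 0 | gk 1 p L ~= 0"
proof (rule ccontr)
  assume "\<not> (gk 0 p L ~= 0 | gk 1 p L ~= 0)"
  then have z: "gk 0 p L = 0" "gk 1 p L = 0" by auto
  have a: "a\<^sup>2 <= 4 / 3" using gk_lower_complex[OF _ assms] z L_pos by force
  have root: "(\<i> * of_real s) ^ 3 + \<i> * of_real s + p = 0" if "s ^ 3 - s = a ^ 3 - a" for s :: real
    unfolding assms that[symmetric] by (simp add: complex_eq_iff power3_eq_cube algebra_simps)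
  \<comment> \<open>A double root would make L e^(rL) vanish.\<close>
  have dbl: False if "s ^ 3 - s = a ^ 3 - a" "3 * s\<^sup>2 = 1" for s :: real
  proof -
    have "3 * (\<i> * of_real s)\<^sup>2 + 1 = (0 :: complex)"
      using that(2) by (simp add: power_mult_distrib complex_eq_iff power2_eq_square)
    from char_double_root_exp[OF root[OF that(1)] this, of L] show False using z L_pos by simp
  qed
  have per: "\<exists>n::int. (s - t) * L = 2 * pi * of_int n" if "s ^ 3 - s = a ^ 3 - a" "t ^ 3 - t = a ^ 3 - a" for s t :: real
  proof -
    have "exp (\<i> * of_real s * of_real L) = exp (\<i> * of_real t * of_real L)"
      unfolding char_root_exp[OF root[OF that(1)]] char_root_exp[OF root[OF that(2)]] z by simp
    then obtain n :: int where "\<i> * of_real s * of_real L = \<i> * of_real t * of_real L + (of_int (2 * n) * pi) * \<i>"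
      by (auto simp: exp_eq)
    then have "s * L = t * L + 2 * of_int n * pi" by (auto simp: complex_eq_iff)
    then show ?thesis by (intro exI[of _ n]) (simp add: algebra_simps)
  qed
  \<comment> \<open>The square root of the discriminant of s^2 + a s + a^2 - 1, whose zeros are the
    other two roots; D is their difference.\<close>
  define D where "D = sqrt (4 - 3 * a\<^sup>2)"
  have D: "D\<^sup>2 = 4 - 3 * a\<^sup>2" "D >= 0" using a by (auto simp: D_def)
  have other: "s ^ 3 - s = a ^ 3 - a" if "s\<^sup>2 + a * s + (a\<^sup>2 - 1) = 0" for s
  proof -
    have "s ^ 3 - s - (a ^ 3 - a) = (s - a) * (s\<^sup>2 + a * s + (a\<^sup>2 - 1))"
      by (simp add: power3_eq_cube power2_eq_square algebra_simps)
    then show ?thesis using that by simp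
  qed
  define b c where "b = (D - a) / 2" and "c = (- D - a) / 2"
  have bc: "b ^ 3 - b = a ^ 3 - a" "c ^ 3 - c = a ^ 3 - a"
    by (rule other, use D(1) in \<open>simp add: b_def c_def power2_eq_square field_simps\<close>)+
  obtain n m :: int where nm: "(b - c) * L = 2 * pi * n" "(a - b) * L = 2 * pi * m"
    using per[OF bc] per[OF refl bc(1)] by auto
  have D_eq: "D * L = 2 * pi * n" 
  proof -
    have "b - c = D" by (simp add: b_def c_def field_simps)
    then show ?thesis using nm(1) by simp
  qed
  have a_eq: "3 * a * L = 2 * pi * (2 * m + n)" 
  proof -
    have "3 * a = 2 * (a - b) + D" by (simp add: b_def field_simps)
    then have "3 * a * L = (2 * (a - b) + D) * L" by (simp only:)
    also have "\<dots> = 2 * ((a - b) * L) + D * L" by (simp add: algebra_simps)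
    finally have "3 * a * L = 2 * ((a - b) * L) + D * L" .
    then show ?thesis unfolding nm(2) D_eq by (simp add: algebra_simps)
  qed
  \<comment> \<open>The three exclusions \<open>n\<close>, \<open>m\<close> and \<open>m + n\<close>
    nonzero say that no two of the roots a, b, c coincide.\<close>
  have "n ~= 0"
  proof
    assume "n = 0"
    then have "D = 0" using D_eq L_pos by simp
    then have "3 * b\<^sup>2 = 1" using D(1) by (simp add: b_def power2_eq_square)
    then show False using dbl[OF bc(1)] by simp
  qed
  moreover have "real_of_int n >= 0"
    using D_eq D(2) L_pos pi_gt_zero by (metis mult_nonneg_nonneg less_imp_le zero_le_mult_iff mult_pos_pos zero_less_numeral not_less)
  ultimately have n: "n > 0" by simp
  have sq: "9 * a\<^sup>2 + 3 * D\<^sup>2 = 12" using D(1) by simp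
  have m: "m ~= 0" and mn: "m + n ~= 0"
  proof -
    have "False" if "(3 * a)\<^sup>2 = D\<^sup>2"
    proof -
      have "3 * a\<^sup>2 = 1" using sq that by (simp add: power_mult_distrib)
      then show False using dbl[OF refl] by simp
    qed
    moreover have "3 * a = D" if "m = 0" using a_eq D_eq that L_pos by (metis mult_zero_right add_0 mult_right_cancel of_int_0 less_irrefl)
    moreover have "3 * a = - D" if "m + n = 0"
    proof -
      have "of_int m = - real_of_int n" using that by linarith
      then have "3 * a * L = - D * L" using a_eq D_eq by (simp add: algebra_simps)
      then have "(3 * a + D) * L = 0" by (simp add: algebra_simps)
      then show ?thesis using L_pos by simp
    qed
    ultimately show "m ~= 0" "m + n ~= 0" by fastforce+
  qed
  \<comment> \<open>Both \<open>D * L\<close> and \<open>3 * a * L\<close> are integer multiples of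
    2 pi, and the relation 9 a^2 + 3 D^2 = 12 makes L^2 a value of the quadratic form m^2 + m n +
    n^2.\<close>
  have "12 * L\<^sup>2 = (3 * a * L)\<^sup>2 + 3 * (D * L)\<^sup>2" unfolding sq[symmetric] by (simp add: power2_eq_square algebra_simps)
  also have "\<dots> = (2 * pi)\<^sup>2 * (4 * (real_of_int m ^ 2 + real_of_int m * real_of_int n + real_of_int n ^ 2))"
    unfolding a_eq D_eq by (simp add: power2_eq_square algebra_simps)
  finally have L2: "L\<^sup>2 = (2 * pi)\<^sup>2 * ((real_of_int m ^ 2 + real_of_int m * real_of_int n + real_of_int n ^ 2) / 3)"
    by (simp add: field_simps)
  have crit: False if "real_of_int m ^ 2 + real_of_int m * real_of_int n + real_of_int n ^ 2 = real_of_int k ^ 2 + real_of_int k * real_of_int l + real_of_int l ^ 2"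
    "k > 0" "l > 0" for k l :: int
  proof -
    have "L = sqrt (L\<^sup>2)" using L_pos by simp
    also have "\<dots> = 2 * pi * sqrt ((real (nat k) ^ 2 + real (nat k) * real (nat l) + real (nat l) ^ 2) / 3)"
      unfolding L2 that(1) real_sqrt_mult real_sqrt_abs using that(2,3) by simp
    finally have "L = 2 * pi * sqrt ((real (nat k) ^ 2 + real (nat k) * real (nat l) + real (nat l) ^ 2) / 3)" .
    moreover have "nat k >= 1" "nat l >= 1" using that(2,3) by auto
    ultimately have "L \<in> critical_lengths" unfolding critical_lengths_def by blast
    then show False using L_nc by simp
  qed
  \<comment> \<open>The form takes the same value at (m, n), (-m, m + n) and (-m - n, n); in each
    sign pattern one of these pairs is positive.\<close>
  consider "m > 0" | "m < 0" "m + n > 0" | "m + n < 0" using m mn by linarith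
  then show False
  proof cases
    case 1
    then show ?thesis using crit[of m n] n by simp
  next
    case 2
    then show ?thesis using crit[of "- m" "m + n"] by (simp add: power2_eq_square algebra_simps)
  next
    case 3
    then show ?thesis using crit[of "- m - n" n] n by (simp add: power2_eq_square algebra_simps)
  qed
qed

text \<open>Nonvanishing and continuity handle a compact range of s, and for large s the bound for
  complex roots takes over, losing only the factor \<open>1 + \<bar>s\<bar>\<close> from the size of
  a. This polynomial loss is harmless against the exponentials to come.\<close>

lemma gk_lower:
  obtains c where "c > 0" "!!s::real. norm (gk 0 (\<i> * of_real s) L) + norm (gk 1 (\<i> * of_real s) L) >= c / (1 + \<bar>s\<bar>)"
proof -
  define F where "F s = norm (gk 0 (\<i> * of_real s) L) + norm (gk 1 (\<i> * of_real s) L)" for s :: real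
  have root: "\<exists>a. a ^ 3 - a = s & \<bar>a\<bar> <= 1 + \<bar>s\<bar>" for s :: real
  proof -
    let ?b = "1 + \<bar>s\<bar>" and ?f = "%a::real. a ^ 3 - a"
    have fb: "?f ?b >= \<bar>s\<bar>"
    proof -
      have "?f ?b - \<bar>s\<bar> = \<bar>s\<bar> + 3 * \<bar>s\<bar>\<^sup>2 + \<bar>s\<bar> ^ 3" by (simp add: power3_eq_cube power2_eq_square algebra_simps)
      also have "\<dots> >= 0" by (intro add_nonneg_nonneg mult_nonneg_nonneg zero_le_power) auto
      finally show ?thesis by linarith
    qed
    have "?f (- ?b) = - ?f ?b" by (simp add: power3_eq_cube algebra_simps)
    then have "\<exists>a\<ge>- ?b. a <= ?b & ?f a = s"
      using fb by (intro IVT') (auto intro!: continuous_intros)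
    then show ?thesis by (auto intro!: abs_leI)
  qed
  have Fc: "continuous_on UNIV F"
  proof -
    have "continuous_on UNIV (%p. gk k p L)" for k
      by (rule holomorphic_on_imp_continuous_on[OF gk_holomorphic])
    then have "continuous_on UNIV (%s::real. gk k (\<i> * of_real s) L)" for k
      by (rule continuous_on_compose2) (auto intro!: continuous_intros)
    then show ?thesis unfolding F_def[abs_def] by (intro continuous_intros)
  qed
  have Fp: "F s > 0" for s
  proof -
    obtain a where "a ^ 3 - a = s" using root by blast
    from gk_nonvanishing[OF refl, of a] this show ?thesis
      unfolding F_def by (auto intro: add_pos_nonneg add_nonneg_pos)
  qed
  \<comment> \<open>Outside [-10, 10] the real solution a of a^3 - a = s satisfies a^2 > 4/3,
    because |a| <= 2 gives |s| <= 8 + 2.\<close>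
  obtain s0 where s0: "s0 \<in> {-10..10}" "!!s. s \<in> {-10..10} ==> F s0 <= F s"
    using continuous_attains_inf[of "{-10..10::real}" F] continuous_on_subset[OF Fc] by auto
  define c where "c = min (F s0) (L / 2)"
  have c: "c > 0" using Fp L_pos by (simp add: c_def)
  have "F s >= c / (1 + \<bar>s\<bar>)" for s
  proof (cases "s \<in> {-10..10}")
    case True
    have "c / (1 + \<bar>s\<bar>) <= c" using c by (simp add: divide_simps mult_le_cancel_left1)
    then show ?thesis using s0(2)[OF True] by (simp add: c_def)
  next
    case False
    obtain a where a: "a ^ 3 - a = s" "\<bar>a\<bar> <= 1 + \<bar>s\<bar>" using root by blast
    have "a\<^sup>2 > 4 / 3"
    proof (rule ccontr)
      assume "\<not> a\<^sup>2 > 4 / 3"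
      then have "\<bar>a\<bar>\<^sup>2 <= 2\<^sup>2" by simp
      then have a2: "\<bar>a\<bar> <= 2" by (rule power2_le_imp_le) simp
      have "\<bar>a ^ 3\<bar> <= 2 ^ 3" unfolding power_abs by (intro power_mono a2) simp
      then have "\<bar>s\<bar> <= 10" using a(1) a2 abs_triangle_ineq4[of "a ^ 3" a] by simp
      then show False using False by (auto simp: abs_le_iff)
    qed
    from gk_lower_complex[OF this refl] have "L / 2 <= norm (gk 1 (\<i> * of_real s) L) + \<bar>a\<bar> * norm (gk 0 (\<i> * of_real s) L)"
      using a(1) by simp
    also have "\<dots> <= (1 + \<bar>s\<bar>) * F s"
    proof -
      have "norm (gk 1 (\<i> * of_real s) L) <= (1 + \<bar>s\<bar>) * norm (gk 1 (\<i> * of_real s) L)"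
        by (simp add: mult_le_cancel_right1)
      moreover have "\<bar>a\<bar> * norm (gk 0 (\<i> * of_real s) L) <= (1 + \<bar>s\<bar>) * norm (gk 0 (\<i> * of_real s) L)"
        by (intro mult_right_mono a) simp
      ultimately show ?thesis unfolding F_def distrib_left by linarith
    qed
    finally have "c <= (1 + \<bar>s\<bar>) * F s" by (simp add: c_def)
    then show ?thesis by (simp add: divide_simps mult.commute)
  qed
  then show ?thesis using that c unfolding F_def by blast
qed

end

section \<open>Smooth solutions\<close>

text \<open>The source \<open>f\<close> is there for the test functions of the weak formulation,
  which satisfy the boundary conditions but not the homogeneous equation. Continuity is joint in (t,
  x) so that time derivatives pass under the integral over x.\<close>

definition kdv :: "real => real => (real => real => real) => (real => real => real) =>
    (real => real => real) => (real => real => real) => (real => real => real) => bool" where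
  "kdv T L f p p1 p2 p3 \<longleftrightarrow>
     continuous_on ({0..T} \<times> {0..L}) (%(t, x). f t x) &
     continuous_on ({0..T} \<times> {0..L}) (%(t, x). p t x) &
     continuous_on ({0..T} \<times> {0..L}) (%(t, x). p1 t x) &
     continuous_on ({0..T} \<times> {0..L}) (%(t, x). p3 t x) &
     (\<forall>t\<in>{0..T}. \<forall>x\<in>{0..L}.
        (p t has_real_derivative p1 t x) (at x within {0..L}) &
        (p1 t has_real_derivative p2 t x) (at x within {0..L}) &
        (p2 t has_real_derivative p3 t x) (at x within {0..L}) &
        ((%s. p s x) has_real_derivative f t x - p1 t x - p3 t x) (at t within {0..T})) &
     (\<forall>t\<in>{0..T}. p t 0 = 0 & p t L = 0)"

abbreviation "kdv0 T L \<equiv> kdv T L (%_ _. 0)"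

lemma slice_x: "continuous_on ({0..T} \<times> {0..L}) (%(t, x). h t x) ==> t \<in> {0..T} ==> continuous_on {0..L::real} (h t)"
  by (erule continuous_on_compose2[where f = "%x. (t, x)" and g = "%(t, x). h t x", simplified])
     (auto intro!: continuous_intros)

lemma slice_t: "continuous_on ({0..T} \<times> {0..L}) (%(t, x). h t x) ==> x \<in> {0..L} ==> continuous_on {0..T::real} (%t. h t x)"
  by (erule continuous_on_compose2[where f = "%t. (t, x)" and g = "%(t, x). h t x", simplified])
     (auto intro!: continuous_intros)

lemma kdv_cont:
  assumes "kdv T L f p p1 p2 p3" "t \<in> {0..T}"
  shows "continuous_on {0..L} (f t)" "continuous_on {0..L} (p t)" "continuous_on {0..L} (p1 t)" "continuous_on {0..L} (p3 t)"
  using assms slice_x unfolding kdv_def by blast+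

lemma kdv_c3: "kdv T L f p p1 p2 p3 ==> t \<in> {0..T} ==> c3 L (p t) (p1 t) (p2 t) (p3 t)"
  unfolding c3_def using kdv_cont(4) by (auto simp: kdv_def)

lemma kdv_bdry: "kdv T L f p p1 p2 p3 ==> t \<in> {0..T} ==> p t 0 = 0 & p t L = 0"
  by (auto simp: kdv_def)

lemma kdv_dt: "kdv T L f p p1 p2 p3 ==> t \<in> {0..T} ==> x \<in> {0..L} ==>
    ((%s. p s x) has_real_derivative f t x - p1 t x - p3 t x) (at t within {0..T})"
  by (auto simp: kdv_def)

lemma kdv_joint:
  assumes "kdv T L f p p1 p2 p3"
  shows "continuous_on ({0..T} \<times> {0..L}) (%z. f (fst z) (snd z))"
    "continuous_on ({0..T} \<times> {0..L}) (%z. p (fst z) (snd z))"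
    "continuous_on ({0..T} \<times> {0..L}) (%z. p1 (fst z) (snd z))"
    "continuous_on ({0..T} \<times> {0..L}) (%z. p3 (fst z) (snd z))"
  using assms by (auto simp: kdv_def case_prod_unfold)

lemma kdv_trace_cont:
  assumes "kdv T L f p p1 p2 p3" "L > 0"
  shows "continuous_on {0..T} (%t. p1 t 0)" "continuous_on {0..T} (%t. p1 t L)"
  by (rule slice_t[of T L p1]; use assms in \<open>auto simp: kdv_def\<close>)+

lemma param_integral_cont:
  fixes h :: "real => real => real"
  assumes "continuous_on ({0..T} \<times> {0..L}) (%z. h (fst z) (snd z))"
  shows "continuous_on {0..T} (%t. integral {0..L} (h t))"
  using integral_continuous_on_param[of "{0..T}" 0 L h] assms by (simp add: case_prod_unfold)

lemma param_integral_deriv: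
  fixes h h' :: "real => real => real"
  assumes "!!t x. t \<in> {0..T} ==> x \<in> {0..L} ==> ((%s. h s x) has_real_derivative h' t x) (at t within {0..T})"
    "!!t. t \<in> {0..T} ==> continuous_on {0..L} (h t)"
    "continuous_on ({0..T} \<times> {0..L}) (%z. h' (fst z) (snd z))" "t \<in> {0..T}"
  shows "((%t. integral {0..L} (h t)) has_real_derivative integral {0..L} (h' t)) (at t within {0..T})"
  using leibniz_rule_field_derivative[of "{0..T}" 0 L h h' t] assms
  by (auto simp: case_prod_unfold intro: integrable_continuous_real)

text \<open>The spatial operator is formally skew-adjoint, so two solutions of the same forward
  equation can be paired: their inner product changes only through the traces of the slopes and the
  sources. A separate backward adjoint equation never appears.\<close>

lemma kdv_pair_deriv:
  assumes p: "kdv T L f p p1 p2 p3" and q: "kdv T L k q q1 q2 q3" and L: "L > 0" and t: "t \<in> {0..T}"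
  shows "((%t. ip (leb L) (p t) (q t)) has_real_derivative
     (p1 t L * q1 t L - p1 t 0 * q1 t 0 + ip (leb L) (f t) (q t) + ip (leb L) (p t) (k t))) (at t within {0..T})"
proof -
  note P = kdv_joint[OF p] and Q = kdv_joint[OF q]
  note Pc = kdv_cont[OF p t] and Qc = kdv_cont[OF q t]
  let ?h' = "%t x. p t x * (k t x - q1 t x - q3 t x) + (f t x - p1 t x - p3 t x) * q t x"
  have "((%t. integral {0..L} (%x. p t x * q t x)) has_real_derivative integral {0..L} (?h' t)) (at t within {0..T})"
  proof (rule param_integral_deriv[OF _ _ _ t])
    show "((%s. p s x * q s x) has_real_derivative ?h' t x) (at t within {0..T})" if "t \<in> {0..T}" "x \<in> {0..L}" for t x
      by (rule derivative_eq_intros kdv_dt[OF p that] kdv_dt[OF q that] refl)+ (simp add: algebra_simps)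
    show "continuous_on {0..L} (%x. p t x * q t x)" if "t \<in> {0..T}" for t
      using kdv_cont[OF p that] kdv_cont[OF q that] by (intro continuous_intros)
    show "continuous_on ({0..T} \<times> {0..L}) (%z. ?h' (fst z) (snd z))"
      using P Q by (intro continuous_intros)
  qed
  moreover have "integral {0..L} (?h' t) = p1 t L * q1 t L - p1 t 0 * q1 t 0 + ip (leb L) (f t) (q t) + ip (leb L) (p t) (k t)"
  proof -
    let ?a = "%x. (p3 t x + p1 t x) * q t x + p t x * (q3 t x + q1 t x)"
    have i: "(%x. f t x * q t x + p t x * k t x) integrable_on {0..L}" "?a integrable_on {0..L}"
      "(%x. f t x * q t x) integrable_on {0..L}" "(%x. p t x * k t x) integrable_on {0..L}"
      using Pc Qc by (auto intro!: integrable_continuous_real continuous_intros)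
    have "integral {0..L} (?h' t) = integral {0..L} (%x. (f t x * q t x + p t x * k t x) - ?a x)"
      by (rule Henstock_Kurzweil_Integration.integral_cong) (simp add: algebra_simps)
    also have "\<dots> = integral {0..L} (%x. f t x * q t x + p t x * k t x) - integral {0..L} ?a"
      by (rule Henstock_Kurzweil_Integration.integral_diff[OF i(1,2)])
    also have "integral {0..L} (%x. f t x * q t x + p t x * k t x) = ip (leb L) (f t) (q t) + ip (leb L) (p t) (k t)"
      using Pc Qc by (simp add: ip_cont Henstock_Kurzweil_Integration.integral_add[OF i(3,4)])
    also have "integral {0..L} ?a = - p1 t L * q1 t L + p1 t 0 * q1 t 0"
      using c3_by_parts[OF kdv_c3[OF p t] kdv_c3[OF q t] L] kdv_bdry[OF p t] kdv_bdry[OF q t] by simp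
    finally show ?thesis by simp
  qed
  ultimately have d: "((%t. integral {0..L} (%x. p t x * q t x)) has_real_derivative
     (p1 t L * q1 t L - p1 t 0 * q1 t 0 + ip (leb L) (f t) (q t) + ip (leb L) (p t) (k t))) (at t within {0..T})" by simp
  show ?thesis
    by (rule has_field_derivative_transform_within[OF d, of 1])
       (use t kdv_cont[OF p] kdv_cont[OF q] in \<open>auto simp: ip_cont\<close>)
qed

lemma ftc_within:
  fixes F :: "real => real"
  assumes "!!r. r \<in> {0..T} ==> (F has_real_derivative g r) (at r within {0..T})" "0 <= s" "s <= t" "t <= T"
  shows "integral {s..t} g = F t - F s"
proof (rule ftc[OF assms(3)])
  fix x assume x: "x \<in> {s..t}"
  then have "x \<in> {0..T}" using assms by auto
  from DERIV_subset[OF assms(1)[OF this]]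
  show "(F has_real_derivative g x) (at x within {s..t})" using assms by auto
qed

lemma kdv_pair:
  assumes "kdv T L f p p1 p2 p3" "kdv T L k q q1 q2 q3" "L > 0" "0 <= s" "s <= t" "t <= T"
  shows "ip (leb L) (p t) (q t) - ip (leb L) (p s) (q s) = integral {s..t} (%r.
     p1 r L * q1 r L - p1 r 0 * q1 r 0 + ip (leb L) (f r) (q r) + ip (leb L) (p r) (k r))"
  by (rule ftc_within[symmetric, OF kdv_pair_deriv[OF assms(1-3)]]) (use assms in auto)

lemma ip_zero [simp]: "ip M (%_. 0) g = 0" "ip M g (%_. 0) = 0" by (simp_all add: ip_def)

lemma kdv0_pair:
  assumes "kdv0 T L p p1 p2 p3" "kdv0 T L q q1 q2 q3" "L > 0" "0 <= s" "s <= t" "t <= T"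
  shows "ip (leb L) (p t) (q t) - ip (leb L) (p s) (q s) = integral {s..t} (%r. p1 r L * q1 r L - p1 r 0 * q1 r 0)"
  using kdv_pair[OF assms] by simp

lemma kdv_lin:
  assumes p: "kdv T L f p p1 p2 p3" and q: "kdv T L k q q1 q2 q3"
  shows "kdv T L (%t x. a * f t x + b * k t x) (%t x. a * p t x + b * q t x) (%t x. a * p1 t x + b * q1 t x)
    (%t x. a * p2 t x + b * q2 t x) (%t x. a * p3 t x + b * q3 t x)"
  unfolding kdv_def case_prod_unfold
proof (intro conjI ballI)
  fix t x assume tx: "t \<in> {0..T}" "x \<in> {0..L}"
  note P = c3_deriv[OF kdv_c3[OF p tx(1)] tx(2)] and Q = c3_deriv[OF kdv_c3[OF q tx(1)] tx(2)]
  show "((%x. a * p t x + b * q t x) has_real_derivative a * p1 t x + b * q1 t x) (at x within {0..L})"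
    "((%x. a * p1 t x + b * q1 t x) has_real_derivative a * p2 t x + b * q2 t x) (at x within {0..L})"
    "((%x. a * p2 t x + b * q2 t x) has_real_derivative a * p3 t x + b * q3 t x) (at x within {0..L})"
    by (intro DERIV_add DERIV_cmult P Q)+
  show "((%s. a * p s x + b * q s x) has_real_derivative
      a * f t x + b * k t x - (a * p1 t x + b * q1 t x) - (a * p3 t x + b * q3 t x)) (at t within {0..T})"
    by (rule derivative_eq_intros kdv_dt[OF p tx] kdv_dt[OF q tx] refl)+ (simp add: algebra_simps)
next
  show "continuous_on ({0..T} \<times> {0..L}) (%z. a * f (fst z) (snd z) + b * k (fst z) (snd z))"
    "continuous_on ({0..T} \<times> {0..L}) (%z. a * p (fst z) (snd z) + b * q (fst z) (snd z))"
    "continuous_on ({0..T} \<times> {0..L}) (%z. a * p1 (fst z) (snd z) + b * q1 (fst z) (snd z))"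
    "continuous_on ({0..T} \<times> {0..L}) (%z. a * p3 (fst z) (snd z) + b * q3 (fst z) (snd z))"
    by (intro continuous_intros kdv_joint[OF p] kdv_joint[OF q])+
qed (use kdv_bdry[OF p] kdv_bdry[OF q] in auto)

lemma kdv0_lin:
  "kdv0 T L p p1 p2 p3 ==> kdv0 T L q q1 q2 q3 ==>
    kdv0 T L (%t x. a * p t x + b * q t x) (%t x. a * p1 t x + b * q1 t x)
    (%t x. a * p2 t x + b * q2 t x) (%t x. a * p3 t x + b * q3 t x)"
  using kdv_lin[of T L "%_ _. 0" p p1 p2 p3 "%_ _. 0" q q1 q2 q3 a b] by simp

lemma kdv_energy:
  assumes "kdv0 T L p p1 p2 p3" "L > 0" "0 <= s" "s <= t" "t <= T"
  shows "(nm (leb L) (p t))\<^sup>2 - (nm (leb L) (p s))\<^sup>2 = integral {s..t} (%r. (p1 r L)\<^sup>2 - (p1 r 0)\<^sup>2)"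
  using kdv0_pair[OF assms(1,1,2-5)] unfolding nm_sq by (simp add: power2_eq_square)

text \<open>Kato smoothing, from the multiplier \<open>x\<close>.\<close>

lemma kdv_kato:
  assumes p: "kdv0 T L p p1 p2 p3" and L: "L > 0" and st: "0 <= s" "s <= t" "t <= T"
  shows "3 * integral {s..t} (%r. (nm (leb L) (p1 r))\<^sup>2) \<le>
     integral {s..t} (%r. (nm (leb L) (p r))\<^sup>2) + L * integral {s..t} (%r. (p1 r L)\<^sup>2) + L * (nm (leb L) (p s))\<^sup>2"
proof -
  note P = kdv_joint[OF p]
  let ?F = "%t. integral {0..L} (%x. x * (p t x * p t x))"
  let ?h' = "%t x. x * (2 * p t x * (- p1 t x - p3 t x))"
  let ?D = "%r. integral {0..L} (%x. p r x * p r x) - 3 * integral {0..L} (%x. p1 r x * p1 r x) + L * (p1 r L)\<^sup>2"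
  have d: "(?F has_real_derivative ?D r) (at r within {0..T})" if r: "r \<in> {0..T}" for r
  proof -
    note C = kdv_cont[OF p r]
    have c2: "continuous_on {0..L} (p2 r)" using c3_cont(3)[OF kdv_c3[OF p r]] .
    have "(?F has_real_derivative integral {0..L} (?h' r)) (at r within {0..T})"
    proof (rule param_integral_deriv[OF _ _ _ r])
      show "((%s. x * (p s x * p s x)) has_real_derivative ?h' t x) (at t within {0..T})" if "t \<in> {0..T}" "x \<in> {0..L}" for t x
        by (rule derivative_eq_intros kdv_dt[OF p that] refl)+ (simp add: algebra_simps)
      show "continuous_on {0..L} (%x. x * (p t x * p t x))" if "t \<in> {0..T}" for t
        using kdv_cont[OF p that] by (intro continuous_intros)
      show "continuous_on ({0..T} \<times> {0..L}) (%z. ?h' (fst z) (snd z))"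
        using P by (intro continuous_intros)
    qed
    moreover have "integral {0..L} (?h' r) = ?D r"
    proof -
      \<comment> \<open>The total derivative left over when x times the product of p with p_x +
        p_xxx is integrated by parts; only L (p_x(L))^2 survives at the ends.\<close>
      let ?A = "%x. - (x * (p r x * p r x)) - 2 * (x * (p r x * p2 r x)) + 2 * (p r x * p1 r x) + x * (p1 r x * p1 r x)"
      have i: "(%x. p r x * p r x) integrable_on {0..L}" "(%x. 3 * (p1 r x * p1 r x)) integrable_on {0..L}"
        "(%x. ?h' r x - p r x * p r x + 3 * (p1 r x * p1 r x)) integrable_on {0..L}"
        "(%x. p r x * p r x - 3 * (p1 r x * p1 r x)) integrable_on {0..L}"
        using C by (auto intro!: integrable_continuous_real continuous_intros)
      have "integral {0..L} (%x. ?h' r x - p r x * p r x + 3 * (p1 r x * p1 r x)) = ?A L - ?A 0"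
      proof (rule ftc)
        fix x assume x: "x \<in> {0..L}"
        note D = c3_deriv[OF kdv_c3[OF p r] x]
        show "(?A has_real_derivative ?h' r x - p r x * p r x + 3 * (p1 r x * p1 r x)) (at x within {0..L})"
          by (rule derivative_eq_intros D refl)+ (simp add: algebra_simps)
      qed (use L in simp)
      also have "\<dots> = L * (p1 r L)\<^sup>2" using kdv_bdry[OF p r] by (simp add: power2_eq_square)
      finally have 1: "integral {0..L} (%x. ?h' r x - p r x * p r x + 3 * (p1 r x * p1 r x)) = L * (p1 r L)\<^sup>2" .
      have "integral {0..L} (?h' r) = integral {0..L} (%x. (?h' r x - p r x * p r x + 3 * (p1 r x * p1 r x)) + (p r x * p r x - 3 * (p1 r x * p1 r x)))"
        by (rule Henstock_Kurzweil_Integration.integral_cong) simp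
      also have "\<dots> = L * (p1 r L)\<^sup>2 + (integral {0..L} (%x. p r x * p r x) - integral {0..L} (%x. 3 * (p1 r x * p1 r x)))"
        unfolding Henstock_Kurzweil_Integration.integral_add[OF i(3,4)] 1 Henstock_Kurzweil_Integration.integral_diff[OF i(1,2)] ..
      finally show ?thesis by simp
    qed
    ultimately show ?thesis by simp
  qed
  have T: "s \<in> {0..T}" "t \<in> {0..T}" "{s..t} \<subseteq> {0..T}" using st by auto
  have 1: "integral {s..t} ?D = ?F t - ?F s" by (rule ftc_within[OF d st])
  have c: "continuous_on {s..t} (%r. integral {0..L} (%x. p r x * p r x))"
    "continuous_on {s..t} (%r. integral {0..L} (%x. p1 r x * p1 r x))" "continuous_on {s..t} (%r. (p1 r L)\<^sup>2)"
    by (rule continuous_on_subset[OF _ T(3)], intro param_integral_cont continuous_intros P kdv_trace_cont[OF p L])+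
  have "integral {s..t} ?D = integral {s..t} (%r. integral {0..L} (%x. p r x * p r x))
      - 3 * integral {s..t} (%r. integral {0..L} (%x. p1 r x * p1 r x)) + L * integral {s..t} (%r. (p1 r L)\<^sup>2)"
    by (subst Henstock_Kurzweil_Integration.integral_add Henstock_Kurzweil_Integration.integral_diff,
        auto intro!: integrable_continuous_real continuous_intros c)+
  moreover have "integral {s..t} (%r. integral {0..L} (%x. p r x * p r x)) = integral {s..t} (%r. (nm (leb L) (p r))\<^sup>2)"
    "integral {s..t} (%r. integral {0..L} (%x. p1 r x * p1 r x)) = integral {s..t} (%r. (nm (leb L) (p1 r))\<^sup>2)"
    by (intro Henstock_Kurzweil_Integration.integral_cong;
        use kdv_cont[OF p] T(3) in \<open>auto simp: nm_sq ip_cont subset_iff\<close>)+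
  moreover have "?F t >= 0"
    by (rule integral_nonneg) (use kdv_cont[OF p T(2)] in \<open>auto intro!: integrable_continuous_real continuous_intros\<close>)
  moreover have "?F s <= L * (nm (leb L) (p s))\<^sup>2"
  proof -
    have "?F s <= integral {0..L} (%x. L * (p s x * p s x))"
      by (rule integral_le) (use kdv_cont[OF p T(1)] in \<open>auto intro!: integrable_continuous_real continuous_intros mult_right_mono\<close>)
    then show ?thesis using kdv_cont[OF p T(1)] by (simp add: nm_sq ip_cont)
  qed
  ultimately show ?thesis using 1 by linarith
qed

lemma nm_sq_cont:
  assumes "kdv T L f p p1 p2 p3"
  shows "continuous_on {0..T} (%r. (nm (leb L) (p r))\<^sup>2)" "continuous_on {0..T} (%r. (nm (leb L) (p1 r))\<^sup>2)"
proof -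
  have "continuous_on {0..T} (%r. integral {0..L} (%x. p r x * p r x))"
    "continuous_on {0..T} (%r. integral {0..L} (%x. p1 r x * p1 r x))"
    by (intro param_integral_cont continuous_intros kdv_joint[OF assms])+
  moreover have e: "(nm (leb L) (p r))\<^sup>2 = integral {0..L} (%x. p r x * p r x)"
    "(nm (leb L) (p1 r))\<^sup>2 = integral {0..L} (%x. p1 r x * p1 r x)" if "r \<in> {0..T}" for r
    unfolding nm_sq using kdv_cont[OF assms that] by (simp_all add: ip_cont)
  ultimately show "continuous_on {0..T} (%r. (nm (leb L) (p r))\<^sup>2)" "continuous_on {0..T} (%r. (nm (leb L) (p1 r))\<^sup>2)"
    by (simp_all only: continuous_on_cong[OF refl e(1)] continuous_on_cong[OF refl e(2)])
qed

lemma exp_Wk_cont: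
  "continuous_on A (%z. Re (c * exp (p * of_real (fst z)) * Wk L k p (snd z)))"
  by (intro continuous_intros)

text \<open>Separated solutions with a free complex amplitude \<open>c\<close>, which serves to
  rotate the phase. With \<open>c = 0\<close> the lemma also supplies the zero solution.\<close>

lemma kdv_exp:
  "kdv0 T L (%t x. Re (c * exp (p * of_real t) * Wk L 0 p x)) (%t x. Re (c * exp (p * of_real t) * Wk L 1 p x))
     (%t x. Re (c * exp (p * of_real t) * Wk L 2 p x)) (%t x. Re (c * exp (p * of_real t) * Wk L 3 p x))"
  unfolding kdv_def case_prod_unfold
proof (intro conjI ballI)
  fix t x
  show "((%x. Re (c * exp (p * of_real t) * Wk L 0 p x)) has_real_derivative Re (c * exp (p * of_real t) * Wk L 1 p x)) (at x within {0..L})"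
    "((%x. Re (c * exp (p * of_real t) * Wk L 1 p x)) has_real_derivative Re (c * exp (p * of_real t) * Wk L 2 p x)) (at x within {0..L})"
    "((%x. Re (c * exp (p * of_real t) * Wk L 2 p x)) has_real_derivative Re (c * exp (p * of_real t) * Wk L 3 p x)) (at x within {0..L})"
    using Wk_real_deriv[of "c * exp (p * of_real t)" L 0 p x "{0..L}"] Wk_real_deriv[of "c * exp (p * of_real t)" L 1 p x "{0..L}"]
      Wk_real_deriv[of "c * exp (p * of_real t)" L 2 p x "{0..L}"]
    by (simp_all add: eval_nat_numeral)
  have "((%z. c * exp (p * z) * Wk L 0 p x) has_field_derivative c * (p * exp (p * of_real t)) * Wk L 0 p x) (at (of_real t))"
    by (auto intro!: derivative_eq_intros)
  from has_vector_derivative_real_field[OF this, of "{0..T}"]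
  have "((%s. Re (c * exp (p * of_real s) * Wk L 0 p x)) has_real_derivative Re (c * (p * exp (p * of_real t)) * Wk L 0 p x)) (at t within {0..T})"
    unfolding has_real_derivative_iff_has_vector_derivative
    by (rule bounded_linear.has_vector_derivative[OF bounded_linear_Re])
  moreover have "c * (p * exp (p * of_real t)) * Wk L 0 p x = - (c * exp (p * of_real t) * Wk L 1 p x) - c * exp (p * of_real t) * Wk L 3 p x"
  proof -
    have w: "Wk L 3 p x = - Wk L 1 p x - p * Wk L 0 p x" using Wk_ode[of L 0 p x] by simp
    show ?thesis unfolding w by (simp add: algebra_simps)
  qed
  ultimately show "((%s. Re (c * exp (p * of_real s) * Wk L 0 p x)) has_real_derivative
     0 - Re (c * exp (p * of_real t) * Wk L 1 p x) - Re (c * exp (p * of_real t) * Wk L 3 p x)) (at t within {0..T})"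
    by simp
qed (rule continuous_on_const exp_Wk_cont | simp)+

section \<open>Observability\<close>

lemma exp_ge_self: "x <= exp (x :: real)" using exp_ge_add_one_self[of x] by linarith

text \<open>The power series about p is cut at order n: Cauchy's inequality on the small circle
  bounds the first n coefficients, on the large circle the tail. Since |q - p| <= 2R lies between R
  and 4R, the first part grows like 2^n and the second decays like 2^(-n). The free n replaces the
  exponent in Hadamard's theorem.\<close>

lemma three_circles:
  assumes h: "b holomorphic_on UNIV" and R: "R > 0" and q: "norm (q - p) <= 2 * R"
    and 1: "!!z. norm (z - p) <= R ==> norm (b z) <= M1" and 3: "!!z. norm (z - p) <= 4 * R ==> norm (b z) <= M3"
  shows "norm (b q) <= M1 * 2 ^ n + 2 * M3 * (1/2) ^ n"
proof -
  define a where "a k = (deriv ^^ k) b p / fact k * (q - p) ^ k" for k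
  have hb: "b holomorphic_on ball p r" "continuous_on (cball p r) b" for r
    using h holomorphic_on_subset[OF h] holomorphic_on_imp_continuous_on[OF h] continuous_on_subset by blast+
  have s: "a sums b q"
    unfolding a_def by (rule holomorphic_power_series[OF hb(1)[of "3 * R"]]) (use q R in \<open>auto simp: dist_norm norm_minus_commute\<close>)
  have M: "M1 >= 0" "M3 >= 0" using order_trans[OF norm_ge_zero 1[of p]] order_trans[OF norm_ge_zero 3[of p]] R by auto
  have qk: "norm (q - p) ^ k <= (2 * R) ^ k" for k by (intro power_mono q) simp
  have a1: "norm (a k) <= M1 * 2 ^ k" for k
  proof -
    have "norm ((deriv ^^ k) b p) <= fact k * M1 / R ^ k"
      by (rule Cauchy_inequality[OF hb R]) (auto simp: norm_minus_commute intro!: 1)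
    from divide_right_mono[OF this, of "fact k"]
    have "norm ((deriv ^^ k) b p) / fact k <= M1 / R ^ k" by simp
    then have "norm (a k) <= (M1 / R ^ k) * (2 * R) ^ k"
      unfolding a_def norm_mult norm_divide norm_power using qk M R by (intro mult_mono) auto
    then show ?thesis using R by (simp add: power_mult_distrib)
  qed
  have a3: "norm (a k) <= M3 * (1/2) ^ k" for k
  proof -
    have "norm ((deriv ^^ k) b p) <= fact k * M3 / (4 * R) ^ k"
      by (rule Cauchy_inequality[OF hb]) (use R in \<open>auto simp: norm_minus_commute intro!: 3\<close>)
    from divide_right_mono[OF this, of "fact k"]
    have "norm ((deriv ^^ k) b p) / fact k <= M3 / (4 * R) ^ k" by simp
    then have "norm (a k) <= (M3 / (4 * R) ^ k) * (2 * R) ^ k"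
      unfolding a_def norm_mult norm_divide norm_power using qk M R by (intro mult_mono) auto
    also have "\<dots> = M3 * ((2 * R) / (4 * R)) ^ k"
      by (simp only: power_divide times_divide_eq_left times_divide_eq_right)
    finally show ?thesis using R by simp
  qed
  have gs: "summable (%k. M3 * (1/2) ^ n * (1/2) ^ k)"
    by (rule summable_mult, rule summable_geometric) simp
  have a3n: "norm (a (k + n)) <= M3 * (1/2) ^ n * (1/2) ^ k" for k
    using a3[of "k + n"] unfolding power_add by (simp only: mult.assoc mult.commute[of "(1/2) ^ k"])
  have sm: "summable (%k. norm (a (k + n)))"
    by (rule summable_comparison_test'[OF gs, of 0]) (simp only: abs_norm_cancel real_norm_def a3n)
  have "b q = (\<Sum>k. a (k + n)) + (\<Sum>k<n. a k)"
    using suminf_split_initial_segment[OF sums_summable[OF s], of n] s by (simp add: sums_iff)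
  then have "norm (b q) <= norm (\<Sum>k. a (k + n)) + norm (\<Sum>k<n. a k)" by (metis norm_triangle_ineq)
  also have "norm (\<Sum>k. a (k + n)) <= (\<Sum>k. norm (a (k + n)))" by (rule summable_norm[OF sm])
  also have "\<dots> <= (\<Sum>k. M3 * (1/2) ^ n * (1/2) ^ k)"
    by (rule suminf_le[OF a3n sm gs])
  also have "\<dots> = 2 * M3 * (1/2) ^ n"
    by (subst suminf_mult) (auto simp: suminf_geometric intro!: summable_geometric)
  also have "norm (\<Sum>k<n. a k) <= (\<Sum>k<n. M1 * 2 ^ k)" by (rule sum_norm_le) (rule a1)
  also have "\<dots> <= M1 * 2 ^ n"
  proof -
    have "(\<Sum>k<n. 2 ^ k :: real) <= 2 ^ n" by (induction n) auto
    then show ?thesis using M by (simp add: sum_distrib_left[symmetric] mult_left_mono)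
  qed
  finally show ?thesis by simp
qed

section \<open>Interpolation inequalities and the splitting into low and high modes\<close>

lemma sq_diff_le:
  assumes "!!x. x \<in> {0..L} ==> (g has_real_derivative g1 x) (at x within {0..L})" "continuous_on {0..L} g1"
    "x \<in> {0..L}" "y \<in> {0..L}" "g y = 0"
  shows "(g x)\<^sup>2 <= 2 * nm (leb L) g * nm (leb L) g1"
proof -
  have gc: "continuous_on {0..L} g" by (rule DERIV_continuous_on[OF assms(1)])
  have main: "\<bar>(g b)\<^sup>2 - (g a)\<^sup>2\<bar> <= 2 * nm (leb L) g * nm (leb L) g1" if "a \<in> {0..L}" "b \<in> {0..L}" "a <= b" for a b
  proof -
    have sub: "{a..b} \<subseteq> {0..L}" using that by auto
    have c: "continuous_on {a..b} g" "continuous_on {a..b} g1" using gc assms(2) sub continuous_on_subset by blast+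
    have "integral {a..b} (%x. 2 * g x * g1 x) = (g b)\<^sup>2 - (g a)\<^sup>2"
    proof (rule ftc[OF that(3)])
      fix x assume x: "x \<in> {a..b}"
      have "(g has_real_derivative g1 x) (at x within {a..b})"
        using DERIV_subset[OF assms(1) sub] x sub by auto
      then show "((%x. (g x)\<^sup>2) has_real_derivative 2 * g x * g1 x) (at x within {a..b})"
        by (auto intro!: derivative_eq_intros)
    qed
    then have "\<bar>(g b)\<^sup>2 - (g a)\<^sup>2\<bar> = norm (integral {a..b} (%x. 2 * g x * g1 x))" by simp
    also have "\<dots> <= integral {a..b} (%x. 2 * (\<bar>g x\<bar> * \<bar>g1 x\<bar>))"
      by (rule integral_norm_bound_integral) (auto intro!: integrable_continuous_real continuous_intros c simp: abs_mult)
    also have "\<dots> <= integral {0..L} (%x. 2 * (\<bar>g x\<bar> * \<bar>g1 x\<bar>))"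
      by (rule integral_subset_le[OF sub]) (auto intro!: integrable_continuous_real continuous_intros c gc assms)
    also have "\<dots> = 2 * ip (leb L) (%x. \<bar>g x\<bar>) (%x. \<bar>g1 x\<bar>)"
      using gc assms(2) by (subst ip_cont) (auto intro!: continuous_intros)
    also have "ip (leb L) (%x. \<bar>g x\<bar>) (%x. \<bar>g1 x\<bar>) <= nm (leb L) (%x. \<bar>g x\<bar>) * nm (leb L) (%x. \<bar>g1 x\<bar>)"
      by (rule order_trans[OF abs_ge_self ip_le_nm]) (auto intro!: cont_l2 continuous_intros gc assms)
    finally show ?thesis by (simp add: nm_def ip_def)
  qed
  show ?thesis
    using main[OF assms(3,4)] main[OF assms(4,3)] assms(5) by (cases "x <= y") auto
qed

lemma rolle_within:
  assumes "!!x. x \<in> {0..L} ==> (g has_real_derivative g1 x) (at x within {0..L})" "g 0 = g L" "L > 0"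
  obtains y where "y \<in> {0..L}" "g1 y = 0"
proof -
  have c: "continuous_on {0..L} g" by (rule DERIV_continuous_on[OF assms(1)])
  have d: "(g has_real_derivative g1 x) (at x)" if "0 < x" "x < L" for x
    using assms(1)[of x] that at_within_Icc_at[of 0 x L] by simp
  have "\<exists>z. z > 0 & z < L & (%h. h * g1 z) = (%v. 0)"
    by (rule Rolle_deriv[OF assms(3,2) c]) (use d in \<open>auto simp: has_field_derivative_def mult_commute_abs\<close>)
  then obtain z where "z > 0" "z < L" "(%h. h * g1 z) = (%v. 0)" by blast
  from this(3) have "1 * g1 z = 0" by metis
  then show ?thesis using that[of z] \<open>z > 0\<close> \<open>z < L\<close> by simp
qed

text \<open>The boundary conditions leave a boundary term w'(0) (w''(L) - w''(0)) when w'' is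
  integrated against itself. Rolle gives zeros of w' and w'', so these values are bounded by
  products of norms through \<open>sq_diff_le\<close>, and the term can be absorbed.\<close>

lemma interpolation:
  assumes w: "c3 L w w1 w2 w3" and bc: "w 0 = 0" "w L = 0" "w1 L = w1 0" and L: "L > 0"
  shows "nm (leb L) w2 ^ 3 <= 625 * nm (leb L) w * (nm (leb L) w3)\<^sup>2"
    "(nm (leb L) w1)\<^sup>2 <= nm (leb L) w * nm (leb L) w2"
proof -
  note D = c3_deriv[OF w] and C = c3_cont[OF w]
  let ?a = "nm (leb L) w" and ?e = "nm (leb L) w1" and ?c = "nm (leb L) w2" and ?d = "nm (leb L) w3"
  have z: "0 \<in> {0..L}" "L \<in> {0..L}" using L by auto
  have ip1: "ip (leb L) w1 w1 = - ip (leb L) w w2"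
  proof -
    have "integral {0..L} (%x. w1 x * w1 x + w x * w2 x) = w L * w1 L - w 0 * w1 0"
    proof (rule ftc)
      fix x assume x: "x \<in> {0..L}"
      show "((%x. w x * w1 x) has_real_derivative w1 x * w1 x + w x * w2 x) (at x within {0..L})"
        by (rule derivative_eq_intros D x refl)+ (simp add: algebra_simps)
    qed (use L in simp)
    moreover have "integral {0..L} (%x. w1 x * w1 x + w x * w2 x) = ip (leb L) w1 w1 + ip (leb L) w w2"
      using C by (subst Henstock_Kurzweil_Integration.integral_add)
        (auto intro!: integrable_continuous_real continuous_intros simp: ip_cont)
    ultimately show ?thesis using bc by simp
  qed
  show ee: "?e\<^sup>2 <= ?a * ?c"
    unfolding nm_sq ip1 using ip_le_nm[OF cont_l2[OF C(1)] cont_l2[OF C(3)]] by linarith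
  obtain y1 where y1: "y1 \<in> {0..L}" "w1 y1 = 0" using rolle_within[OF D(1)] bc L by metis
  obtain y2 where y2: "y2 \<in> {0..L}" "w2 y2 = 0" using rolle_within[OF D(2)] bc L by metis
  have b: "(w1 0)\<^sup>2 <= 2 * ?e * ?c" by (rule sq_diff_le[OF D(2) C(3) z(1) y1])
  have M: "(w2 x)\<^sup>2 <= 2 * ?c * ?d" if "x \<in> {0..L}" for x by (rule sq_diff_le[OF D(3) C(4) that y2])
  let ?s = "sqrt (?e * ?d)"
  have s2: "?s\<^sup>2 = ?e * ?d" and s0: "?s >= 0" by simp_all
  have bw: "\<bar>w1 0 * w2 x\<bar> <= 2 * ?c * ?s" if "x \<in> {0..L}" for x
  proof (rule power2_le_imp_le)
    have "(w1 0)\<^sup>2 * (w2 x)\<^sup>2 <= (2 * ?e * ?c) * (2 * ?c * ?d)"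
      by (intro mult_mono b M that) auto
    also have "\<dots> = (2 * ?c * ?s)\<^sup>2" unfolding power_mult_distrib s2 by (simp add: power2_eq_square)
    finally show "\<bar>w1 0 * w2 x\<bar>\<^sup>2 <= (2 * ?c * ?s)\<^sup>2" by (simp add: power_mult_distrib)
  qed simp
  have ip2: "ip (leb L) w2 w2 = w1 0 * w2 L - w1 0 * w2 0 - ip (leb L) w1 w3"
  proof -
    have "integral {0..L} (%x. w2 x * w2 x + w1 x * w3 x) = w1 L * w2 L - w1 0 * w2 0"
    proof (rule ftc)
      fix x assume x: "x \<in> {0..L}"
      show "((%x. w1 x * w2 x) has_real_derivative w2 x * w2 x + w1 x * w3 x) (at x within {0..L})"
        by (rule derivative_eq_intros D x refl)+ (simp add: algebra_simps)
    qed (use L in simp)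
    moreover have "integral {0..L} (%x. w2 x * w2 x + w1 x * w3 x) = ip (leb L) w2 w2 + ip (leb L) w1 w3"
      using C by (subst Henstock_Kurzweil_Integration.integral_add)
        (auto intro!: integrable_continuous_real continuous_intros simp: ip_cont)
    ultimately show ?thesis using bc by simp
  qed
  \<comment> \<open>With s^2 = |w'| |w'''| this quadratic inequality forces
    \<open>?c <= 5 * ?s\<close>; the constant 625 is 5^4, obtained after inserting |w'|^2 <= |w|
    |w''|.\<close>
  have "?c\<^sup>2 <= 4 * ?c * ?s + ?s\<^sup>2"
    unfolding s2 nm_sq ip2 using bw[OF z(1)] bw[OF z(2)] ip_le_nm[OF cont_l2[OF C(2)] cont_l2[OF C(4)]] by linarith
  then have c5: "?c <= 5 * ?s"
  proof (rule contrapos_pp)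
    assume "\<not> ?c <= 5 * ?s"
    then have c: "?c > 5 * ?s" by simp
    have "?s\<^sup>2 <= ?c * ?s" unfolding power2_eq_square using c s0 by (intro mult_right_mono) linarith+
    moreover have "?c\<^sup>2 > 5 * ?s * ?c"
      unfolding power2_eq_square using c s0 by (intro mult_strict_right_mono) linarith+
    ultimately show "\<not> ?c\<^sup>2 <= 4 * ?c * ?s + ?s\<^sup>2" by (simp add: mult.commute)
  qed
  have "?c ^ 4 <= (5 * ?s) ^ 4" by (intro power_mono c5) simp
  also have "\<dots> = 625 * (?s\<^sup>2)\<^sup>2"
  proof -
    have "(5 * s) ^ 4 = 625 * (s\<^sup>2)\<^sup>2" for s :: real by (simp add: power2_eq_square eval_nat_numeral)
    then show ?thesis .
  qed
  also have "\<dots> = 625 * (?e\<^sup>2 * ?d\<^sup>2)" unfolding s2 by (simp add: power_mult_distrib)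
  also have "\<dots> <= 625 * ((?a * ?c) * ?d\<^sup>2)" by (intro mult_left_mono mult_right_mono ee) auto
  finally have "?c ^ 3 * ?c <= (625 * ?a * ?d\<^sup>2) * ?c" by (simp add: eval_nat_numeral mult_ac)
  then show "?c ^ 3 <= 625 * ?a * ?d\<^sup>2"
    by (cases "?c = 0") (auto simp: mult_le_cancel_right less_le)
qed

context noncritical
begin

lemma eig_nm_G:
  assumes "eigfam \<epsilon> n e m" "j < n" "\<epsilon> > 0"
  shows "nmL (G0 (e j)) = m j"
proof -
  note E = eigfamD[OF assms(1,2)]
  have "(nmL (G0 (e j)))\<^sup>2 = (m j)\<^sup>2"
    unfolding nm_sq
    using G0_skew[OF G0_cont[OF E(1)] E(1)] eig_ip_G[OF assms(1,2) E(1)] E(4)[OF assms(2)] by (simp add: ip_commute)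
  then show ?thesis using E(2) assms(3) nm_nonneg[of "leb L" "G0 (e j)"] by (simp add: power2_eq_iff)
qed

text \<open>A real mode is the real part of a complex eigenfunction that vanishes at 0 and L, hence
  a multiple of \<open>Wk\<close> at an imaginary parameter. The multiple involves
  \<open>gk 0 p L\<close> and \<open>gk 1 p L\<close>, and \<open>gk_lower\<close> says that these
  are not both small.\<close>

lemma eig_pair:
  obtains C where "C >= 0" "!!\<epsilon> n e m j f. eigfam \<epsilon> n e m ==> \<epsilon> > 0 ==> j < n ==> f \<in> l2 (leb L) ==>
     \<bar>ipL f (e j)\<bar> <= C * (1 + 1 / m j)\<^sup>2 * norm (pair L f (\<i> * of_real (1 / m j)))"
proof -
  obtain c where c: "c > 0" "!!s::real. norm (gk 0 (\<i> * of_real s) L) + norm (gk 1 (\<i> * of_real s) L) >= c / (1 + \<bar>s\<bar>)"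
    using gk_lower by blast
  have main: "\<bar>ipL f (e j)\<bar> <= (4 * CG / c) * (1 + 1 / m j)\<^sup>2 * norm (pair L f (\<i> * of_real (1 / m j)))"
    if fam: "eigfam \<epsilon> n e m" and eps: "\<epsilon> > 0" and j: "j < n" and f: "f \<in> l2 (leb L)" for \<epsilon> n e m j f
  proof -
    note E = eigfamD[OF fam j]
    define lam where "lam = 1 / m j"
    define p where "p = \<i> * of_real lam"
    define h where "h = e j"
    define A where "A = G0 h"
    have m0: "m j > 0" using E(2) eps by simp
    have lam: "lam > 0" "lam * m j = 1" using m0 by (auto simp: lam_def)
    have hc: "contL h" "contL A" using E(1) by (auto simp: h_def A_def)
    have heq: "h x = - lam\<^sup>2 * G0 A x" if "x \<in> {0..L}" for x
      using E(3)[OF that] m0 by (simp add: lam_def h_def A_def power_divide)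
    \<comment> \<open>On [0,L] this is h - i lam \<open>G0 h\<close>, an eigenfunction of the skew
      operator. The real part is written as -lam^2 \<open>G0 A\<close> instead of h because only
      images under \<open>G0\<close> come with three derivatives.\<close>
    define z where "z x = Complex (- lam\<^sup>2 * G0 A x) (- lam * G0 h x)" for x
    define z1 where "z1 x = Complex (- lam\<^sup>2 * G1 A x) (- lam * G1 h x)" for x
    define z2 where "z2 x = Complex (- lam\<^sup>2 * G2 A x) (- lam * G2 h x)" for x
    define z3 where "z3 x = Complex (- lam\<^sup>2 * (A x - G1 A x)) (- lam * (h x - G1 h x))" for x
    note dA = c3_deriv[OF G_c3[OF hc(2)]] and dh = c3_deriv[OF G_c3[OF hc(1)]]
    have dz: "(z has_vector_derivative z1 x) (at x within {0..L})" "(z1 has_vector_derivative z2 x) (at x within {0..L})"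
      "(z2 has_vector_derivative z3 x) (at x within {0..L})" if "x \<in> {0..L}" for x
      unfolding has_vector_derivative_complex_iff z_def z1_def z2_def z3_def complex.sel
      by (intro conjI DERIV_cmult dA dh that)+
    have ode: "z3 x + z1 x + p * z x = 0" if "x \<in> {0..L}" for x
    proof -
      have "lam * (- lam * G0 h x) = - lam\<^sup>2 * A x" by (simp add: A_def power2_eq_square)
      then show ?thesis using heq[OF that]
        by (simp add: complex_eq_iff z_def z1_def z3_def p_def algebra_simps)
    qed
    define \<alpha> where "\<alpha> = z1 0"
    define \<beta> where "\<beta> = z2 0"
    have zrep: "z x = \<alpha> * gk 1 p x + \<beta> * gk 0 p x" if x: "x \<in> {0..L}" for x
      unfolding \<alpha>_def \<beta>_def
    proof (rule variation_id[of x z z1 z2 z3])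
      have sub: "{0..x} \<subseteq> {0..L}" using x by auto
      fix s assume s: "s \<in> {0..x}"
      then have "s \<in> {0..L}" using sub by auto
      then show "(z has_vector_derivative z1 s) (at s within {0..x})" "(z1 has_vector_derivative z2 s) (at s within {0..x})"
        "(z2 has_vector_derivative z3 s) (at s within {0..x})" "z3 s + z1 s + p * z s = 0"
        using dz ode has_vector_derivative_within_subset[OF _ sub] by blast+
    qed (use x in \<open>auto simp: z_def G_bc complex_eq_iff\<close>)
    have zL: "\<alpha> * gk 1 p L + \<beta> * gk 0 p L = 0" using zrep[of L] L_pos by (simp add: z_def G_bc complex_eq_iff)
    \<comment> \<open>Two proportionalities between z and \<open>Wk\<close>. Both are kept, because
      either factor may vanish; adding the norms of the two resulting identities avoids a
      division.\<close>
    have W0: "gk 0 p L * z x = \<alpha> * Wk L 0 p x" and W1: "gk 1 p L * z x = - \<beta> * Wk L 0 p x" if x: "x \<in> {0..L}" for x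
    proof -
      have "\<beta> * gk 0 p L = - \<alpha> * gk 1 p L" using zL by (simp add: eq_neg_iff_add_eq_0 add.commute)
      then have "gk 0 p x * (\<beta> * gk 0 p L) = gk 0 p x * (- \<alpha> * gk 1 p L)" by simp
      then show "gk 0 p L * z x = \<alpha> * Wk L 0 p x" unfolding zrep[OF x] Wk_def by (simp add: algebra_simps)
      have "\<alpha> * gk 1 p L = - \<beta> * gk 0 p L" using zL by (simp add: eq_neg_iff_add_eq_0)
      then have "gk 1 p x * (\<alpha> * gk 1 p L) = gk 1 p x * (- \<beta> * gk 0 p L)" by simp
      then show "gk 1 p L * z x = - \<beta> * Wk L 0 p x" unfolding zrep[OF x] Wk_def by (simp add: algebra_simps)
    qed
    define Z where "Z = (LINT x|leb L. of_real (f x) * z x)"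
    have zc: "continuous_on {0..L} z" by (rule continuous_on_vector_derivative[OF dz(1)])
    have int: "integrable (leb L) (%x. of_real (f x) * z x)" by (rule l2_integrable_mult_bounded[OF f zc])
    have Z0: "gk 0 p L * Z = \<alpha> * pair L f p"
    proof -
      have "gk 0 p L * Z = (LINT x|leb L. gk 0 p L * (of_real (f x) * z x))" unfolding Z_def by simp
      also have "\<dots> = (LINT x|leb L. \<alpha> * (of_real (f x) * Wk L 0 p x))"
        by (rule Bochner_Integration.integral_cong) (use W0 in \<open>auto simp: mult.left_commute\<close>)
      finally show ?thesis by (simp add: pair_def)
    qed
    have Z1: "gk 1 p L * Z = - \<beta> * pair L f p"
    proof -
      have "gk 1 p L * Z = (LINT x|leb L. gk 1 p L * (of_real (f x) * z x))" unfolding Z_def by simp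
      also have "\<dots> = (LINT x|leb L. - \<beta> * (of_real (f x) * Wk L 0 p x))"
        by (rule Bochner_Integration.integral_cong) (use W1 in \<open>auto simp: mult.left_commute\<close>)
      finally show ?thesis by (simp add: pair_def)
    qed
    have ReZ: "Re Z = ipL f h"
    proof -
      have "Re Z = (LINT x|leb L. Re (of_real (f x) * z x))" unfolding Z_def using integral_Re[OF int] by simp
      also have "\<dots> = ipL f h"
        unfolding ip_def by (rule Bochner_Integration.integral_cong) (use heq in \<open>auto simp: z_def\<close>)
      finally show ?thesis .
    qed
    have nA: "nmL A = m j" using eig_nm_G[OF fam j eps] by (simp add: A_def h_def)
    have nh: "nmL h = 1" using E(4)[OF j] by (simp add: nm_def h_def)
    have z0: "0 \<in> {0..L}" using L_pos by simp
    have bnd: "norm \<alpha> <= 2 * lam * CG" "norm \<beta> <= 2 * lam * CG"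
    proof -
      have GA: "\<bar>Ga A\<bar> <= CG * m j" "\<bar>Gb A\<bar> <= CG * m j" "\<bar>Ga h\<bar> <= CG" "\<bar>Gb h\<bar> <= CG"
        using G_bound(1,2)[OF hc(2) z0] G_bound(1,2)[OF hc(1) z0] nA nh by simp_all
      have l: "lam\<^sup>2 * \<bar>y\<bar> <= lam * CG" if "\<bar>y\<bar> <= CG * m j" for y
      proof -
        have "lam\<^sup>2 * \<bar>y\<bar> <= lam\<^sup>2 * (CG * m j)" by (intro mult_left_mono that) simp
        also have "\<dots> = lam * CG * (lam * m j)" by (simp add: power2_eq_square mult_ac)
        finally show ?thesis using lam by simp
      qed
      have l2: "lam * \<bar>y\<bar> <= lam * CG" if "\<bar>y\<bar> <= CG" for y using that lam by (intro mult_left_mono) auto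
      show "norm \<alpha> <= 2 * lam * CG"
      proof -
        have "\<bar>Re \<alpha>\<bar> = lam\<^sup>2 * \<bar>Gb A\<bar>" "\<bar>Im \<alpha>\<bar> = lam * \<bar>Gb h\<bar>"
          using lam(1) by (simp_all add: \<alpha>_def z1_def G_bc abs_mult)
        then show ?thesis using cmod_le[of \<alpha>] l[OF GA(2)] l2[OF GA(4)] by linarith
      qed
      show "norm \<beta> <= 2 * lam * CG"
      proof -
        have "\<bar>Re \<beta>\<bar> = lam\<^sup>2 * \<bar>Ga A\<bar>" "\<bar>Im \<beta>\<bar> = lam * \<bar>Ga h\<bar>"
          using lam(1) by (simp_all add: \<beta>_def z2_def G_bc abs_mult)
        then show ?thesis using cmod_le[of \<beta>] l[OF GA(1)] l2[OF GA(3)] by linarith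
      qed
    qed
    have "c / (1 + lam) * norm Z <= (norm (gk 0 p L) + norm (gk 1 p L)) * norm Z"
      using c(2)[of lam] lam(1) by (intro mult_right_mono) (auto simp: p_def)
    also have "\<dots> = norm (gk 0 p L * Z) + norm (gk 1 p L * Z)" by (simp add: norm_mult algebra_simps)
    also have "\<dots> = (norm \<alpha> + norm \<beta>) * norm (pair L f p)" unfolding Z0 Z1 by (simp add: norm_mult algebra_simps)
    also have "\<dots> <= (4 * lam * CG) * norm (pair L f p)" using bnd by (intro mult_right_mono) auto
    finally have "norm Z <= (4 * CG / c) * (lam * (1 + lam)) * norm (pair L f p)"
      using c(1) lam(1) by (simp add: field_simps)
    also have "\<dots> <= (4 * CG / c) * (1 + lam)\<^sup>2 * norm (pair L f p)"
      using c(1) lam(1) CG_nonneg by (intro mult_right_mono mult_left_mono) (auto simp: power2_eq_square)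
    finally have "norm Z <= (4 * CG / c) * (1 + lam)\<^sup>2 * norm (pair L f p)" .
    then show ?thesis using abs_Re_le_cmod[of Z] unfolding ReZ by (simp add: h_def lam_def p_def)
  qed
  show ?thesis by (rule that[of "4 * CG / c"]) (use main c(1) CG_nonneg in auto)
qed

text \<open>The part h of \<open>f\<close> orthogonal to the low modes is w''' + w' for w =
  \<open>G0 h\<close>, and w is smaller than h by the factor \<epsilon>. Moving one derivative onto
  \<open>f\<close> leaves w'' + w, which interpolation bounds by \<epsilon>^(1/3) |h|. The exponent
  1/3 is one derivative against an operator of order three.\<close>

lemma high_modes:
  obtains K where "K >= 0" "!!\<epsilon> n e m f f1. 0 < \<epsilon> ==> \<epsilon> <= 1 ==> eigfam \<epsilon> n e m ==>
     (!!h. contL h ==> (!!j. j < n ==> ipL h (e j) = 0) ==> nmL (G0 h) <= \<epsilon> * nmL h) ==>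
     (!!x. x \<in> {0..L} ==> (f has_real_derivative f1 x) (at x within {0..L})) ==> contL f1 ==> f 0 = 0 ==> f L = 0 ==>
     nmL f <= sqrt (\<Sum>j<n. (ipL f (e j))\<^sup>2) + K * root 3 \<epsilon> * nmL f1"
proof -
  define K where "K = root 3 (625 * (1 + KG)\<^sup>2) + 1"
  have K0: "K >= 0" by (simp add: K_def)
  have main: "nmL f <= sqrt (\<Sum>j<n. (ipL f (e j))\<^sup>2) + K * root 3 \<epsilon> * nmL f1"
    if eps: "0 < \<epsilon>" "\<epsilon> <= 1" and fam: "eigfam \<epsilon> n e m"
      and comp: "!!h. contL h ==> (!!j. j < n ==> ipL h (e j) = 0) ==> nmL (G0 h) <= \<epsilon> * nmL h"
      and df: "!!x. x \<in> {0..L} ==> (f has_real_derivative f1 x) (at x within {0..L})" and f1c: "contL f1"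
      and f0: "f 0 = 0" "f L = 0" for \<epsilon> n e m f f1
  proof -
    note E = eigfamD[OF fam]
    define c where "c j = ipL f (e j)" for j
    define lo where "lo x = (\<Sum>j<n. c j * e j x)" for x
    define h where "h x = f x - lo x" for x
    have fc: "contL f" by (rule DERIV_continuous_on[OF df])
    have loc: "contL lo" unfolding lo_def[abs_def] using E(1) by (auto intro!: continuous_intros)
    have hc: "contL h" unfolding h_def[abs_def] using fc loc by (intro continuous_intros)
    have lo_e: "ipL lo (e k) = c k" if "k < n" for k
      unfolding lo_def[abs_def] by (rule orthonormal_ip) (use E that in auto)
    have h_e: "ipL h (e k) = 0" if "k < n" for k
      unfolding h_def[abs_def] using ip_diff_left[OF cont_l2[OF fc] cont_l2[OF loc] E(5)[OF that]] lo_e[OF that] by (simp add: c_def)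
    have h_lo: "ipL lo h = 0"
    proof -
      have "ipL lo h = (\<Sum>j<n. c j * ipL (e j) h)"
        unfolding lo_def[abs_def] by (rule ip_sum_left) (use E cont_l2[OF hc] in auto)
      also have "\<dots> = 0" by (rule sum.neutral) (use h_e in \<open>metis ip_commute lessThan_iff mult_zero_right\<close>)
      finally show ?thesis .
    qed
    define F where "F = nmL h"
    define w where "w = G0 h"
    have w3: "c3 L w (G1 h) (G2 h) (%x. h x - G1 h x)" unfolding w_def by (rule G_c3[OF hc])
    note C = c3_cont[OF w3]
    have wF: "nmL w <= \<epsilon> * F" unfolding w_def F_def by (rule comp[OF hc h_e])
    have w1F: "nmL (G1 h) <= KG * F"
      using nm_le_sup[of L "G1 h" "6 * CG * F"] C(2) G_bound(4)[OF hc] L_pos by (auto simp: KG_def F_def mult_ac)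
    have w3F: "nmL (%x. h x - G1 h x) <= (1 + KG) * F"
      using nm_triangle_diff[OF cont_l2[OF hc] l2_zero cont_l2[OF C(2)]] w1F nm_minus_commute[of "leb L" "%_. 0" "G1 h"]
      by (simp add: F_def algebra_simps)
    have F0: "F >= 0" by (simp add: F_def)
    have "nmL (G2 h) ^ 3 <= 625 * nmL w * (nmL (%x. h x - G1 h x))\<^sup>2"
      by (rule interpolation(1)[OF w3]) (auto simp: w_def G_bc L_pos)
    also have "\<dots> <= 625 * (\<epsilon> * F) * ((1 + KG) * F)\<^sup>2"
      using wF w3F eps F0 by (intro mult_mono power_mono) auto
    also have "\<dots> = (625 * (1 + KG)\<^sup>2) * \<epsilon> * F ^ 3" by (simp add: power2_eq_square power3_eq_cube)
    finally have "root 3 (nmL (G2 h) ^ 3) <= root 3 ((625 * (1 + KG)\<^sup>2) * \<epsilon> * F ^ 3)" by simp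
    then have w2F: "nmL (G2 h) <= (K - 1) * root 3 \<epsilon> * F"
      using F0 by (simp add: real_root_mult real_root_power_cancel K_def)
    have er: "\<epsilon> <= root 3 \<epsilon>"
    proof -
      have "\<epsilon> ^ 3 <= \<epsilon> ^ 1" using eps by (intro power_decreasing) auto
      then have "root 3 (\<epsilon> ^ 3) <= root 3 \<epsilon>" by simp
      then show ?thesis using eps by (simp add: real_root_power_cancel)
    qed
    \<comment> \<open>A single integration by parts: \<open>f\<close> vanishes at the ends, but its
      slopes there are unrelated, so no further derivative can be moved.\<close>
    have FF: "F\<^sup>2 = - integral {0..L} (%x. f1 x * (G2 h x + w x))"
    proof -
      have "F\<^sup>2 = ipL f h"
        unfolding F_def nm_sq using ip_diff_left[OF cont_l2[OF fc] cont_l2[OF loc] cont_l2[OF hc]] h_lo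
        by (simp add: h_def[abs_def])
      also have "\<dots> = integral {0..L} (%x. f x * h x)" by (rule ip_cont[OF fc hc])
      also have "\<dots> = integral {0..L} (%x. (f1 x * (G2 h x + w x) + f x * h x) - f1 x * (G2 h x + w x))" by simp
      also have "\<dots> = integral {0..L} (%x. f1 x * (G2 h x + w x) + f x * h x) - integral {0..L} (%x. f1 x * (G2 h x + w x))"
        by (rule Henstock_Kurzweil_Integration.integral_diff) (auto intro!: integrable_continuous_real continuous_intros fc f1c hc C)
      also have "integral {0..L} (%x. f1 x * (G2 h x + w x) + f x * h x) = f L * (G2 h L + w L) - f 0 * (G2 h 0 + w 0)"
      proof (rule ftc)
        fix x assume x: "x \<in> {0..L}"
        show "((%x. f x * (G2 h x + w x)) has_real_derivative f1 x * (G2 h x + w x) + f x * h x) (at x within {0..L})"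
          by (rule derivative_eq_intros df c3_deriv[OF w3] x refl)+ (simp add: algebra_simps)
      qed (use L_pos in simp)
      finally show ?thesis using f0 by simp
    qed
    have gc: "contL (%x. G2 h x + w x)" using C by (intro continuous_intros)
    have "F\<^sup>2 <= nmL f1 * nmL (%x. G2 h x + w x)"
      unfolding FF ip_cont[OF f1c gc, symmetric] using ip_le_nm[OF cont_l2[OF f1c] cont_l2[OF gc]] by linarith
    also have "\<dots> <= nmL f1 * (K * root 3 \<epsilon> * F)"
    proof (rule mult_left_mono)
      have "nmL (%x. G2 h x + w x) <= nmL (G2 h) + nmL w" by (rule nm_triangle[OF cont_l2[OF C(3)] cont_l2[OF C(1)]])
      also have "\<dots> <= K * root 3 \<epsilon> * F"
        using w2F wF mult_right_mono[OF er F0] by (simp add: algebra_simps)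
      finally show "nmL (%x. G2 h x + w x) <= K * root 3 \<epsilon> * F" .
    qed simp
    finally have "F * F <= (K * root 3 \<epsilon> * nmL f1) * F" by (simp add: power2_eq_square mult_ac)
    then have Fb: "F <= K * root 3 \<epsilon> * nmL f1"
      using F0 K0 eps by (cases "F = 0") (auto simp: mult_le_cancel_right)
    have "nmL f = nmL (%x. lo x + h x)" by (simp add: h_def)
    also have "\<dots> <= nmL lo + F" unfolding F_def by (rule nm_triangle[OF cont_l2[OF loc] cont_l2[OF hc]])
    also have "nmL lo = sqrt (\<Sum>j<n. (c j)\<^sup>2)"
    proof -
      have "(nmL lo)\<^sup>2 = (\<Sum>j<n. (c j)\<^sup>2)" unfolding lo_def[abs_def] by (rule orthonormal_nm) (use E in auto)
      then show ?thesis using real_sqrt_unique[of "nmL lo"] by simp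
    qed
    finally show ?thesis using Fb by (simp add: c_def)
  qed
  show ?thesis
  proof (rule that[OF K0])
    fix \<epsilon> n e m f f1
    assume a: "0 < \<epsilon>" "\<epsilon> <= 1" "eigfam \<epsilon> n e m"
      "!!h. contL h ==> (!!j. j < n ==> ipL h (e j) = 0) ==> nmL (G0 h) <= \<epsilon> * nmL h"
      "!!x. x \<in> {0..L} ==> (f has_real_derivative f1 x) (at x within {0..L})" "contL f1" "f 0 = 0" "f L = 0"
    show "nmL f <= sqrt (\<Sum>j<n. (ipL f (e j))\<^sup>2) + K * root 3 \<epsilon> * nmL f1"
      by (rule main[OF a])
  qed
qed

end

section \<open>Estimates along trajectories\<close>

lemma integral_le_sqrt:
  assumes "continuous_on {0..T} g" "T >= 0"
  shows "integral {0..T} (%r. \<bar>g r\<bar>) <= sqrt T * sqrt (integral {0..T} (%r. (g r)\<^sup>2))"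
proof -
  have c: "continuous_on {0..T} (%r. \<bar>g r\<bar>)" by (intro continuous_intros assms)
  have "\<bar>integral {0..T} (%s. 1 * \<bar>g s\<bar>)\<bar> <= sqrt T * nm (leb T) (%r. \<bar>g r\<bar>)"
    by (rule cont_integral_le_nm[OF c]) (use assms(2) in auto)
  also have "nm (leb T) (%r. \<bar>g r\<bar>) = sqrt (integral {0..T} (%r. (g r)\<^sup>2))"
    unfolding nm_def ip_cont[OF c c] by (simp add: power2_eq_square)
  finally show ?thesis by simp
qed

lemma trace_L1:
  assumes "kdv0 T L p p1 p2 p3" "L > 0" "T >= 0"
  shows "integral {0..T} (%r. \<bar>p1 r L\<bar> + \<bar>p1 r 0\<bar>)
    <= 2 * sqrt T * sqrt (integral {0..T} (%r. (p1 r 0)\<^sup>2 + (p1 r L)\<^sup>2))"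
proof -
  note c = kdv_trace_cont[OF assms(1,2)]
  have i: "(%r. \<bar>p1 r L\<bar>) integrable_on {0..T}" "(%r. \<bar>p1 r 0\<bar>) integrable_on {0..T}"
    by (auto intro!: integrable_continuous_real continuous_intros c)
  have m: "integral {0..T} (%r. (p1 r y)\<^sup>2) <= integral {0..T} (%r. (p1 r 0)\<^sup>2 + (p1 r L)\<^sup>2)" if "y = 0 | y = L" for y
    by (rule integral_le) (use that c in \<open>auto intro!: integrable_continuous_real continuous_intros\<close>)
  have "integral {0..T} (%r. \<bar>p1 r L\<bar> + \<bar>p1 r 0\<bar>) = integral {0..T} (%r. \<bar>p1 r L\<bar>) + integral {0..T} (%r. \<bar>p1 r 0\<bar>)"
    by (rule Henstock_Kurzweil_Integration.integral_add[OF i])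
  also have "\<dots> <= sqrt T * sqrt (integral {0..T} (%r. (p1 r L)\<^sup>2)) + sqrt T * sqrt (integral {0..T} (%r. (p1 r 0)\<^sup>2))"
    by (intro add_mono integral_le_sqrt c assms)
  also have "\<dots> <= sqrt T * sqrt (integral {0..T} (%r. (p1 r 0)\<^sup>2 + (p1 r L)\<^sup>2)) + sqrt T * sqrt (integral {0..T} (%r. (p1 r 0)\<^sup>2 + (p1 r L)\<^sup>2))"
    by (intro add_mono mult_left_mono real_sqrt_le_mono m) (use assms in auto)
  finally show ?thesis by simp
qed

definition Wbound :: "real => complex => real" where
  "Wbound L s = 2 * (rho s)\<^sup>2 * exp (2 * rho s * L)"

lemma Wbound: "x \<in> {0..L} ==> k <= 1 ==> norm (Wk L k s x) <= Wbound L s"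
proof -
  assume a: "x \<in> {0..L}" "k <= 1"
  have "rho s ^ (k + 1) <= rho s ^ 2" using rho_ge_1[of s] a(2) by (intro power_increasing) auto
  then have "2 * rho s ^ (k + 1) * exp (2 * rho s * L) <= Wbound L s" unfolding Wbound_def by simp
  then show ?thesis using Wk_bound[OF a(1), of k s] by linarith
qed

lemma Wbound_nonneg: "Wbound L s >= 0" by (simp add: Wbound_def)

lemma pair_le:
  assumes "f \<in> l2 (leb L)" "L >= 0"
  shows "norm (pair L f s) <= nm (leb L) f * (sqrt L * Wbound L s)"
proof -
  have "norm (pair L f s) <= nm (leb L) f * nm (leb L) (%x. norm (Wk L 0 s x))"
    unfolding pair_def by (rule pair_bound[OF assms(1)]) (intro continuous_intros)
  also have "nm (leb L) (%x. norm (Wk L 0 s x)) <= sqrt L * Wbound L s"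
    by (rule nm_le_sup) (use Wbound assms in \<open>auto intro!: continuous_intros\<close>)
  finally show ?thesis by (simp add: mult_left_mono)
qed

text \<open>Rotating the phase makes the pairing with \<open>e\<^sup>s\<^sup>t W\<^sub>s\<close> real, so the real duality identity applies.\<close>

lemma pair_past_bound:
  assumes p: "kdv0 T L p p1 p2 p3" and L: "L > 0" and \<tau>: "0 <= \<tau>" "\<tau> <= T" and s: "Re s >= 0"
  shows "norm (pair L (p \<tau>) s) <= Wbound L s * (sqrt L * exp (- Re s * \<tau>) * nm (leb L) (p 0)
     + 2 * sqrt T * sqrt (integral {0..T} (%r. (p1 r 0)\<^sup>2 + (p1 r L)\<^sup>2)))"
proof -
  define b where "b = pair L (p \<tau>) s"
  define c where "c = (if b = 0 then 1 else cnj b / of_real (norm b))"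
  have c: "norm c = 1" "c * b = of_real (norm b)"
  proof -
    show "norm c = 1" by (simp add: c_def norm_divide)
    show "c * b = of_real (norm b)"
      using complex_norm_square[of b] by (cases "b = 0") (simp_all add: c_def mult.commute[of _ b] power2_eq_square nonzero_divide_eq_eq)
  qed
  \<comment> \<open>Normalised at time \<tau>: there the exponential factor has modulus one and the
    real pairing equals \<open>norm b\<close>, while at time 0 it carries the damping e^(-Re s
    \<tau>).\<close>
  define c' where "c' = c * exp (- s * of_real \<tau>)"
  let ?q = "%k t x. Re (c' * exp (s * of_real t) * Wk L k s x)"
  have q: "kdv0 T L (?q 0) (?q 1) (?q 2) (?q 3)" by (rule kdv_exp)
  have mem: "0 \<in> {0..T}" "\<tau> \<in> {0..T}" "0 \<in> {0..L}" "L \<in> {0..L}" using \<tau> L by auto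
  have qb: "\<bar>?q k t x\<bar> <= exp (Re s * (t - \<tau>)) * Wbound L s" if "k <= 1" "x \<in> {0..L}" for k t x
  proof -
    have "\<bar>?q k t x\<bar> <= norm (c' * exp (s * of_real t) * Wk L k s x)" by (rule abs_Re_le_cmod)
    also have "\<dots> = exp (- (Re s * \<tau>)) * exp (Re s * t) * norm (Wk L k s x)"
      by (simp add: norm_mult c'_def c norm_exp_eq_Re)
    also have "exp (- (Re s * \<tau>)) * exp (Re s * t) = exp (Re s * (t - \<tau>))" by (simp add: exp_add[symmetric] algebra_simps)
    finally show ?thesis using Wbound[OF that(2,1)] by (meson exp_ge_zero mult_left_mono order_trans)
  qed
  have pc: "continuous_on {0..L} (p \<tau>)" using kdv_cont[OF p mem(2)] by simp
  have "norm b = ip (leb L) (p \<tau>) (?q 0 \<tau>)"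
  proof -
    have i: "integrable (leb L) (%x. of_real (p \<tau> x) * Wk L 0 s x)"
      by (rule l2_integrable_mult_bounded[OF cont_l2[OF pc]]) (intro continuous_intros)
    have cc: "c' * exp (s * of_real \<tau>) = c" by (simp add: c'_def exp_minus)
    have "of_real (norm b) = c * (LINT x|leb L. of_real (p \<tau> x) * Wk L 0 s x)"
      using c(2) by (simp add: b_def pair_def)
    also have "\<dots> = (LINT x|leb L. c * (of_real (p \<tau> x) * Wk L 0 s x))" by simp
    finally have "norm b = Re (LINT x|leb L. c * (of_real (p \<tau> x) * Wk L 0 s x))" by (metis Re_complex_of_real)
    also have "\<dots> = (LINT x|leb L. Re (c * (of_real (p \<tau> x) * Wk L 0 s x)))"
      using i by (intro integral_Re[symmetric]) simp
    also have "\<dots> = ip (leb L) (p \<tau>) (?q 0 \<tau>)" unfolding ip_def cc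
      by (rule Bochner_Integration.integral_cong) (auto simp: algebra_simps)
    finally show ?thesis .
  qed
  also have "\<dots> = ip (leb L) (p 0) (?q 0 0) + integral {0..\<tau>} (%r. p1 r L * ?q 1 r L - p1 r 0 * ?q 1 r 0)"
    using kdv0_pair[OF p q L order_refl \<tau>] by simp
  also have "ip (leb L) (p 0) (?q 0 0) <= nm (leb L) (p 0) * (sqrt L * (exp (- Re s * \<tau>) * Wbound L s))"
  proof -
    have c0: "continuous_on {0..L} (?q 0 0)" by (intro continuous_intros)
    have "nm (leb L) (?q 0 0) <= sqrt L * (exp (Re s * (0 - \<tau>)) * Wbound L s)"
      by (rule nm_le_sup[OF c0 qb]) (use L in auto)
    then show ?thesis
      using ip_le_nm[OF cont_l2[OF kdv_cont(2)[OF p mem(1)]] cont_l2[OF c0]]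
      by (smt (verit, ccfv_threshold) mult_left_mono nm_nonneg minus_mult_left minus_mult_right diff_0)
  qed
  also have "integral {0..\<tau>} (%r. p1 r L * ?q 1 r L - p1 r 0 * ?q 1 r 0)
     <= Wbound L s * (2 * sqrt T * sqrt (integral {0..T} (%r. (p1 r 0)\<^sup>2 + (p1 r L)\<^sup>2)))"
  proof -
    note tc = kdv_trace_cont[OF p L]
    have sub: "{0..\<tau>} \<subseteq> {0..T}" using \<tau> by auto
    have "integral {0..\<tau>} (%r. p1 r L * ?q 1 r L - p1 r 0 * ?q 1 r 0) <= integral {0..\<tau>} (%r. Wbound L s * (\<bar>p1 r L\<bar> + \<bar>p1 r 0\<bar>))"
    proof (rule integral_le)
      fix r assume r: "r \<in> {0..\<tau>}"
      have e: "\<bar>?q 1 r x\<bar> <= Wbound L s" if "x \<in> {0..L}" for x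
      proof -
        have "exp (Re s * (r - \<tau>)) <= 1" using s r by (auto intro: mult_nonneg_nonpos)
        then show ?thesis using qb[OF order_refl that, of r] Wbound_nonneg[of L s]
          by (meson mult_left_le_one_le exp_ge_zero order_trans)
      qed
      have "p1 r L * ?q 1 r L <= \<bar>p1 r L\<bar> * Wbound L s"
        using mult_left_mono[OF e[OF mem(4)] abs_ge_zero[of "p1 r L"]] unfolding abs_mult[symmetric] by linarith
      moreover have "- (p1 r 0 * ?q 1 r 0) <= \<bar>p1 r 0\<bar> * Wbound L s"
        using mult_left_mono[OF e[OF mem(3)] abs_ge_zero[of "p1 r 0"]] unfolding abs_mult[symmetric] by linarith
      ultimately show "p1 r L * ?q 1 r L - p1 r 0 * ?q 1 r 0 <= Wbound L s * (\<bar>p1 r L\<bar> + \<bar>p1 r 0\<bar>)"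
        by (simp add: algebra_simps)
    qed (auto intro!: integrable_continuous_real continuous_intros continuous_on_subset[OF tc(1) sub] continuous_on_subset[OF tc(2) sub])
    also have "\<dots> <= integral {0..T} (%r. Wbound L s * (\<bar>p1 r L\<bar> + \<bar>p1 r 0\<bar>))"
      by (rule integral_subset_le[OF sub])
         (auto intro!: integrable_continuous_real continuous_intros continuous_on_subset[OF tc(1) sub] continuous_on_subset[OF tc(2) sub] tc mult_nonneg_nonneg Wbound_nonneg)
    also have "\<dots> = Wbound L s * integral {0..T} (%r. \<bar>p1 r L\<bar> + \<bar>p1 r 0\<bar>)" by simp
    also have "\<dots> <= Wbound L s * (2 * sqrt T * sqrt (integral {0..T} (%r. (p1 r 0)\<^sup>2 + (p1 r L)\<^sup>2)))"
      by (intro mult_left_mono trace_L1[OF p L] Wbound_nonneg) (use \<tau> in auto)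
    finally show ?thesis .
  qed
  finally show ?thesis unfolding b_def by (simp add: algebra_simps)
qed

lemma mean_value_le:
  fixes g :: "real => real"
  assumes "continuous_on {a..b} g" "a < b"
  obtains \<tau> where "\<tau> \<in> {a..b}" "g \<tau> * (b - a) <= integral {a..b} g"
proof -
  obtain \<tau> where t: "\<tau> \<in> {a..b}" "\<forall>x\<in>{a..b}. g \<tau> <= g x"
    using continuous_attains_inf[of "{a..b}" g] assms by auto
  have "integral {a..b} (%x. g \<tau>) <= integral {a..b} g"
    by (rule integral_le) (use t assms in \<open>auto intro!: integrable_continuous_real\<close>)
  then show ?thesis using that t(1) assms(2) by (simp add: mult.commute)
qed

context noncritical
begin

text \<open>The energy changes by at most the observation \<open>Q\<close>. Kato smoothing bounds
  the slope in the mean, hence at some time; that time is sought in the second half of [0,T] so that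
  the damping from time 0 up to it is at least e^(-Re s T/2).\<close>

lemma kato_time:
  assumes p: "kdv0 T L p p1 p2 p3" and T: "T > 0"
    and Q: "Q = integral {0..T} (%r. (p1 r 0)\<^sup>2 + (p1 r L)\<^sup>2)" and E: "E = nmL (p 0)"
  shows "!!t. t \<in> {0..T} ==> \<bar>(nmL (p t))\<^sup>2 - E\<^sup>2\<bar> <= Q"
    "\<exists>\<tau>\<in>{T/2..T}. (nmL (p1 \<tau>))\<^sup>2 <= (T + 2 * L) / T * (E\<^sup>2 + Q)"
proof -
  note c = kdv_trace_cont[OF p L_pos]
  have O0: "Q >= 0" unfolding Q by (rule integral_nonneg) (auto intro!: integrable_continuous_real continuous_intros c)
  show en: "\<bar>(nmL (p t))\<^sup>2 - E\<^sup>2\<bar> <= Q" if t: "t \<in> {0..T}" for t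
  proof -
    have sub: "{0..t} \<subseteq> {0..T}" using t by auto
    have ct: "continuous_on {0..t} (%r. p1 r 0)" "continuous_on {0..t} (%r. p1 r L)"
      using c sub continuous_on_subset by blast+
    have "\<bar>(nmL (p t))\<^sup>2 - E\<^sup>2\<bar> = norm (integral {0..t} (%r. (p1 r L)\<^sup>2 - (p1 r 0)\<^sup>2))"
      using kdv_energy[OF p L_pos order_refl, of t] t E by simp
    also have "\<dots> <= integral {0..t} (%r. (p1 r 0)\<^sup>2 + (p1 r L)\<^sup>2)"
      by (rule integral_norm_bound_integral) (auto intro!: integrable_continuous_real continuous_intros ct simp: abs_le_iff)
    also have "\<dots> <= Q" unfolding Q
      by (rule integral_subset_le[OF sub]) (auto intro!: integrable_continuous_real continuous_intros ct c)
    finally show ?thesis .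
  qed
  have sub: "{T/2..T} \<subseteq> {0..T}" using T by auto
  have c1: "continuous_on {T/2..T} (%r. (nmL (p1 r))\<^sup>2)" "continuous_on {T/2..T} (%r. (nmL (p r))\<^sup>2)"
    using nm_sq_cont[OF p] continuous_on_subset[OF _ sub] by blast+
  obtain \<tau> where \<tau>: "\<tau> \<in> {T/2..T}" "(nmL (p1 \<tau>))\<^sup>2 * (T - T/2) <= integral {T/2..T} (%r. (nmL (p1 r))\<^sup>2)"
    using mean_value_le[OF c1(1)] T by auto
  have "integral {T/2..T} (%r. (nmL (p r))\<^sup>2) <= integral {T/2..T} (%r. E\<^sup>2 + Q)"
  proof (rule integral_le)
    fix r assume "r \<in> {T/2..T}"
    then have "r \<in> {0..T}" using sub by auto
    from en[OF this] show "(nmL (p r))\<^sup>2 <= E\<^sup>2 + Q" by linarith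
  qed (auto intro!: integrable_continuous_real c1)
  then have 1: "integral {T/2..T} (%r. (nmL (p r))\<^sup>2) <= T * (E\<^sup>2 + Q)"
    using T O0 by (simp add: field_simps) (smt (verit) mult_nonneg_nonneg zero_le_power2)
  have "integral {T/2..T} (%r. (p1 r L)\<^sup>2) <= integral {T/2..T} (%r. (p1 r 0)\<^sup>2 + (p1 r L)\<^sup>2)"
    by (rule integral_le) (auto intro!: integrable_continuous_real continuous_intros continuous_on_subset[OF c(1) sub] continuous_on_subset[OF c(2) sub])
  also have "\<dots> <= Q" unfolding Q
    by (rule integral_subset_le[OF sub]) (auto intro!: integrable_continuous_real continuous_intros continuous_on_subset[OF c(1) sub] continuous_on_subset[OF c(2) sub] c)
  finally have 2: "L * integral {T/2..T} (%r. (p1 r L)\<^sup>2) <= L * (E\<^sup>2 + Q)"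
    using L_pos by (intro mult_left_mono) (auto intro: order_trans)
  have "(nmL (p (T/2)))\<^sup>2 <= E\<^sup>2 + Q" using en[of "T/2"] T by auto
  then have 3: "L * (nmL (p (T/2)))\<^sup>2 <= L * (E\<^sup>2 + Q)" using L_pos by (intro mult_left_mono) auto
  have "3 * ((nmL (p1 \<tau>))\<^sup>2 * (T / 2)) <= (T + 2 * L) * (E\<^sup>2 + Q)"
    using kdv_kato[OF p L_pos, of "T/2" T] \<tau>(2) T 1 2 3 by (simp add: algebra_simps)
  moreover have "(nmL (p1 \<tau>))\<^sup>2 * T >= 0" using T by simp
  ultimately have "(nmL (p1 \<tau>))\<^sup>2 * T <= (T + 2 * L) * (E\<^sup>2 + Q)" by linarith
  then have "(nmL (p1 \<tau>))\<^sup>2 <= (T + 2 * L) / T * (E\<^sup>2 + Q)" using T by (simp add: field_simps)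
  then show "\<exists>\<tau>\<in>{T/2..T}. (nmL (p1 \<tau>))\<^sup>2 <= (T + 2 * L) / T * (E\<^sup>2 + Q)" using \<tau>(1) by blast
qed

end

text \<open>The factor 7 = 1 + 2 + 4 adds the size of the target frequency, the shift of the centre
  and the radius of the largest disc in \<open>low_pair\<close>, all in units of y^3. It gives
  \<open>rho s <= 3 * y\<close>, and y^2 <= 2 e^y removes the polynomial factor.\<close>

lemma Wbound_cube_le:
  assumes "norm s <= 7 * y ^ 3" "y >= 1" "L >= 0"
  shows "Wbound L s <= 36 * exp ((6 * L + 1) * y)"
proof -
  have "root 3 (norm s) <= root 3 ((2 * y) ^ 3)"
  proof (rule real_root_le_mono)
    have "(2 * y) ^ 3 = 8 * y ^ 3" by (simp add: power_mult_distrib)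
    moreover have "y ^ 3 >= 0" using assms(2) by simp
    ultimately show "norm s <= (2 * y) ^ 3" using assms(1) by linarith
  qed simp
  also have "root 3 ((2 * y) ^ 3) = 2 * y" using assms(2) by (intro real_root_power_cancel) auto
  finally have r: "rho s <= 3 * y" using assms(2) by (simp add: rho_def)
  have r1: "0 <= rho s" using rho_ge_1[of s] by linarith
  have "y\<^sup>2 <= 2 * exp y" using exp_lower_Taylor_quadratic[of y] assms by linarith
  have "Wbound L s <= 2 * (3 * y)\<^sup>2 * exp (6 * y * L)"
  proof -
    have "L * rho s <= 3 * (L * y)" using mult_left_mono[OF r assms(3)] by simp
    then show ?thesis unfolding Wbound_def using r r1 assms(2,3) by (intro mult_mono power_mono) auto
  qed
  also have "\<dots> <= 36 * exp y * exp (6 * y * L)" using \<open>y\<^sup>2 <= 2 * exp y\<close> by (simp add: power_mult_distrib)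
  also have "\<dots> = 36 * exp ((6 * L + 1) * y)" by (simp add: exp_add[symmetric] algebra_simps)
  finally show ?thesis .
qed

text \<open>Three circles about c = q + 2R with R = y^3. The disc of radius R lies in Re z >= R,
  where the past is damped by e^(-X/2); q lies at distance 2R; on the disc of radius 4R only the
  norm of the state is used. The initial state ends up with a small factor and the observation with
  a large one.\<close>

lemma low_pair:
  assumes p: "kdv0 T L p p1 p2 p3" and L: "L > 0" and y: "y >= 1" and T: "0 < T" "T < T0"
    and \<tau>: "T / 2 <= \<tau>" "\<tau> <= T" and lam: "\<bar>lam\<bar> <= y ^ 3"
    and o: "o' = sqrt (integral {0..T} (%r. (p1 r 0)\<^sup>2 + (p1 r L)\<^sup>2))" "o' >= 0"
    and E: "E = nm (leb L) (p 0)" and fE: "nm (leb L) (p \<tau>) <= E + o'" and X: "X = y ^ 3 * T"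
  shows "norm (pair L (p \<tau>) (\<i> * of_real lam))
    <= 36 * exp ((6 * L + 1) * y) * (5 * sqrt L + 2 * sqrt T0) * (exp (- X / 8) * E + exp (X / 4) * o')"
proof -
  define R where "R = y ^ 3"
  define B where "B = 36 * exp ((6 * L + 1) * y)"
  have R: "R >= 1" unfolding R_def using y by simp
  have X0: "X >= 0" unfolding X using y T by simp
  have B0: "B >= 0" by (simp add: B_def)
  have E0: "E >= 0" by (simp add: E)
  have \<tau>0: "\<tau> \<in> {0..T}" using \<tau> T by auto
  have fl: "p \<tau> \<in> l2 (leb L)" by (rule cont_l2[OF kdv_cont(2)[OF p \<tau>0]])
  define q where "q = \<i> * of_real lam"
  define c where "c = q + of_real (2 * R)"
  \<comment> \<open>The order X/4 is a compromise: 2^n <= e^(X/4) does not use up the damping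
    e^(-X/2), and 2^(-n) <= 2 e^(-X/8) still makes the tail small.\<close>
  define n where "n = nat \<lfloor>X / 4\<rfloor>"
  have n: "real n <= X / 4" "X / 4 - 1 <= real n" using X0 unfolding n_def by (simp_all add: of_nat_nat) linarith+
  have WB: "Wbound L z <= B" if "norm (z - c) <= 4 * R" for z
  proof -
    have "norm z <= norm (z - c) + norm c" by (metis diff_add_cancel norm_triangle_ineq)
    also have "norm c <= norm q + norm (of_real (2 * R) :: complex)" unfolding c_def by (rule norm_triangle_ineq)
    also have "norm q = \<bar>lam\<bar>" by (simp add: q_def norm_mult)
    also have "norm (of_real (2 * R) :: complex) = 2 * R" using R by (simp only: norm_of_real)
    finally have "norm z <= 7 * y ^ 3" using that lam by (simp add: R_def)
    then show ?thesis unfolding B_def using Wbound_cube_le y L by simp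
  qed
  define M1 where "M1 = B * (sqrt L * exp (- X / 2) * E + 2 * sqrt T0 * o')"
  define M3 where "M3 = (E + o') * (sqrt L * B)"
  have "norm (pair L (p \<tau>) q) <= M1 * 2 ^ n + 2 * M3 * (1/2) ^ n"
  proof (rule three_circles[of "pair L (p \<tau>)" R q c M1 M3 n])
    show "pair L (p \<tau>) holomorphic_on UNIV" using pair_holomorphic[OF fl] L by simp
    show "norm (q - c) <= 2 * R" using R by (simp add: c_def)
    fix z assume z: "norm (z - c) <= R"
    have "Re c - R <= Re z" using abs_Re_le_cmod[of "z - c"] z by simp
    then have Rz: "Re z >= R" by (simp add: c_def q_def)
    have e: "exp (- Re z * \<tau>) <= exp (- X / 2)"
    proof -
      have "R * (T / 2) <= Re z * \<tau>" using Rz \<tau> T R by (intro mult_mono) auto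
      then show ?thesis by (simp add: X R_def)
    qed
    have "norm (pair L (p \<tau>) z) <= Wbound L z * (sqrt L * exp (- Re z * \<tau>) * nm (leb L) (p 0) + 2 * sqrt T * o')"
      unfolding o(1) by (rule pair_past_bound[OF p L]) (use \<tau>0 Rz R in auto)
    also have "\<dots> <= M1"
      unfolding M1_def E[symmetric] using e WB[of z] z R B0 E0 o(2) T L
      by (intro mult_mono add_mono mult_left_mono mult_right_mono) (auto simp: Wbound_nonneg)
    finally show "norm (pair L (p \<tau>) z) <= M1" .
  next
    fix z assume z: "norm (z - c) <= 4 * R"
    have "norm (pair L (p \<tau>) z) <= nm (leb L) (p \<tau>) * (sqrt L * Wbound L z)" by (rule pair_le[OF fl]) (use L in simp)
    also have "\<dots> <= M3" unfolding M3_def using WB[OF z] fE B0 E0 o(2) L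
      by (intro mult_mono) (auto simp: Wbound_nonneg)
    finally show "norm (pair L (p \<tau>) z) <= M3" .
  qed (use R in simp)
  also have "\<dots> <= M1 * exp (X / 4) + 2 * M3 * (2 * exp (- X / 8))"
  proof (intro add_mono mult_left_mono)
    have "(2::real) ^ n = exp (n * ln 2)" by (simp add: exp_of_nat_mult)
    also have "\<dots> <= exp (X / 4)"
    proof -
      have "n * ln 2 <= n * (1::real)" using ln_2_less_1 by (intro mult_left_mono) auto
      then show ?thesis using n(1) by simp
    qed
    finally show "(2::real) ^ n <= exp (X / 4)" .
    have "(1/2::real) ^ n = exp (- (n * ln 2))" by (simp add: exp_of_nat_mult exp_minus power_one_over inverse_eq_divide)
    also have "\<dots> <= exp (ln 2 - X / 8)"
    proof -
      have "ln 2 >= (1/2::real)" using ln2_ge_two_thirds by simp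
      then have "(X / 4) * (1 / 2) <= (X / 4) * ln 2" using X0 by (intro mult_left_mono) auto
      moreover have "(X / 4 - 1) * ln 2 <= n * ln 2" using n(2) by (intro mult_right_mono) auto
      ultimately have "X / 8 - ln 2 <= n * ln 2" by (simp add: algebra_simps)
      then show ?thesis by simp
    qed
    also have "\<dots> = 2 * exp (- X / 8)" using exp_add[of "ln 2" "- X / 8"] by simp
    finally show "(1/2::real) ^ n <= 2 * exp (- X / 8)" .
  qed (use B0 E0 o(2) T L in \<open>auto simp: M1_def M3_def\<close>)
  also have "\<dots> = B * (sqrt L * E * exp (- X / 4) + 2 * sqrt T0 * (o' * exp (X / 4)) + 4 * sqrt L * (E * exp (- X / 8)) + 4 * sqrt L * (o' * exp (- X / 8)))"
  proof -
    have "exp (- X / 2) * exp (X / 4) = exp (- X / 4)" by (simp add: exp_add[symmetric])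
    then show ?thesis unfolding M1_def M3_def by (simp add: algebra_simps)
  qed
  also have "\<dots> <= B * (sqrt L * E * exp (- X / 8) + 2 * sqrt T0 * (o' * exp (X / 4)) + 4 * sqrt L * (E * exp (- X / 8)) + 4 * sqrt L * (o' * exp (X / 4)))"
    using X0 B0 E0 o(2) L by (intro mult_left_mono add_mono mult_mono order_refl) auto
  also have "\<dots> <= B * (5 * sqrt L + 2 * sqrt T0) * (exp (- X / 8) * E + exp (X / 4) * o')"
  proof -
    have "0 <= sqrt L * (o' * exp (X / 4)) + 2 * sqrt T0 * (E * exp (- X / 8))" using E0 o(2) L T by auto
    then have "sqrt L * E * exp (- X / 8) + 2 * sqrt T0 * (o' * exp (X / 4)) + 4 * sqrt L * (E * exp (- X / 8)) + 4 * sqrt L * (o' * exp (X / 4))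
       <= (5 * sqrt L + 2 * sqrt T0) * (exp (- X / 8) * E + exp (X / 4) * o')" by (simp add: algebra_simps)
    then show ?thesis using mult_left_mono[OF _ B0] by (simp only: mult.assoc)
  qed
  finally show ?thesis unfolding q_def B_def .
qed

lemma sqrt_add_le: "0 <= a ==> 0 <= b ==> x\<^sup>2 <= a\<^sup>2 + b\<^sup>2 ==> x <= a + (b::real)"
  by (rule power2_le_imp_le) (auto simp: power2_sum intro: order_trans)

section \<open>The observability inequality\<close>

context noncritical
begin

text \<open>At one well chosen time the state splits at frequency y^3. High modes are a fraction of
  the slope, low modes are bounded by \<open>low_pair\<close>. Every term containing the initial
  norm \<open>E\<close> gets a coefficient small enough to be absorbed, and what remains is the
  observation times e^X with X = k^3 / sqrt T.\<close>

theorem observability: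
  assumes "T0 > 0"
  obtains C c where "C > 0" "c > 0" "!!T p p1 p2 p3. 0 < T ==> T < T0 ==> kdv0 T L p p1 p2 p3 ==>
     nmL (p 0) <= C * exp (c / sqrt T) * sqrt (integral {0..T} (%r. (p1 r 0)\<^sup>2 + (p1 r L)\<^sup>2))"
proof -
  obtain C1 where C1: "C1 >= 0" "!!\<epsilon> n e m j f. eigfam \<epsilon> n e m ==> \<epsilon> > 0 ==> j < n ==> f \<in> l2 (leb L) ==>
     \<bar>ipL f (e j)\<bar> <= C1 * (1 + 1 / m j)\<^sup>2 * norm (pair L f (\<i> * of_real (1 / m j)))"
    using eig_pair by blast
  obtain KH where KH: "KH >= 0" "!!\<epsilon> n e m f f1. 0 < \<epsilon> ==> \<epsilon> <= 1 ==> eigfam \<epsilon> n e m ==>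
     (!!h. contL h ==> (!!j. j < n ==> ipL h (e j) = 0) ==> nmL (G0 h) <= \<epsilon> * nmL h) ==>
     (!!x. x \<in> {0..L} ==> (f has_real_derivative f1 x) (at x within {0..L})) ==> contL f1 ==> f 0 = 0 ==> f L = 0 ==>
     nmL f <= sqrt (\<Sum>j<n. (ipL f (e j))\<^sup>2) + KH * root 3 \<epsilon> * nmL f1"
    using high_modes by blast
  define N0 where "N0 = sqrt L * (6 * CG)"
  define C3 where "C3 = 5 * sqrt L + 2 * sqrt T0"
  \<comment> \<open>Collects 36 from \<open>Wbound\<close>, 4 from (2 y^3)^2 and 9^9 from y^9 <= 9^9
    e^y. The power y^9 combines y^6 from the weights of the coefficients and y^3 from the square
    root of the number of modes.\<close>
  define C7 where "C7 = 144 * 9 ^ 9 * N0 * C1 * C3"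
  have N0: "N0 >= 0" "C3 >= 0" using L_pos CG_nonneg assms by (simp_all add: N0_def C3_def)
  then have C7: "C7 >= 0" unfolding C7_def using C1(1) by simp
  \<comment> \<open>One entry per demand: \<open>sqrt T0\<close> gives y >= 1; the entry with
    \<open>KH\<close> makes the high modes at most a quarter; \<open>16 * (6 * L + 2)\<close> keeps
    the growth of \<open>Wk\<close> below e^(X/16); the last entry gives
    \<open>64 * C7 <= X\<close>, so that e^(-X/16) beats the prefactor.\<close>
  define k where "k = Max {1, sqrt T0, 4 * KH * sqrt (T0 + 2 * L), 16 * (6 * L + 2), 64 * sqrt T0 * C7}"
  have k: "1 <= k" "sqrt T0 <= k" "4 * KH * sqrt (T0 + 2 * L) <= k" "16 * (6 * L + 2) <= k" "64 * sqrt T0 * C7 <= k"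
    unfolding k_def by (rule Max_ge; simp)+
  have main: "nmL (p 0) <= (2 * C7 + 3) * exp (k ^ 3 / sqrt T) * sqrt (integral {0..T} (%r. (p1 r 0)\<^sup>2 + (p1 r L)\<^sup>2))"
    if T: "0 < T" "T < T0" and p: "kdv0 T L p p1 p2 p3" for T p p1 p2 p3
  proof -
    define Q where "Q = integral {0..T} (%r. (p1 r 0)\<^sup>2 + (p1 r L)\<^sup>2)"
    note c = kdv_trace_cont[OF p L_pos]
    have Q0: "Q >= 0" unfolding Q_def by (rule integral_nonneg) (auto intro!: integrable_continuous_real continuous_intros c)
    define o' where "o' = sqrt Q"
    have o: "o' >= 0" "o'\<^sup>2 = Q" using Q0 by (simp_all add: o'_def)
    define E where "E = nmL (p 0)"
    have E0: "E >= 0" by (simp add: E_def)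
    define \<sigma> where "\<sigma> = sqrt T"
    have \<sigma>: "\<sigma> > 0" "\<sigma>\<^sup>2 = T" "\<sigma> <= sqrt T0" using T by (simp_all add: \<sigma>_def)
    define y where "y = k / \<sigma>"
    have y: "y >= 1" unfolding y_def using \<sigma> k by (simp add: le_divide_eq)
    define X where "X = y ^ 3 * T"
    have Xk: "X = k ^ 3 / \<sigma>" unfolding X_def y_def \<sigma>(2)[symmetric] using \<sigma>(1) by (simp add: field_simps power2_eq_square power3_eq_cube)
    have Xy: "X = k\<^sup>2 * y" unfolding Xk y_def by (simp add: power2_eq_square power3_eq_cube)
    have X0: "X > 0" unfolding X_def using y T by simp
    obtain \<tau> where \<tau>: "T / 2 <= \<tau>" "\<tau> <= T" "(nmL (p1 \<tau>))\<^sup>2 <= (T + 2 * L) / T * (E\<^sup>2 + Q)"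
      using kato_time(2)[OF p T(1) Q_def E_def] by auto
    have \<tau>0: "\<tau> \<in> {0..T}" using \<tau> T by auto
    have en: "\<bar>(nmL (p \<tau>))\<^sup>2 - E\<^sup>2\<bar> <= Q" by (rule kato_time(1)[OF p T(1) Q_def E_def \<tau>0])
    define f where "f = p \<tau>"
    have Ef: "E <= nmL f + o'" "nmL f <= E + o'"
    proof -
      have "E\<^sup>2 <= (nmL (p \<tau>))\<^sup>2 + o'\<^sup>2" "(nmL (p \<tau>))\<^sup>2 <= E\<^sup>2 + o'\<^sup>2" using en o(2) by linarith+
      then show "E <= nmL f + o'" "nmL f <= E + o'"
        unfolding f_def using sqrt_add_le[OF nm_nonneg o(1)] sqrt_add_le[OF E0 o(1)] by blast+
    qed
    have f1: "nmL (p1 \<tau>) <= sqrt (T0 + 2 * L) / \<sigma> * (E + o')"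
    proof (rule power2_le_imp_le)
      have "(T + 2 * L) / T * (E\<^sup>2 + Q) <= (T0 + 2 * L) / T * (E + o')\<^sup>2"
      proof (intro mult_mono divide_right_mono)
        have "0 <= 2 * E * o'" using E0 o by simp
        then show "E\<^sup>2 + Q <= (E + o')\<^sup>2" unfolding power2_sum using o(2) by linarith
      qed (use T L_pos Q0 in auto)
      also have "\<dots> = (sqrt (T0 + 2 * L) / \<sigma> * (E + o'))\<^sup>2"
        using T L_pos \<sigma>(2) by (simp add: power_mult_distrib power_divide)
      finally show "(nmL (p1 \<tau>))\<^sup>2 <= (sqrt (T0 + 2 * L) / \<sigma> * (E + o'))\<^sup>2" using \<tau>(3) by linarith
    qed (use E0 o \<sigma> T L_pos in auto)
    \<comment> \<open>Cut-off at frequency y^3. Its cube root is \<sigma> / k, which cancels the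
      factor 1 / \<sigma> that Kato smoothing costs and leaves the free small factor 1 / k.\<close>
    define \<epsilon> where "\<epsilon> = 1 / y ^ 3"
    have eps: "0 < \<epsilon>" "\<epsilon> <= 1" unfolding \<epsilon>_def using y by auto
    have re: "root 3 \<epsilon> = \<sigma> / k"
    proof -
      have "\<epsilon> = (\<sigma> / k) ^ 3" unfolding \<epsilon>_def y_def by (simp add: power_divide)
      then show ?thesis using \<sigma> k(1) by (simp add: real_root_power_cancel)
    qed
    obtain n e m where fam: "eigfam \<epsilon> n e m"
      and comp: "!!h. contL h ==> (!!j. j < n ==> ipL h (e j) = 0) ==> nmL (G0 h) <= \<epsilon> * nmL h"
      using spectral[OF eps(1)] by blast
    define S where "S = (\<Sum>j<n. (ipL f (e j))\<^sup>2)"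
    have pS: "kdv T L (%t x. 0) p p1 p2 p3" using p .
    have "nmL f <= sqrt S + KH * root 3 \<epsilon> * nmL (p1 \<tau>)"
      unfolding S_def f_def
      by (rule KH(2)[OF eps fam comp])
         (use c3_deriv[OF kdv_c3[OF pS \<tau>0]] kdv_cont[OF pS \<tau>0] kdv_bdry[OF pS \<tau>0] in \<open>simp_all\<close>)
    also have "KH * root 3 \<epsilon> * nmL (p1 \<tau>) <= KH * (\<sigma> / k) * (sqrt (T0 + 2 * L) / \<sigma> * (E + o'))"
      unfolding re using KH(1) \<sigma> k(1) by (intro mult_left_mono f1) auto
    also have "\<dots> = (KH * sqrt (T0 + 2 * L) / k) * (E + o')" using \<sigma>(1) by simp
    also have "\<dots> <= (1 / 4) * (E + o')"
      using k(1,3) E0 o by (intro mult_right_mono) (auto simp: divide_le_eq)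
    finally have nf: "nmL f <= sqrt S + (E + o') / 4" by simp
    define P where "P = 36 * exp ((6 * L + 1) * y) * C3 * (exp (- X / 8) * E + exp (X / 4) * o')"
    have P0: "P >= 0" unfolding P_def using N0(2) E0 o by simp
    have y3: "y ^ 3 >= 1" using y by simp
    have each: "\<bar>ipL f (e j)\<bar> <= C1 * (4 * (y ^ 3)\<^sup>2) * P" if j: "j < n" for j
    proof -
      have m: "m j >= \<epsilon>" using eigfamD(2)[OF fam j] .
      then have mi: "1 / m j <= y ^ 3" "0 < m j"
        using frac_le[of 1 1 \<epsilon> "m j"] eps by (simp add: \<epsilon>_def, linarith)
      have "norm (pair L f (\<i> * of_real (1 / m j))) <= P"
        unfolding P_def C3_def f_def
        by (rule low_pair[OF p L_pos y T \<tau>(1,2) _ o'_def[unfolded Q_def] o(1) E_def _ X_def])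
           (use mi Ef(2) in \<open>auto simp: f_def\<close>)
      moreover have "(1 + 1 / m j)\<^sup>2 <= (2 * y ^ 3)\<^sup>2" using mi y3 by (intro power_mono) auto
      ultimately have "C1 * (1 + 1 / m j)\<^sup>2 * norm (pair L f (\<i> * of_real (1 / m j))) <= C1 * (2 * y ^ 3)\<^sup>2 * P"
        using C1(1) P0 by (intro mult_mono) auto
      moreover have "f \<in> l2 (leb L)" unfolding f_def by (rule cont_l2[OF kdv_cont(2)[OF p \<tau>0]])
      ultimately show ?thesis using C1(2)[OF fam eps(1) j, of f] by (simp add: power_mult_distrib)
    qed
    have "sqrt S <= sqrt (\<Sum>j<n. (C1 * (4 * (y ^ 3)\<^sup>2) * P)\<^sup>2)"
      unfolding S_def using each by (intro real_sqrt_le_mono sum_mono abs_le_square_iff[THEN iffD1]) (metis abs_ge_self lessThan_iff order_trans)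
    also have "\<dots> = sqrt n * (C1 * (4 * (y ^ 3)\<^sup>2) * P)" using C1(1) P0 by (simp add: real_sqrt_mult)
    also have "\<dots> <= (N0 * y ^ 3) * (C1 * (4 * (y ^ 3)\<^sup>2) * P)"
    proof (rule mult_right_mono)
      have "real n * \<epsilon>\<^sup>2 <= L * (6 * CG)\<^sup>2" by (rule eig_count[OF fam eps(1)])
      then have "real n * \<epsilon>\<^sup>2 * (y ^ 3)\<^sup>2 <= L * (6 * CG)\<^sup>2 * (y ^ 3)\<^sup>2" by (rule mult_right_mono) simp
      moreover have "\<epsilon>\<^sup>2 * (y ^ 3)\<^sup>2 = 1" using y by (simp add: \<epsilon>_def power_divide)
      ultimately have "real n <= L * (6 * CG)\<^sup>2 * (y ^ 3)\<^sup>2" by (simp only: mult.assoc mult_1_right)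
      then have "sqrt n <= sqrt (L * (6 * CG)\<^sup>2 * (y ^ 3)\<^sup>2)" by (rule real_sqrt_le_mono)
      then show "sqrt n <= N0 * y ^ 3" using y CG_nonneg real_sqrt_unique[of "y ^ 3" "y ^ 6"] by (simp add: real_sqrt_mult N0_def)
    qed (use C1(1) P0 in auto)
    also have "\<dots> = (4 * N0 * C1 * y ^ 9) * P"
      by (simp add: power_mult[symmetric] power_add[symmetric] mult_ac)
    also have "\<dots> <= (4 * N0 * C1 * (9 ^ 9 * exp y)) * P"
    proof (intro mult_right_mono mult_left_mono)
      have "(y / 9) ^ 9 <= exp (y / 9) ^ 9" using y by (intro power_mono exp_ge_self) auto
      also have "\<dots> = exp y" by (simp add: exp_of_nat_mult[symmetric])
      finally show "y ^ 9 <= 9 ^ 9 * exp y" by (simp add: power_divide field_simps)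
    qed (use P0 N0 C1(1) in auto)
    also have "\<dots> = C7 * exp ((6 * L + 2) * y) * (exp (- X / 8) * E + exp (X / 4) * o')"
    proof -
      have "exp ((6 * L + 2) * y) = exp y * exp ((6 * L + 1) * y)" by (simp add: exp_add[symmetric] algebra_simps)
      then show ?thesis unfolding P_def C7_def by (simp add: mult_ac)
    qed
    also have "\<dots> <= C7 * exp (X / 16) * (exp (- X / 8) * E + exp (X / 4) * o')"
    proof -
      have "(6 * L + 2) * y <= (k / 16) * y" using k(4) y by (intro mult_right_mono) auto
      also have "\<dots> <= (k\<^sup>2 / 16) * y" using k(1) y by (intro mult_right_mono) (auto simp: power2_eq_square)
      finally have "(6 * L + 2) * y <= X / 16" by (simp add: Xy)
      then show ?thesis using C7 E0 o by (intro mult_right_mono mult_left_mono) auto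
    qed
    also have "\<dots> = C7 * exp (- X / 16) * E + C7 * exp (X * (5/16)) * o'"
    proof -
      have a: "exp (X / 16) * exp (- X / 8) = exp (- X / 16)" "exp (X / 16) * exp (X / 4) = exp (X * (5 / 16))"
        by (simp_all add: exp_add[symmetric])
      show ?thesis unfolding a[symmetric] by (simp add: algebra_simps)
    qed
    also have "\<dots> <= E / 4 + C7 * exp X * o'"
    \<comment> \<open>Together with the quarter from the high modes this leaves half of
      \<open>E\<close> on the left-hand side.\<close>
    proof (rule add_mono)
      have "64 * C7 * \<sigma> <= 64 * C7 * sqrt T0" using \<sigma>(3) C7 by (intro mult_left_mono) auto
      also have "\<dots> <= k" using k(5) by (simp add: mult_ac)
      also have "\<dots> <= k ^ 3" using k(1) power_increasing[of 1 3 k] by simp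
      finally have X64: "64 * C7 <= X" unfolding Xk using \<sigma>(1) by (simp add: le_divide_eq)
      have "C7 <= exp (X / 16) / 4" using X64 exp_ge_self[of "X / 16"] by linarith
      then have "C7 * exp (- X / 16) <= exp (X / 16) / 4 * exp (- X / 16)" by (intro mult_right_mono) auto
      also have "\<dots> = 1 / 4" by (simp add: exp_minus)
      finally have "C7 * exp (- X / 16) * E <= 1 / 4 * E" using E0 by (intro mult_right_mono)
      then show "C7 * exp (- X / 16) * E <= E / 4" by simp
      show "C7 * exp (X * (5/16)) * o' <= C7 * exp X * o'"
        using X0 C7 o by (intro mult_right_mono mult_left_mono) auto
    qed
    finally have "sqrt S <= E / 4 + C7 * exp X * o'" .
    then have "E <= 2 * C7 * (exp X * o') + 5 / 2 * o'" using nf Ef(1) by (simp add: field_simps)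
    also have "\<dots> <= (2 * C7 + 3) * exp X * o'"
    proof -
      have "1 * o' <= exp X * o'" using X0 o by (intro mult_right_mono) auto
      then show ?thesis using o by (simp add: algebra_simps)
    qed
    finally show ?thesis unfolding E_def o'_def Q_def Xk \<sigma>_def .
  qed
  show ?thesis by (rule that[of "2 * C7 + 3" "k ^ 3"]) (use main C7 k(1) in auto)
qed

end

section \<open>Completeness of the pairings\<close>

lemma zero_of_le_eps:
  fixes a :: real
  assumes "!!e. e > 0 ==> \<bar>a\<bar> <= e * K"
  shows "a = 0"
proof (rule ccontr)
  assume "a ~= 0"
  define e where "e = \<bar>a\<bar> / (2 * (\<bar>K\<bar> + 1))"
  have e: "e > 0" using \<open>a ~= 0\<close> by (simp add: e_def)
  have "e * (2 * (\<bar>K\<bar> + 1)) = \<bar>a\<bar>" using nonzero_eq_divide_eq[of "2 * (\<bar>K\<bar> + 1)" e "\<bar>a\<bar>"] e_def by auto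
  then have "2 * (e * \<bar>K\<bar>) + 2 * e = \<bar>a\<bar>" by (simp add: algebra_simps)
  moreover have "e * K <= e * \<bar>K\<bar>" using e by (intro mult_left_mono) auto
  moreover have "e * \<bar>K\<bar> >= 0" using e by simp
  ultimately show False using assms[OF e] e by linarith
qed

lemma l2_mult_cont:
  assumes "f \<in> l2 (leb L)" "continuous_on {0..L} h"
  shows "(%x. f x * h x) \<in> l2 (leb L)"
proof -
  obtain B where B: "!!x. x \<in> {0..L} ==> \<bar>h x\<bar> <= B"
    using compact_imp_bounded[OF compact_continuous_image[OF assms(2) compact_Icc]] unfolding bounded_iff by (metis imageI real_norm_def)
  have m: "f \<in> borel_measurable (leb L)" "h \<in> borel_measurable (leb L)"
    using l2_meas[OF assms(1)] l2_meas[OF cont_l2[OF assms(2)]] by auto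
  have "integrable (leb L) (%x. (f x * h x)\<^sup>2)"
  proof (rule Bochner_Integration.integrable_bound)
    show "integrable (leb L) (%x. B\<^sup>2 * (f x)\<^sup>2)" using assms(1) by (simp add: l2_def)
    show "(%x. (f x * h x)\<^sup>2) \<in> borel_measurable (leb L)" using m by measurable
    have "(f x * h x)\<^sup>2 <= B\<^sup>2 * (f x)\<^sup>2" if "x \<in> {0..L}" for x
    proof -
      have "(h x)\<^sup>2 <= B\<^sup>2" using B[OF that] by (metis abs_ge_zero power2_abs power_mono)
      then show ?thesis unfolding power_mult_distrib by (metis mult.commute mult_left_mono zero_le_power2)
    qed
    then show "AE x in leb L. norm ((f x * h x)\<^sup>2) <= norm (B\<^sup>2 * (f x)\<^sup>2)" by (intro AE_I2) simp
  qed
  then show ?thesis using m by (simp add: l2_def)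
qed

lemma ip_poly_zero:
  assumes f: "f \<in> l2 (leb L)" and mom: "!!k. ip (leb L) f (%x. x ^ k) = 0"
    and h: "continuous_on {0..L} h" and L: "L >= 0"
  shows "ip (leb L) f h = 0"
proof -
  have "\<bar>ip (leb L) f h\<bar> <= (nm (leb L) f * sqrt L) * e" if e: "e > 0" for e
  proof -
    obtain g where g: "real_polynomial_function g" "!!x. x \<in> {0..L} ==> \<bar>h x - g x\<bar> < e"
      using Stone_Weierstrass_real_polynomial_function[OF compact_Icc h e] by blast
    then obtain a n where a: "g = (%x. \<Sum>i\<le>n. a i * x ^ i)" unfolding real_polynomial_function_iff_sum by blast
    have gc: "continuous_on {0..L} g" unfolding a by (intro continuous_intros)
    have "ip (leb L) g f = (\<Sum>i<Suc n. a i * ip (leb L) (%x. x ^ i) f)"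
      unfolding a lessThan_Suc_atMost[symmetric] by (rule ip_sum_left[OF _ f]) (auto intro!: cont_l2 continuous_intros)
    also have "\<dots> = 0" using mom by (simp add: ip_commute[of _ _ f])
    finally have "ip (leb L) f h = ip (leb L) (%x. h x - g x) f"
      using ip_diff_left[OF cont_l2[OF h] cont_l2[OF gc] f] by (simp add: ip_commute)
    also have "\<bar>\<dots>\<bar> <= nm (leb L) (%x. h x - g x) * nm (leb L) f" by (rule ip_le_nm) (auto intro: f cont_l2 gc h)
    also have "\<dots> <= (sqrt L * e) * nm (leb L) f"
      by (intro mult_right_mono nm_le_sup[OF _ _ L]) (use g(2) in \<open>auto intro!: continuous_intros gc h less_imp_le\<close>)
    finally show ?thesis by (simp add: mult_ac)
  qed
  then show ?thesis using zero_of_le_eps[of "ip (leb L) f h" "nm (leb L) f * sqrt L"] by (simp add: mult.commute)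
qed

text \<open>The choice h = f would give the claim, but \<open>f\<close> is neither continuous nor
  bounded. A bounded truncation of \<open>f\<close> is an almost everywhere limit of bounded
  continuous functions, and dominated convergence carries the orthogonality over. The weight
  \<open>q\<close> admits test classes that degenerate at the ends.\<close>

lemma AE_zero_of_cont:
  assumes f: "f \<in> l2 (leb L)" and q: "!!x. x \<in> {0<..<L} ==> q x >= 0" "continuous_on {0..L} q"
    and z: "!!h. continuous_on {0..L} h ==> ip (leb L) f (%x. q x * h x) = 0"
  shows "AE x in leb L. q x ~= 0 --> f x = 0"
proof -
  have [measurable]: "f \<in> borel_measurable (leb L)" "q \<in> borel_measurable (leb L)" by (rule l2_meas[OF f], rule l2_meas[OF cont_l2[OF q(2)]])
  have "f measurable_on {0<..<L}" by (subst measurable_on_iff_borel_measurable) auto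
  then obtain N g where g: "negligible N" "!!n. continuous_on UNIV (g n)"
    "!!x. x \<notin> N ==> (%n. g n x) \<longlonglongrightarrow> (if x \<in> {0<..<L} then f x else 0)"
    unfolding measurable_on_def by blast
  \<comment> \<open>Truncation to [-1,1]: bounded, continuous, of the sign of y and zero only at 0,
    so a vanishing integral of \<open>q * f * cl f\<close> forces f = 0 where q is positive.\<close>
  define cl where "cl y = max (-1) (min 1 y)" for y :: real
  have clc: "continuous_on UNIV cl" unfolding cl_def[abs_def] by (intro continuous_intros)
  have hc: "continuous_on A (%x. cl (g n x))" for n A
    by (rule continuous_on_compose2[OF clc continuous_on_subset[OF g(2)]]) auto
  have fq: "(%x. f x * q x) \<in> l2 (leb L)" by (rule l2_mult_cont[OF f q(2)])
  have fqi: "integrable (leb L) (%x. f x * q x)" by (rule l2_leb_integrable[OF fq])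
  have clb: "\<bar>cl y\<bar> <= 1" for y by (auto simp: cl_def)
  have [measurable]: "cl \<in> borel_measurable borel" using clc by (rule borel_measurable_continuous_onI)
  have m: "(%x. cl (g n x)) \<in> borel_measurable (leb L)" for n by (rule l2_meas[OF cont_l2[OF hc]])
  have bb: "norm ((f x * q x) * cl y) <= norm (f x * q x)" for x y
    using mult_left_mono[OF clb[of y] abs_ge_zero[of "f x * q x"]] by (simp add: abs_mult mult.assoc)
  have AEN: "AE x in leb L. x \<notin> N"
  proof -
    have "N \<in> null_sets lebesgue" using g(1) negligible_iff_null_sets by blast
    then have "AE x in lebesgue. x \<notin> N" by (rule AE_not_in)
    then show ?thesis by (subst AE_restrict_space_iff) (auto elim: eventually_mono)
  qed
  have "(%n. LINT x|leb L. (f x * q x) * cl (g n x)) \<longlonglongrightarrow> (LINT x|leb L. (f x * q x) * cl (f x))"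
  proof (rule integral_dominated_convergence[where w = "%x. norm (f x * q x)"])
    show "AE x in leb L. (%n. (f x * q x) * cl (g n x)) \<longlonglongrightarrow> (f x * q x) * cl (f x)"
      using AEN AE_space
    proof eventually_elim
      case (elim x)
      then have "(%n. g n x) \<longlonglongrightarrow> f x" using g(3)[of x] by simp
      moreover have "isCont cl (f x)" using clc by (simp add: continuous_on_eq_continuous_at)
      ultimately have "(%n. cl (g n x)) \<longlonglongrightarrow> cl (f x)" by (rule isCont_tendsto_compose[rotated])
      then show ?case by (intro tendsto_intros)
    qed
  qed (use fqi m bb in \<open>auto intro!: AE_I2\<close>)
  moreover have "(LINT x|leb L. (f x * q x) * cl (g n x)) = 0" for n
    using z[OF hc] unfolding ip_def by (simp add: mult.assoc)
  ultimately have z0: "(LINT x|leb L. (f x * q x) * cl (f x)) = 0" using LIMSEQ_unique[OF tendsto_const] by force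
  have "integrable (leb L) (%x. (f x * q x) * cl (f x))"
    by (rule Bochner_Integration.integrable_bound[OF fqi]) (use bb in auto)
  moreover have ylc: "y * cl y >= 0" "y * cl y = 0 ==> y = 0" for y
    by (auto simp: cl_def min_def max_def split: if_splits)
  have "AE x in leb L. 0 <= (f x * q x) * cl (f x)"
  proof (rule AE_I2)
    fix x assume "x \<in> space (leb L)"
    then have "q x >= 0" using q by simp
    then have "0 <= q x * (f x * cl (f x))" by (rule mult_nonneg_nonneg[OF _ ylc(1)])
    then show "0 <= (f x * q x) * cl (f x)" by (simp add: mult_ac)
  qed
  ultimately have "AE x in leb L. (f x * q x) * cl (f x) = 0" using z0 integral_nonneg_eq_0_iff_AE by blast
  then show ?thesis
  proof eventually_elim
    case (elim x)
    then show ?case using ylc(2)[of "f x"] by auto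
  qed
qed

lemma poly_dvd_pderiv:
  fixes s :: "'a :: idom poly"
  assumes "s ^ Suc n dvd f"
  shows "s ^ n dvd pderiv f"
proof -
  obtain u where u: "f = s ^ Suc n * u" using assms by (elim dvdE)
  have "pderiv f = s ^ n * (s * pderiv u + smult (of_nat (Suc n)) (pderiv s * u))"
    unfolding u pderiv_mult pderiv_power_Suc by (simp add: algebra_simps)
  then show ?thesis by simp
qed

context noncritical
begin

text \<open>The pairings at imaginary parameters make \<alpha> orthogonal to every eigenfunction,
  hence to the range of \<open>G0\<close> squared: the low part contributes nothing and the high
  part at most \<epsilon>. That range contains every polynomial divisible by a power of x (L - x),
  and such polynomials determine \<alpha>.\<close>

theorem pair_complete:
  assumes a: "\<alpha> \<in> l2 (leb L)" and z: "!!p. pair L \<alpha> p = 0"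
  shows "AE x in leb L. \<alpha> x = 0"
proof -
  obtain C where C: "C >= 0" "!!\<epsilon> n e m j f. eigfam \<epsilon> n e m ==> \<epsilon> > 0 ==> j < n ==> f \<in> l2 (leb L) ==>
     \<bar>ipL f (e j)\<bar> <= C * (1 + 1 / m j)\<^sup>2 * norm (pair L f (\<i> * of_real (1 / m j)))"
    using eig_pair by blast
  have GG: "ipL \<alpha> (G0 (G0 h)) = 0" if h: "contL h" for h
  proof -
    have "\<bar>ipL \<alpha> (G0 (G0 h))\<bar> <= \<epsilon> * (nmL \<alpha> * (KG * nmL h))" if eps: "\<epsilon> > 0" for \<epsilon>
    proof -
      obtain n e m where fam: "eigfam \<epsilon> n e m"
        and comp: "!!h. contL h ==> (!!j. j < n ==> ipL h (e j) = 0) ==> nmL (G0 h) <= \<epsilon> * nmL h"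
        using spectral[OF eps] by blast
      note E = eigfamD[OF fam]
      have orth: "ipL \<alpha> (e j) = 0" if "j < n" for j using C(2)[OF fam eps that a] z by simp
      define lo where "lo x = (\<Sum>j<n. ipL h (e j) * e j x)" for x
      define hi where "hi x = h x - lo x" for x
      have loc: "contL lo" unfolding lo_def[abs_def] using E(1) by (auto intro!: continuous_intros)
      have hic: "contL hi" unfolding hi_def[abs_def] using h loc by (intro continuous_intros)
      have lo_e: "ipL lo (e k) = ipL h (e k)" if "k < n" for k
        unfolding lo_def[abs_def] by (rule orthonormal_ip) (use E that in auto)
      have hi_e: "ipL hi (e k) = 0" if "k < n" for k
        unfolding hi_def[abs_def] using ip_diff_left[OF cont_l2[OF h] cont_l2[OF loc] E(5)[OF that]] lo_e[OF that] by simp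
      have hl: "ipL lo hi = 0"
      proof -
        have "ipL lo hi = (\<Sum>j<n. ipL h (e j) * ipL (e j) hi)"
          unfolding lo_def[abs_def] by (rule ip_sum_left) (use E cont_l2[OF hic] in auto)
        also have "\<dots> = 0" by (rule sum.neutral) (use hi_e in \<open>metis ip_commute lessThan_iff mult_zero_right\<close>)
        finally show ?thesis .
      qed
      have "(nmL h)\<^sup>2 = (nmL lo)\<^sup>2 + (nmL hi)\<^sup>2"
      proof -
        have hd: "(%x. 1 * lo x + 1 * hi x) = h" by (rule ext) (simp add: hi_def)
        show ?thesis using nm_lin_sq[OF cont_l2[OF loc] cont_l2[OF hic], of 1 1, unfolded hd] hl by simp
      qed
      then have hih: "nmL hi <= nmL h" using zero_le_power2[of "nmL lo"] by (intro power2_le_imp_le[OF _ nm_nonneg]) linarith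
      have Glo: "G0 (G0 lo) x = (\<Sum>j<n. (- (m j)\<^sup>2 * ipL h (e j)) * e j x)" if x: "x \<in> {0..L}" for x
      proof -
        have "G0 (G0 lo) x = G0 (%x. \<Sum>j<n. ipL h (e j) * G0 (e j) x) x"
        proof (rule G0_cong[OF _ _ x])
          show "contL (%x. \<Sum>j<n. ipL h (e j) * G0 (e j) x)"
            by (intro continuous_intros G0_cont E) auto
          show "!!x. x \<in> {0..L} ==> (\<Sum>j<n. ipL h (e j) * G0 (e j) x) = G0 lo x"
            unfolding lo_def[abs_def] by (rule G0_sum[symmetric]) (use E in auto)
        qed
        also have "\<dots> = (\<Sum>j<n. ipL h (e j) * G0 (G0 (e j)) x)" by (rule G0_sum) (use E x in auto)
        also have "\<dots> = (\<Sum>j<n. (- (m j)\<^sup>2 * ipL h (e j)) * e j x)"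
          by (rule sum.cong) (use E(3) x in auto)
        finally show ?thesis .
      qed
      have "ipL (G0 (G0 lo)) \<alpha> = ipL (%x. \<Sum>j<n. (- (m j)\<^sup>2 * ipL h (e j)) * e j x) \<alpha>"
        by (rule ip_cong_on) (use Glo in auto)
      also have "\<dots> = (\<Sum>j<n. (- (m j)\<^sup>2 * ipL h (e j)) * ipL (e j) \<alpha>)" by (rule ip_sum_left) (use E a in auto)
      also have "\<dots> = 0" using orth by (intro sum.neutral) (auto simp: ip_commute)
      finally have lo0: "ipL (G0 (G0 lo)) \<alpha> = 0" .
      have Gd: "G0 (G0 h) x = 1 * G0 (G0 lo) x + 1 * G0 (G0 hi) x" if x: "x \<in> {0..L}" for x
      proof -
        have "G0 (G0 h) x = G0 (%x. 1 * G0 lo x + 1 * G0 hi x) x"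
        proof (rule G0_cong[OF _ _ x])
          show "contL (%x. 1 * G0 lo x + 1 * G0 hi x)" by (intro continuous_intros G0_cont loc hic)
          fix y assume y: "y \<in> {0..L}"
          have "G0 h = G0 (%x. 1 * lo x + 1 * hi x)" by (simp add: hi_def)
          then show "1 * G0 lo y + 1 * G0 hi y = G0 h y" using G0_lin[OF loc hic y, of 1 1] by simp
        qed
        also have "\<dots> = 1 * G0 (G0 lo) x + 1 * G0 (G0 hi) x" by (rule G0_lin[OF G0_cont[OF loc] G0_cont[OF hic] x])
        finally show ?thesis .
      qed
      note gl = cont_l2[OF G0_cont[OF G0_cont[OF loc]]] and gh = cont_l2[OF G0_cont[OF G0_cont[OF hic]]]
      have "ipL (G0 (G0 h)) \<alpha> = ipL (%x. 1 * G0 (G0 lo) x + 1 * G0 (G0 hi) x) \<alpha>" by (rule ip_cong_on) (use Gd in auto)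
      also have "\<dots> = ipL (G0 (G0 hi)) \<alpha>" using ip_lin_left[OF gl gh a, of 1 1] lo0 by simp
      also have "\<bar>\<dots>\<bar> <= nmL (G0 (G0 hi)) * nmL \<alpha>" by (rule ip_le_nm[OF gh a])
      also have "\<dots> <= (KG * (\<epsilon> * nmL h)) * nmL \<alpha>"
      proof (rule mult_right_mono)
        have "nmL (G0 (G0 hi)) <= KG * nmL (G0 hi)" by (rule nm_G0[OF G0_cont[OF hic]])
        also have "\<dots> <= KG * (\<epsilon> * nmL h)"
          using order_trans[OF comp[OF hic hi_e] mult_left_mono[OF hih less_imp_le[OF eps]]] KG_nonneg by (intro mult_left_mono)
        finally show "nmL (G0 (G0 hi)) <= KG * (\<epsilon> * nmL h)" .
      qed simp
      finally show ?thesis by (simp add: ip_commute mult_ac)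
    qed
    then show ?thesis by (rule zero_of_le_eps)
  qed
  \<comment> \<open>The exponent 6 pays for two applications of the third-order operator: three
    derivatives reduce s^6 to s^3, so both the polynomial and its first image, together with their
    slopes, still vanish at 0 and L and qualify for \<open>G_unique\<close>.\<close>
  define s :: "real poly" where "s = [:0, L, -1:]"
  have s0: "poly s 0 = 0" "poly s L = 0" by (simp_all add: s_def algebra_simps)
  have vz: "poly f 0 = 0 & poly f L = 0" if "s ^ Suc n dvd f" for f n
  proof -
    obtain u where "f = s ^ Suc n * u" using \<open>s ^ Suc n dvd f\<close> by (elim dvdE)
    then show ?thesis using s0 by simp
  qed
  have mom: "ipL \<alpha> (poly (r * s ^ 6)) = 0" for r
  proof -
    define w where "w = r * s ^ 6"
    define v where "v = pderiv (pderiv (pderiv w)) + pderiv w"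
    define h where "h = pderiv (pderiv (pderiv v)) + pderiv v"
    have d: "s ^ 6 dvd w" "s ^ 5 dvd pderiv w" "s ^ 4 dvd pderiv (pderiv w)" "s ^ 3 dvd pderiv (pderiv (pderiv w))"
      using poly_dvd_pderiv[of s 5 w] poly_dvd_pderiv[of s 4 "pderiv w"] poly_dvd_pderiv[of s 3 "pderiv (pderiv w)"]
      by (auto simp: w_def eval_nat_numeral)
    have "s ^ 3 dvd pderiv w" using d(2) by (rule dvd_trans[rotated]) (simp add: le_imp_power_dvd)
    then have dv: "s ^ 3 dvd v" unfolding v_def using d(4) by (rule dvd_add[rotated])
    then have dv1: "s ^ 2 dvd pderiv v" using poly_dvd_pderiv[of s 2 v] by (simp add: eval_nat_numeral)
    have c3p: "c3 L (poly f) (poly (pderiv f)) (poly (pderiv (pderiv f))) (poly (pderiv (pderiv (pderiv f))))" for f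
      unfolding c3_def by (auto intro!: continuous_intros DERIV_subset[OF poly_DERIV])
    have wG: "poly w x = G0 (poly v) x" if "x \<in> {0..L}" for x
      by (rule G_unique[OF c3p]) (use that vz[of 5 w] vz[of 4 "pderiv w"] d in \<open>auto simp: v_def eval_nat_numeral\<close>)
    have vG: "poly v x = G0 (poly h) x" if "x \<in> {0..L}" for x
      by (rule G_unique[OF c3p]) (use that vz[of 2 v] vz[of 1 "pderiv v"] dv dv1 in \<open>auto simp: h_def eval_nat_numeral\<close>)
    have hc: "contL (poly h)" by (intro continuous_intros)
    have "ipL \<alpha> (poly w) = ipL \<alpha> (G0 (G0 (poly h)))"
    proof (rule ip_cong_on)
      fix x assume x: "x \<in> {0..L}"
      have "G0 (poly v) x = G0 (G0 (poly h)) x"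
        by (rule G0_cong[OF G0_cont[OF hc] _ x]) (use vG in auto)
      then show "poly w x = G0 (G0 (poly h)) x" using wG[OF x] by simp
    qed simp
    then show ?thesis using GG[OF hc] by (simp add: w_def)
  qed
  have sp: "0 < poly (s ^ 6) x" if "x \<in> {0<..<L}" for x
  proof -
    have "poly s x > 0" using that by (simp add: s_def algebra_simps)
    then show ?thesis by (simp add: poly_power)
  qed
  have "AE x in leb L. poly (s ^ 6) x ~= 0 --> \<alpha> x = 0"
  proof (rule AE_zero_of_cont[OF a, of "poly (s ^ 6)"])
    show "!!x. x \<in> {0<..<L} ==> 0 <= poly (s ^ 6) x" using sp by (simp add: less_imp_le)
    show c: "contL (poly (s ^ 6))" by (intro continuous_intros)
    fix h :: "real => real" assume h: "contL h"
    have "ipL (%x. \<alpha> x * poly (s ^ 6) x) h = 0"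
    proof (rule ip_poly_zero[OF l2_mult_cont[OF a c] _ h])
      fix k
      show "ipL (%x. \<alpha> x * poly (s ^ 6) x) (%x. x ^ k) = 0"
        using mom[of "monom 1 k"] by (simp add: ip_def poly_monom mult_ac)
    qed (use L_pos in simp)
    then show "ipL \<alpha> (%x. poly (s ^ 6) x * h x) = 0" by (simp add: ip_def mult_ac)
  qed
  then show ?thesis using AE_space
  proof eventually_elim
    case (elim x)
    then show ?case using sp[of x] by simp
  qed
qed

end

section \<open>Density of the traces\<close>

lemma nm_norm_sq: "continuous_on {0..L} z ==> (nm (leb L) (%x. norm (z x :: complex)))\<^sup>2 = integral {0..L} (%x. (norm (z x))\<^sup>2)"
  unfolding nm_sq by (subst ip_cont) (auto intro!: continuous_intros simp: power2_eq_square)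

lemma deriv_of_zero:
  assumes "(f has_vector_derivative d) (at x within {0..L})" "!!x. x \<in> {0..L} ==> f x = 0" "x \<in> {0..L}" "L > (0::real)"
  shows "d = 0"
proof -
  have "((%_. 0) has_vector_derivative d) (at x within {0..L})"
    by (rule has_vector_derivative_transform[OF assms(3) _ assms(1)]) (use assms(2) in auto)
  then show ?thesis
    using vector_derivative_unique_within_closed_interval[of 0 L x "%_. 0" d 0] assms(3,4) by (auto simp: has_vector_derivative_const)
qed

lemma gk_not_identically_zero:
  assumes "L > 0"
  obtains x where "x \<in> {0..L}" "gk 0 p x ~= 0"
proof -
  have False if z: "!!x. x \<in> {0..L} ==> gk 0 p x = 0"
  proof -
    have z1: "gk (Suc 0) p x = 0" if "x \<in> {0..L}" for x by (rule deriv_of_zero[OF gk_deriv z that assms])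
    have "gk (Suc (Suc 0)) p 0 = 0" by (rule deriv_of_zero[OF gk_deriv z1 _ assms]) (use assms in auto)
    then show False by (simp add: eval_nat_numeral)
  qed
  then show ?thesis using that by blast
qed

text \<open>If \<open>Wk L 0 p\<close> vanished identically, both \<open>gk 0 p L\<close> and
  \<open>gk 1 p L\<close> would be 0. The energy identity for \<open>gk\<close> itself then has no
  boundary terms, and Re p nonzero would force \<open>gk 0 p\<close> to vanish.\<close>

lemma Wk_nontrivial:
  assumes L: "L > 0" and p: "Re p ~= 0"
  shows "nm (leb L) (%x. norm (Wk L 0 p x)) > 0"
proof (rule ccontr)
  assume "\<not> ?thesis"
  then have n0: "nm (leb L) (%x. norm (Wk L 0 p x)) = 0" using nm_nonneg[of "leb L" "%x. norm (Wk L 0 p x)"] by linarith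
  have W0: "Wk L 0 p x = 0" if "x \<in> {0..L}" for x
  proof -
    have "norm (Wk L 0 p x) = 0"
      by (rule cont_nm_zero[where f = "%x. norm (Wk L 0 p x)", OF _ n0 L that]) (intro continuous_intros)
    then show ?thesis by simp
  qed
  have "Wk L (Suc 0) p 0 = 0" by (rule deriv_of_zero[OF Wk_deriv W0 _ L]) (use L in auto)
  then have g0: "gk 0 p L = 0" by simp
  obtain x where x: "x \<in> {0..L}" "gk 0 p x ~= 0" by (rule gk_not_identically_zero[OF L])
  have "gk 1 p L * gk 0 p x = 0" using W0[OF x(1)] g0 by (simp add: Wk_def)
  then have g1: "gk 1 p L = 0" using x(2) by simp
  have "Re p * integral {0..L} (%x. (norm (gk 0 p x))\<^sup>2) + (norm (gk 1 p 0))\<^sup>2 / 2 = (norm (gk 1 p L))\<^sup>2 / 2"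
    by (rule ode_energy) (use gk_ode[of 0 p] g0 L in \<open>auto intro: gk_deriv\<close>)
  then have "integral {0..L} (%x. (norm (gk 0 p x))\<^sup>2) = 0" using g1 p by simp
  then have "(nm (leb L) (%x. norm (gk 0 p x)))\<^sup>2 = 0" by (subst nm_norm_sq) (auto intro: continuous_intros)
  then have n1: "nm (leb L) (%x. norm (gk 0 p x)) = 0" by simp
  have "norm (gk 0 p x) = 0"
    by (rule cont_nm_zero[where f = "%x. norm (gk 0 p x)", OF _ n1 L x(1)]) (intro continuous_intros)
  then show False using x(2) by simp
qed

text \<open>The energy identity has one boundary term of each sign: in the right half plane the
  slope at L dominates the solution, in the left half plane the slope at 0, which is
  \<open>gk 0 p L\<close>. The decay in |Re p| of these quotients feeds both Liouville
  arguments.\<close>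

lemma Wk_norm_le:
  assumes "L > 0"
  shows "Re p > 0 ==> Wk L 1 p L ~= 0 & nm (leb L) (%x. norm (Wk L 0 p x)) <= norm (Wk L 1 p L) / sqrt (2 * Re p)"
    "Re p < 0 ==> gk 0 p L ~= 0 & nm (leb L) (%x. norm (Wk L 0 p x)) <= norm (gk 0 p L) / sqrt (2 * - Re p)"
proof -
  define N where "N = nm (leb L) (%x. norm (Wk L 0 p x))"
  have e: "Re p * N\<^sup>2 + (norm (gk 0 p L))\<^sup>2 / 2 = (norm (Wk L 1 p L))\<^sup>2 / 2"
    using Wk_energy[of L p] assms unfolding N_def by (subst nm_norm_sq) (auto intro: continuous_intros)
  have aux: "w ~= 0 & N <= norm w / sqrt (2 * a)" if "a > 0" "N > 0" "a * N\<^sup>2 <= (norm w)\<^sup>2 / 2" for a and w :: complex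
  proof
    have "a * N\<^sup>2 > 0" using that by simp
    then show "w ~= 0" using that(3) by auto
    have "(N * sqrt (2 * a))\<^sup>2 <= (norm w)\<^sup>2" using that(1,3) by (simp add: power_mult_distrib mult_ac)
    then have "N * sqrt (2 * a) <= norm w" by (rule power2_le_imp_le) simp
    then show "N <= norm w / sqrt (2 * a)" using that(1) by (simp add: le_divide_eq)
  qed
  show "Wk L 1 p L ~= 0 & nm (leb L) (%x. norm (Wk L 0 p x)) <= norm (Wk L 1 p L) / sqrt (2 * Re p)" if "Re p > 0"
    unfolding N_def[symmetric]
  proof (rule aux)
    show "Re p * N\<^sup>2 <= (norm (Wk L 1 p L))\<^sup>2 / 2" using e zero_le_power2[of "norm (gk 0 p L)"] by linarith
  qed (use that Wk_nontrivial[OF assms, of p] in \<open>auto simp: N_def\<close>)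
  show "gk 0 p L ~= 0 & nm (leb L) (%x. norm (Wk L 0 p x)) <= norm (gk 0 p L) / sqrt (2 * - Re p)" if "Re p < 0"
    unfolding N_def[symmetric]
  proof (rule aux)
    show "- Re p * N\<^sup>2 <= (norm (gk 0 p L))\<^sup>2 / 2" using e zero_le_power2[of "norm (Wk L 1 p L)"] by linarith
  qed (use that Wk_nontrivial[OF assms, of p] in \<open>auto simp: N_def\<close>)
qed

section \<open>Finite Laplace transforms and the orthogonality of traces\<close>

definition lap :: "real => (real => complex) => complex => complex" where
  "lap T f p = (LINT t|leb T. f t * exp (p * of_real t))"

lemma lap_integrable:
  assumes "integrable (leb T) f" "continuous_on {0..T} (h :: real => complex)"
  shows "integrable (leb T) (%t. f t * h t)"
proof -
  obtain B where B: "!!x. x \<in> {0..T} ==> norm (h x) <= B"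
    using compact_imp_bounded[OF compact_continuous_image[OF assms(2) compact_Icc]] unfolding bounded_iff by (metis imageI)
  show ?thesis
  proof (rule Bochner_Integration.integrable_bound)
    show "integrable (leb T) (%t. norm (f t) * B)" using assms(1) by simp
    show "(%t. f t * h t) \<in> borel_measurable (leb T)"
      using assms(1) leb_cont_integrable[OF assms(2)] by (intro borel_measurable_times borel_measurable_integrable)
    show "AE x in leb T. norm (f x * h x) <= norm (norm (f x) * B)"
    proof (rule AE_I2)
      fix x assume "x \<in> space (leb T)"
      then have "norm (h x) <= B" using B by simp
      then have "norm (f x) * norm (h x) <= norm (f x) * B" by (intro mult_left_mono) auto
      then show "norm (f x * h x) <= norm (norm (f x) * B)" unfolding norm_mult[of "f x"] by (simp only: real_norm_def)
    qed
  qed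
qed

lemma lap_bound:
  assumes "integrable (leb T) f" "Re p <= a" "a >= 0"
  shows "norm (lap T f p) <= (LINT t|leb T. norm (f t)) * exp (a * T)"
proof -
  have i: "integrable (leb T) (%t. f t * exp (p * of_real t))" by (rule lap_integrable[OF assms(1)]) (intro continuous_intros)
  have "norm (lap T f p) <= (LINT t|leb T. norm (f t * exp (p * of_real t)))" unfolding lap_def by simp
  also have "\<dots> <= (LINT t|leb T. norm (f t) * exp (a * T))"
  proof (rule integral_mono)
    fix t assume "t \<in> space (leb T)"
    then have t: "0 <= t" "t <= T" by auto
    have "Re p * t <= a * T" using assms t by (meson mult_left_mono mult_right_mono order_trans)
    then show "norm (f t * exp (p * of_real t)) <= norm (f t) * exp (a * T)"
      by (simp add: norm_mult norm_exp_eq_Re mult_left_mono)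
  qed (use i assms(1) in auto)
  finally show ?thesis by simp
qed

lemma lap_sums:
  assumes f: "integrable (leb T) f" and T: "T >= 0"
  shows "(%m. (LINT t|leb T. f t * of_real t ^ m) / fact m * p ^ m) sums lap T f p"
proof -
  let ?F = "%m t. f t * ((p * of_real t) ^ m /\<^sub>R fact m)"
  have s: "summable (%m. (norm p * T) ^ m /\<^sub>R fact m)" by (rule summable_exp_generic)
  have i: "integrable (leb T) (?F m)" for m by (rule lap_integrable[OF f]) (intro continuous_intros)
  have nb: "norm (?F m t) <= norm (f t) * ((norm p * T) ^ m /\<^sub>R fact m)" if "t \<in> {0<..<T}" for m t
    using that by (auto simp: norm_mult norm_power divide_inverse intro!: mult_left_mono power_mono)
  have s1: "(LINT t|leb T. (\<Sum>m. ?F m t)) = (\<Sum>m. LINT t|leb T. ?F m t)"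
    and s2: "summable (%m. LINT t|leb T. norm (?F m t))"
  proof -
    show s2: "summable (%m. LINT t|leb T. norm (?F m t))"
    proof (rule summable_comparison_test'[OF summable_mult[OF s, of "LINT t|leb T. norm (f t)"], of 0])
      fix m
      have "(LINT t|leb T. norm (?F m t)) <= (LINT t|leb T. norm (f t) * ((norm p * T) ^ m /\<^sub>R fact m))"
      proof (rule integral_mono)
        show "integrable (leb T) (%t. norm (?F m t))" by (rule integrable_norm[OF i])
        show "integrable (leb T) (%t. norm (f t) * ((norm p * T) ^ m /\<^sub>R fact m))" using f by simp
        show "!!t. t \<in> space (leb T) ==> norm (?F m t) <= norm (f t) * ((norm p * T) ^ m /\<^sub>R fact m)" by (rule nb) simp
      qed
      then show "norm (LINT t|leb T. norm (?F m t)) <= (LINT t|leb T. norm (f t)) * ((norm p * T) ^ m /\<^sub>R fact m)" by simp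
    qed
    show "(LINT t|leb T. (\<Sum>m. ?F m t)) = (\<Sum>m. LINT t|leb T. ?F m t)"
    proof (rule integral_suminf[OF i _ s2])
      show "AE t in leb T. summable (%m. norm (?F m t))"
      proof (rule AE_I2)
        fix t assume "t \<in> space (leb T)"
        then show "summable (%m. norm (?F m t))"
          by (intro summable_comparison_test'[OF summable_mult[OF s, of "norm (f t)"], of 0]) (use nb[of t] in simp)
      qed
    qed
  qed
  have "(\<Sum>m. ?F m t) = f t * exp (p * of_real t)" for t
    unfolding exp_def by (rule suminf_mult[OF summable_exp_generic])
  then have l: "lap T f p = (\<Sum>m. LINT t|leb T. ?F m t)" unfolding lap_def s1[symmetric] by simp
  have "summable (%m. LINT t|leb T. ?F m t)"
    by (rule summable_comparison_test'[OF s2, of 0]) simp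
  then have "(%m. LINT t|leb T. ?F m t) sums lap T f p" unfolding l by (rule summable_sums)
  moreover have "(LINT t|leb T. ?F m t) = (LINT t|leb T. f t * of_real t ^ m) / fact m * p ^ m" for m
  proof -
    have "?F m t = (p ^ m / fact m) * (f t * of_real t ^ m)" for t
      by (simp add: power_mult_distrib scaleR_conv_of_real divide_inverse mult_ac)
    then have "(LINT t|leb T. ?F m t) = (p ^ m / fact m) * (LINT t|leb T. f t * of_real t ^ m)"
      by (simp only: integral_mult_right_zero)
    then show ?thesis by simp
  qed
  ultimately show ?thesis by simp
qed

lemma lap_entire:
  assumes "integrable (leb T) f" "T >= 0"
  shows "lap T f holomorphic_on UNIV"
proof -
  have "lap T f holomorphic_on ball 0 r" for r
    by (rule power_series_holomorphic[where z = 0 and a = "%m. (LINT t|leb T. f t * of_real t ^ m) / fact m"]) (use lap_sums[OF assms] in simp)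
  then have "lap T f holomorphic_on (\<Union>n::nat. ball 0 (real n))" by (intro holomorphic_on_UN_open) auto
  moreover have "(\<Union>n::nat. ball 0 (real n)) = (UNIV :: complex set)" by (auto simp: reals_Archimedean2)
  ultimately show ?thesis by simp
qed

lemma lap_zero_moments:
  assumes "integrable (leb T) f" "T >= 0" "!!p. lap T f p = 0"
  shows "(LINT t|leb T. f t * of_real t ^ m) = 0"
proof (rule ccontr)
  define a where "a m = (LINT t|leb T. f t * of_real t ^ m) / fact m" for m
  assume "\<not> ?thesis"
  then have am: "a m ~= 0" by (simp add: a_def)
  have s: "(%n. a n * (x - 0) ^ n) sums 0" for x
    using lap_sums[OF assms(1,2), of x] assms(3) by (simp add: a_def)
  have "a 0 = 0" using s[of 0] by simp
  then have "m > 0" using am by (cases m) auto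
  then obtain e where "e > 0" "!!z. z \<in> cball 0 e - {0::complex} ==> (%_. 0::complex) z ~= 0"
    using powser_0_nonzero[of 1 0 a "%_. 0" m] s am by auto
  from this(2)[of "of_real e"] this(1) show False by simp
qed

lemma ip_Re:
  assumes "f \<in> l2 (leb L)" "continuous_on {0..L} h"
  shows "ip (leb L) f (%x. Re (c * h x)) = Re (c * (LINT x|leb L. of_real (f x) * h x))"
proof -
  have i: "integrable (leb L) (%x. of_real (f x) * h x)" by (rule l2_integrable_mult_bounded[OF assms])
  have "Re (c * (LINT x|leb L. of_real (f x) * h x)) = Re (LINT x|leb L. c * (of_real (f x) * h x))" by simp
  also have "\<dots> = (LINT x|leb L. Re (c * (of_real (f x) * h x)))" using i by (intro integral_Re[symmetric]) simp
  also have "\<dots> = ip (leb L) f (%x. Re (c * h x))" unfolding ip_def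
    by (rule Bochner_Integration.integral_cong) (auto simp: algebra_simps)
  finally show ?thesis by simp
qed

lemma complex_zero_of_Re: "(!!c. Re (c * z) = 0) ==> z = 0"
  using complex_eq_iff[of z 0] by (metis (no_types) Re_i_times add.inverse_inverse mult_1 neg_0_equal_iff_equal zero_complex.simps)

lemma decay_zero:
  assumes "!!s::real. s >= 1 ==> norm c <= K / sqrt s"
  shows "c = 0"
proof -
  have "((%s. K / sqrt s) \<longlongrightarrow> 0) at_top"
    by (intro tendsto_divide_0[OF tendsto_const] filterlim_at_top_imp_at_infinity sqrt_at_top)
  then have "norm c <= 0"
    by (rule tendsto_lowerbound) (auto simp: eventually_at_top_linorder intro!: exI[of _ 1] assms)
  then show ?thesis by simp
qed

context noncritical
begin

text \<open>Testing with e^(pt) \<open>Wk\<close> expresses the Laplace transform of \<beta> as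
  minus the pairing of \<alpha> over the slope at L. This quotient is bounded and decays to the
  right, and to the left the transform is bounded because t stays in [0,T]. Liouville makes it a
  constant, which the decay identifies as 0; then all pairings of \<alpha> vanish.\<close>

lemma trace_orth_zero:
  assumes a: "\<alpha> \<in> l2 (leb L)" and b: "\<beta> \<in> l2 (leb T)" and T: "T > 0"
    and z: "!!p p1 p2 p3. kdv0 T L p p1 p2 p3 ==> ipL \<alpha> (p 0) + ip (leb T) \<beta> (%t. p1 t L) = 0"
  shows "AE x in leb L. \<alpha> x = 0" "AE t in leb T. \<beta> t = 0"
proof -
  define B where "B = lap T (%t. of_real (\<beta> t))"
  have bi: "integrable (leb T) (%t. complex_of_real (\<beta> t))" using l2_leb_integrable[OF b] by simp
  have key: "pair L \<alpha> p + Wk L 1 p L * B p = 0" for p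
  proof (rule complex_zero_of_Re)
    fix c
    have 1: "ipL \<alpha> (%x. Re (c * Wk L 0 p x)) = Re (c * pair L \<alpha> p)"
      unfolding pair_def by (rule ip_Re[OF a]) (intro continuous_intros)
    have 2: "ip (leb T) \<beta> (%t. Re ((c * Wk L 1 p L) * exp (p * of_real t))) = Re ((c * Wk L 1 p L) * B p)"
      unfolding B_def lap_def by (rule ip_Re[OF b]) (intro continuous_intros)
    have "ipL \<alpha> (%x. Re (c * exp (p * of_real 0) * Wk L 0 p x)) + ip (leb T) \<beta> (%t. Re (c * exp (p * of_real t) * Wk L 1 p L)) = 0"
      by (rule z[OF kdv_exp])
    then show "Re (c * (pair L \<alpha> p + Wk L 1 p L * B p)) = 0" using 1 2 by (simp add: algebra_simps)
  qed
  have dec: "norm (B p) <= nmL \<alpha> / sqrt (2 * Re p)" if p: "Re p > 0" for p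
  proof -
    note W = Wk_norm_le(1)[OF L_pos p]
    have "norm (Wk L 1 p L) * norm (B p) = norm (pair L \<alpha> p)"
      using key[of p] by (metis add_eq_0_iff norm_minus_cancel norm_mult)
    also have "\<dots> <= nmL \<alpha> * nmL (%x. norm (Wk L 0 p x))"
      unfolding pair_def by (rule pair_bound[OF a]) (intro continuous_intros)
    also have "\<dots> <= nmL \<alpha> * (norm (Wk L 1 p L) / sqrt (2 * Re p))" using W by (intro mult_left_mono) auto
    finally have "norm (Wk L 1 p L) * norm (B p) <= norm (Wk L 1 p L) * (nmL \<alpha> / sqrt (2 * Re p))" by (simp add: mult_ac)
    then show ?thesis by (rule mult_left_le_imp_le) (use W in simp)
  qed
  have "bounded (range B)"
  proof -
    have "norm (B p) <= max (nmL \<alpha>) ((LINT t|leb T. norm (complex_of_real (\<beta> t))) * exp (1 * T))" for p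
    proof (cases "Re p >= 1")
      case True
      have "nmL \<alpha> / sqrt (2 * Re p) <= nmL \<alpha> / 1" using True by (intro divide_left_mono) auto
      then show ?thesis using dec[of p] True by simp
    next
      case False
      then show ?thesis using lap_bound[OF bi, of p 1] unfolding B_def by simp
    qed
    then show ?thesis unfolding bounded_iff by blast
  qed
  then obtain c where c: "!!p. B p = c"
    using Liouville_theorem[of B] lap_entire[OF bi less_imp_le[OF T]] unfolding B_def[symmetric] constant_on_def by blast
  have "c = 0"
  proof (rule decay_zero[where K = "nmL \<alpha>"])
    fix s :: real assume s: "s >= 1"
    have "norm c <= nmL \<alpha> / sqrt (2 * s)" using dec[of "of_real s"] c s by simp
    also have "\<dots> <= nmL \<alpha> / sqrt s" using s by (intro divide_left_mono) auto
    finally show "norm c <= nmL \<alpha> / sqrt s" .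
  qed
  then have B0: "B p = 0" for p using c by simp
  have mom: "ip (leb T) \<beta> (%t. t ^ k) = 0" for k
  proof -
    have "(LINT t|leb T. complex_of_real (\<beta> t) * of_real t ^ k) = 0"
      by (rule lap_zero_moments[OF bi]) (use B0 T in \<open>auto simp: B_def\<close>)
    then have "(LINT t|leb T. complex_of_real (\<beta> t * t ^ k)) = 0" by simp
    then have "complex_of_real (LINT t|leb T. \<beta> t * t ^ k) = 0" by (simp only: integral_complex_of_real)
    then show ?thesis by (simp add: ip_def)
  qed
  have "AE x in leb T. (1::real) ~= 0 --> \<beta> x = 0"
    by (rule AE_zero_of_cont[OF b, of "%_. 1"]) (use ip_poly_zero[OF b mom] T in auto)
  then show "AE x in leb T. \<beta> x = 0" by simp
  show "AE x in leb L. \<alpha> x = 0" by (rule pair_complete[OF a]) (use key B0 in simp)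
qed

end

section \<open>Reflected intervals and glued pairs of functions\<close>

lemma lebesgue_reflect:
  fixes c :: real
  shows "lebesgue = distr lebesgue lebesgue (%x. c - x)" "(%x. c - x) \<in> lebesgue \<rightarrow>\<^sub>M lebesgue"
proof -
  show "lebesgue = distr lebesgue lebesgue (%x. c - x)"
    using lebesgue_real_affine[of "-1" c] by (simp add: density_1)
  show "(%x. c - x) \<in> lebesgue \<rightarrow>\<^sub>M lebesgue"
    using lebesgue_affine_measurable[where c = "%x::real. -1" and t = c] by simp
qed

lemma reflect_integral:
  fixes F :: "real => real"
  assumes "F \<in> borel_measurable (lebesgue_on {a<..<b})"
  shows "(%x. F (c - x)) \<in> borel_measurable (lebesgue_on {c-b<..<c-a})"
    "(LINT x|lebesgue_on {c-b<..<c-a}. F (c - x)) = (LINT x|lebesgue_on {a<..<b}. F x)"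
    "integrable (lebesgue_on {c-b<..<c-a}) (%x. F (c - x)) \<longleftrightarrow> integrable (lebesgue_on {a<..<b}) F"
proof -
  define g where "g x = indicator {a<..<b} x *\<^sub>R F x" for x
  have g: "g \<in> borel_measurable lebesgue"
    unfolding g_def[abs_def] using assms by (subst borel_measurable_restrict_space_iff[symmetric]) auto
  have gr: "(%x. indicator {c-b<..<c-a} x *\<^sub>R F (c - x)) = (%x. g (c - x))"
    by (rule ext) (auto simp: g_def indicator_def)
  note r = lebesgue_reflect[of c]
  have gm: "(%x. g (c - x)) \<in> borel_measurable lebesgue" by (rule measurable_compose[OF r(2) g])
  show "(%x. F (c - x)) \<in> borel_measurable (lebesgue_on {c-b<..<c-a})"
    by (subst borel_measurable_restrict_space_iff) (use gm in \<open>simp_all only: gr\<close>, simp)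
  have i1: "(LINT x|lebesgue_on {c-b<..<c-a}. F (c - x)) = integral\<^sup>L lebesgue (%x. g (c - x))"
    unfolding gr[symmetric] by (rule integral_restrict_space) simp
  have i2: "(LINT x|lebesgue_on {a<..<b}. F x) = integral\<^sup>L lebesgue g"
    unfolding g_def[abs_def] by (rule integral_restrict_space) simp
  have j1: "integrable (lebesgue_on {c-b<..<c-a}) (%x. F (c - x)) \<longleftrightarrow> integrable lebesgue (%x. g (c - x))"
    unfolding gr[symmetric] by (rule integrable_restrict_space) simp
  have j2: "integrable (lebesgue_on {a<..<b}) F \<longleftrightarrow> integrable lebesgue g"
    unfolding g_def[abs_def] by (rule integrable_restrict_space) simp
  have "integral\<^sup>L lebesgue (%x. g (c - x)) = integral\<^sup>L (distr lebesgue lebesgue (%x. c - x)) g"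
    by (rule integral_distr[OF r(2) g, symmetric])
  then show "(LINT x|lebesgue_on {c-b<..<c-a}. F (c - x)) = (LINT x|lebesgue_on {a<..<b}. F x)"
    unfolding r(1)[symmetric] i1 i2 .
  have "integrable (distr lebesgue lebesgue (%x. c - x)) g \<longleftrightarrow> integrable lebesgue (%x. g (c - x))"
    by (rule integrable_distr_eq[OF r(2) g])
  then show "integrable (lebesgue_on {c-b<..<c-a}) (%x. F (c - x)) \<longleftrightarrow> integrable (lebesgue_on {a<..<b}) F"
    unfolding r(1)[symmetric] j1 j2 by simp
qed

lemma reflect_l2:
  assumes "f \<in> l2 (leb L)"
  shows "(%x. f (L - x)) \<in> l2 (leb L)" "nm (leb L) (%x. f (L - x)) = nm (leb L) f"
proof -
  have m: "f \<in> borel_measurable (lebesgue_on {0<..<L})" by (rule l2_meas[OF assms])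
  then have m2: "(%x. (f x)\<^sup>2) \<in> borel_measurable (lebesgue_on {0<..<L})" by measurable
  show "(%x. f (L - x)) \<in> l2 (leb L)"
    using reflect_integral(1)[OF m, of L] reflect_integral(3)[OF m2, of L] assms by (simp add: l2_def)
  show "nm (leb L) (%x. f (L - x)) = nm (leb L) f"
    using reflect_integral(2)[OF m2, of L] by (simp add: nm_def ip_def power2_eq_square)
qed

text \<open>Pairs of functions on \<open>(0,A)\<close> and \<open>(0,B)\<close> are encoded as one function on \<open>(-A,0) \<union> (0,B)\<close>.\<close>

definition catM :: "real => real => real measure" where
  "catM A B = lebesgue_on ({-A<..<0} \<union> {0<..<B})"

definition cat :: "(real => real) => (real => real) => real => real" where
  "cat f g s = (if s < 0 then f (- s) else g s)"

lemma cat_integral: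
  assumes "integrable (leb A) f" "integrable (leb B) g"
  shows "integrable (catM A B) (cat f g)" "(LINT s|catM A B. cat f g s) = (LINT x|leb A. f x) + (LINT x|leb B. g x)"
proof -
  let ?S = "{-A<..<0} \<union> {0<..<B}"
  let ?f = "%s. indicator {-A<..<0} s *\<^sub>R f (- s)" and ?g = "%s. indicator {0<..<B} s *\<^sub>R g s"
  have S: "?S \<inter> space lebesgue \<in> sets lebesgue" by auto
  have e: "(%s. indicator ?S s *\<^sub>R cat f g s) = (%s. ?f s + ?g s)"
    by (rule ext) (auto simp: cat_def indicator_def)
  have fm: "f \<in> borel_measurable (lebesgue_on {0<..<A})" using assms(1) by auto
  have i: "integrable lebesgue ?f" "integrable lebesgue ?g"
    "integral\<^sup>L lebesgue ?f = (LINT x|leb A. f x)" "integral\<^sup>L lebesgue ?g = (LINT x|leb B. g x)"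
    using reflect_integral(2,3)[OF fm, of 0] assms by (simp_all add: integrable_restrict_space integral_restrict_space)
  show "integrable (catM A B) (cat f g)"
    unfolding catM_def integrable_restrict_space[OF S] e using i by simp
  show "(LINT s|catM A B. cat f g s) = (LINT x|leb A. f x) + (LINT x|leb B. g x)"
    unfolding catM_def integral_restrict_space[OF S] e using i by simp
qed

lemma cat_l2:
  assumes "f \<in> l2 (leb A)" "g \<in> l2 (leb B)"
  shows "cat f g \<in> l2 (catM A B)"
proof -
  have "integrable (catM A B) (cat (%x. (f x)\<^sup>2) (%x. (g x)\<^sup>2))" by (rule cat_integral) (use assms in \<open>auto simp: l2_def\<close>)
  moreover have "cat (%x. (f x)\<^sup>2) (%x. (g x)\<^sup>2) = (%s. (cat f g s)\<^sup>2)" by (auto simp: cat_def)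
  moreover have "integrable (catM A B) (cat f g)" by (rule cat_integral) (use assms l2_leb_integrable in auto)
  ultimately show ?thesis by (auto simp: l2_def)
qed

lemma cat_ip:
  assumes "f \<in> l2 (leb A)" "g \<in> l2 (leb B)" "f' \<in> l2 (leb A)" "g' \<in> l2 (leb B)"
  shows "ip (catM A B) (cat f g) (cat f' g') = ip (leb A) f f' + ip (leb B) g g'"
proof -
  have "(%s. cat f g s * cat f' g' s) = cat (%x. f x * f' x) (%x. g x * g' x)" by (auto simp: cat_def)
  then show ?thesis unfolding ip_def using cat_integral(2)[OF l2_integrable_mult l2_integrable_mult] assms by simp
qed

lemma cat_nm:
  assumes "f \<in> l2 (leb A)" "g \<in> l2 (leb B)"
  shows "nm (catM A B) (cat f g) = sqrt ((nm (leb A) f)\<^sup>2 + (nm (leb B) g)\<^sup>2)"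
  unfolding nm_sq unfolding nm_def cat_ip[OF assms assms] ..

lemma l2_subset:
  assumes "f \<in> l2 (lebesgue_on S)" "U \<subseteq> S" "S \<in> sets lebesgue" "U \<in> sets lebesgue"
  shows "f \<in> l2 (lebesgue_on U)"
proof -
  have "f \<in> borel_measurable (lebesgue_on U)"
    by (rule measurable_restrict_mono[OF l2_meas[OF assms(1)] assms(2)])
  moreover have "set_integrable lebesgue S (%x. (f x)\<^sup>2)"
    using assms(1,3) by (simp add: l2_def set_integrable_def integrable_restrict_space)
  then have "set_integrable lebesgue U (%x. (f x)\<^sup>2)" by (rule set_integrable_subset) (use assms in auto)
  ultimately show ?thesis using assms(4) by (simp add: l2_def set_integrable_def integrable_restrict_space)
qed

lemma cat_split:
  assumes "w \<in> l2 (catM A B)"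
  shows "(%x. w (- x)) \<in> l2 (leb A)" "w \<in> l2 (leb B)" "cat (%x. w (- x)) w = w"
proof -
  have "w \<in> l2 (lebesgue_on {-A<..<0})" using assms unfolding catM_def by (rule l2_subset) auto
  then have m: "w \<in> borel_measurable (lebesgue_on {-A<..<0})" "integrable (lebesgue_on {-A<..<0}) (%x. (w x)\<^sup>2)"
    by (auto simp: l2_def)
  from reflect_integral(1)[OF m(1), of 0] reflect_integral(3)[of "%x. (w x)\<^sup>2" "-A" 0 0] m
  show "(%x. w (- x)) \<in> l2 (leb A)" by (simp add: l2_def)
  show "w \<in> l2 (leb B)" using assms unfolding catM_def by (rule l2_subset) auto
  show "cat (%x. w (- x)) w = w" by (auto simp: cat_def)
qed

text \<open>Riesz representation in a product of two spaces: gluing makes a pair one function on one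
  measure space, where the scalar version applies.\<close>

lemma l2_riesz_pair:
  fixes D :: "((real => real) \<times> (real => real) \<times> real) set"
  assumes ne: "D ~= {}" and dl: "!!d e r. (d, e, r) \<in> D ==> d \<in> l2 (leb A) & e \<in> l2 (leb B)"
    and lin: "!!d e r d' e' r' a b. (d, e, r) \<in> D ==> (d', e', r') \<in> D ==>
      ((%x. a * d x + b * d' x), (%x. a * e x + b * e' x), a * r + b * r') \<in> D"
    and bd: "!!d e r. (d, e, r) \<in> D ==> \<bar>r\<bar> <= K * sqrt ((nm (leb A) d)\<^sup>2 + (nm (leb B) e)\<^sup>2)"
  obtains u v ds es where "u \<in> l2 (leb A)" "v \<in> l2 (leb B)"
    "sqrt ((nm (leb A) u)\<^sup>2 + (nm (leb B) v)\<^sup>2) <= K | nm (leb A) u = 0 & nm (leb B) v = 0"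
    "!!d e r. (d, e, r) \<in> D ==> ip (leb A) u d + ip (leb B) v e = r"
    "!!n. \<exists>r. (ds n, es n, r) \<in> D"
    "(%n. nm (leb A) (%x. ds n x - u x)) \<longlonglongrightarrow> 0" "(%n. nm (leb B) (%x. es n x - v x)) \<longlonglongrightarrow> 0"
proof -
  note concl = that
  define D' where "D' = {(cat d e, r) |d e r. (d, e, r) \<in> D}"
  have catlin: "(%x. a * cat d e x + b * cat d' e' x) = cat (%x. a * d x + b * d' x) (%x. a * e x + b * e' x)" for a b d e d' e'
    by (auto simp: cat_def)
  obtain w cs where w: "w \<in> l2 (catM A B)" "nm (catM A B) w <= K | nm (catM A B) w = 0"
    "!!d r. (d, r) \<in> D' ==> ip (catM A B) w d = r" "!!n. cs n \<in> fst ` D'"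
    "(%n. nm (catM A B) (%x. cs n x - w x)) \<longlonglongrightarrow> 0"
  proof (rule l2_riesz[of D' "catM A B" K])
    show "D' ~= {}" using ne by (auto simp: D'_def)
    show "!!d r. (d, r) \<in> D' ==> d \<in> l2 (catM A B)" using dl by (auto simp: D'_def intro!: cat_l2)
    fix d r e s a b assume "(d, r) \<in> D'" "(e, s) \<in> D'"
    then obtain d1 d2 e1 e2 where "d = cat d1 d2" "e = cat e1 e2" "(d1, d2, r) \<in> D" "(e1, e2, s) \<in> D" unfolding D'_def by blast
    then show "((%x. a * d x + b * e x), a * r + b * s) \<in> D'" unfolding D'_def using lin catlin by blast
  next
    fix d r assume "(d, r) \<in> D'"
    then obtain d1 d2 where "d = cat d1 d2" "(d1, d2, r) \<in> D" unfolding D'_def by blast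
    then show "\<bar>r\<bar> <= K * nm (catM A B) d" using bd dl cat_nm by simp
  qed blast
  define u where "u x = w (- x)" for x
  have wc: "w = cat u w" using cat_split(3)[OF w(1)] by (simp add: u_def[abs_def])
  have l: "u \<in> l2 (leb A)" "w \<in> l2 (leb B)" using cat_split(1,2)[OF w(1)] by (simp_all add: u_def[abs_def])
  have "\<exists>d e r. cs n = cat d e & (d, e, r) \<in> D" for n
  proof -
    obtain x where x: "x \<in> D'" "cs n = fst x" using w(4)[of n] by blast
    then obtain d e r where "x = (cat d e, r)" "(d, e, r) \<in> D" unfolding D'_def by blast
    then show ?thesis using x(2) by (intro exI[of _ d] exI[of _ e] exI[of _ r]) simp
  qed
  then obtain ds es rs where ds: "!!n. cs n = cat (ds n) (es n)" "!!n. (ds n, es n, rs n) \<in> D" by metis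
  have nmw: "nm (catM A B) w = sqrt ((nm (leb A) u)\<^sup>2 + (nm (leb B) w)\<^sup>2)" using cat_nm[OF l] wc by simp
  have nmd: "nm (catM A B) (%x. cs n x - w x) = sqrt ((nm (leb A) (%x. ds n x - u x))\<^sup>2 + (nm (leb B) (%x. es n x - w x))\<^sup>2)" for n
  proof -
    have "(%x. cs n x - w x) = cat (%x. ds n x - u x) (%x. es n x - w x)"
      unfolding ds(1) by (auto simp: cat_def u_def)
    then show ?thesis using cat_nm[OF l2_diff l2_diff] dl[OF ds(2)] l by simp
  qed
  show ?thesis
  proof (rule concl[of u w ds es])
    show "sqrt ((nm (leb A) u)\<^sup>2 + (nm (leb B) w)\<^sup>2) <= K | nm (leb A) u = 0 & nm (leb B) w = 0"
      using w(2) unfolding nmw by (auto simp: sum_power2_eq_zero_iff)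
    fix d e r assume d: "(d, e, r) \<in> D"
    then have "ip (catM A B) w (cat d e) = r" by (intro w(3)) (auto simp: D'_def)
    then show "ip (leb A) u d + ip (leb B) w e = r" using cat_ip[OF l] dl[OF d] wc by metis
  next
    show "\<exists>r. (ds n, es n, r) \<in> D" for n using ds(2) by blast
    show "(%n. nm (leb A) (%x. ds n x - u x)) \<longlonglongrightarrow> 0"
      by (rule tendsto_sandwich[OF _ _ tendsto_const w(5)]) (auto simp: nmd intro!: always_eventually)
    show "(%n. nm (leb B) (%x. es n x - w x)) \<longlonglongrightarrow> 0"
      by (rule tendsto_sandwich[OF _ _ tendsto_const w(5)]) (auto simp: nmd intro!: always_eventually)
  qed (use l in auto)
qed

section \<open>Approximation of arbitrary data by smooth solutions\<close>

context noncritical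
begin

text \<open>The representer of the functional given by (y0, u) lies in the closure of the data of
  smooth solutions. It differs from (y0, u) by a pair orthogonal to all of them, which
  \<open>trace_orth_zero\<close> shows to be null. This replaces an existence theory for the
  evolution equation.\<close>

theorem trace_dense:
  assumes y: "y0 \<in> l2 (leb L)" and u: "u \<in> l2 (leb T)" and T: "T > 0"
  obtains p p1 p2 p3 where "!!n::nat. kdv0 T L (p n) (p1 n) (p2 n) (p3 n)"
    "(%n. nmL (%x. p n 0 x - y0 x)) \<longlonglongrightarrow> 0" "(%n. nm (leb T) (%t. p1 n t L - u t)) \<longlonglongrightarrow> 0"
proof -
  note concl = that
  define D where "D = {(p 0, (%t. p1 t L), ipL y0 (p 0) + ip (leb T) u (%t. p1 t L)) |p p1 p2 p3. kdv0 T L p p1 p2 p3}"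
  have l: "p 0 \<in> l2 (leb L)" "(%t. p1 t L) \<in> l2 (leb T)" if p: "kdv0 T L p p1 p2 p3" for p p1 p2 p3
    using cont_l2[OF kdv_cont(2)[OF p]] cont_l2[OF kdv_trace_cont(2)[OF p L_pos]] T by auto
  obtain y' u' ds es where R: "y' \<in> l2 (leb L)" "u' \<in> l2 (leb T)"
    "!!d e r. (d, e, r) \<in> D ==> ipL y' d + ip (leb T) u' e = r" "!!n. \<exists>r. (ds n, es n, r) \<in> D"
    "(%n. nmL (%x. ds n x - y' x)) \<longlonglongrightarrow> 0" "(%n. nm (leb T) (%x. es n x - u' x)) \<longlonglongrightarrow> 0"
  proof (rule l2_riesz_pair[of D L T "sqrt ((nmL y0)\<^sup>2 + (nm (leb T) u)\<^sup>2)"])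
    have "(%_. 0, %_. 0, 0) \<in> D"
      unfolding D_def using kdv_exp[of T L 0 0] by (auto intro!: exI[of _ "%_ _. 0"])
    then show "D ~= {}" by blast
    show "!!d e r. (d, e, r) \<in> D ==> d \<in> l2 (leb L) & e \<in> l2 (leb T)" using l unfolding D_def by blast
    show "((%x. a * d x + b * d' x), (%x. a * e x + b * e' x), a * r + b * r') \<in> D"
      if "(d, e, r) \<in> D" "(d', e', r') \<in> D" for d e r d' e' r' a b
    proof -
      obtain p p1 p2 p3 where p: "kdv0 T L p p1 p2 p3" "d = p 0" "e = (%t. p1 t L)" "r = ipL y0 (p 0) + ip (leb T) u (%t. p1 t L)"
        using \<open>(d, e, r) \<in> D\<close> unfolding D_def by blast
      obtain q q1 q2 q3 where q: "kdv0 T L q q1 q2 q3" "d' = q 0" "e' = (%t. q1 t L)" "r' = ipL y0 (q 0) + ip (leb T) u (%t. q1 t L)"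
        using \<open>(d', e', r') \<in> D\<close> unfolding D_def by blast
      have "a * r + b * r' = ipL y0 (%x. a * p 0 x + b * q 0 x) + ip (leb T) u (%t. a * p1 t L + b * q1 t L)"
        unfolding p q using ip_lin_right[OF l(1)[OF p(1)] l(1)[OF q(1)] y] ip_lin_right[OF l(2)[OF p(1)] l(2)[OF q(1)] u]
        by (simp add: algebra_simps)
      note eq = this
      define P P1 P2 P3 where P: "P = (%t x. a * p t x + b * q t x)" "P1 = (%t x. a * p1 t x + b * q1 t x)"
        "P2 = (%t x. a * p2 t x + b * q2 t x)" "P3 = (%t x. a * p3 t x + b * q3 t x)"
      have "kdv0 T L P P1 P2 P3" unfolding P by (rule kdv0_lin[OF p(1) q(1)])
      then have "(P 0, (%t. P1 t L), ipL y0 (P 0) + ip (leb T) u (%t. P1 t L)) \<in> D" unfolding D_def by blast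
      then show ?thesis unfolding eq p(2,3) q(2,3) P .
    qed
    show "\<bar>r\<bar> <= sqrt ((nmL y0)\<^sup>2 + (nm (leb T) u)\<^sup>2) * sqrt ((nmL d)\<^sup>2 + (nm (leb T) e)\<^sup>2)" if "(d, e, r) \<in> D" for d e r
    proof -
      have de: "d \<in> l2 (leb L)" "e \<in> l2 (leb T)" "r = ipL y0 d + ip (leb T) u e" using that l unfolding D_def by blast+
      show ?thesis unfolding de(3) cat_ip[OF y u de(1,2), symmetric] cat_nm[OF y u, symmetric] cat_nm[OF de(1,2), symmetric]
        by (rule ip_le_nm[OF cat_l2[OF y u] cat_l2[OF de(1,2)]])
    qed
  qed blast
  have "AE x in leb L. y0 x - y' x = 0" "AE t in leb T. u t - u' t = 0"
  proof -
    have z: "ipL (%x. y0 x - y' x) (p 0) + ip (leb T) (%t. u t - u' t) (%t. p1 t L) = 0" if p: "kdv0 T L p p1 p2 p3" for p p1 p2 p3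
    proof -
      have "(p 0, (%t. p1 t L), ipL y0 (p 0) + ip (leb T) u (%t. p1 t L)) \<in> D" unfolding D_def using p by blast
      from R(3)[OF this] show ?thesis using ip_diff_left[OF y R(1) l(1)[OF p]] ip_diff_left[OF u R(2) l(2)[OF p]] by simp
    qed
    show "AE x in leb L. y0 x - y' x = 0"
      by (rule trace_orth_zero(1)[OF l2_diff[OF y R(1)] l2_diff[OF u R(2)] T]) (rule z)
    show "AE t in leb T. u t - u' t = 0"
      by (rule trace_orth_zero(2)[OF l2_diff[OF y R(1)] l2_diff[OF u R(2)] T]) (rule z)
  qed
  note ae = this
  have "\<forall>n. \<exists>p p1 p2 p3. kdv0 T L p p1 p2 p3 & ds n = p 0 & es n = (%t. p1 t L)" using R(4) unfolding D_def by blast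
  then obtain p p1 p2 p3 where p: "!!n. kdv0 T L (p n) (p1 n) (p2 n) (p3 n)" "!!n. ds n = p n 0" "!!n. es n = (%t. p1 n t L)" by metis
  have "nmL (%x. p n 0 x - y0 x) = nmL (%x. ds n x - y' x)" for n
    unfolding p(2) by (rule nm_AE_cong) (use ae(1) l2_meas[OF l2_diff[OF l(1)[OF p(1)] y]] l2_meas[OF l2_diff[OF l(1)[OF p(1)] R(1)]] in auto)
  moreover have "nm (leb T) (%t. p1 n t L - u t) = nm (leb T) (%x. es n x - u' x)" for n
    unfolding p(3) by (rule nm_AE_cong) (use ae(2) l2_meas[OF l2_diff[OF l(2)[OF p(1)] u]] l2_meas[OF l2_diff[OF l(2)[OF p(1)] R(2)]] in auto)
  ultimately show ?thesis using concl[OF p(1)] R(5,6) by simp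
qed

end

section \<open>Functions in \<open>H\<^sup>1\<^sub>0\<close>\<close>

lemma power_over_fact_le_exp: "x >= 0 ==> x ^ n / fact n <= exp (x :: real)"
  using sum_le_suminf[OF summable_exp_generic[of x], of "{n}"] by (simp add: exp_def divide_inverse mult.commute)

definition smooth :: "(real => real) => bool" where
  "smooth f \<longleftrightarrow> (\<forall>n. (deriv ^^ n) f differentiable_on UNIV)"

lemma test_functions_iff: "\<phi> \<in> test_functions L \<longleftrightarrow> smooth \<phi> & closure {x. \<phi> x ~= 0} \<subseteq> {0<..<L}"
  by (simp add: test_functions_def smooth_def)

lemma smooth_deriv_n: "smooth f ==> ((deriv ^^ n) f has_real_derivative (deriv ^^ Suc n) f x) (at x)"
  by (simp add: smooth_def differentiable_on_def DERIV_deriv_iff_real_differentiable)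

lemma smooth_deriv: "smooth f ==> (f has_real_derivative deriv f x) (at x)"
  using smooth_deriv_n[of f 0 x] by simp

lemma smoothI: "(!!n x. \<exists>d. ((deriv ^^ n) f has_real_derivative d) (at x)) ==> smooth f"
  unfolding smooth_def differentiable_on_def by (metis real_differentiable_def UNIV_I)

lemma smooth_lin:
  assumes "smooth f" "smooth g"
  shows "smooth (%x. a * f x + b * g x)" "deriv (%x. a * f x + b * g x) = (%x. a * deriv f x + b * deriv g x)"
proof -
  have d: "((%x. a * (deriv ^^ n) f x + b * (deriv ^^ n) g x) has_real_derivative a * (deriv ^^ Suc n) f x + b * (deriv ^^ Suc n) g x) (at x)" for n x
    using smooth_deriv_n[OF assms(1), of n x] smooth_deriv_n[OF assms(2), of n x] by (intro DERIV_add DERIV_cmult)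
  have e: "(deriv ^^ n) (%x. a * f x + b * g x) = (%x. a * (deriv ^^ n) f x + b * (deriv ^^ n) g x)" for n
  proof (induction n)
    case (Suc n)
    have "(deriv ^^ Suc n) (%x. a * f x + b * g x) = deriv (%x. a * (deriv ^^ n) f x + b * (deriv ^^ n) g x)" by (simp add: Suc)
    also have "\<dots> = (%x. a * (deriv ^^ Suc n) f x + b * (deriv ^^ Suc n) g x)" by (rule ext) (rule DERIV_imp_deriv[OF d])
    finally show ?case .
  qed simp
  show "smooth (%x. a * f x + b * g x)" by (rule smoothI) (unfold e, blast intro: d)
  show "deriv (%x. a * f x + b * g x) = (%x. a * deriv f x + b * deriv g x)" using e[of 1] by simp
qed

lemma smooth_cont: "smooth f ==> continuous_on A f" "smooth f ==> continuous_on A (deriv f)"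
  using smooth_deriv_n[of f 0] smooth_deriv_n[of f 1]
  by (auto intro!: continuous_at_imp_continuous_on DERIV_isCont)

text \<open>Chosen as a class closed under differentiation: a polynomial times a power of 1 / ((x -
  a)(b - x)) times the exponential cut-off. Smoothness becomes an induction on the form, and the
  free polynomial provides the products of one cut-off with all monomials.\<close>

definition bump :: "real => real => real poly => nat => real => real" where
  "bump a b P m x = (if a < x & x < b then poly P x * inverse ((x - a) * (b - x)) ^ m * exp (- inverse ((x - a) * (b - x))) else 0)"

lemma DERIV_zero_of_quadratic_bound:
  fixes f :: "real => real"
  assumes "!!y. \<bar>f y\<bar> <= K * (y - x)\<^sup>2"
  shows "(f has_real_derivative 0) (at x)"
proof -
  have f0: "f x = 0" using assms[of x] by simp
  have "((%y. (f y - f x) / (y - x)) \<longlongrightarrow> 0) (at x)"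
  proof (rule Lim_null_comparison)
    show "\<forall>\<^sub>F y in at x. norm ((f y - f x) / (y - x)) <= K * \<bar>y - x\<bar>"
    proof (rule eventually_at_filter[THEN iffD2], rule always_eventually, intro allI impI)
      fix y assume "y ~= x"
      then have p: "\<bar>y - x\<bar> > 0" by simp
      have "\<bar>f y\<bar> <= (K * \<bar>y - x\<bar>) * \<bar>y - x\<bar>" using assms[of y] by (simp add: power2_eq_square mult.assoc abs_mult_self_eq)
      then show "norm ((f y - f x) / (y - x)) <= K * \<bar>y - x\<bar>" using p by (simp add: f0 pos_divide_le_eq)
    qed
    have "((%y. K * \<bar>y - x\<bar>) \<longlongrightarrow> K * \<bar>x - x\<bar>) (at x)" by (intro tendsto_intros)
    then show "((%y. K * \<bar>y - x\<bar>) \<longlongrightarrow> 0) (at x)" by simp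
  qed
  then show ?thesis by (simp add: has_field_derivative_iff)
qed

text \<open>Inside, the quotient rule with q = (x - a)(b - x) on the common denominator q^(m+2);
  outside, zero; at the end points the function is quadratically small, so its derivative there is
  0.\<close>

lemma bump_deriv:
  assumes ab: "a < b"
  defines "q \<equiv> [:- (a * b), a + b, -1:]"
  shows "(bump a b P m has_real_derivative
     bump a b (pderiv P * q ^ 2 - smult (of_nat m) (q * pderiv q * P) + pderiv q * P) (m + 2) x) (at x)"
proof -
  define P' where "P' = pderiv P * q ^ 2 - smult (of_nat m) (q * pderiv q * P) + pderiv q * P"
  have q: "poly q y = (y - a) * (b - y)" for y by (simp add: q_def algebra_simps)
  consider "a < x & x < b" | "x < a | x > b" | "x = a | x = b" using ab by linarith
  then have "(bump a b P m has_real_derivative bump a b P' (m + 2) x) (at x)"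
  proof cases
    case 1
    define i where "i = inverse (poly q x)"
    have qp: "poly q x > 0" using 1 by (simp add: q)
    have qi: "poly q x * i = 1" using qp by (simp add: i_def)
    have di: "((%y. inverse (poly q y)) has_real_derivative - poly (pderiv q) x * i ^ 2) (at x)"
      using DERIV_inverse'[OF poly_DERIV[of q x]] qp by (simp add: i_def power2_eq_square mult_ac)
    have dp: "((%y. inverse (poly q y) ^ m) has_real_derivative - real m * poly (pderiv q) x * i ^ (m + 1)) (at x)"
    proof (cases m)
      case (Suc k)
      have "((%y. inverse (poly q y) ^ Suc k) has_real_derivative (1 + real k) * (i ^ k) * (- poly (pderiv q) x * i ^ 2)) (at x)"
        unfolding i_def using DERIV_power_Suc[OF di[unfolded i_def], of k] by (simp add: mult_ac)
      then show ?thesis unfolding Suc by (rule DERIV_cong) (simp add: power2_eq_square algebra_simps)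
    qed simp
    have "((%y. poly P y * inverse (poly q y) ^ m * exp (- inverse (poly q y))) has_real_derivative
        (poly (pderiv P) x * i ^ m + poly P x * (- real m * poly (pderiv q) x * i ^ (m + 1))) * exp (- i)
        + poly P x * i ^ m * (exp (- i) * (poly (pderiv q) x * i ^ 2))) (at x)"
      by (rule derivative_eq_intros poly_DERIV dp di refl)+ (simp add: i_def algebra_simps)
    moreover have "(poly (pderiv P) x * i ^ m + poly P x * (- real m * poly (pderiv q) x * i ^ (m + 1))) * exp (- i)
        + poly P x * i ^ m * (exp (- i) * (poly (pderiv q) x * i ^ 2)) = bump a b P' (m + 2) x"
    proof -
      have 1: "i ^ m = (poly q x)\<^sup>2 * i ^ (m + 2)"
      proof -
        have "(poly q x)\<^sup>2 * i ^ (m + 2) = (poly q x * i)\<^sup>2 * i ^ m" by (simp add: power_mult_distrib power_add power2_eq_square mult_ac)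
        then show ?thesis by (simp add: qi)
      qed
      have 2: "i ^ (m + 1) = poly q x * i ^ (m + 2)"
      proof -
        have "poly q x * i ^ (m + 2) = (poly q x * i) * i ^ (m + 1)" by simp
        then show ?thesis by (simp add: qi)
      qed
      have 3: "i ^ m * i ^ 2 = i ^ (m + 2)" by (simp add: power_add power2_eq_square)
      have b: "bump a b P' (m + 2) x = poly P' x * i ^ (m + 2) * exp (- i)"
        using \<open>a < x & x < b\<close> by (simp add: bump_def i_def q)
      have "poly P x * i ^ m * (exp (- i) * (poly (pderiv q) x * i ^ 2)) = poly P x * (i ^ m * i ^ 2) * (exp (- i) * poly (pderiv q) x)"
        by (simp add: mult_ac)
      then show ?thesis unfolding b 3 unfolding 1 2 by (simp add: P'_def algebra_simps)
    qed
    ultimately have "((%y. poly P y * inverse (poly q y) ^ m * exp (- inverse (poly q y))) has_real_derivative bump a b P' (m + 2) x) (at x)" by simp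
    then show ?thesis
      by (rule has_field_derivative_transform_within_open[of _ _ _ "{a<..<b}"]) (use 1 in \<open>auto simp: bump_def q\<close>)
  next
    case 2
    then have z: "bump a b P' (m + 2) x = 0" using ab by (auto simp: bump_def)
    have "((%_. 0) has_real_derivative 0) (at x)" by simp
    then show ?thesis unfolding z
      by (rule has_field_derivative_transform_within_open[of _ _ _ "{..<a} \<union> {b<..}"]) (use 2 in \<open>auto simp: bump_def\<close>)
  next
    case 3
    then have z: "bump a b P' (m + 2) x = 0" by (auto simp: bump_def)
    have "compact (poly P ` {a..b})" by (intro compact_continuous_image continuous_intros compact_Icc)
    then have "bounded (poly P ` {a..b})" by (rule compact_imp_bounded)
    then obtain B where "\<forall>z\<in>poly P ` {a..b}. norm z <= B" unfolding bounded_iff by blast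
    then have B: "!!y. y \<in> {a..b} ==> \<bar>poly P y\<bar> <= B" by auto
    have B0: "B >= 0" using order_trans[OF abs_ge_zero B[of a]] ab by simp
    have bd: "\<bar>bump a b P m y\<bar> <= (B * fact (m + 2) * (b - a)\<^sup>2) * (y - x)\<^sup>2" for y
    proof (cases "a < y & y < b")
      case True
      define r where "r = (y - a) * (b - y)"
      have r: "r > 0" using True by (simp add: r_def)
      \<comment> \<open>One term of the exponential series: r^(-m) e^(-1/r) is at most (m+2)! r^2,
        and r vanishes linearly at either end.\<close>
      have "inverse r ^ (m + 2) / fact (m + 2) <= exp (inverse r)" using r by (intro power_over_fact_le_exp) simp
      then have "inverse r ^ (m + 2) <= exp (inverse r) * fact (m + 2)" by (simp only: pos_divide_le_eq fact_gt_zero)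
      then have "inverse r ^ (m + 2) * exp (- inverse r) <= (exp (inverse r) * fact (m + 2)) * exp (- inverse r)"
        by (rule mult_right_mono) simp
      also have "\<dots> = fact (m + 2) * (exp (inverse r) * exp (- inverse r))" by (simp only: mult_ac)
      also have "\<dots> = fact (m + 2)" by (simp only: exp_minus_inverse mult_1_right)
      finally have "inverse r ^ (m + 2) * exp (- inverse r) <= fact (m + 2)" .
      then have "(inverse r ^ (m + 2) * exp (- inverse r)) * r\<^sup>2 <= fact (m + 2) * r\<^sup>2" by (rule mult_right_mono) simp
      moreover have "(inverse r ^ (m + 2) * exp (- inverse r)) * r\<^sup>2 = (inverse r * r)\<^sup>2 * (inverse r ^ m * exp (- inverse r))"
        by (simp only: power_add power_mult_distrib mult_ac)
      moreover have "inverse r * r = 1" using r by simp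
      ultimately have 1: "inverse r ^ m * exp (- inverse r) <= fact (m + 2) * r\<^sup>2" by (simp only: power_one mult_1_left)
      have 2: "r\<^sup>2 <= (b - a)\<^sup>2 * (y - x)\<^sup>2"
      proof (cases "x = a")
        case True
        have "(b - y)\<^sup>2 <= (b - a)\<^sup>2" using \<open>a < y & y < b\<close> by (intro power_mono) auto
        then show ?thesis unfolding r_def True power_mult_distrib by (simp add: mult.commute[of "(y - a)\<^sup>2"] mult_right_mono)
      next
        case False
        then have xb: "x = b" using 3 by simp
        have "(y - a)\<^sup>2 <= (b - a)\<^sup>2" using \<open>a < y & y < b\<close> by (intro power_mono) auto
        then show ?thesis unfolding r_def xb power_mult_distrib by (simp add: power2_commute[of b y] mult_right_mono)
      qed
      have "\<bar>bump a b P m y\<bar> = \<bar>poly P y\<bar> * (inverse r ^ m * exp (- inverse r))"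
        using True r by (simp add: bump_def r_def[symmetric] abs_mult)
      also have "\<dots> <= B * (fact (m + 2) * ((b - a)\<^sup>2 * (y - x)\<^sup>2))"
      proof (rule mult_mono)
        show "\<bar>poly P y\<bar> <= B" using B True by simp
        have "fact (m + 2) * r\<^sup>2 <= fact (m + 2) * ((b - a)\<^sup>2 * (y - x)\<^sup>2)" using 2 by (intro mult_left_mono) auto
        then show "inverse r ^ m * exp (- inverse r) <= fact (m + 2) * ((b - a)\<^sup>2 * (y - x)\<^sup>2)" using 1 by linarith
      qed (use B0 r in auto)
      finally show ?thesis by (simp only: mult.assoc)
    next
      case False
      then have "bump a b P m y = 0" by (auto simp: bump_def)
      moreover have "0 <= (B * fact (m + 2) * (b - a)\<^sup>2) * (y - x)\<^sup>2" by (intro mult_nonneg_nonneg B0) auto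
      ultimately show ?thesis by simp
    qed
    show ?thesis unfolding z by (rule DERIV_zero_of_quadratic_bound[OF bd])
  qed
  then show ?thesis unfolding P'_def .
qed

lemma bump_smooth:
  assumes "a < b"
  shows "smooth (bump a b P m)"
proof -
  have "\<exists>P' m'. (deriv ^^ n) (bump a b P m) = bump a b P' m'" for n
  proof (induction n)
    case 0
    show ?case by auto
  next
    case (Suc n)
    then obtain P' m' where "(deriv ^^ n) (bump a b P m) = bump a b P' m'" by blast
    then have e: "(deriv ^^ Suc n) (bump a b P m) = deriv (bump a b P' m')" by simp
    show ?case unfolding e by (intro exI ext) (rule DERIV_imp_deriv[OF bump_deriv[OF assms]])
  qed
  then show ?thesis by (intro smoothI) (metis bump_deriv[OF assms])
qed

lemma bump_test:
  assumes "0 < a" "a < b" "b < L"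
  shows "bump a b P m \<in> test_functions L"
proof -
  have "closure {x. bump a b P m x ~= 0} \<subseteq> {a..b}" by (rule closure_minimal) (auto simp: bump_def split: if_splits)
  then show ?thesis unfolding test_functions_iff using bump_smooth[OF assms(2)] assms by auto
qed

lemma testD:
  assumes "\<phi> \<in> test_functions L"
  shows "smooth \<phi>" "x \<notin> {0<..<L} ==> \<phi> x = 0"
  using assms closure_subset[of "{x. \<phi> x ~= 0}"] unfolding test_functions_iff by auto

lemma test_lin:
  assumes "\<phi> \<in> test_functions L" "\<psi> \<in> test_functions L"
  shows "(%x. a * \<phi> x + b * \<psi> x) \<in> test_functions L"
proof -
  have "closure {x. a * \<phi> x + b * \<psi> x ~= 0} \<subseteq> closure ({x. \<phi> x ~= 0} \<union> {x. \<psi> x ~= 0})" by (rule closure_mono) auto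
  then show ?thesis using assms unfolding test_functions_iff closure_Un by (auto intro: smooth_lin)
qed

lemma test_l2: "\<phi> \<in> test_functions L ==> \<phi> \<in> l2 (leb L)" "\<phi> \<in> test_functions L ==> deriv \<phi> \<in> l2 (leb L)"
  using smooth_cont[OF testD(1)] by (auto intro: cont_l2)

text \<open>Cut-off times monomial is a test function. By Weierstrass, \<open>w\<close> is then
  orthogonal to the cut-off times any continuous function and vanishes where the cut-off is
  positive; countably many cut-offs exhaust the interval.\<close>

lemma orth_tests_zero:
  assumes w: "w \<in> l2 (leb L)" and L: "L > 0" and z: "!!\<phi>. \<phi> \<in> test_functions L ==> ip (leb L) w \<phi> = 0"
  shows "AE x in leb L. w x = 0"
proof -
  \<comment> \<open>Margins that shrink to 0; the summand 3 makes them at most L / 3, so the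
    interval between them is never empty.\<close>
  define a where "a n = L / (real n + 3)" for n :: nat
  have a: "0 < a n" "a n < L - a n" "L - a n < L" for n
  proof -
    have "a n <= L / 3" unfolding a_def using L by (intro divide_left_mono) auto
    moreover have "0 < a n" using L by (simp add: a_def)
    ultimately show "0 < a n" "a n < L - a n" "L - a n < L" using L by linarith+
  qed
  have "AE x in leb L. bump (a n) (L - a n) 1 0 x ~= 0 --> w x = 0" for n
  proof (rule AE_zero_of_cont[OF w])
    show c: "continuous_on {0..L} (bump (a n) (L - a n) 1 0)" by (rule smooth_cont(1)[OF bump_smooth[OF a(2)]])
    show "!!x. 0 <= bump (a n) (L - a n) 1 0 x" by (simp add: bump_def)
    fix h :: "real => real" assume h: "continuous_on {0..L} h"
    have "ip (leb L) (%x. w x * bump (a n) (L - a n) 1 0 x) h = 0"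
    proof (rule ip_poly_zero[OF l2_mult_cont[OF w c] _ h])
      fix k
      have "ip (leb L) w (bump (a n) (L - a n) (monom 1 k) 0) = 0" by (rule z[OF bump_test[OF a]])
      moreover have "bump (a n) (L - a n) (monom 1 k) 0 x = bump (a n) (L - a n) 1 0 x * x ^ k" for x
        by (simp add: bump_def poly_monom)
      ultimately show "ip (leb L) (%x. w x * bump (a n) (L - a n) 1 0 x) (%x. x ^ k) = 0" by (simp add: ip_def mult.assoc)
    qed (use L in simp)
    then show "ip (leb L) w (%x. bump (a n) (L - a n) 1 0 x * h x) = 0" by (simp add: ip_def mult.assoc)
  qed
  then have "AE x in leb L. \<forall>n. bump (a n) (L - a n) 1 0 x ~= 0 --> w x = 0" unfolding AE_all_countable by blast
  then show ?thesis using AE_space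
  proof eventually_elim
    case (elim x)
    then have x: "0 < x" "x < L" by auto
    define e where "e = min x (L - x)"
    have e: "e > 0" using x by (simp add: e_def)
    obtain n :: nat where "L / e < real n" using reals_Archimedean2 by blast
    then have "L < real n * e" using e by (simp add: pos_divide_less_eq)
    then have "L < (real n + 3) * e" using e by (simp add: algebra_simps)
    then have "a n < e" by (simp add: a_def pos_divide_less_eq mult.commute)
    then have "bump (a n) (L - a n) 1 0 x ~= 0" by (simp add: bump_def e_def)
    then show ?case using elim(1) by blast
  qed
qed

text \<open>Density without mollifiers: the representer of the inner product with \<open>f\<close>
  on test functions is a limit of test functions, and it equals \<open>f\<close> almost everywhere
  because the difference is orthogonal to all of them.\<close>

lemma test_dense:
  assumes f: "f \<in> l2 (leb L)" and L: "L > 0" and e: "e > 0"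
  obtains \<phi> where "\<phi> \<in> test_functions L" "nm (leb L) (%x. f x - \<phi> x) < e"
proof -
  note concl = that
  define D where "D = {(\<phi>, ip (leb L) f \<phi>) |\<phi>. \<phi> \<in> test_functions L}"
  obtain v ds where v: "v \<in> l2 (leb L)" "!!d r. (d, r) \<in> D ==> ip (leb L) v d = r"
    "!!n. ds n \<in> fst ` D" "(%n. nm (leb L) (%x. ds n x - v x)) \<longlonglongrightarrow> 0"
  proof (rule l2_riesz[of D "leb L" "nm (leb L) f"])
    have "bump (L/3) (L/2) 1 0 \<in> test_functions L" by (rule bump_test) (use L in auto)
    then show "D ~= {}" by (auto simp: D_def)
    show "!!d r. (d, r) \<in> D ==> d \<in> l2 (leb L)" by (auto simp: D_def test_l2)
    show "!!d r. (d, r) \<in> D ==> \<bar>r\<bar> <= nm (leb L) f * nm (leb L) d" by (auto simp: D_def intro!: ip_le_nm f test_l2)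
    fix d r e s a b assume "(d, r) \<in> D" "(e, s) \<in> D"
    then have "d \<in> test_functions L" "e \<in> test_functions L" "r = ip (leb L) f d" "s = ip (leb L) f e" by (auto simp: D_def)
    then show "((%x. a * d x + b * e x), a * r + b * s) \<in> D"
      unfolding D_def using test_lin[of d L e a b] ip_lin_right[OF test_l2(1) test_l2(1) f, of d e a b] by auto
  qed blast
  have ds: "ds n \<in> test_functions L" for n using v(3)[of n] by (auto simp: D_def)
  have ae: "AE x in leb L. f x - v x = 0"
  proof (rule orth_tests_zero[OF l2_diff[OF f v(1)] L])
    fix \<phi> assume p: "\<phi> \<in> test_functions L"
    then have "ip (leb L) v \<phi> = ip (leb L) f \<phi>" by (intro v(2)) (auto simp: D_def)
    then show "ip (leb L) (%x. f x - v x) \<phi> = 0" using ip_diff_left[OF f v(1) test_l2(1)[OF p]] by simp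
  qed
  have eq: "nm (leb L) (%x. f x - ds n x) = nm (leb L) (%x. ds n x - v x)" for n
    unfolding nm_minus_commute[of "leb L" f]
    by (rule nm_AE_cong) (use ae l2_meas[OF l2_diff[OF test_l2(1)[OF ds] f]] l2_meas[OF l2_diff[OF test_l2(1)[OF ds] v(1)]] in auto)
  have "\<forall>\<^sub>F n in sequentially. nm (leb L) (%x. ds n x - v x) < e" using order_tendstoD(2)[OF v(4) e] .
  then obtain n where "nm (leb L) (%x. ds n x - v x) < e" by (auto simp: eventually_sequentially)
  then show ?thesis using concl[OF ds, of n] eq by simp
qed

lemma test_support:
  assumes "\<phi> \<in> test_functions L" "L > 0"
  obtains a b where "0 < a" "a <= b" "b < L" "!!x. x \<notin> {a..b} ==> \<phi> x = 0"
proof -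
  define K where "K = closure {x. \<phi> x ~= 0}"
  have K: "K \<subseteq> {0<..<L}" "closed K" using assms by (auto simp: K_def test_functions_iff)
  have "bounded K" by (rule bounded_subset[OF compact_imp_bounded[OF compact_Icc[of 0 L]]]) (use K(1) in auto)
  then have cK: "compact K" using K(2) by (simp add: compact_eq_bounded_closed)
  have z: "\<phi> x = 0" if "x \<notin> K" for x using that closure_subset[of "{x. \<phi> x ~= 0}"] by (auto simp: K_def)
  show ?thesis
  proof (cases "K = {}")
    case True
    then show ?thesis using that[of "L/2" "L/2"] z assms(2) by auto
  next
    case False
    obtain a where a: "a \<in> K" "!!x. x \<in> K ==> a <= x" using compact_attains_inf[OF cK False] by blast
    obtain b where b: "b \<in> K" "!!x. x \<in> K ==> x <= b" using compact_attains_sup[OF cK False] by blast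
    show ?thesis by (rule that[of a b]) (use a b K z in auto)
  qed
qed

text \<open>The zero mean is what makes the antiderivative vanish again to the right of the
  support.\<close>

lemma test_antideriv:
  assumes psi: "\<psi> \<in> test_functions L" and L: "L > 0" and z: "integral {0..L} \<psi> = 0"
  obtains \<phi> where "\<phi> \<in> test_functions L" "deriv \<phi> = \<psi>" "!!x. x \<in> {0..L} ==> \<phi> x = integral {0..x} \<psi>"
proof -
  obtain a b where ab: "0 < a" "a <= b" "b < L" "!!x. x \<notin> {a..b} ==> \<psi> x = 0" by (rule test_support[OF psi L]) blast
  note sm = testD(1)[OF psi]
  \<comment> \<open>Starting at -1, left of the support, gives two-sided derivatives at 0 as
    well.\<close>
  define \<phi> where "\<phi> x = integral {-1..x} \<psi>" for x
  have cont: "continuous_on S \<psi>" for S by (rule smooth_cont(1)[OF sm])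
  have int: "\<psi> integrable_on {c..d}" for c d by (intro integrable_continuous_real cont)
  have neg: "\<phi> x = 0" if "x <= a" for x
  proof -
    have "negligible {a}" by simp
    then have "integral {-1..x} \<psi> = integral {-1..x} (%_. 0)" by (rule integral_spike) (use that ab(4) in force)
    then show ?thesis by (simp add: \<phi>_def)
  qed
  have pos: "\<phi> x = integral {0..x} \<psi>" if "x >= 0" for x
    using Henstock_Kurzweil_Integration.integral_combine[OF _ that int, of "-1"] neg[of 0] ab(1) by (simp add: \<phi>_def)
  have d: "(\<phi> has_real_derivative \<psi> x) (at x)" for x
  proof (cases "x > -1")
    case True
    have "((%y. integral {-1..y} \<psi>) has_real_derivative \<psi> x) (at x within {-1..x+1})"
      by (rule integral_has_real_derivative[OF cont]) (use True in auto)
    then show ?thesis unfolding \<phi>_def[abs_def] using True at_within_Icc_at[of "-1" x "x+1"] by simp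
  next
    case False
    then have p0: "\<psi> x = 0" using ab by simp
    have "((%_. 0) has_real_derivative 0) (at x)" by simp
    then show ?thesis unfolding p0
      by (rule has_field_derivative_transform_within_open[of _ _ _ "{..<0}"]) (use False neg ab(1) in auto)
  qed
  have dd: "deriv \<phi> = \<psi>" by (rule ext) (rule DERIV_imp_deriv[OF d])
  have "smooth \<phi>"
  proof (rule smoothI)
    fix n x
    show "\<exists>d. ((deriv ^^ n) \<phi> has_real_derivative d) (at x)"
    proof (cases n)
      case 0
      then show ?thesis using d by auto
    next
      case (Suc k)
      have "(deriv ^^ n) \<phi> = (deriv ^^ k) \<psi>" unfolding Suc funpow_Suc_right by (simp add: dd)
      then show ?thesis using smooth_deriv_n[OF sm] by metis
    qed
  qed
  moreover have "\<phi> x = 0" if "x \<notin> {a..b}" for x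
  proof (cases "x <= a")
    case False
    then have xb: "x > b" "x >= 0" using that ab by auto
    have t: "integral {b..y} \<psi> = 0" for y
    proof -
      have "negligible {b}" by simp
      then have "integral {b..y} \<psi> = integral {b..y} (%_. 0)" by (rule integral_spike) (use ab(4) in force)
      then show ?thesis by simp
    qed
    have c: "integral {0..y} \<psi> = integral {0..b} \<psi>" if "b <= y" for y
      using Henstock_Kurzweil_Integration.integral_combine[OF _ that int, of 0] t[of y] ab by simp
    show ?thesis using pos[OF xb(2)] c[of x] c[of L] xb ab z by simp
  qed (rule neg)
  then have "{x. \<phi> x ~= 0} \<subseteq> {a..b}" by blast
  then have "closure {x. \<phi> x ~= 0} \<subseteq> {a..b}" by (rule closure_minimal) simp
  then have "closure {x. \<phi> x ~= 0} \<subseteq> {0<..<L}" using ab by force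
  ultimately have "\<phi> \<in> test_functions L" by (simp add: test_functions_iff)
  then show ?thesis using that dd pos by auto
qed

section \<open>Limits of continuously differentiable functions\<close>

definition c1_0 :: "real => (real => real) => (real => real) => bool" where
  "c1_0 L h h1 \<longleftrightarrow> (\<forall>x\<in>{0..L}. (h has_real_derivative h1 x) (at x within {0..L})) & continuous_on {0..L} h1 & h 0 = 0 & h L = 0"

lemma c1_0_cont: "c1_0 L h h1 ==> continuous_on {0..L} h"
  unfolding c1_0_def by (rule DERIV_continuous_on) blast

lemma test_c1_0: "\<phi> \<in> test_functions L ==> L > 0 ==> c1_0 L \<phi> (deriv \<phi>)"
  unfolding c1_0_def using smooth_deriv[OF testD(1)] smooth_cont(2)[OF testD(1)] testD(2)
  by (auto intro: has_field_derivative_at_within)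

text \<open>Approximate the derivative by a test function in the mean-square sense, correct its
  integral with a fixed bump, and integrate. The correction is small because the integral of
  \<open>h1\<close> is h(L) - h(0) = 0.\<close>

lemma c1_0_approx:
  assumes h: "c1_0 L h h1" and L: "L > 0" and e: "e > 0"
  obtains \<phi> where "\<phi> \<in> test_functions L" "nm (leb L) (%x. h x - \<phi> x) < e" "nm (leb L) (%x. h1 x - deriv \<phi> x) < e"
proof -
  define \<rho> where "\<rho> = bump (L/3) (L/2) 1 0"
  have rt: "\<rho> \<in> test_functions L" unfolding \<rho>_def by (rule bump_test) (use L in auto)
  have rc: "continuous_on S \<rho>" for S by (rule smooth_cont(1)[OF testD(1)[OF rt]])
  have rn: "\<rho> x >= 0" for x by (simp add: \<rho>_def bump_def)
  define I where "I = integral {0..L} \<rho>"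
  have I: "I > 0"
  proof -
    have "I >= 0" unfolding I_def by (rule integral_nonneg) (auto simp: \<rho>_def bump_def intro!: integrable_continuous_real rc[unfolded \<rho>_def])
    moreover have "I ~= 0"
    proof
      assume "I = 0"
      then have "\<forall>x\<in>{0..L}. \<rho> x = 0"
        unfolding I_def using integral_eq_0_iff[of 0 L \<rho>] rc[of "{0..L}"] L rn by metis
      moreover have "\<rho> (5 * L / 12) ~= 0" using L by (simp add: \<rho>_def bump_def)
      moreover have "5 * L / 12 \<in> {0..L}" using L by simp
      ultimately show False by blast
    qed
    ultimately show ?thesis by simp
  qed
  \<comment> \<open>Amplification by the mean correction; integrating costs a further factor L, and
    \<eta> is chosen so that \<open>(1 + L) * (\<eta> * K)\<close> is e / 2.\<close>
  define K where "K = 1 + sqrt L * nm (leb L) \<rho> / I"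
  have K: "K >= 1" using I L by (simp add: K_def)
  define \<eta> where "\<eta> = e / (2 * (1 + L) * K)"
  have eta: "\<eta> > 0" using e K L by (simp add: \<eta>_def)
  have h1c: "continuous_on {0..L} h1" using h by (simp add: c1_0_def)
  obtain \<psi>0 where p0: "\<psi>0 \<in> test_functions L" "nm (leb L) (%x. h1 x - \<psi>0 x) < \<eta>"
    by (rule test_dense[OF cont_l2[OF h1c] L eta])
  have p0c: "continuous_on S \<psi>0" for S by (rule smooth_cont(1)[OF testD(1)[OF p0(1)]])
  define s where "s = integral {0..L} \<psi>0"
  have hint: "integral {0..x} h1 = h x - h 0" if "x \<in> {0..L}" for x
  proof (rule ftc)
    fix y assume y: "y \<in> {0..x}"
    then have "(h has_real_derivative h1 y) (at y within {0..L})" using h that by (simp add: c1_0_def)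
    then show "(h has_real_derivative h1 y) (at y within {0..x})" by (rule DERIV_subset) (use that in auto)
  qed (use that in simp)
  have h0: "h 0 = 0" "h L = 0" using h by (auto simp: c1_0_def)
  have s: "\<bar>s\<bar> <= sqrt L * \<eta>"
  proof -
    have "integral {0..L} (%x. h1 x - \<psi>0 x) = - s" unfolding s_def
      by (subst Henstock_Kurzweil_Integration.integral_diff) (use hint[of L] h0 L in \<open>auto intro!: integrable_continuous_real h1c p0c\<close>)
    moreover have "\<bar>integral {0..L} (%x. 1 * (h1 x - \<psi>0 x))\<bar> <= sqrt L * nm (leb L) (%x. h1 x - \<psi>0 x)"
      by (rule cont_integral_le_nm) (use L in \<open>auto intro!: continuous_intros h1c p0c\<close>)
    moreover have "sqrt L * nm (leb L) (%x. h1 x - \<psi>0 x) <= sqrt L * \<eta>" using p0(2) L by (intro mult_left_mono) auto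
    ultimately show ?thesis by simp
  qed
  define \<psi> where "\<psi> x = 1 * \<psi>0 x + (- s / I) * \<rho> x" for x
  have pt: "\<psi> \<in> test_functions L" unfolding \<psi>_def[abs_def] by (rule test_lin[OF p0(1) rt])
  have pc: "continuous_on S \<psi>" for S by (rule smooth_cont(1)[OF testD(1)[OF pt]])
  have "integral {0..L} \<psi> = integral {0..L} (%x. 1 * \<psi>0 x) + integral {0..L} (%x. (- s / I) * \<rho> x)"
    unfolding \<psi>_def[abs_def]
    by (rule Henstock_Kurzweil_Integration.integral_add) (intro integrable_continuous_real continuous_intros p0c rc)+
  also have "\<dots> = s + (- s / I) * I"
    by (simp only: integral_mult_right mult_1_left I_def[symmetric] s_def[symmetric])
  finally have pz: "integral {0..L} \<psi> = 0" using I by simp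
  obtain \<phi> where phi: "\<phi> \<in> test_functions L" "deriv \<phi> = \<psi>" "!!x. x \<in> {0..L} ==> \<phi> x = integral {0..x} \<psi>"
    by (rule test_antideriv[OF pt L pz]) blast
  have n1: "nm (leb L) (%x. h1 x - \<psi> x) <= \<eta> * K"
  proof -
    have "(%x. h1 x - \<psi> x) = (%x. (h1 x - \<psi>0 x) + (s / I) * \<rho> x)" by (rule ext) (simp add: \<psi>_def)
    then have "nm (leb L) (%x. h1 x - \<psi> x) <= nm (leb L) (%x. h1 x - \<psi>0 x) + nm (leb L) (%x. (s / I) * \<rho> x)"
      using nm_triangle[OF l2_diff[OF cont_l2[OF h1c] cont_l2[OF p0c]] l2_scale[OF cont_l2[OF rc], of "s / I" L]] by simp
    also have "\<dots> <= \<eta> + (sqrt L * \<eta>) / I * nm (leb L) \<rho>"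
      unfolding nm_scale using p0(2) s I by (intro add_mono mult_right_mono) (auto simp: abs_divide intro: divide_right_mono)
    finally show ?thesis by (simp add: K_def algebra_simps)
  qed
  have n0: "nm (leb L) (%x. h x - \<phi> x) <= L * (\<eta> * K)"
  proof -
    have "nm (leb L) (%x. h x - \<phi> x) <= sqrt L * (sqrt L * (\<eta> * K))"
    proof (rule nm_le_sup)
      show "continuous_on {0..L} (%x. h x - \<phi> x)"
        by (intro continuous_intros c1_0_cont[OF h] smooth_cont(1)[OF testD(1)[OF phi(1)]])
      fix x assume x: "x \<in> {0..L}"
      have sub: "{0..x} \<subseteq> {0..L}" using x by auto
      have "h x - \<phi> x = integral {0..x} (%y. 1 * (h1 y - \<psi> y))"
        using hint[OF x] h0 phi(3)[OF x]
        by (subst mult_1, subst Henstock_Kurzweil_Integration.integral_diff)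
           (auto intro!: integrable_continuous_real continuous_on_subset[OF h1c sub] pc)
      also have "\<bar>\<dots>\<bar> <= sqrt L * nm (leb L) (%x. h1 x - \<psi> x)"
        by (rule cont_integral_le_nm) (use x in \<open>auto intro!: continuous_intros h1c pc\<close>)
      also have "\<dots> <= sqrt L * (\<eta> * K)" using n1 L by (intro mult_left_mono) auto
      finally show "\<bar>h x - \<phi> x\<bar> <= sqrt L * (\<eta> * K)" .
    qed (use L in simp)
    then show ?thesis using L by (simp add: mult.assoc[symmetric])
  qed
  have ek: "(1 + L) * (\<eta> * K) = e / 2"
  proof -
    have D: "2 * (1 + L) * K ~= 0" using K L by auto
    have "\<eta> * (2 * (1 + L) * K) = e" by (rule nonzero_eq_divide_eq[OF D, THEN iffD1, OF \<eta>_def])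
    then show ?thesis by (simp add: algebra_simps)
  qed
  have "\<eta> * K > 0" "L * (\<eta> * K) > 0" using eta K L by auto
  then have "\<eta> * K < e" "L * (\<eta> * K) < e" using ek e by (simp_all add: algebra_simps)
  then show ?thesis using that[OF phi(1)] n0 n1 phi(2) by simp
qed

lemma weak_deriv_c1:
  assumes h: "c1_0 L h h1" and L: "L > 0"
  shows "is_weak_deriv L h h1"
  unfolding is_weak_deriv_def
proof
  fix \<phi> assume p: "\<phi> \<in> test_functions L"
  note c = c1_0_cont[OF h] smooth_cont[OF testD(1)[OF p], of "{0..L}"]
  have h1c: "continuous_on {0..L} h1" using h by (simp add: c1_0_def)
  have "integral {0..L} (%x. h x * deriv \<phi> x + h1 x * \<phi> x) = h L * \<phi> L - h 0 * \<phi> 0"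
  proof (rule ftc)
    fix x assume x: "x \<in> {0..L}"
    have "(h has_real_derivative h1 x) (at x within {0..L})" using h x by (simp add: c1_0_def)
    from DERIV_mult[OF this has_field_derivative_at_within[OF smooth_deriv[OF testD(1)[OF p]]]]
    show "((%x. h x * \<phi> x) has_real_derivative h x * deriv \<phi> x + h1 x * \<phi> x) (at x within {0..L})" by (simp add: algebra_simps)
  qed (use L in simp)
  also have "\<dots> = 0" using h by (simp add: c1_0_def)
  finally have "integral {0..L} (%x. h x * deriv \<phi> x) + integral {0..L} (%x. h1 x * \<phi> x) = 0"
    by (subst (asm) Henstock_Kurzweil_Integration.integral_add) (auto intro!: integrable_continuous_real continuous_intros c h1c)
  then show "(LINT x|leb L. h x * deriv \<phi> x) = - (LINT x|leb L. h1 x * \<phi> x)"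
    by (subst (1 2) leb_cont_integral) (auto intro!: continuous_intros c h1c)
qed

text \<open>\<open>weak_deriv\<close> is an arbitrary choice; any two weak derivatives differ by a
  function orthogonal to all tests, so the norm can be computed with the derivative at hand.\<close>

lemma H1_norm_eq:
  assumes f: "f \<in> l2 (leb L)" "g \<in> l2 (leb L)" "is_weak_deriv L f g" and L: "L > 0"
  shows "f \<in> H1 L" "H1_norm L f = sqrt ((nm (leb L) f)\<^sup>2 + (nm (leb L) g)\<^sup>2)"
proof -
  show "f \<in> H1 L" unfolding H1_def L2_eq using f by blast
  have "weak_deriv L f \<in> L2 {0<..<L} & is_weak_deriv L f (weak_deriv L f)"
    unfolding weak_deriv_def by (rule someI[of _ g]) (use f in \<open>simp add: L2_eq\<close>)
  then have w: "weak_deriv L f \<in> l2 (leb L)" "is_weak_deriv L f (weak_deriv L f)" by (auto simp: L2_eq)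
  have "AE x in leb L. weak_deriv L f x - g x = 0"
  proof (rule orth_tests_zero[OF l2_diff[OF w(1) f(2)] L])
    fix \<phi> assume p: "\<phi> \<in> test_functions L"
    have "ip (leb L) (weak_deriv L f) \<phi> = ip (leb L) g \<phi>" using w(2) f(3) p unfolding is_weak_deriv_def ip_def by auto
    then show "ip (leb L) (%x. weak_deriv L f x - g x) \<phi> = 0" using ip_diff_left[OF w(1) f(2) test_l2(1)[OF p]] by simp
  qed
  then have "nm (leb L) (weak_deriv L f) = nm (leb L) g"
    by (intro nm_AE_cong l2_meas w f) (auto elim: eventually_mono)
  then show "H1_norm L f = sqrt ((nm (leb L) f)\<^sup>2 + (nm (leb L) g)\<^sup>2)" by (simp add: H1_norm_def L2_norm_eq)
qed

text \<open>Closedness in the graph norm: a simultaneous limit of functions and of their derivatives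
  keeps the weak derivative relation and stays approximable by test functions. It is applied at
  almost every time to the limits of smooth solutions.\<close>

lemma H10_limit:
  assumes f: "f \<in> l2 (leb L)" "g \<in> l2 (leb L)" and L: "L > 0"
    and ap: "!!e. e > 0 ==> \<exists>h h1. c1_0 L h h1 & nm (leb L) (%x. f x - h x) < e & nm (leb L) (%x. g x - h1 x) < e"
  shows "f \<in> H10 L" "H1_norm L f = sqrt ((nm (leb L) f)\<^sup>2 + (nm (leb L) g)\<^sup>2)"
proof -
  have ap2: "\<exists>\<phi>\<in>test_functions L. nm (leb L) (%x. f x - \<phi> x) < e & nm (leb L) (%x. g x - deriv \<phi> x) < e" if e: "e > 0" for e
  proof -
    have e2: "e / 2 > 0" using e by simp
    obtain h h1 where h: "c1_0 L h h1" "nm (leb L) (%x. f x - h x) < e / 2" "nm (leb L) (%x. g x - h1 x) < e / 2" using ap[OF e2] by blast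
    obtain \<phi> where p: "\<phi> \<in> test_functions L" "nm (leb L) (%x. h x - \<phi> x) < e / 2" "nm (leb L) (%x. h1 x - deriv \<phi> x) < e / 2"
      by (rule c1_0_approx[OF h(1) L e2])
    have hl: "h \<in> l2 (leb L)" "h1 \<in> l2 (leb L)" using c1_0_cont[OF h(1)] h(1) by (auto simp: c1_0_def intro: cont_l2)
    show ?thesis
      using nm_triangle_diff[OF f(1) hl(1) test_l2(1)[OF p(1)]] nm_triangle_diff[OF f(2) hl(2) test_l2(2)[OF p(1)]] h p
      by (intro bexI[OF _ p(1)]) linarith
  qed
  have wd: "is_weak_deriv L f g" unfolding is_weak_deriv_def
  proof
    fix \<eta> assume c: "\<eta> \<in> test_functions L"
    note cl = test_l2[OF c]
    have "\<bar>ip (leb L) f (deriv \<eta>) + ip (leb L) g \<eta>\<bar> <= e * (nm (leb L) (deriv \<eta>) + nm (leb L) \<eta>)" if e: "e > 0" for e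
    proof -
      obtain \<phi> where p: "\<phi> \<in> test_functions L" "nm (leb L) (%x. f x - \<phi> x) < e" "nm (leb L) (%x. g x - deriv \<phi> x) < e"
        using ap2[OF e] by blast
      note pl = test_l2[OF p(1)]
      have "ip (leb L) \<phi> (deriv \<eta>) = - ip (leb L) (deriv \<phi>) \<eta>"
        using weak_deriv_c1[OF test_c1_0[OF p(1) L] L] c by (simp add: is_weak_deriv_def ip_def)
      then have "ip (leb L) f (deriv \<eta>) + ip (leb L) g \<eta>
         = ip (leb L) (%x. f x - \<phi> x) (deriv \<eta>) + ip (leb L) (%x. g x - deriv \<phi> x) \<eta>"
        using ip_diff_left[OF f(1) pl(1) cl(2)] ip_diff_left[OF f(2) pl(2) cl(1)] by simp
      moreover have "\<bar>ip (leb L) (%x. f x - \<phi> x) (deriv \<eta>)\<bar> <= e * nm (leb L) (deriv \<eta>)"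
        by (rule order_trans[OF ip_le_nm[OF l2_diff[OF f(1) pl(1)] cl(2)]]) (intro mult_right_mono less_imp_le p nm_nonneg)
      moreover have "\<bar>ip (leb L) (%x. g x - deriv \<phi> x) \<eta>\<bar> <= e * nm (leb L) \<eta>"
        by (rule order_trans[OF ip_le_nm[OF l2_diff[OF f(2) pl(2)] cl(1)]]) (intro mult_right_mono less_imp_le p nm_nonneg)
      ultimately show ?thesis unfolding distrib_left by linarith
    qed
    then have "ip (leb L) f (deriv \<eta>) + ip (leb L) g \<eta> = 0" by (rule zero_of_le_eps)
    then show "(LINT x|leb L. f x * deriv \<eta> x) = - (LINT x|leb L. g x * \<eta> x)" by (simp add: ip_def)
  qed
  note eq = H1_norm_eq[OF f wd L]
  show "H1_norm L f = sqrt ((nm (leb L) f)\<^sup>2 + (nm (leb L) g)\<^sup>2)" by (rule eq(2))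
  show "f \<in> H10 L" unfolding H10_def
  proof (intro CollectI conjI allI impI)
    show "f \<in> H1 L" by (rule eq(1))
    fix e :: real assume e: "e > 0"
    then have e2: "e / 2 > 0" by simp
    obtain \<phi> where p: "\<phi> \<in> test_functions L" "nm (leb L) (%x. f x - \<phi> x) < e / 2" "nm (leb L) (%x. g x - deriv \<phi> x) < e / 2"
      using ap2[OF e2] by blast
    note pl = test_l2[OF p(1)]
    have "is_weak_deriv L (%x. f x - \<phi> x) (%x. g x - deriv \<phi> x)" unfolding is_weak_deriv_def
    proof
      fix \<eta> assume c: "\<eta> \<in> test_functions L"
      note cl = test_l2[OF c]
      have "ip (leb L) (%x. f x - \<phi> x) (deriv \<eta>) = - ip (leb L) (%x. g x - deriv \<phi> x) \<eta>"
        using ip_diff_left[OF f(1) pl(1) cl(2)] ip_diff_left[OF f(2) pl(2) cl(1)] wd weak_deriv_c1[OF test_c1_0[OF p(1) L] L] c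
        by (simp add: is_weak_deriv_def ip_def)
      then show "(LINT x|leb L. (f x - \<phi> x) * deriv \<eta> x) = - (LINT x|leb L. (g x - deriv \<phi> x) * \<eta> x)" by (simp add: ip_def)
    qed
    from H1_norm_eq(2)[OF l2_diff[OF f(1) pl(1)] l2_diff[OF f(2) pl(2)] this L]
    have "H1_norm L (%x. f x - \<phi> x) <= nm (leb L) (%x. f x - \<phi> x) + nm (leb L) (%x. g x - deriv \<phi> x)"
      using sqrt_sum_squares_le_sum[OF nm_nonneg nm_nonneg] by simp
    then show "\<exists>\<phi>\<in>test_functions L. H1_norm L (%x. f x - \<phi> x) < e"
      using p by (intro bexI[OF _ p(1)]) linarith
  qed
qed

lemma c1_0_H10:
  assumes "c1_0 L h h1" "L > 0"
  shows "h \<in> H10 L"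
proof (rule H10_limit(1)[OF cont_l2[OF c1_0_cont[OF assms(1)]] _ assms(2)])
  show "h1 \<in> l2 (leb L)" using assms(1) by (auto simp: c1_0_def intro: cont_l2)
  show "\<exists>k k1. c1_0 L k k1 & nm (leb L) (%x. h x - k x) < e & nm (leb L) (%x. h1 x - k1 x) < e" if "e > 0" for e
    using assms(1) that by (intro exI[of _ h] exI[of _ h1]) (simp add: nm_def ip_def)
qed

section \<open>Weak solutions and null control\<close>

lemma nm_geometric_limit:
  assumes f: "!!n. f n \<in> l2 M" and g: "g \<in> l2 M" and c: "!!n. nm M (%x. f (Suc n) x - f n x) <= (1/4) ^ n"
    and lim: "(%n. nm M (%x. f n x - g x)) \<longlonglongrightarrow> 0"
  shows "nm M (%x. f n x - g x) <= 2 * (1/4) ^ n"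
proof -
  \<comment> \<open>The subtracted term is the slack that closes the induction: adding q =
    (1/4)^(n+k) turns -4/3 q into -1/3 q, which is -4/3 times the next power.\<close>
  have step: "nm M (%x. f (n + k) x - f n x) <= 2 * (1/4) ^ n - 4/3 * ((1/4) ^ (n + k))" for k
  proof (induction k)
    case 0
    have "(0::real) < (1/4) ^ n" by simp
    then show ?case by (simp add: nm_def ip_def)
  next
    case (Suc k)
    have "nm M (%x. f (n + Suc k) x - f n x) <= nm M (%x. f (Suc (n + k)) x - f (n + k) x) + nm M (%x. f (n + k) x - f n x)"
      using nm_triangle_diff[OF f f f] by simp
    also have "\<dots> <= (1/4) ^ (n + k) + (2 * (1/4) ^ n - 4/3 * ((1/4) ^ (n + k)))" by (rule add_mono[OF c Suc])
    also have "\<dots> = 2 * (1/4) ^ n - 4/3 * ((1/4) ^ (n + Suc k))" by simp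
    finally show ?case .
  qed
  have le: "nm M (%x. f n x - g x) <= 2 * (1/4) ^ n + nm M (%x. f (n + k) x - g x)" for k
  proof -
    have "nm M (%x. f n x - g x) <= nm M (%x. f n x - f (n + k) x) + nm M (%x. f (n + k) x - g x)" by (rule nm_triangle_diff[OF f f g])
    moreover have "(0::real) < (1/4) ^ (n + k)" by simp
    ultimately show ?thesis using step[of k] unfolding nm_minus_commute[of M "f n" "f (n + k)"] by linarith
  qed
  have "(%k. 2 * (1/4) ^ n + nm M (%x. f (n + k) x - g x)) \<longlonglongrightarrow> 2 * (1/4) ^ n + 0"
    by (intro tendsto_add tendsto_const) (use LIMSEQ_ignore_initial_segment[OF lim, of n] in \<open>simp add: add.commute\<close>)
  from LIMSEQ_le_const[OF this] le show ?thesis by auto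
qed

text \<open>Lebesgue measure is complete. The squared Sobolev norm along the solution is only known
  as an almost everywhere limit, and its measurability comes from here.\<close>

lemma leb_measurable_AE:
  fixes f g :: "real => real"
  assumes "f \<in> borel_measurable (leb T)" "AE t in leb T. f t = g t"
  shows "g \<in> borel_measurable (leb T)"
proof -
  have "(%x. indicator {0<..<T} x *\<^sub>R f x) \<in> borel_measurable lebesgue"
    using assms(1) by (subst borel_measurable_restrict_space_iff[symmetric]) auto
  moreover have "AE x in lebesgue. indicator {0<..<T} x *\<^sub>R f x = indicator {0<..<T} x *\<^sub>R g x"
    using assms(2) by (subst (asm) AE_restrict_space_iff) (auto elim!: eventually_mono simp: indicator_def)
  ultimately have "(%x. indicator {0<..<T} x *\<^sub>R g x) \<in> borel_measurable lebesgue" by (rule borel_measurable_AE)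
  then show ?thesis by (subst borel_measurable_restrict_space_iff) auto
qed

text \<open>Makes a test function of the weak formulation a solution with source, the source being
  its residual in the equation, so that the pairing identity against smooth solutions
  applies.\<close>

lemma Ck3_kdv:
  assumes C: "Ck_on_rect 3 T L \<phi>" and b: "!!t. t \<in> {0..T} ==> \<phi> t 0 = 0 & \<phi> t L = 0" and TL: "T > 0" "L > 0"
  shows "kdv T L (%t x. Dt T \<phi> t x + Dx L \<phi> t x + Dx L (Dx L (Dx L \<phi>)) t x) \<phi> (Dx L \<phi>) (Dx L (Dx L \<phi>)) (Dx L (Dx L (Dx L \<phi>)))"
proof -
  have C1: "Ck_on_rect 2 T L (Dx L \<phi>)" "Ck_on_rect 2 T L (Dt T \<phi>)" and C2: "Ck_on_rect 1 T L (Dx L (Dx L \<phi>))"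
    and C3: "Ck_on_rect 0 T L (Dx L (Dx L (Dx L \<phi>)))"
    using C by (auto simp: numeral_3_eq_3 numeral_2_eq_2)
  have cc: "continuous_on ({0..T} \<times> {0..L}) (%(t, x). \<psi> t x)" if "Ck_on_rect k T L \<psi>" for k \<psi>
    using that by (cases k) auto
  have dx: "(\<psi> t has_real_derivative Dx L \<psi> t x) (at x within {0..L})"
    and dt: "((%s. \<psi> s x) has_real_derivative Dt T \<psi> t x) (at t within {0..T})"
    if "Ck_on_rect (Suc k) T L \<psi>" "t \<in> {0..T}" "x \<in> {0..L}" for k \<psi> t x
    using that unfolding Dx_def Dt_def has_real_derivative_iff_has_vector_derivative
    by (auto simp: vector_derivative_works[symmetric])
  have S: "Ck_on_rect (Suc 2) T L \<phi>" "Ck_on_rect (Suc 1) T L (Dx L \<phi>)" "Ck_on_rect (Suc 0) T L (Dx L (Dx L \<phi>))"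
    using C C1 C2 by (simp_all add: numeral_3_eq_3 numeral_2_eq_2)
  have c: "continuous_on ({0..T} \<times> {0..L}) (%z. Dt T \<phi> (fst z) (snd z))" "continuous_on ({0..T} \<times> {0..L}) (%z. Dx L \<phi> (fst z) (snd z))"
    "continuous_on ({0..T} \<times> {0..L}) (%z. Dx L (Dx L (Dx L \<phi>)) (fst z) (snd z))" "continuous_on ({0..T} \<times> {0..L}) (%z. \<phi> (fst z) (snd z))"
    using cc[OF C1(2)] cc[OF C1(1)] cc[OF C3] cc[OF C] by (simp_all add: case_prod_unfold)
  show ?thesis unfolding kdv_def case_prod_unfold
  proof (intro conjI ballI)
    show "continuous_on ({0..T} \<times> {0..L}) (%z. Dt T \<phi> (fst z) (snd z) + Dx L \<phi> (fst z) (snd z) + Dx L (Dx L (Dx L \<phi>)) (fst z) (snd z))"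
      by (intro continuous_intros c)
  qed (use c b dx[OF S(1)] dx[OF S(2)] dx[OF S(3)] dt[OF S(1)] in auto)
qed

section \<open>Existence of weak solutions by closure\<close>

context noncritical
begin

text \<open>Smooth solutions with data converging at a geometric rate converge to a weak solution,
  by the energy identity and Kato smoothing. The energy also bounds the trace at x = 0, whose limit
  is \<open>v\<close>. The closing duality identity holds for test solutions that vanish neither at
  time T nor in their slope at 0, which the weak formulation alone does not offer.\<close>

theorem closure_solution:
  assumes y0: "y0 \<in> l2 (leb L)" and u: "u \<in> l2 (leb T)" and T: "T > 0"
  obtains y v where "kdv_weak_solution L T y0 u y" "v \<in> l2 (leb T)" "(nm (leb T) v)\<^sup>2 <= (nmL y0)\<^sup>2 + (nm (leb T) u)\<^sup>2"
    "!!q q1 q2 q3. kdv0 T L q q1 q2 q3 ==>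
       ipL (y T) (q T) - ipL y0 (q 0) = ip (leb T) u (%t. q1 t L) - ip (leb T) v (%t. q1 t 0)"
proof -
  note concl = that
  obtain P P1 P2 P3 where P: "!!n::nat. kdv0 T L (P n) (P1 n) (P2 n) (P3 n)"
    "(%n. nmL (%x. P n 0 x - y0 x)) \<longlonglongrightarrow> 0" "(%n. nm (leb T) (%t. P1 n t L - u t)) \<longlonglongrightarrow> 0"
    using trace_dense[OF y0 u T] by blast
  \<comment> \<open>For homogeneous solutions the time integral of the squared slope norm is at most
    \<open>K\<close> times the squared data, by energy and smoothing. Dividing by 4 K in
    \<open>r\<close> makes the squared increments, even after multiplication by \<open>K\<close>,
    smaller than 16^(-n).\<close>
  define K where "K = 1 + T + 2 * L"
  have K: "K >= 1" using T L_pos by (simp add: K_def)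
  define r where "r n = (1/4) ^ n / (4 * K)" for n :: nat
  have r: "r n > 0" for n using K by (simp add: r_def)
  have "\<exists>N. nmL (%x. P N 0 x - y0 x) < r n & nm (leb T) (%t. P1 N t L - u t) < r n" for n
  proof -
    have "\<forall>\<^sub>F N in sequentially. nmL (%x. P N 0 x - y0 x) < r n & nm (leb T) (%t. P1 N t L - u t) < r n"
      using order_tendstoD(2)[OF P(2) r] order_tendstoD(2)[OF P(3) r] by (rule eventually_conj)
    then show ?thesis by (auto simp: eventually_sequentially)
  qed
  then obtain N where N: "!!n. nmL (%x. P (N n) 0 x - y0 x) < r n" "!!n. nm (leb T) (%t. P1 (N n) t L - u t) < r n" by metis
  define p where "p n = P (N n)" for n
  define p1 where "p1 n = P1 (N n)" for n
  define p2 where "p2 n = P2 (N n)" for n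
  define p3 where "p3 n = P3 (N n)" for n
  have p: "kdv0 T L (p n) (p1 n) (p2 n) (p3 n)" for n unfolding p_def p1_def p2_def p3_def by (rule P(1))
  have mem: "0 \<in> {0..T}" "T \<in> {0..T}" using T by auto
  have pl: "p n t \<in> l2 (leb L)" "p1 n t \<in> l2 (leb L)" if "t \<in> {0..T}" for n t
    using kdv_cont[OF p that] cont_l2 by blast+
  note tr = kdv_trace_cont[OF p L_pos]
  have tl: "(%t. p1 n t 0) \<in> l2 (leb T)" "(%t. p1 n t L) \<in> l2 (leb T)" for n using tr cont_l2 by blast+
  have rS: "r (Suc n) + r n <= (1/4) ^ n / (2 * K)" for n
  proof -
    have "r (Suc n) = r n / 4" by (simp add: r_def)
    moreover have "2 * r n = (1/4) ^ n / (2 * K)" by (simp add: r_def)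
    ultimately show ?thesis using r[of n] by linarith
  qed
  define d where "d n t x = p (Suc n) t x - p n t x" for n t x
  define d1 where "d1 n t x = p1 (Suc n) t x - p1 n t x" for n t x
  define d2 where "d2 n t x = p2 (Suc n) t x - p2 n t x" for n t x
  define d3 where "d3 n t x = p3 (Suc n) t x - p3 n t x" for n t x
  have dk: "kdv0 T L (d n) (d1 n) (d2 n) (d3 n)" for n
    using kdv0_lin[OF p[of "Suc n"] p[of n], of 1 "-1"] by (simp add: d_def[abs_def] d1_def[abs_def] d2_def[abs_def] d3_def[abs_def])
  have d0: "nmL (d n 0) <= (1/4) ^ n / (2 * K)" for n
  proof -
    have "nmL (d n 0) <= nmL (%x. p (Suc n) 0 x - y0 x) + nmL (%x. y0 x - p n 0 x)"
      unfolding d_def[abs_def] by (rule nm_triangle_diff[OF pl(1)[OF mem(1)] y0 pl(1)[OF mem(1)]])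
    then show ?thesis using N(1)[of "Suc n"] N(1)[of n] rS[of n] unfolding p_def[symmetric] nm_minus_commute[of _ y0] by linarith
  qed
  have dL: "nm (leb T) (%t. d1 n t L) <= (1/4) ^ n / (2 * K)" for n
  proof -
    have "nm (leb T) (%t. d1 n t L) <= nm (leb T) (%t. p1 (Suc n) t L - u t) + nm (leb T) (%t. u t - p1 n t L)"
      unfolding d1_def[abs_def] by (rule nm_triangle_diff[OF tl(2) u tl(2)])
    then show ?thesis using N(2)[of "Suc n"] N(2)[of n] rS[of n] unfolding p1_def[symmetric] nm_minus_commute[of _ u] by linarith
  qed
  define D where "D n = (nmL (d n 0))\<^sup>2 + (nm (leb T) (%t. d1 n t L))\<^sup>2" for n
  have q16: "((1/4::real) ^ n)\<^sup>2 = (1/16) ^ n" for n by (simp add: power_mult_distrib[symmetric] power_mult[symmetric] power2_eq_square mult.commute)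
  have DK: "K * D n <= (1/16) ^ n" for n
  proof -
    have "D n <= ((1/4) ^ n / (2 * K))\<^sup>2 + ((1/4) ^ n / (2 * K))\<^sup>2"
      unfolding D_def using d0 dL by (intro add_mono power_mono) auto
    also have "\<dots> = (1/16) ^ n / (2 * K\<^sup>2)"
    proof -
      have "(x / (2 * K))\<^sup>2 + (x / (2 * K))\<^sup>2 = x\<^sup>2 / (2 * K\<^sup>2)" for x using K by (simp add: power2_eq_square field_simps)
      then show ?thesis unfolding q16[symmetric] .
    qed
    also have "\<dots> <= (1/16) ^ n / K"
    proof (rule divide_left_mono)
      have "K * 1 <= K * K" using K by (intro mult_left_mono) auto
      then show "K <= 2 * K\<^sup>2" using K by (simp add: power2_eq_square)
    qed (use K in auto)
    finally show ?thesis using K by (simp add: pos_le_divide_eq mult.commute)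
  qed
  have D0: "D n >= 0" for n by (simp add: D_def)
  have D16: "D n <= (1/16) ^ n" for n
    using DK[of n] D0[of n] K mult_right_mono[of 1 K "D n"] by linarith
  have trn: "(nm (leb T) (%t. q t))\<^sup>2 = integral {0..T} (%t. (q t)\<^sup>2)" if "continuous_on {0..T} q" for q
    unfolding nm_sq ip_cont[OF that that] by (simp add: power2_eq_square)
  have en: "(nm (leb L) (a t))\<^sup>2 <= (nmL (a 0))\<^sup>2 + (nm (leb T) (%t. a1 t L))\<^sup>2"
    "(nm (leb T) (%t. a1 t 0))\<^sup>2 <= (nmL (a 0))\<^sup>2 + (nm (leb T) (%t. a1 t L))\<^sup>2"
    if a: "kdv0 T L a a1 a2 a3" and t: "t \<in> {0..T}" for a a1 a2 a3 t
  proof -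
    note c = kdv_trace_cont[OF a L_pos]
    have i: "(%t. (a1 t L)\<^sup>2) integrable_on {0..T}" "(%t. (a1 t 0)\<^sup>2) integrable_on {0..T}"
      by (auto intro!: integrable_continuous_real continuous_intros c)
    have sub: "{0..t} \<subseteq> {0..T}" using t by auto
    have ct: "continuous_on {0..t} (%t. a1 t L)" "continuous_on {0..t} (%t. a1 t 0)" using c continuous_on_subset[OF _ sub] by blast+
    have "(nmL (a t))\<^sup>2 - (nmL (a 0))\<^sup>2 = integral {0..t} (%r. (a1 r L)\<^sup>2 - (a1 r 0)\<^sup>2)"
      by (rule kdv_energy[OF a L_pos]) (use t in auto)
    also have "\<dots> <= integral {0..t} (%r. (a1 r L)\<^sup>2)"
      by (rule integral_le) (auto intro!: integrable_continuous_real continuous_intros ct)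
    also have "\<dots> <= integral {0..T} (%r. (a1 r L)\<^sup>2)"
      by (rule integral_subset_le[OF sub]) (auto intro!: integrable_continuous_real continuous_intros ct c)
    finally show "(nm (leb L) (a t))\<^sup>2 <= (nmL (a 0))\<^sup>2 + (nm (leb T) (%t. a1 t L))\<^sup>2" unfolding trn[OF c(2)] by linarith
    have "(nmL (a T))\<^sup>2 - (nmL (a 0))\<^sup>2 = integral {0..T} (%r. (a1 r L)\<^sup>2 - (a1 r 0)\<^sup>2)"
      by (rule kdv_energy[OF a L_pos]) (use T in auto)
    then show "(nm (leb T) (%t. a1 t 0))\<^sup>2 <= (nmL (a 0))\<^sup>2 + (nm (leb T) (%t. a1 t L))\<^sup>2"
      unfolding trn[OF c(1)] trn[OF c(2)] Henstock_Kurzweil_Integration.integral_diff[OF i]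
      using zero_le_power2[of "nmL (a T)"] by linarith
  qed
  have sq4: "x <= (1/4) ^ n" if "x\<^sup>2 <= (1/16) ^ n" for x :: real and n
    using that unfolding q16[symmetric] by (rule power2_le_imp_le) simp
  have dt: "nmL (%x. p (Suc n) t x - p n t x) <= (1/4) ^ n" if t: "t \<in> {0..T}" for n t
    using en(1)[OF dk t, of n] D16[of n] unfolding D_def by (intro sq4) (simp add: d_def[abs_def])
  have dv: "nm (leb T) (%t. p1 (Suc n) t 0 - p1 n t 0) <= (1/4) ^ n" for n
    using en(2)[OF dk mem(1), of n] D16[of n] unfolding D_def by (intro sq4) (simp add: d1_def[abs_def])
  have "\<exists>y. t \<in> {0..T} --> y \<in> l2 (leb L) & (%n. nmL (%x. p n t x - y x)) \<longlonglongrightarrow> 0" for t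
  proof (cases "t \<in> {0..T}")
    case True
    obtain g where "g \<in> l2 (leb L)" "(%n. nmL (%x. p n t x - g x)) \<longlonglongrightarrow> 0"
      using l2_complete_fast[of "%n. p n t" "leb L", OF pl(1)[OF True] dt[OF True]] by metis
    then show ?thesis by blast
  qed auto
  then obtain y where y: "!!t. t \<in> {0..T} ==> y t \<in> l2 (leb L)" "!!t. t \<in> {0..T} ==> (%n. nmL (%x. p n t x - y t x)) \<longlonglongrightarrow> 0" by metis
  obtain v where v: "v \<in> l2 (leb T)" "(%n. nm (leb T) (%t. p1 n t 0 - v t)) \<longlonglongrightarrow> 0"
    using l2_complete_fast[of "%n t. p1 n t 0" "leb T", OF tl(1) dv] by blast
  have unif: "nmL (%x. p n t x - y t x) <= 2 * (1/4) ^ n" if t: "t \<in> {0..T}" for n t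
    by (rule nm_geometric_limit[of "%n. p n t", OF pl(1)[OF t] y(1)[OF t] dt[OF t] y(2)[OF t]])
  have lim0: "(%n. nmL (%x. p n 0 x - y0 x)) \<longlonglongrightarrow> 0"
    "(%n. nm (leb T) (%t. p1 n t L - u t)) \<longlonglongrightarrow> 0"
  proof -
    have r0: "r \<longlonglongrightarrow> 0" unfolding r_def[abs_def] by (intro tendsto_divide_zero LIMSEQ_realpow_zero) auto
    show "(%n. nmL (%x. p n 0 x - y0 x)) \<longlonglongrightarrow> 0"
      by (rule tendsto_sandwich[OF _ _ tendsto_const r0]) (use N(1) in \<open>auto simp: p_def intro!: always_eventually less_imp_le\<close>)
    show "(%n. nm (leb T) (%t. p1 n t L - u t)) \<longlonglongrightarrow> 0"
      by (rule tendsto_sandwich[OF _ _ tendsto_const r0]) (use N(2) in \<open>auto simp: p1_def intro!: always_eventually less_imp_le\<close>)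
  qed
  have cy: "((%t. nmL (%x. y t x - y s x)) \<longlongrightarrow> 0) (at s within {0..T})" if s: "s \<in> {0..T}" for s
  proof (rule tendstoI)
    fix e :: real assume e: "e > 0"
    have "(%n. 4 * (1/4) ^ n :: real) \<longlonglongrightarrow> 4 * 0" by (intro tendsto_mult tendsto_const LIMSEQ_realpow_zero) auto
    from order_tendstoD(2)[OF this, of "e/2"] e obtain n where n: "4 * (1/4) ^ n < e / 2" by (auto simp: eventually_sequentially)
    note J = kdv_joint(2)[OF p[of n]]
    have sc: "continuous_on ({0..T} \<times> {0..L}) (%z. p n s (snd z))"
      by (rule continuous_on_compose2[OF kdv_cont(2)[OF p s]]) (auto intro!: continuous_intros)
    have "continuous_on {0..T} (%t. integral {0..L} (%x. (p n t x - p n s x) * (p n t x - p n s x)))"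
      by (rule param_integral_cont) (intro continuous_intros J sc)
    then have "((%t. sqrt (integral {0..L} (%x. (p n t x - p n s x) * (p n t x - p n s x)))) \<longlongrightarrow> sqrt (integral {0..L} (%x. (p n s x - p n s x) * (p n s x - p n s x)))) (at s within {0..T})"
      using s unfolding continuous_on_def by (intro tendsto_real_sqrt) blast
    then have "\<forall>\<^sub>F t in at s within {0..T}. sqrt (integral {0..L} (%x. (p n t x - p n s x) * (p n t x - p n s x))) < e / 2"
      using e by (intro order_tendstoD(2)) auto
    moreover have "\<forall>\<^sub>F t in at s within {0..T}. t \<in> {0..T}" by (simp add: eventually_at_filter)
    ultimately show "\<forall>\<^sub>F t in at s within {0..T}. dist (nmL (%x. y t x - y s x)) 0 < e"
    proof eventually_elim
      case (elim t)
      have cd: "contL (%x. p n t x - p n s x)" by (intro continuous_intros kdv_cont(2)[OF p elim(2)] kdv_cont(2)[OF p s])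
      have "nmL (%x. p n t x - p n s x) < e / 2" using elim(1) unfolding nm_def ip_cont[OF cd cd] .
      moreover have "nmL (%x. y t x - y s x) <= nmL (%x. y t x - p n t x) + nmL (%x. p n t x - y s x)"
        by (rule nm_triangle_diff[OF y(1)[OF elim(2)] pl(1)[OF elim(2)] y(1)[OF s]])
      moreover have "nmL (%x. p n t x - y s x) <= nmL (%x. p n t x - p n s x) + nmL (%x. p n s x - y s x)"
        by (rule nm_triangle_diff[OF pl(1)[OF elim(2)] pl(1)[OF s] y(1)[OF s]])
      ultimately show ?case using unif[OF elim(2), of n] unif[OF s, of n] n unfolding nm_minus_commute[of _ "y t" "p n t"]
        by (simp add: dist_real_def)
    qed
  qed
  have nmc: "continuous_on {0..T} (%t. (nmL (a t))\<^sup>2)" "continuous_on {0..T} (%t. (nmL (a1 t))\<^sup>2)" if "kdv0 T L a a1 a2 a3" for a a1 a2 a3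
    using nm_sq_cont[OF that] by auto
  have kato: "integral {0..T} (%t. (nmL (a1 t))\<^sup>2) <= K * ((nmL (a 0))\<^sup>2 + (nm (leb T) (%t. a1 t L))\<^sup>2)" if a: "kdv0 T L a a1 a2 a3" for a a1 a2 a3
  proof -
    define Q where "Q = (nmL (a 0))\<^sup>2 + (nm (leb T) (%t. a1 t L))\<^sup>2"
    have Q0: "Q >= 0" by (simp add: Q_def)
    have "integral {0..T} (%r. (nmL (a r))\<^sup>2) <= integral {0..T} (%r. Q)"
      by (rule integral_le) (use en(1)[OF a] nmc(1)[OF a] in \<open>auto simp: Q_def intro!: integrable_continuous_real\<close>)
    then have 1: "integral {0..T} (%r. (nmL (a r))\<^sup>2) <= T * Q" using T by simp
    have 2: "L * integral {0..T} (%r. (a1 r L)\<^sup>2) <= L * Q" "L * (nmL (a 0))\<^sup>2 <= L * Q"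
      unfolding trn[OF kdv_trace_cont(2)[OF a L_pos], symmetric] Q_def using L_pos by (auto intro!: mult_left_mono)
    have 3: "3 * integral {0..T} (%t. (nmL (a1 t))\<^sup>2) <= T * Q + L * Q + L * Q"
      using kdv_kato[OF a L_pos order_refl, of T] T 1 2 by simp
    have "integral {0..T} (%t. (nmL (a1 t))\<^sup>2) >= 0" by (rule integral_nonneg) (auto intro!: integrable_continuous_real nmc(2)[OF a])
    moreover have "K * Q = Q + T * Q + 2 * (L * Q)" by (simp add: K_def algebra_simps)
    ultimately show ?thesis using 3 Q0 unfolding Q_def[symmetric] by linarith
  qed
  have nn: "(\<integral>\<^sup>+t. ennreal (f t) \<partial>leb T) = ennreal (integral {0..T} f)" if "continuous_on {0..T} f" "!!t. t \<in> {0..T} ==> f t >= 0" for f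
    using that by (subst nn_integral_eq_integral) (auto simp: leb_cont_integral intro!: leb_cont_integrable AE_I2)
  \<comment> \<open>Smoothing controls the slopes only in the time mean; the fast rate turns this
    into convergence at almost every single time.\<close>
  have "AE t in leb T. summable (%k. sqrt ((nmL (d1 k t))\<^sup>2))"
  proof (rule AE_summable_sqrt)
    fix k
    show "(%t. (nmL (d1 k t))\<^sup>2) \<in> borel_measurable (leb T)" using leb_cont_integrable[OF nmc(2)[OF dk]] by auto
    have "(\<integral>\<^sup>+t. ennreal ((nmL (d1 k t))\<^sup>2) \<partial>leb T) = ennreal (integral {0..T} (%t. (nmL (d1 k t))\<^sup>2))" by (rule nn[OF nmc(2)[OF dk]]) simp
    also have "\<dots> <= ennreal ((1/16) ^ k)"
      using kato[OF dk, of k] DK[of k] unfolding D_def by (intro ennreal_leI) linarith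
    finally show "(\<integral>\<^sup>+t. ennreal ((nmL (d1 k t))\<^sup>2) \<partial>leb T) <= ennreal ((1/16) ^ k)" .
  qed simp
  then have good: "AE t in leb T. t \<in> {0<..<T} & summable (%k. nmL (d1 k t))"
    using AE_space by eventually_elim auto
  have H: "y t \<in> H10 L & (%n. (nmL (p n t))\<^sup>2 + (nmL (p1 n t))\<^sup>2) \<longlonglongrightarrow> (H1_norm L (y t))\<^sup>2"
    if "t \<in> {0<..<T} & summable (%k. nmL (d1 k t))" for t
  proof -
    have t: "t \<in> {0..T}" and sm: "summable (%k. nmL (d1 k t))" using that by auto
    have tail: "nmL (%x. p1 (n + k) t x - p1 n t x) <= (\<Sum>j. nmL (d1 (j + n) t))" for n k
    proof -
      have "nmL (%x. p1 (n + k) t x - p1 n t x) <= (\<Sum>j<k. nmL (d1 (j + n) t))"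
      proof (induction k)
        case 0
        show ?case by (simp add: nm_def ip_def)
      next
        case (Suc k)
        have "nmL (%x. p1 (n + Suc k) t x - p1 n t x) <= nmL (d1 (n + k) t) + nmL (%x. p1 (n + k) t x - p1 n t x)"
          unfolding d1_def[abs_def] using nm_triangle_diff[OF pl(2)[OF t] pl(2)[OF t] pl(2)[OF t]] by simp
        then show ?case using Suc by (simp add: add.commute)
      qed
      also have "\<dots> <= (\<Sum>j. nmL (d1 (j + n) t))" by (rule sum_le_suminf) (use summable_ignore_initial_segment[OF sm] in auto)
      finally show ?thesis .
    qed
    have tz: "(%n. \<Sum>j. nmL (d1 (j + n) t)) \<longlonglongrightarrow> 0" by (rule suminf_exist_split2[OF sm])
    obtain g where g: "g \<in> l2 (leb L)" "(%n. nmL (%x. p1 n t x - g x)) \<longlonglongrightarrow> 0"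
    proof (rule l2_complete[of "%n. p1 n t" "leb L"])
      fix e :: real assume e: "e > 0"
      from order_tendstoD(2)[OF tz, of "e/2"] e obtain M where M: "(\<Sum>j. nmL (d1 (j + M) t)) < e / 2" by (auto simp: eventually_sequentially)
      have "nmL (%x. p1 m t x - p1 n t x) < e" if "m >= M" "n >= M" for m n
        using tail[of M "m - M"] tail[of M "n - M"] that M nm_triangle_diff[OF pl(2)[OF t, of m] pl(2)[OF t, of M] pl(2)[OF t, of n]]
          nm_minus_commute[of "leb L" "p1 M t" "p1 n t"] by simp
      then show "\<exists>N. \<forall>m\<ge>N. \<forall>n\<ge>N. nmL (%x. p1 m t x - p1 n t x) < e" by blast
    qed (use pl(2)[OF t] in auto)
    have c1: "c1_0 L (p n t) (p1 n t)" for n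
      unfolding c1_0_def using c3_deriv(1)[OF kdv_c3[OF p t]] kdv_cont(3)[OF p t] kdv_bdry[OF p t] by auto
    have ap: "\<exists>h h1. c1_0 L h h1 & nmL (%x. y t x - h x) < e & nmL (%x. g x - h1 x) < e" if e: "e > 0" for e
    proof -
      have "\<forall>\<^sub>F n in sequentially. nmL (%x. p n t x - y t x) < e & nmL (%x. p1 n t x - g x) < e"
        using order_tendstoD(2)[OF y(2)[OF t] e] order_tendstoD(2)[OF g(2) e] by (rule eventually_conj)
      then obtain n where "nmL (%x. p n t x - y t x) < e" "nmL (%x. p1 n t x - g x) < e" by (auto simp: eventually_sequentially)
      then show ?thesis using c1[of n] nm_minus_commute[of "leb L" "y t" "p n t"] nm_minus_commute[of "leb L" g "p1 n t"]
        by (intro exI[of _ "p n t"] exI[of _ "p1 n t"]) simp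
    qed
    note HH = H10_limit[OF y(1)[OF t] g(1) L_pos ap]
    have "(%n. (nmL (p n t))\<^sup>2 + (nmL (p1 n t))\<^sup>2) \<longlonglongrightarrow> (nmL (y t))\<^sup>2 + (nmL g)\<^sup>2"
      by (intro tendsto_add tendsto_power nm_tendsto[OF pl(1)[OF t] y(1)[OF t] y(2)[OF t]] nm_tendsto[OF pl(2)[OF t] g])
    then show ?thesis using HH by simp
  qed
  define X where "X n t = (nmL (p n t))\<^sup>2 + (nmL (p1 n t))\<^sup>2" for n t
  have Xc: "continuous_on {0..T} (X n)" for n unfolding X_def[abs_def] by (intro continuous_intros nmc[OF p])
  have Xm: "X n \<in> borel_measurable (leb T)" for n using leb_cont_integrable[OF Xc] by auto
  have Xlim: "AE t in leb T. (%n. X n t) \<longlonglongrightarrow> (H1_norm L (y t))\<^sup>2"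
    using good by eventually_elim (use H in \<open>auto simp: X_def\<close>)
  \<comment> \<open>The limit norm need not depend continuously on t; it is measurable as an almost
    everywhere limit of continuous functions, and Fatou below makes it integrable.\<close>
  have Hm: "(%t. (H1_norm L (y t))\<^sup>2) \<in> borel_measurable (leb T)"
  proof -
    define Z where "Z t = lim (%n. X n t)" for t
    have [measurable]: "X n \<in> borel_measurable (leb T)" for n by (rule Xm)
    have "Z \<in> borel_measurable (leb T)" unfolding Z_def[abs_def] by measurable
    moreover have "AE t in leb T. Z t = (H1_norm L (y t))\<^sup>2"
      using Xlim by eventually_elim (simp add: Z_def limI)
    ultimately show ?thesis by (rule leb_measurable_AE)
  qed
  have datalim: "(%n. (nmL (p n 0))\<^sup>2 + (nm (leb T) (%t. p1 n t L))\<^sup>2) \<longlonglongrightarrow> (nmL y0)\<^sup>2 + (nm (leb T) u)\<^sup>2"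
    by (rule tendsto_add[OF tendsto_power[OF nm_tendsto[OF pl(1)[OF mem(1)] y0 lim0(1)]] tendsto_power[OF nm_tendsto[OF tl(2) u lim0(2)]]])
  obtain B where B: "!!n. (nmL (p n 0))\<^sup>2 + (nm (leb T) (%t. p1 n t L))\<^sup>2 <= B"
  proof -
    have "Bseq (%n. (nmL (p n 0))\<^sup>2 + (nm (leb T) (%t. p1 n t L))\<^sup>2)"
      using datalim by (intro convergent_imp_Bseq) (auto simp: convergent_def)
    then obtain B where B: "\<forall>n. norm ((nmL (p n 0))\<^sup>2 + (nm (leb T) (%t. p1 n t L))\<^sup>2) <= B" unfolding Bseq_def by blast
    have "(nmL (p n 0))\<^sup>2 + (nm (leb T) (%t. p1 n t L))\<^sup>2 <= B" for n
      using spec[OF B, of n] abs_ge_self[of "(nmL (p n 0))\<^sup>2 + (nm (leb T) (%t. p1 n t L))\<^sup>2"] by (simp only: real_norm_def)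
    then show ?thesis by (rule that)
  qed
  have XI: "integral {0..T} (X n) <= (T + K) * B" for n
  proof -
    have "integral {0..T} (X n) = integral {0..T} (%t. (nmL (p n t))\<^sup>2) + integral {0..T} (%t. (nmL (p1 n t))\<^sup>2)"
      unfolding X_def by (rule Henstock_Kurzweil_Integration.integral_add) (auto intro!: integrable_continuous_real nmc[OF p])
    moreover have "integral {0..T} (%t. (nmL (p n t))\<^sup>2) <= integral {0..T} (%t. B)"
      by (rule integral_le) (use order_trans[OF en(1)[OF p] B] nmc(1)[OF p] in \<open>auto intro!: integrable_continuous_real\<close>)
    moreover have "integral {0..T} (%t. (nmL (p1 n t))\<^sup>2) <= K * B"
      using order_trans[OF kato[OF p] mult_left_mono[OF B]] K by simp
    ultimately show ?thesis using T by (simp add: algebra_simps)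
  qed
  have Hi: "integrable (leb T) (%t. (H1_norm L (y t))\<^sup>2)"
  proof (rule integrableI_bounded[OF Hm])
    have "(\<integral>\<^sup>+t. ennreal (norm ((H1_norm L (y t))\<^sup>2)) \<partial>leb T) = (\<integral>\<^sup>+t. liminf (%n. ennreal (X n t)) \<partial>leb T)"
    proof (rule nn_integral_cong_AE)
      show "AE t in leb T. ennreal (norm ((H1_norm L (y t))\<^sup>2)) = liminf (%n. ennreal (X n t))"
        using Xlim
      proof eventually_elim
        case (elim t)
        have "liminf (%n. ennreal (X n t)) = ennreal ((H1_norm L (y t))\<^sup>2)"
          by (rule lim_imp_Liminf[OF sequentially_bot tendsto_ennrealI[OF elim]])
        then show ?case by simp
      qed
    qed
    also have "\<dots> <= liminf (%n. \<integral>\<^sup>+t. ennreal (X n t) \<partial>leb T)"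
      by (rule nn_integral_liminf) (use Xm in measurable)
    also have "\<dots> <= ennreal ((T + K) * B)"
    proof (rule order_trans[OF Liminf_mono Liminf_const[THEN eq_refl]])
      show "\<forall>\<^sub>F n in sequentially. (\<integral>\<^sup>+t. ennreal (X n t) \<partial>leb T) <= ennreal ((T + K) * B)"
        by (rule always_eventually, subst nn[OF Xc]) (use XI in \<open>auto simp: X_def intro!: ennreal_leI\<close>)
    qed simp
    also have "\<dots> < \<infinity>" by simp
    finally show "(\<integral>\<^sup>+t. ennreal (norm ((H1_norm L (y t))\<^sup>2)) \<partial>leb T) < \<infinity>" .
  qed
  have yXT: "y \<in> XT L T" unfolding XT_def L2_eq L2_norm_eq
  proof (intro CollectI conjI ballI)
    show "AE t in leb T. y t \<in> H10 L" using good by eventually_elim (use H in blast)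
  qed (use y(1) cy Hi in auto)
  have ipt: "(%n. ip (leb T) (%t. p1 n t L) f) \<longlonglongrightarrow> ip (leb T) u f" "(%n. ip (leb T) (%t. p1 n t 0) f) \<longlonglongrightarrow> ip (leb T) v f"
    if "continuous_on {0..T} f" for f
    by (rule ip_tendsto[OF tl(2) u cont_l2[OF that] lim0(2)], rule ip_tendsto[OF tl(1) v(1) cont_l2[OF that] v(2)])
  have weak: "kdv_weak_solution L T y0 u y" unfolding kdv_weak_solution_def
  proof (intro conjI allI impI yXT, elim conjE)
    fix \<phi> assume C: "Ck_on_rect 3 T L \<phi>" and b: "\<forall>t\<in>{0..T}. \<phi> t 0 = 0 & \<phi> t L = 0 & Dx L \<phi> t 0 = 0" and e: "\<forall>x\<in>{0..L}. \<phi> T x = 0"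
    define k where "k t x = Dt T \<phi> t x + Dx L \<phi> t x + Dx L (Dx L (Dx L \<phi>)) t x" for t x
    have q: "kdv T L k \<phi> (Dx L \<phi>) (Dx L (Dx L \<phi>)) (Dx L (Dx L (Dx L \<phi>)))"
      unfolding k_def[abs_def] by (rule Ck3_kdv[OF C _ T L_pos]) (use b in auto)
    have kl: "k t \<in> l2 (leb L)" if "t \<in> {0..T}" for t by (rule cont_l2[OF kdv_cont(1)[OF q that]])
    have kc: "continuous_on {0..T} (%r. ipL (p n r) (k r))" for n
    proof -
      have "continuous_on {0..T} (%r. integral {0..L} (%x. p n r x * k r x))"
        by (rule param_integral_cont) (intro continuous_intros kdv_joint(2)[OF p] kdv_joint(1)[OF q])
      then show ?thesis by (rule continuous_on_eq) (use ip_cont[OF kdv_cont(2)[OF p] kdv_cont(1)[OF q]] in auto)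
    qed
    have pair: "integral {0..T} (%r. p1 n r L * Dx L \<phi> r L) + integral {0..T} (%r. ipL (p n r) (k r)) + ipL (p n 0) (\<phi> 0) = 0" for n
    proof -
      have "ipL (p n T) (\<phi> T) - ipL (p n 0) (\<phi> 0) = integral {0..T} (%r. p1 n r L * Dx L \<phi> r L - p1 n r 0 * Dx L \<phi> r 0
          + ipL (%_. 0) (\<phi> r) + ipL (p n r) (k r))"
        using kdv_pair[OF p q L_pos order_refl] T by simp
      also have "\<dots> = integral {0..T} (%r. p1 n r L * Dx L \<phi> r L + ipL (p n r) (k r))"
        by (rule Henstock_Kurzweil_Integration.integral_cong) (use b in simp)
      also have "\<dots> = integral {0..T} (%r. p1 n r L * Dx L \<phi> r L) + integral {0..T} (%r. ipL (p n r) (k r))"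
        by (rule Henstock_Kurzweil_Integration.integral_add)
           (auto intro!: integrable_continuous_real continuous_intros kc tr kdv_trace_cont[OF q L_pos])
      also have "ipL (p n T) (\<phi> T) = ipL (p n T) (%_. 0)" by (rule ip_cong_on) (use e in auto)
      finally show ?thesis by simp
    qed
    have "compact ((%r. (nmL (k r))\<^sup>2) ` {0..T})"
    proof (intro compact_continuous_image compact_Icc)
      have "continuous_on {0..T} (%r. integral {0..L} (%x. k r x * k r x))"
        by (rule param_integral_cont) (intro continuous_intros kdv_joint(1)[OF q])
      then show "continuous_on {0..T} (%r. (nmL (k r))\<^sup>2)"
        unfolding nm_sq by (rule continuous_on_eq) (use ip_cont[OF kdv_cont(1)[OF q] kdv_cont(1)[OF q]] in auto)
    qed
    then have "bounded ((%r. (nmL (k r))\<^sup>2) ` {0..T})" by (rule compact_imp_bounded)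
    then obtain Bk where "\<forall>z\<in>(%r. (nmL (k r))\<^sup>2) ` {0..T}. norm z <= Bk" unfolding bounded_iff by blast
    then have Bk: "nmL (k r) <= sqrt Bk" if "r \<in> {0..T}" for r using that by (auto intro!: real_le_rsqrt)
    \<comment> \<open>States converge uniformly in time, so the paired integrands do as well; this
      also shows that the integrand of the weak formulation is continuous in t.\<close>
    have ul: "uniform_limit {0..T} (%n r. ipL (p n r) (k r)) (%r. ipL (y r) (k r)) sequentially"
    proof (rule uniform_limitI)
      fix e :: real assume e: "e > 0"
      have "(%n. 2 * (1/4) ^ n * sqrt Bk) \<longlonglongrightarrow> 2 * 0 * sqrt Bk" by (intro tendsto_mult tendsto_const LIMSEQ_realpow_zero) auto
      then have "\<forall>\<^sub>F n in sequentially. 2 * (1/4) ^ n * sqrt Bk < e" using e by (intro order_tendstoD(2)) auto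
      then show "\<forall>\<^sub>F n in sequentially. \<forall>r\<in>{0..T}. dist (ipL (p n r) (k r)) (ipL (y r) (k r)) < e"
      proof eventually_elim
        case (elim n)
        show ?case
        proof
          fix r assume r: "r \<in> {0..T}"
          have "\<bar>ipL (p n r) (k r) - ipL (y r) (k r)\<bar> = \<bar>ipL (%x. p n r x - y r x) (k r)\<bar>"
            using ip_diff_left[OF pl(1)[OF r] y(1)[OF r] kl[OF r]] by simp
          also have "\<dots> <= nmL (%x. p n r x - y r x) * nmL (k r)" by (rule ip_le_nm[OF l2_diff[OF pl(1)[OF r] y(1)[OF r]] kl[OF r]])
          also have "\<dots> <= 2 * (1/4) ^ n * sqrt Bk" using unif[OF r] Bk[OF r] by (intro mult_mono) auto
          finally show "dist (ipL (p n r) (k r)) (ipL (y r) (k r)) < e" using elim by (simp add: dist_real_def)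
        qed
      qed
    qed
    have yc: "continuous_on {0..T} (%r. ipL (y r) (k r))"
      by (rule uniform_limit_theorem[OF _ ul]) (use kc in auto)
    obtain I J where IJ: "!!n. ((%r. ipL (p n r) (k r)) has_integral I n) {0..T}"
      "((%r. ipL (y r) (k r)) has_integral J) {0..T}" "(I \<longlongrightarrow> J) sequentially"
      using uniform_limit_integral[OF ul kc sequentially_bot] by blast
    have l1: "(%n. integral {0..T} (%r. ipL (p n r) (k r))) \<longlonglongrightarrow> integral {0..T} (%r. ipL (y r) (k r))"
      unfolding integral_unique[OF IJ(1)] integral_unique[OF IJ(2)] by (rule IJ(3))
    have trc: "continuous_on {0..T} (%t. Dx L \<phi> t L)" by (rule kdv_trace_cont(2)[OF q L_pos])
    have l2: "(%n. integral {0..T} (%r. p1 n r L * Dx L \<phi> r L)) \<longlonglongrightarrow> ip (leb T) u (%t. Dx L \<phi> t L)"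
      using ipt(1)[OF trc] unfolding ip_cont[OF tr(2) trc] .
    have l3: "(%n. ipL (p n 0) (\<phi> 0)) \<longlonglongrightarrow> ipL y0 (\<phi> 0)"
      by (rule ip_tendsto[OF pl(1)[OF mem(1)] y0 cont_l2[OF kdv_cont(2)[OF q mem(1)]] lim0(1)])
    have "(%n. 0) \<longlonglongrightarrow> ip (leb T) u (%t. Dx L \<phi> t L) + integral {0..T} (%r. ipL (y r) (k r)) + ipL y0 (\<phi> 0)"
      using tendsto_add[OF tendsto_add[OF l2 l1] l3] unfolding pair .
    then have "ip (leb T) u (%t. Dx L \<phi> t L) + integral {0..T} (%r. ipL (y r) (k r)) + ipL y0 (\<phi> 0) = 0"
      unfolding LIMSEQ_const_iff by simp
    moreover have "(LINT t|leb T. LINT x|leb L. y t x * (Dt T \<phi> t x + Dx L \<phi> t x + Dx L (Dx L (Dx L \<phi>)) t x)) = integral {0..T} (%r. ipL (y r) (k r))"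
      using leb_cont_integral[OF yc] by (simp add: ip_def k_def)
    ultimately show "- (LINT t|leb T. LINT x|leb L. y t x * (Dt T \<phi> t x + Dx L \<phi> t x + Dx L (Dx L (Dx L \<phi>)) t x))
        - (LINT x|leb L. y0 x * \<phi> 0 x) - (LINT t|leb T. u t * Dx L \<phi> t L) = 0" by (simp add: ip_def)
  qed
  have vb: "(nm (leb T) v)\<^sup>2 <= (nmL y0)\<^sup>2 + (nm (leb T) u)\<^sup>2"
  proof (rule LIMSEQ_le)
    show "(%n. (nm (leb T) (%t. p1 n t 0))\<^sup>2) \<longlonglongrightarrow> (nm (leb T) v)\<^sup>2" by (rule tendsto_power[OF nm_tendsto[OF tl(1) v]])
    show "(%n. (nmL (p n 0))\<^sup>2 + (nm (leb T) (%t. p1 n t L))\<^sup>2) \<longlonglongrightarrow> (nmL y0)\<^sup>2 + (nm (leb T) u)\<^sup>2"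
      by (rule datalim)
    show "\<exists>N. \<forall>n\<ge>N. (nm (leb T) (%t. p1 n t 0))\<^sup>2 <= (nmL (p n 0))\<^sup>2 + (nm (leb T) (%t. p1 n t L))\<^sup>2"
      using en(2)[OF p mem(1)] by blast
  qed
  have dual: "ipL (y T) (q T) - ipL y0 (q 0) = ip (leb T) u (%t. q1 t L) - ip (leb T) v (%t. q1 t 0)"
    if q: "kdv0 T L q q1 q2 q3" for q q1 q2 q3
  proof -
    note c = kdv_trace_cont[OF q L_pos]
    have ql: "q T \<in> l2 (leb L)" "q 0 \<in> l2 (leb L)" using cont_l2[OF kdv_cont(2)[OF q]] mem by blast+
    have eq: "ipL (p n T) (q T) - ipL (p n 0) (q 0) = ip (leb T) (%t. p1 n t L) (%t. q1 t L) - ip (leb T) (%t. p1 n t 0) (%t. q1 t 0)" for n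
    proof -
      have "ipL (p n T) (q T) - ipL (p n 0) (q 0) = integral {0..T} (%r. p1 n r L * q1 r L - p1 n r 0 * q1 r 0)"
        using kdv0_pair[OF p q L_pos order_refl] T by simp
      also have "\<dots> = integral {0..T} (%r. p1 n r L * q1 r L) - integral {0..T} (%r. p1 n r 0 * q1 r 0)"
        by (rule Henstock_Kurzweil_Integration.integral_diff) (auto intro!: integrable_continuous_real continuous_intros tr c)
      finally show ?thesis unfolding ip_cont[OF tr(2) c(2)] ip_cont[OF tr(1) c(1)] .
    qed
    have 1: "(%n. ipL (p n T) (q T) - ipL (p n 0) (q 0)) \<longlonglongrightarrow> ipL (y T) (q T) - ipL y0 (q 0)"
      by (intro tendsto_diff ip_tendsto[OF pl(1)[OF mem(2)] y(1)[OF mem(2)] ql(1) y(2)[OF mem(2)]] ip_tendsto[OF pl(1)[OF mem(1)] y0 ql(2) lim0(1)])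
    have 2: "(%n. ipL (p n T) (q T) - ipL (p n 0) (q 0)) \<longlonglongrightarrow> ip (leb T) u (%t. q1 t L) - ip (leb T) v (%t. q1 t 0)"
      unfolding eq by (intro tendsto_diff ipt c)
    show ?thesis by (rule LIMSEQ_unique[OF 1 2])
  qed
  show ?thesis by (rule concl[OF weak v(1) vb dual])
qed

end

lemma reflect_deriv:
  fixes f :: "real => real"
  assumes "(f has_real_derivative d) (at (c - x) within {0..c})"
  shows "((%x. f (c - x)) has_real_derivative - d) (at x within {0..c})"
proof -
  have "(f has_real_derivative d) (at (c - x) within (%x. c - x) ` {0..c})" by (rule DERIV_subset[OF assms]) auto
  moreover have "((%x. c - x) has_real_derivative - 1) (at x within {0..c})" by (rule derivative_eq_intros refl)+ simp
  ultimately have "(f \<circ> (%x. c - x) has_real_derivative d * - 1) (at x within {0..c})" by (rule DERIV_image_chain)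
  then show ?thesis by (simp add: o_def)
qed

text \<open>All derivatives in the equation have odd order, so reversing time and space together
  preserves it. The reflection exchanges the two traces and the initial with the final state, which
  lets \<open>trace_dense\<close> speak about final states and the trace at 0.\<close>

lemma kdv_reflect:
  assumes p: "kdv0 T L p p1 p2 p3"
  shows "kdv0 T L (%t x. p (T - t) (L - x)) (%t x. - p1 (T - t) (L - x)) (%t x. p2 (T - t) (L - x)) (%t x. - p3 (T - t) (L - x))"
proof -
  have c: "continuous_on ({0..T} \<times> {0..L}) (%z. h (T - fst z) (L - snd z))"
    if "continuous_on ({0..T} \<times> {0..L}) (%z. h (fst z) (snd z))" for h :: "real => real => real"
  proof -
    have 1: "continuous_on ({0..T} \<times> {0..L}) (%z. (T - fst z, L - snd z))" by (intro continuous_intros)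
    have 2: "(%z. (T - fst z, L - snd z)) ` ({0..T} \<times> {0..L}) \<subseteq> {0..T} \<times> {0..L}" by auto
    show ?thesis using continuous_on_compose[OF 1 continuous_on_subset[OF that 2]] by (simp add: o_def)
  qed
  note J = kdv_joint[OF p]
  show ?thesis unfolding kdv_def case_prod_unfold
  proof (intro conjI ballI)
    fix t x assume t: "t \<in> {0..T}" and x: "x \<in> {0..L}"
    have t': "T - t \<in> {0..T}" and x': "L - x \<in> {0..L}" using t x by auto
    note D = c3_deriv[OF kdv_c3[OF p t'] x'] and B = kdv_bdry[OF p t'] and E = kdv_dt[OF p t' x']
    show "((%x. p (T - t) (L - x)) has_real_derivative - p1 (T - t) (L - x)) (at x within {0..L})" by (rule reflect_deriv[OF D(1)])
    show "((%x. - p1 (T - t) (L - x)) has_real_derivative p2 (T - t) (L - x)) (at x within {0..L})"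
      using DERIV_minus[OF reflect_deriv[OF D(2)]] by simp
    show "((%x. p2 (T - t) (L - x)) has_real_derivative - p3 (T - t) (L - x)) (at x within {0..L})" by (rule reflect_deriv[OF D(3)])
    show "((%s. p (T - s) (L - x)) has_real_derivative 0 - - p1 (T - t) (L - x) - - p3 (T - t) (L - x)) (at t within {0..T})"
      using reflect_deriv[OF E] by (simp add: add.commute)
  next
    fix t assume "t \<in> {0..T}"
    then have t': "T - t \<in> {0..T}" by auto
    show "p (T - t) (L - 0) = 0" "p (T - t) (L - L) = 0" using kdv_bdry[OF p t'] by simp_all
  qed (intro continuous_intros c J)+
qed

section \<open>Null controllability with one control\<close>

context noncritical
begin

text \<open>Observability makes q(0) a bounded functional of the two traces, and Riesz returns u and
  v of the required size. The weak solution driven by u has a trace of its own at x = 0 instead of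
  the prescribed -v; that this difference is harmless is the content of the density step.\<close>

theorem null_control:
  assumes "T0 > 0"
  obtains C c where "C > 0" "c > 0" "!!T y0. 0 < T ==> T < T0 ==> y0 \<in> l2 (leb L) ==>
    \<exists>u\<in>l2 (leb T). (\<exists>y. kdv_weak_solution L T y0 u y & (AE x in leb L. y T x = 0)) & nm (leb T) u <= C * exp (c / sqrt T) * nmL y0"
proof -
  obtain C c where C: "C > 0" "c > 0" "!!T p p1 p2 p3. 0 < T ==> T < T0 ==> kdv0 T L p p1 p2 p3 ==>
     nmL (p 0) <= C * exp (c / sqrt T) * sqrt (integral {0..T} (%r. (p1 r 0)\<^sup>2 + (p1 r L)\<^sup>2))"
    using observability[OF assms] by blast
  have main: "\<exists>u\<in>l2 (leb T). (\<exists>y. kdv_weak_solution L T y0 u y & (AE x in leb L. y T x = 0)) & nm (leb T) u <= C * exp (c / sqrt T) * nmL y0"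
    if T: "0 < T" "T < T0" and y0: "y0 \<in> l2 (leb L)" for T y0
  proof -
    define D where "D = {((%t. q1 t L), (%t. q1 t 0), - ipL y0 (q 0)) |q q1 q2 q3. kdv0 T L q q1 q2 q3}"
    have mem: "0 \<in> {0..T}" "T \<in> {0..T}" using T by auto
    have l: "(%t. q1 t L) \<in> l2 (leb T)" "(%t. q1 t 0) \<in> l2 (leb T)" "q 0 \<in> l2 (leb L)" "q T \<in> l2 (leb L)"
      if q: "kdv0 T L q q1 q2 q3" for q q1 q2 q3
      using cont_l2[OF kdv_trace_cont(2)[OF q L_pos]] cont_l2[OF kdv_trace_cont(1)[OF q L_pos]]
        cont_l2[OF kdv_cont(2)[OF q mem(1)]] cont_l2[OF kdv_cont(2)[OF q mem(2)]] by auto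
    define K where "K = C * exp (c / sqrt T) * nmL y0"
    have K0: "K >= 0" using C(1) by (simp add: K_def)
    obtain u v ds es where R: "u \<in> l2 (leb T)" "v \<in> l2 (leb T)"
      "sqrt ((nm (leb T) u)\<^sup>2 + (nm (leb T) v)\<^sup>2) <= K | nm (leb T) u = 0 & nm (leb T) v = 0"
      "!!d e r. (d, e, r) \<in> D ==> ip (leb T) u d + ip (leb T) v e = r"
    proof (rule l2_riesz_pair[of D T T K])
      have "((%t. 0), (%t. 0), - ipL y0 (%x. 0)) \<in> D"
        unfolding D_def using kdv_exp[of T L 0 0] by (auto intro!: exI[of _ "%_ _. 0"])
      then show "D ~= {}" by blast
      show "!!d e r. (d, e, r) \<in> D ==> d \<in> l2 (leb T) & e \<in> l2 (leb T)" using l unfolding D_def by blast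
      show "((%x. a * d x + b * d' x), (%x. a * e x + b * e' x), a * r + b * r') \<in> D"
        if "(d, e, r) \<in> D" "(d', e', r') \<in> D" for d e r d' e' r' a b
      proof -
        obtain p p1 p2 p3 where p: "kdv0 T L p p1 p2 p3" "d = (%t. p1 t L)" "e = (%t. p1 t 0)" "r = - ipL y0 (p 0)"
          using \<open>(d, e, r) \<in> D\<close> unfolding D_def by blast
        obtain q q1 q2 q3 where q: "kdv0 T L q q1 q2 q3" "d' = (%t. q1 t L)" "e' = (%t. q1 t 0)" "r' = - ipL y0 (q 0)"
          using \<open>(d', e', r') \<in> D\<close> unfolding D_def by blast
        have eq: "a * r + b * r' = - ipL y0 (%x. a * p 0 x + b * q 0 x)"
          unfolding p q using ip_lin_right[OF l(3)[OF p(1)] l(3)[OF q(1)] y0] by (simp add: algebra_simps)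
        define P P1 P2 P3 where P: "P = (%t x. a * p t x + b * q t x)" "P1 = (%t x. a * p1 t x + b * q1 t x)"
          "P2 = (%t x. a * p2 t x + b * q2 t x)" "P3 = (%t x. a * p3 t x + b * q3 t x)"
        have "kdv0 T L P P1 P2 P3" unfolding P by (rule kdv0_lin[OF p(1) q(1)])
        then have "((%t. P1 t L), (%t. P1 t 0), - ipL y0 (P 0)) \<in> D" unfolding D_def by blast
        then show ?thesis unfolding eq p(2,3) q(2,3) P .
      qed
      show "\<bar>r\<bar> <= K * sqrt ((nm (leb T) d)\<^sup>2 + (nm (leb T) e)\<^sup>2)" if der: "(d, e, r) \<in> D" for d e r
      proof -
        obtain q q1 q2 q3 where q: "kdv0 T L q q1 q2 q3" "d = (%t. q1 t L)" "e = (%t. q1 t 0)" "r = - ipL y0 (q 0)"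
          using der unfolding D_def by blast
        note tc = kdv_trace_cont[OF q(1) L_pos]
        have "(nm (leb T) d)\<^sup>2 + (nm (leb T) e)\<^sup>2 = integral {0..T} (%t. q1 t L * q1 t L) + integral {0..T} (%t. q1 t 0 * q1 t 0)"
          unfolding nm_sq q ip_cont[OF tc(2) tc(2)] ip_cont[OF tc(1) tc(1)] ..
        also have "\<dots> = integral {0..T} (%r. q1 r L * q1 r L + q1 r 0 * q1 r 0)"
          by (rule Henstock_Kurzweil_Integration.integral_add[symmetric]) (auto intro!: integrable_continuous_real continuous_intros tc)
        also have "\<dots> = integral {0..T} (%r. (q1 r 0)\<^sup>2 + (q1 r L)\<^sup>2)" by (simp add: power2_eq_square add.commute)
        finally have e: "(nm (leb T) d)\<^sup>2 + (nm (leb T) e)\<^sup>2 = integral {0..T} (%r. (q1 r 0)\<^sup>2 + (q1 r L)\<^sup>2)" .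
        have "\<bar>r\<bar> <= nmL y0 * nmL (q 0)" unfolding q(4) using ip_le_nm[OF y0 l(3)[OF q(1)]] by simp
        also have "\<dots> <= nmL y0 * (C * exp (c / sqrt T) * sqrt (integral {0..T} (%r. (q1 r 0)\<^sup>2 + (q1 r L)\<^sup>2)))"
          by (intro mult_left_mono C(3)[OF T q(1)]) simp
        finally show ?thesis unfolding e K_def by (simp add: mult_ac)
      qed
    qed blast
    obtain y w where y: "kdv_weak_solution L T y0 u y" "w \<in> l2 (leb T)" "(nm (leb T) w)\<^sup>2 <= (nmL y0)\<^sup>2 + (nm (leb T) u)\<^sup>2"
      "!!q q1 q2 q3. kdv0 T L q q1 q2 q3 ==> ipL (y T) (q T) - ipL y0 (q 0) = ip (leb T) u (%t. q1 t L) - ip (leb T) w (%t. q1 t 0)"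
      using closure_solution[OF y0 R(1) T(1)] by blast
    have yT: "y T \<in> l2 (leb L)" using y(1) mem by (auto simp: kdv_weak_solution_def XT_def L2_eq)
    \<comment> \<open>Subtracting the Riesz identity from the duality identity leaves only this
      combination: the final state paired with q(T) is minus \<open>g\<close> paired with the slope
      of q at 0.\<close>
    define g where "g t = v t + w t" for t
    have gl: "g \<in> l2 (leb T)" unfolding g_def[abs_def] by (rule l2_add[OF R(2) y(2)])
    have id: "ipL (y T) (q T) = - ip (leb T) g (%t. q1 t 0)" if q: "kdv0 T L q q1 q2 q3" for q q1 q2 q3
    proof -
      have "((%t. q1 t L), (%t. q1 t 0), - ipL y0 (q 0)) \<in> D" unfolding D_def using q by blast
      from R(4)[OF this] y(4)[OF q] ip_lin_left[OF R(2) y(2) l(2)[OF q], of 1 1] show ?thesis by (simp add: g_def[abs_def])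
    qed
    \<comment> \<open>After reflection these are solutions whose final state tends to
      \<open>y T\<close> while their slope at x = 0 tends to 0, so the identity gives |y(T)|^2 = 0
      in the limit.\<close>
    obtain p p1 p2 p3 where p: "!!n::nat. kdv0 T L (p n) (p1 n) (p2 n) (p3 n)"
      "(%n. nmL (%x. p n 0 x - y T (L - x))) \<longlonglongrightarrow> 0" "(%n. nm (leb T) (%t. p1 n t L - 0)) \<longlonglongrightarrow> 0"
      using trace_dense[OF reflect_l2(1)[OF yT] l2_zero T(1)] by blast
    have "ipL (%x. p n 0 (L - x)) (y T) = ip (leb T) g (%t. p1 n (T - t) L)" for n
    proof -
      have "ipL (y T) (%x. p n (T - T) (L - x)) = - ip (leb T) g (%t. - p1 n (T - t) (L - 0))"
        by (rule id[OF kdv_reflect[OF p(1)]])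
      then show ?thesis by (simp add: ip_def mult.commute)
    qed
    moreover have "(%n. ipL (%x. p n 0 (L - x)) (y T)) \<longlonglongrightarrow> ipL (y T) (y T)"
    proof (rule ip_tendsto[OF _ yT yT])
      show "(%x. p n 0 (L - x)) \<in> l2 (leb L)" for n by (rule reflect_l2(1)[OF l(3)[OF p(1)]])
      have "nmL (%x. p n 0 (L - x) - y T x) = nmL (%x. p n 0 x - y T (L - x))" for n
        using reflect_l2(2)[OF l2_diff[OF l(3)[OF p(1)] reflect_l2(1)[OF yT]]] by simp
      then show "(%n. nmL (%x. p n 0 (L - x) - y T x)) \<longlonglongrightarrow> 0" using p(2) by simp
    qed
    moreover have "(%n. ip (leb T) g (%t. p1 n (T - t) L)) \<longlonglongrightarrow> 0"
    proof (rule Lim_null_comparison)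
      have "\<bar>ip (leb T) g (%t. p1 n (T - t) L)\<bar> <= nm (leb T) g * nm (leb T) (%t. p1 n t L - 0)" for n
        using ip_le_nm[OF gl reflect_l2(1)[OF l(1)[OF p(1)]]] reflect_l2(2)[OF l(1)[OF p(1)]] by simp
      then show "\<forall>\<^sub>F n in sequentially. norm (ip (leb T) g (%t. p1 n (T - t) L)) <= nm (leb T) g * nm (leb T) (%t. p1 n t L - 0)" by simp
      show "(%n. nm (leb T) g * nm (leb T) (%t. p1 n t L - 0)) \<longlonglongrightarrow> 0" using tendsto_mult[OF tendsto_const p(3)] by simp
    qed
    ultimately have "ipL (y T) (y T) = 0" using LIMSEQ_unique by simp
    then have "AE x in leb L. y T x = 0" by (intro nm_0_AE[OF yT]) (simp add: nm_def)
    moreover have "nm (leb T) u <= K"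
    proof -
      have "nm (leb T) u <= sqrt ((nm (leb T) u)\<^sup>2 + (nm (leb T) v)\<^sup>2)" by (rule real_le_rsqrt) simp
      then show ?thesis using R(3) K0 by (metis order_trans)
    qed
    ultimately show ?thesis using R(1) y(1) unfolding K_def by blast
  qed
  show ?thesis by (rule that[OF C(1,2) main])
qed

end

section \<open>Uniqueness of weak solutions\<close>

text \<open>The array of all mixed derivatives, i in time and j in space. Closing it under both
  differentiations makes the class C^k a plain induction on k.\<close>

definition deriv_family :: "real => real => (nat => nat => real => real => real) => bool" where
  "deriv_family T L h \<longleftrightarrow> (\<forall>i j. continuous_on ({0..T} \<times> {0..L}) (%(t, x). h i j t x) &
     (\<forall>t\<in>{0..T}. \<forall>x\<in>{0..L}. ((%s. h i j s x) has_real_derivative h (Suc i) j t x) (at t within {0..T}) &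
        (h i j t has_real_derivative h i (Suc j) t x) (at x within {0..L})))"

lemma deriv_family_vals:
  assumes F: "deriv_family T L h" and TL: "T > 0" "L > 0"
    and eq: "\<forall>t\<in>{0..T}. \<forall>x\<in>{0..L}. \<phi> t x = h i j t x" and tx: "t \<in> {0..T}" "x \<in> {0..L}"
  shows "((%s. \<phi> s x) has_vector_derivative h (Suc i) j t x) (at t within {0..T})"
    "(\<phi> t has_vector_derivative h i (Suc j) t x) (at x within {0..L})"
    "Dt T \<phi> t x = h (Suc i) j t x" "Dx L \<phi> t x = h i (Suc j) t x"
proof -
  have d: "((%s. h i j s x) has_vector_derivative h (Suc i) j t x) (at t within {0..T})"
    "(h i j t has_vector_derivative h i (Suc j) t x) (at x within {0..L})"
    using F tx unfolding deriv_family_def has_real_derivative_iff_has_vector_derivative by blast+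
  show 1: "((%s. \<phi> s x) has_vector_derivative h (Suc i) j t x) (at t within {0..T})"
    by (rule has_vector_derivative_transform[OF tx(1) _ d(1)]) (use eq tx in auto)
  show 2: "(\<phi> t has_vector_derivative h i (Suc j) t x) (at x within {0..L})"
    by (rule has_vector_derivative_transform[OF tx(2) _ d(2)]) (use eq tx in auto)
  show "Dt T \<phi> t x = h (Suc i) j t x" unfolding Dt_def
    using vector_derivative_within_cbox[of 0 T t] 1 tx TL by simp
  show "Dx L \<phi> t x = h i (Suc j) t x" unfolding Dx_def
    using vector_derivative_within_cbox[of 0 L x] 2 tx TL by simp
qed

lemma deriv_family_Ck:
  assumes F: "deriv_family T L h" and TL: "T > 0" "L > 0"
    and eq: "\<forall>t\<in>{0..T}. \<forall>x\<in>{0..L}. \<phi> t x = h i j t x"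
  shows "Ck_on_rect k T L \<phi>"
  using eq
proof (induction k arbitrary: \<phi> i j)
  case (0 \<phi> i j)
  have "continuous_on ({0..T} \<times> {0..L}) (%(t, x). h i j t x)" using F by (simp add: deriv_family_def)
  then have "continuous_on ({0..T} \<times> {0..L}) (%(t, x). \<phi> t x)"
    by (rule continuous_on_eq) (use 0 in auto)
  then show ?case by simp
next
  case (Suc k \<phi> i j)
  note V = deriv_family_vals[OF F TL Suc.prems]
  have "continuous_on ({0..T} \<times> {0..L}) (%(t, x). h i j t x)" using F by (simp add: deriv_family_def)
  then have c: "continuous_on ({0..T} \<times> {0..L}) (%(t, x). \<phi> t x)"
    by (rule continuous_on_eq) (use Suc.prems in auto)
  have d: "(%s. \<phi> s x) differentiable (at t within {0..T}) & \<phi> t differentiable (at x within {0..L})"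
    if "t \<in> {0..T}" "x \<in> {0..L}" for t x
    using V(1,2)[OF that] by (blast intro: differentiableI_vector)
  have "Ck_on_rect k T L (Dt T \<phi>)" by (rule Suc.IH[of _ "Suc i" j]) (use V(3) in blast)
  moreover have "Ck_on_rect k T L (Dx L \<phi>)" by (rule Suc.IH[of _ i "Suc j"]) (use V(4) in blast)
  ultimately show ?case using c d by simp
qed

lemma weak_identity:
  assumes w: "kdv_weak_solution L T y0 u y" and F: "deriv_family T L h" and TL: "T > 0" "L > 0"
    and b: "!!t. t \<in> {0..T} ==> h 0 0 t 0 = 0 & h 0 0 t L = 0 & h 0 1 t 0 = 0" "!!x. x \<in> {0..L} ==> h 0 0 T x = 0"
  shows "(LINT t|leb T. ip (leb L) (y t) (%x. h 1 0 t x + h 0 1 t x + h 0 3 t x))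
     + ip (leb L) y0 (h 0 0 0) + ip (leb T) u (%t. h 0 1 t L) = 0"
proof -
  define \<phi> where "\<phi> = h 0 0"
  have e0: "\<forall>t\<in>{0..T}. \<forall>x\<in>{0..L}. \<phi> t x = h 0 0 t x" by (simp add: \<phi>_def)
  note V = deriv_family_vals(3,4)[OF F TL]
  have dt: "\<forall>t\<in>{0..T}. \<forall>x\<in>{0..L}. Dt T \<phi> t x = h 1 0 t x" and d1: "\<forall>t\<in>{0..T}. \<forall>x\<in>{0..L}. Dx L \<phi> t x = h 0 1 t x"
    using V[OF e0] by simp_all
  have d2: "\<forall>t\<in>{0..T}. \<forall>x\<in>{0..L}. Dx L (Dx L \<phi>) t x = h 0 2 t x"
    using V(2)[OF d1] by (simp add: numeral_2_eq_2)
  have d3: "\<forall>t\<in>{0..T}. \<forall>x\<in>{0..L}. Dx L (Dx L (Dx L \<phi>)) t x = h 0 3 t x"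
    using V(2)[OF d2] by (simp add: numeral_3_eq_3 numeral_2_eq_2)
  have "Ck_on_rect 3 T L \<phi>" by (rule deriv_family_Ck[OF F TL e0])
  moreover have "\<forall>t\<in>{0..T}. \<phi> t 0 = 0 & \<phi> t L = 0 & Dx L \<phi> t 0 = 0" using b(1) d1 TL by (simp add: \<phi>_def)
  moreover have "\<forall>x\<in>{0..L}. \<phi> T x = 0" using b(2) by (simp add: \<phi>_def)
  ultimately have "- (LINT t|leb T. LINT x|leb L. y t x * (Dt T \<phi> t x + Dx L \<phi> t x + Dx L (Dx L (Dx L \<phi>)) t x))
        - (LINT x|leb L. y0 x * \<phi> 0 x) - (LINT t|leb T. u t * Dx L \<phi> t L) = 0"
    using w unfolding kdv_weak_solution_def by blast
  moreover have "(LINT t|leb T. LINT x|leb L. y t x * (Dt T \<phi> t x + Dx L \<phi> t x + Dx L (Dx L (Dx L \<phi>)) t x))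
     = (LINT t|leb T. ip (leb L) (y t) (%x. h 1 0 t x + h 0 1 t x + h 0 3 t x))"
    unfolding ip_def
    by (intro Bochner_Integration.integral_cong refl) (use dt d1 d3 in auto)
  moreover have "(LINT t|leb T. u t * Dx L \<phi> t L) = ip (leb T) u (%t. h 0 1 t L)"
    unfolding ip_def by (intro Bochner_Integration.integral_cong refl) (use d1 TL in auto)
  ultimately show ?thesis by (simp add: ip_def \<phi>_def)
qed

lemma XT_D:
  assumes "y \<in> XT L T"
  shows "t \<in> {0..T} ==> y t \<in> l2 (leb L)"
    "s \<in> {0..T} ==> ((%t. nm (leb L) (%x. y t x - y s x)) \<longlongrightarrow> 0) (at s within {0..T})"
  using assms by (auto simp: XT_def L2_eq L2_norm_eq)

lemma XT_pair_cont:
  assumes y: "y \<in> XT L T"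
  shows "continuous_on {0..T} (%t. pair L (y t) p)"
  unfolding continuous_on_def
proof
  fix s assume s: "s \<in> {0..T}"
  define N where "N = nm (leb L) (%x. norm (Wk L 0 p x))"
  show "((%t. pair L (y t) p) \<longlongrightarrow> pair L (y s) p) (at s within {0..T})"
  proof (rule Lim_null[THEN iffD2], rule Lim_null_comparison)
    show "\<forall>\<^sub>F t in at s within {0..T}. norm (pair L (y t) p - pair L (y s) p) <= nm (leb L) (%x. y t x - y s x) * N"
      unfolding eventually_at_filter
    proof (rule always_eventually, intro allI impI)
      fix t assume t: "t \<in> {0..T}"
      note l = XT_D(1)[OF y t] XT_D(1)[OF y s]
      have i: "integrable (leb L) (%x. of_real (f x) * Wk L 0 p x)" if "f \<in> l2 (leb L)" for f
        by (rule l2_integrable_mult_bounded[OF that]) (intro continuous_intros)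
      have "pair L (y t) p - pair L (y s) p = (LINT x|leb L. of_real (y t x - y s x) * Wk L 0 p x)"
        unfolding pair_def by (subst Bochner_Integration.integral_diff[OF i[OF l(1)] i[OF l(2)], symmetric]) (simp add: algebra_simps)
      then show "norm (pair L (y t) p - pair L (y s) p) <= nm (leb L) (%x. y t x - y s x) * N"
        unfolding N_def using pair_bound[OF l2_diff[OF l], of "Wk L 0 p"] by (simp add: continuous_intros)
    qed
    have "((%t. nm (leb L) (%x. y t x - y s x) * N) \<longlongrightarrow> 0 * N) (at s within {0..T})"
      by (intro tendsto_mult tendsto_const XT_D(2)[OF y s])
    then show "((%t. nm (leb L) (%x. y t x - y s x) * N) \<longlongrightarrow> 0) (at s within {0..T})" by simp
  qed
qed

text \<open>Since \<open>\<omega>\<^sub>p'(0) = 1\<close> for every \<open>p\<close>, the products \<open>\<theta>(t) (\<omega>\<^sub>p - \<omega>\<^sub>q)(x)\<close> with \<open>\<theta>(T) = 0\<close> are admissible test functions.\<close>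

definition omega :: "real => nat => complex => real => complex" where
  "omega L j p x = Wk L j p x / gk 0 p L"

definition theta :: "real => nat => complex => real => complex" where
  "theta T i p t = p ^ i * (exp (p * of_real t) * exp (- p * of_real T)) - (if i = 0 then 1 else 0)"

definition testh :: "real => real => complex => complex => complex => nat => nat => real => real => real" where
  "testh T L c p q i j t x = Re (c * (theta T i p t * (omega L j p x - omega L j q x)))"

lemma theta_deriv: "(theta T i p has_vector_derivative theta T (Suc i) p t) (at t within S)"
proof -
  have "((%z. p ^ i * (exp (p * z) * exp (- p * of_real T)) - (if i = 0 then 1 else 0)) has_field_derivative theta T (Suc i) p t) (at (of_real t))"
    unfolding theta_def by (rule derivative_eq_intros refl)+ simp
  then show ?thesis unfolding theta_def[abs_def] by (rule has_vector_derivative_real_field)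
qed

lemma omega_deriv: "(omega L j p has_vector_derivative omega L (Suc j) p x) (at x within S)"
  unfolding omega_def[abs_def] divide_inverse
  by (rule bounded_linear.has_vector_derivative[OF bounded_linear_mult_left Wk_deriv])

lemma omega_cont [continuous_intros]: "continuous_on A f ==> continuous_on A (%x. omega L j p (f x))"
  unfolding omega_def divide_inverse by (intro continuous_intros)

lemma theta_cont [continuous_intros]: "continuous_on A f ==> continuous_on A (%x. theta T j p (f x))"
  unfolding theta_def by (intro continuous_intros)

lemma testh_family: "deriv_family T L (testh T L c p q)"
  unfolding deriv_family_def case_prod_unfold
proof (intro allI conjI ballI)
  fix i j
  show "continuous_on ({0..T} \<times> {0..L}) (%z. testh T L c p q i j (fst z) (snd z))"
    unfolding testh_def by (intro continuous_intros)
  fix t x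
  have "((%s. c * (theta T i p s * (omega L j p x - omega L j q x))) has_vector_derivative
      c * (theta T (Suc i) p t * (omega L j p x - omega L j q x))) (at t within {0..T})"
    by (intro bounded_linear.has_vector_derivative[OF bounded_linear_mult_right]
        bounded_linear.has_vector_derivative[OF bounded_linear_mult_left] theta_deriv)
  from bounded_linear.has_vector_derivative[OF bounded_linear_Re this]
  show "((%s. testh T L c p q i j s x) has_real_derivative testh T L c p q (Suc i) j t x) (at t within {0..T})"
    unfolding testh_def has_real_derivative_iff_has_vector_derivative .
  have "((%x. c * (theta T i p t * (omega L j p x - omega L j q x))) has_vector_derivative
      c * (theta T i p t * (omega L (Suc j) p x - omega L (Suc j) q x))) (at x within {0..L})"
    by (intro bounded_linear.has_vector_derivative[OF bounded_linear_mult_right] has_vector_derivative_diff omega_deriv)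
  from bounded_linear.has_vector_derivative[OF bounded_linear_Re this]
  show "(testh T L c p q i j t has_real_derivative testh T L c p q i (Suc j) t x) (at x within {0..L})"
    unfolding testh_def[abs_def] has_real_derivative_iff_has_vector_derivative .
qed

definition opair :: "real => (real => real => real) => complex => real => complex" where
  "opair L y p t = pair L (y t) p / gk 0 p L"

lemma opair_cont: "y \<in> XT L T ==> continuous_on {0..T} (opair L y p)"
  unfolding opair_def[abs_def] divide_inverse by (intro continuous_intros XT_pair_cont)

text \<open>For the test function (e^(p(t-T)) - 1) (omega_p - omega_q) the terms with e^(p(t-T))
  omega_p cancel, and the residual is p omega_p - q omega_q + (q - p) e^(p(t-T)) omega_q. So the
  time integrals of two pairings are linked to the Laplace transform of one of them.\<close>

lemma weak_pair:
  assumes w: "kdv_weak_solution L T y0 u y" and TL: "T > 0" "L > 0" and g: "gk 0 p L ~= 0" "gk 0 q L ~= 0"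
  shows "Re (c * (p * (LINT t|leb T. opair L y p t) - q * (LINT t|leb T. opair L y q t)
      + (q - p) * (exp (- p * of_real T) * lap T (opair L y q) p)))
     + ip (leb L) y0 (testh T L c p q 0 0 0) + ip (leb T) u (%t. testh T L c p q 0 1 t L) = 0"
proof -
  let ?h = "testh T L c p q"
  have y: "y \<in> XT L T" using w by (simp add: kdv_weak_solution_def)
  have id: "(LINT t|leb T. ip (leb L) (y t) (%x. ?h 1 0 t x + ?h 0 1 t x + ?h 0 3 t x))
     + ip (leb L) y0 (?h 0 0 0) + ip (leb T) u (%t. ?h 0 1 t L) = 0"
    by (rule weak_identity[OF w testh_family TL])
       (use g in \<open>auto simp: testh_def omega_def theta_def exp_minus\<close>)
  define E where "E t = exp (p * of_real t) * exp (- p * of_real T)" for t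
  define K where "K t x = p * omega L 0 p x - q * omega L 0 q x + E t * (q - p) * omega L 0 q x" for t x
  define X where "X t = p * opair L y p t - q * opair L y q t + (q - p) * (exp (- p * of_real T) * (opair L y q t * exp (p * of_real t)))" for t
  have o3: "omega L 3 r x = - omega L 1 r x - r * omega L 0 r x" for r x
  proof -
    have "Wk L 3 r x = - Wk L 1 r x - r * Wk L 0 r x" using Wk_ode[of L 0 r x] by simp
    then show ?thesis by (simp only: omega_def diff_divide_distrib minus_divide_left times_divide_eq_right)
  qed
  have hK: "?h 1 0 t x + ?h 0 1 t x + ?h 0 3 t x = Re (c * K t x)" for t x
  proof -
    have t: "theta T 1 p t = p * E t" "theta T 0 p t = E t - 1" by (simp_all add: theta_def E_def)
    have "theta T 1 p t * (omega L 0 p x - omega L 0 q x) + theta T 0 p t * (omega L 1 p x - omega L 1 q x)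
       + theta T 0 p t * (omega L 3 p x - omega L 3 q x) = K t x"
      unfolding t o3 K_def by (simp add: algebra_simps)
    then show ?thesis unfolding testh_def plus_complex.simps(1)[symmetric] distrib_left[symmetric] by simp
  qed
  have inner: "ip (leb L) (y t) (%x. Re (c * K t x)) = Re (c * X t)" if t: "t \<in> {0..T}" for t
  proof -
    have yl: "y t \<in> l2 (leb L)" by (rule XT_D(1)[OF y t])
    have i: "integrable (leb L) (%x. of_real (y t x) * Wk L 0 r x)" for r
      by (rule l2_integrable_mult_bounded[OF yl]) (intro continuous_intros)
    have io: "integrable (leb L) (%x. of_real (y t x) * omega L 0 r x)" for r
      using i[of r] by (simp add: omega_def)
    have po: "(LINT x|leb L. of_real (y t x) * omega L 0 r x) = opair L y r t" for r
      by (simp add: omega_def opair_def pair_def)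
    have "ip (leb L) (y t) (%x. Re (c * K t x)) = Re (c * (LINT x|leb L. of_real (y t x) * K t x))"
      by (rule ip_Re[OF yl]) (unfold K_def, intro continuous_intros)
    also have "(LINT x|leb L. of_real (y t x) * K t x)
       = (LINT x|leb L. p * (of_real (y t x) * omega L 0 p x) - q * (of_real (y t x) * omega L 0 q x) + E t * (q - p) * (of_real (y t x) * omega L 0 q x))"
      by (intro Bochner_Integration.integral_cong refl) (simp add: K_def algebra_simps)
    also have "\<dots> = p * opair L y p t - q * opair L y q t + E t * (q - p) * opair L y q t"
      using io by (simp add: po)
    also have "\<dots> = X t" by (simp add: X_def E_def mult_ac)
    finally show ?thesis .
  qed
  have oi: "integrable (leb T) (opair L y r)" for r by (rule leb_cont_integrable[OF opair_cont[OF y]])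
  have ol: "integrable (leb T) (%t. opair L y q t * exp (p * of_real t))"
    by (rule lap_integrable[OF oi]) (intro continuous_intros)
  have Xi: "integrable (leb T) X" unfolding X_def[abs_def] using oi ol by simp
  have "(LINT t|leb T. ip (leb L) (y t) (%x. ?h 1 0 t x + ?h 0 1 t x + ?h 0 3 t x)) = (LINT t|leb T. Re (c * X t))"
    unfolding hK by (intro Bochner_Integration.integral_cong refl) (use inner in auto)
  also have "\<dots> = Re (LINT t|leb T. c * X t)" using Xi by (intro integral_Re) simp
  also have "(LINT t|leb T. c * X t) = c * (LINT t|leb T. X t)" by simp
  also have "(LINT t|leb T. X t) = p * (LINT t|leb T. opair L y p t) - q * (LINT t|leb T. opair L y q t)
      + (q - p) * (exp (- p * of_real T) * lap T (opair L y q) p)"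
    unfolding X_def[abs_def] lap_def using oi ol by simp
  finally show ?thesis using id by simp
qed

context noncritical
begin

text \<open>For the difference of two solutions the data drop out of \<open>weak_pair\<close>. With
  q fixed in the left half plane, the identity makes \<open>V q p\<close> decay as Re p tends to
  minus infinity, and it is bounded to the right since T bounds all times. Liouville gives
  \<open>V q\<close> = 0, hence vanishing pairings at q for all times, and completeness
  finishes.\<close>

theorem weak_solution_unique:
  assumes w: "kdv_weak_solution L T y0 u y" and w': "kdv_weak_solution L T y0 u y'" and T: "T > 0" and t: "t \<in> {0..T}"
  shows "AE x in leb L. y t x = y' t x"
proof -
  have y: "y \<in> XT L T" "y' \<in> XT L T" using w w' by (simp_all add: kdv_weak_solution_def)
  define G where "G p t = opair L y p t - opair L y' p t" for p t
  define z where "z t x = y t x - y' t x" for t x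
  have zl: "z t \<in> l2 (leb L)" if "t \<in> {0..T}" for t
    unfolding z_def[abs_def] by (rule l2_diff) (use XT_D(1)[OF y(1) that] XT_D(1)[OF y(2) that] in auto)
  have Gc: "continuous_on {0..T} (G p)" for p unfolding G_def[abs_def] by (intro continuous_intros opair_cont y)
  have Gi: "integrable (leb T) (G p)" for p by (rule leb_cont_integrable[OF Gc])
  have Gz: "G p t = pair L (z t) p / gk 0 p L" if "t \<in> {0..T}" for p t
  proof -
    have i: "integrable (leb L) (%x. of_real (f x) * Wk L 0 p x)" if "f \<in> l2 (leb L)" for f
      by (rule l2_integrable_mult_bounded[OF that]) (intro continuous_intros)
    have "pair L (z t) p = pair L (y t) p - pair L (y' t) p"
      unfolding pair_def z_def using i[OF XT_D(1)[OF y(1) that]] i[OF XT_D(1)[OF y(2) that]]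
      by (subst Bochner_Integration.integral_diff[symmetric]) (simp_all add: algebra_simps)
    then show ?thesis by (simp add: G_def opair_def diff_divide_distrib)
  qed
  define V where "V q p = exp (- p * of_real T) * lap T (G q) p" for q p
  have key: "p * (LINT t|leb T. G p t) - q * (LINT t|leb T. G q t) + (q - p) * V q p = 0"
    if "Re p < 0" "Re q < 0" for p q
  proof -
    have g: "gk 0 p L ~= 0" "gk 0 q L ~= 0" using Wk_norm_le(2)[OF L_pos] that by blast+
    have oi: "integrable (leb T) (opair L y r)" "integrable (leb T) (opair L y' r)" for r
      by (rule leb_cont_integrable[OF opair_cont[OF y(1)]], rule leb_cont_integrable[OF opair_cont[OF y(2)]])
    have ol: "integrable (leb T) (%t. opair L y q t * exp (p * of_real t))" "integrable (leb T) (%t. opair L y' q t * exp (p * of_real t))"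
      by (rule lap_integrable[OF oi(1)], intro continuous_intros, rule lap_integrable[OF oi(2)], intro continuous_intros)
    define A where "A y = p * (LINT t|leb T. opair L y p t) - q * (LINT t|leb T. opair L y q t)
      + (q - p) * (exp (- p * of_real T) * lap T (opair L y q) p)" for y
    have "A y - A y' = 0"
    proof (rule complex_zero_of_Re)
      fix c
      show "Re (c * (A y - A y')) = 0"
        using weak_pair[OF w T L_pos g, of c] weak_pair[OF w' T L_pos g, of c] unfolding A_def[symmetric]
        by (simp add: right_diff_distrib)
    qed
    have e1: "(LINT t|leb T. G r t) = (LINT t|leb T. opair L y r t) - (LINT t|leb T. opair L y' r t)" for r
      unfolding G_def using oi by simp
    have e2: "lap T (G q) p = lap T (opair L y q) p - lap T (opair L y' q) p"
      unfolding lap_def G_def left_diff_distrib using ol by simp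
    have "p * (LINT t|leb T. G p t) - q * (LINT t|leb T. G q t) + (q - p) * V q p = A y - A y'"
      unfolding A_def V_def e1 e2 by (simp add: algebra_simps)
    then show ?thesis using \<open>A y - A y' = 0\<close> by simp
  qed
  have "continuous_on {0..T} (%t. nmL (z t))" unfolding continuous_on_def
  proof
    fix s assume s: "s \<in> {0..T}"
    show "((%t. nmL (z t)) \<longlongrightarrow> nmL (z s)) (at s within {0..T})"
    proof (rule Lim_null[THEN iffD2], rule Lim_null_comparison)
      show "\<forall>\<^sub>F t in at s within {0..T}. norm (nmL (z t) - nmL (z s)) <= nmL (%x. y t x - y s x) + nmL (%x. y' t x - y' s x)"
        unfolding eventually_at_filter
      proof (rule always_eventually, intro allI impI)
        fix t assume t: "t \<in> {0..T}"
        note l = XT_D(1)[OF y(1) t] XT_D(1)[OF y(1) s] XT_D(1)[OF y(2) t] XT_D(1)[OF y(2) s]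
        have "\<bar>nmL (z t) - nmL (z s)\<bar> <= nmL (%x. z t x - z s x)" by (rule nm_reverse_triangle[OF zl[OF t] zl[OF s]])
        also have "(%x. z t x - z s x) = (%x. (y t x - y s x) + (y' s x - y' t x))" by (simp add: z_def algebra_simps fun_eq_iff)
        also have "nmL \<dots> <= nmL (%x. y t x - y s x) + nmL (%x. y' s x - y' t x)"
          by (rule nm_triangle[OF l2_diff[OF l(1,2)] l2_diff[OF l(4,3)]])
        finally show "norm (nmL (z t) - nmL (z s)) <= nmL (%x. y t x - y s x) + nmL (%x. y' t x - y' s x)"
          by (simp add: nm_minus_commute[of _ "y' t"])
      qed
      show "((%t. nmL (%x. y t x - y s x) + nmL (%x. y' t x - y' s x)) \<longlongrightarrow> 0) (at s within {0..T})"
        using tendsto_add[OF XT_D(2)[OF y(1) s] XT_D(2)[OF y(2) s]] by simp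
    qed
  qed
  then have "bounded ((%t. nmL (z t)) ` {0..T})" by (intro compact_imp_bounded compact_continuous_image compact_Icc)
  then obtain Z where "\<forall>r\<in>(%t. nmL (z t)) ` {0..T}. norm r <= Z" unfolding bounded_iff by blast
  then have Z: "nmL (z t) <= Z" if "t \<in> {0..T}" for t using that by auto
  have Z0: "Z >= 0" using order_trans[OF nm_nonneg Z[of 0]] T by simp
  \<comment> \<open>Normalising by the slope at 0 is what produces decay in the left half plane,
    uniformly in t because the norms of the states are bounded on [0,T].\<close>
  have GI: "norm (LINT t|leb T. G p t) <= T * Z / sqrt (2 * - Re p)" if p: "Re p < 0" for p
  proof -
    note W = Wk_norm_le(2)[OF L_pos p]
    have gb: "norm (G p t) <= Z / sqrt (2 * - Re p)" if t: "t \<in> {0..T}" for t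
    proof -
      have "norm (pair L (z t) p) <= nmL (z t) * nmL (%x. norm (Wk L 0 p x))"
        unfolding pair_def by (rule pair_bound[OF zl[OF t]]) (intro continuous_intros)
      also have "\<dots> <= Z * (norm (gk 0 p L) / sqrt (2 * - Re p))" using W Z[OF t] Z0 by (intro mult_mono) auto
      finally show ?thesis unfolding Gz[OF t] norm_divide using W by (simp add: field_simps)
    qed
    have "norm (LINT t|leb T. G p t) <= (LINT t|leb T. norm (G p t))" by simp
    also have "\<dots> <= (LINT t|leb T. Z / sqrt (2 * - Re p))"
      by (rule integral_mono) (use Gi gb in \<open>auto intro!: leb_cont_integrable\<close>)
    also have "\<dots> = T * (Z / sqrt (2 * - Re p))" using T by (subst leb_cont_integral) auto
    finally show ?thesis by simp
  qed
  have pz: "pair L (z t) q = 0" if q: "Re q < 0" and t: "t \<in> {0..T}" for q t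
  proof -
    define C where "C = norm (LINT t|leb T. G q t)"
    define I where "I = (LINT t|leb T. norm (G q t))"
    \<comment> \<open>The plane is split at Re p = Re q - 1: to its left p stays at distance at
      least 1 from q and the identity can be divided by p - q, to its right the trivial bound
      holds.\<close>
    define a where "a = 1 - Re q"
    define K where "K = (1 + norm q) * (T * Z) + norm q * C"
    have nn: "C >= 0" "I >= 0" by (simp_all add: C_def I_def)
    have left: "norm (V q p) <= (1 + norm q) * (T * Z) / sqrt s + norm q * C / sqrt s"
      if s: "s >= 1" and p: "Re p <= Re q - s" for p s
    proof -
      have ps: "Re p < 0" using p q s by linarith
      have "s <= Re (q - p)" using p by simp
      then have ds: "s <= norm (p - q)" using complex_Re_le_cmod[of "q - p"] by (simp add: norm_minus_commute)
      have d1: "norm (p - q) > 0" using ds s by linarith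
      have ss: "sqrt s <= s" using s real_sqrt_le_mono[of s "s\<^sup>2"] power_increasing[of 1 2 s] by simp
      have sp: "sqrt s > 0" using s by simp
      have "(p - q) * V q p = p * (LINT t|leb T. G p t) - q * (LINT t|leb T. G q t)" using key[OF ps q] by (simp add: algebra_simps)
      then have "norm (p - q) * norm (V q p) <= norm p * norm (LINT t|leb T. G p t) + norm q * C"
        unfolding C_def norm_mult[symmetric] using norm_triangle_ineq4 by metis
      also have "\<dots> <= (norm (p - q) * (1 + norm q)) * (T * Z / sqrt s) + norm q * (norm (p - q) * (C / sqrt s))"
      proof (intro add_mono mult_mono mult_left_mono)
        have "norm p <= norm (p - q) + norm q" by (metis diff_add_cancel norm_triangle_ineq)
        also have "norm q <= norm (p - q) * norm q" using ds s by (simp add: mult_le_cancel_right1)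
        finally show "norm p <= norm (p - q) * (1 + norm q)" by (simp add: algebra_simps)
        have "norm (LINT t|leb T. G p t) <= T * Z / sqrt (2 * - Re p)" by (rule GI[OF ps])
        also have "\<dots> <= T * Z / sqrt s" using p q s T Z0 by (intro divide_left_mono) auto
        finally show "norm (LINT t|leb T. G p t) <= T * Z / sqrt s" .
        have "C * sqrt s <= C * norm (p - q)" using ss ds nn by (intro mult_left_mono) auto
        then show "C <= norm (p - q) * (C / sqrt s)" using sp by (simp add: field_simps)
      qed (use T Z0 s nn in auto)
      also have "\<dots> = norm (p - q) * ((1 + norm q) * (T * Z) / sqrt s + norm q * C / sqrt s)" by (simp add: algebra_simps add_divide_distrib)
      finally show ?thesis using d1 by (simp add: mult_le_cancel_left)
    qed
    have right: "norm (V q p) <= I * exp (a * T)" if p: "Re p >= - a" for p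
    proof -
      have i: "integrable (leb T) (%t. G q t * exp (p * of_real (t - T)))" by (rule lap_integrable[OF Gi]) (intro continuous_intros)
      have "V q p = (LINT t|leb T. exp (- p * of_real T) * (G q t * exp (p * of_real t)))" by (simp add: V_def lap_def)
      also have "\<dots> = (LINT t|leb T. G q t * exp (p * of_real (t - T)))"
        by (intro Bochner_Integration.integral_cong refl) (simp add: exp_diff exp_minus right_diff_distrib divide_inverse)
      also have "norm \<dots> <= (LINT t|leb T. norm (G q t * exp (p * of_real (t - T))))" by simp
      also have "\<dots> <= (LINT t|leb T. norm (G q t) * exp (a * T))"
      proof (rule integral_mono)
        fix t assume "t \<in> space (leb T)"
        then have t: "0 <= t" "t <= T" by auto
        have "- Re p * (T - t) <= a * (T - t)" using p t by (intro mult_right_mono) auto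
        also have "\<dots> <= a * T" using t q by (intro mult_left_mono) (auto simp: a_def)
        finally have "Re p * (t - T) <= a * T" by (simp add: algebra_simps)
        then show "norm (G q t * exp (p * of_real (t - T))) <= norm (G q t) * exp (a * T)"
          by (simp add: norm_mult norm_exp_eq_Re mult_left_mono)
      qed (use i Gi in \<open>auto simp del: of_real_diff\<close>)
      finally show ?thesis by (simp add: I_def)
    qed
    have "bounded (range (V q))"
    proof -
      have "norm (V q p) <= K + I * exp (a * T)" for p
      proof (cases "Re p >= - a")
        case True
        have "K >= 0" using T Z0 nn by (simp add: K_def)
        then show ?thesis using right[OF True] by simp
      next
        case False
        then have "norm (V q p) <= K" using left[of 1 p] by (simp add: a_def K_def)
        moreover have "I * exp (a * T) >= 0" using nn by simp
        ultimately show ?thesis by linarith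
      qed
      then show ?thesis unfolding bounded_iff by blast
    qed
    moreover have "V q holomorphic_on UNIV"
      unfolding V_def[abs_def] by (intro holomorphic_intros lap_entire[OF Gi less_imp_le[OF T]])
    ultimately obtain c where c: "!!p. V q p = c"
      using Liouville_theorem[of "V q"] unfolding constant_on_def by blast
    have "c = 0"
    proof (rule decay_zero[where K = K])
      fix s :: real assume "s >= 1"
      then show "norm c <= K / sqrt s" using left[of s "q - of_real s"] c by (simp add: K_def add_divide_distrib)
    qed
    then have "lap T (G q) p = 0" for p using c[of p] by (simp add: V_def)
    then have mom: "(LINT t|leb T. G q t * of_real t ^ k) = 0" for k
      by (intro lap_zero_moments[OF Gi]) (use T in auto)
    have zr: "r t = 0" if rc: "continuous_on {0..T} r" and rm: "!!k. (LINT t|leb T. r t * t ^ k) = 0" for r :: "real => real"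
    proof (rule cont_nm_zero[OF rc _ T t])
      have "ip (leb T) r r = 0" by (rule ip_poly_zero[OF cont_l2[OF rc] _ rc]) (use rm T in \<open>auto simp: ip_def\<close>)
      then show "nm (leb T) r = 0" by (simp add: nm_def)
    qed
    have Gk: "integrable (leb T) (%t. G q t * of_real t ^ k)" for k by (rule lap_integrable[OF Gi]) (intro continuous_intros)
    have "Re (G q t) = 0"
    proof (rule zr)
      show "continuous_on {0..T} (%t. Re (G q t))" by (intro continuous_intros Gc)
      show "(LINT t|leb T. Re (G q t) * t ^ k) = 0" for k
        using integral_Re[OF Gk[of k]] mom[of k] by (simp add: of_real_power[symmetric] del: of_real_power)
    qed
    moreover have "Im (G q t) = 0"
    proof (rule zr)
      show "continuous_on {0..T} (%t. Im (G q t))" by (intro continuous_intros Gc)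
      show "(LINT t|leb T. Im (G q t) * t ^ k) = 0" for k
        using integral_Im[OF Gk[of k]] mom[of k] by (simp add: of_real_power[symmetric] del: of_real_power)
    qed
    ultimately have "G q t = 0" by (simp add: complex_eq_iff)
    then show ?thesis unfolding Gz[OF t] using Wk_norm_le(2)[OF L_pos q] by simp
  qed
  have hol: "pair L (z t) holomorphic_on UNIV" using pair_holomorphic[OF zl[OF t]] L_pos by simp
  \<comment> \<open>The vanishing is known in the left half plane only; completeness wants imaginary
    parameters, reached by analytic continuation.\<close>
  have "pair L (z t) p = 0" for p
  proof (rule analytic_continuation_open[of "{p. Re p < 0}" UNIV "pair L (z t)" "%_. 0"])
    show "open {p. Re p < 0}" by (rule open_halfspace_Re_lt)
    have "Re (- 1) < 0" by simp
    then show "{p. Re p < 0} ~= {}" by blast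
  qed (use hol pz[OF _ t] in auto)
  from pair_complete[OF zl[OF t] this]
  show ?thesis by (simp add: z_def)
qed

end

section \<open>The lower bound\<close>

text \<open>More unknowns than equations, by eliminating one unknown with the last equation. It is
  used to cancel projections on modes and to cancel Taylor coefficients.\<close>

lemma nontrivial_solution:
  fixes A :: "nat => 'a => real"
  assumes "finite J" "card J > M"
  obtains c where "\<exists>j\<in>J. c j ~= 0" "!!k. k < M ==> (\<Sum>j\<in>J. A k j * c j) = 0"
proof -
  have "\<exists>c. (\<exists>j\<in>J. c j ~= 0) & (\<forall>k<M. (\<Sum>j\<in>J. A k j * c j) = 0)"
    using assms
  proof (induction M arbitrary: J A)
    case 0
    then obtain j where "j \<in> J" by fastforce
    then show ?case by (intro exI[of _ "%_. 1"]) auto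
  next
    case (Suc M)
    show ?case
    proof (cases "\<forall>j\<in>J. A M j = 0")
      case True
      obtain c where c: "\<exists>j\<in>J. c j ~= 0" "\<forall>k<M. (\<Sum>j\<in>J. A k j * c j) = 0"
        using Suc.IH[OF Suc.prems(1), of A] Suc.prems(2) by auto
      have "(\<Sum>j\<in>J. A M j * c j) = 0" using True by simp
      then show ?thesis using c by (intro exI[of _ c]) (auto simp: less_Suc_eq)
    next
      case False
      then obtain j0 where j0: "j0 \<in> J" "A M j0 ~= 0" by blast
      define J' where "J' = J - {j0}"
      have J': "finite J'" "card J' > M" "J = insert j0 J'" "j0 \<notin> J'" using Suc.prems j0 by (auto simp: J'_def)
      obtain c where c: "\<exists>j\<in>J'. c j ~= 0" "\<forall>k<M. (\<Sum>j\<in>J'. (A k j - A k j0 * A M j / A M j0) * c j) = 0"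
        using Suc.IH[OF J'(1,2), of "%k j. A k j - A k j0 * A M j / A M j0"] by auto
      define d where "d = c(j0 := - (\<Sum>j\<in>J'. A M j * c j) / A M j0)"
      have s: "(\<Sum>j\<in>J. A k j * d j) = A k j0 * d j0 + (\<Sum>j\<in>J'. A k j * c j)" for k
      proof -
        have "(\<Sum>j\<in>J'. A k j * d j) = (\<Sum>j\<in>J'. A k j * c j)" by (rule sum.cong) (use J'(4) in \<open>auto simp: d_def\<close>)
        then show ?thesis unfolding J'(3) using J' by simp
      qed
      have "(\<Sum>j\<in>J. A k j * d j) = 0" if "k < Suc M" for k
      proof (cases "k = M")
        case True
        then show ?thesis unfolding s using j0(2) by (simp add: d_def)
      next
        case False
        then have "(\<Sum>j\<in>J'. (A k j - A k j0 * A M j / A M j0) * c j) = 0" using c(2) that by simp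
        moreover have "(\<Sum>j\<in>J'. (A k j - A k j0 * A M j / A M j0) * c j)
          = (\<Sum>j\<in>J'. A k j * c j) - A k j0 * (\<Sum>j\<in>J'. A M j * c j) / A M j0"
          by (simp add: algebra_simps sum_subtractf sum_distrib_left sum_divide_distrib)
        ultimately show ?thesis unfolding s by (simp add: d_def)
      qed
      moreover have "\<exists>j\<in>J. d j ~= 0"
      proof -
        obtain j where "j \<in> J'" "c j ~= 0" using c(1) by blast
        then show ?thesis using J'(3,4) by (intro bexI[of _ j]) (auto simp: d_def)
      qed
      ultimately show ?thesis by blast
    qed
  qed
  then show ?thesis using that by blast
qed

lemma integral_cos_period:
  fixes n :: int
  assumes "L > 0"
  shows "integral {0..L} (%x. cos (2 * pi * of_int n / L * x)) = (if n = 0 then L else 0)"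
proof (cases "n = 0")
  case True
  then show ?thesis using assms by simp
next
  case False
  define w where "w = 2 * pi * of_int n / L"
  have w: "w ~= 0" using False assms by (simp add: w_def)
  have "integral {0..L} (%x. cos (w * x)) = sin (w * L) / w - sin (w * 0) / w"
  proof (rule ftc)
    fix x
    show "((%x. sin (w * x) / w) has_real_derivative cos (w * x)) (at x within {0..L})"
      by (rule derivative_eq_intros refl | use w in simp)+
  qed (use assms in simp)
  moreover have "w * L = 2 * pi * of_int n" using assms by (simp add: w_def)
  ultimately show ?thesis using False unfolding w_def[symmetric] by (simp add: sin_int_2pin)
qed

lemma fourier_orth:
  fixes j k :: nat
  assumes L: "L > 0" and jk: "j >= 1" "k >= 1"
  defines "w \<equiv> %k::nat. 2 * pi * real k / L"
  shows "ip (leb L) (%x. sin (w j * x)) (%x. sin (w k * x)) = (if j = k then L / 2 else 0)"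
    "ip (leb L) (%x. cos (w j * x)) (%x. cos (w k * x)) = (if j = k then L / 2 else 0)"
proof -
  let ?d = "%x. cos (2 * pi * of_int (int j - int k) / L * x)" and ?s = "%x. cos (2 * pi * of_int (int j + int k) / L * x)"
  have d: "w j * x - w k * x = 2 * pi * of_int (int j - int k) / L * x" "w j * x + w k * x = 2 * pi * of_int (int j + int k) / L * x" for x
    using L by (simp_all add: w_def algebra_simps add_divide_distrib diff_divide_distrib)
  have ss: "sin (w j * x) * sin (w k * x) = (1/2) * (?d x - ?s x)" "cos (w j * x) * cos (w k * x) = (1/2) * (?d x + ?s x)" for x
    unfolding d[symmetric] sin_times_sin cos_times_cos by simp_all
  have i: "?d integrable_on {0..L}" "?s integrable_on {0..L}" using L by (auto intro!: integrable_continuous_real continuous_intros)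
  have v: "integral {0..L} ?d = (if j = k then L else 0)" "integral {0..L} ?s = 0"
    using integral_cos_period[OF L, of "int j - int k"] integral_cos_period[OF L, of "int j + int k"] jk by auto
  show "ip (leb L) (%x. sin (w j * x)) (%x. sin (w k * x)) = (if j = k then L / 2 else 0)"
  proof -
    have "ip (leb L) (%x. sin (w j * x)) (%x. sin (w k * x)) = integral {0..L} (%x. (1/2) * (?d x - ?s x))"
      by (subst ip_cont) (auto intro!: continuous_intros simp only: ss)
    also have "\<dots> = (1/2) * (integral {0..L} ?d - integral {0..L} ?s)"
      by (simp only: integral_mult_right Henstock_Kurzweil_Integration.integral_diff[OF i])
    finally show ?thesis unfolding v by (cases "j = k") simp_all
  qed
  show "ip (leb L) (%x. cos (w j * x)) (%x. cos (w k * x)) = (if j = k then L / 2 else 0)"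
  proof -
    have "ip (leb L) (%x. cos (w j * x)) (%x. cos (w k * x)) = integral {0..L} (%x. (1/2) * (?d x + ?s x))"
      by (subst ip_cont) (auto intro!: continuous_intros simp only: ss)
    also have "\<dots> = (1/2) * (integral {0..L} ?d + integral {0..L} ?s)"
      by (simp only: integral_mult_right Henstock_Kurzweil_Integration.integral_add[OF i])
    finally show ?thesis unfolding v by (cases "j = k") simp_all
  qed
qed

lemma orthogonal_nm:
  assumes "!!j. j < n ==> e j \<in> l2 M" "!!i j. i < n ==> j < n ==> ip M (e i) (e j) = (if i = j then a else 0)"
  shows "(nm M (%x. \<Sum>j<(n::nat). c j * e j x))\<^sup>2 = a * (\<Sum>j<n. (c j)\<^sup>2)"
proof -
  let ?f = "%x. \<Sum>j<n. c j * e j x"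
  have f: "?f \<in> l2 M" by (rule l2_sum) (use assms in auto)
  have e: "ip M ?f (e i) = a * c i" if i: "i < n" for i
  proof -
    have "ip M ?f (e i) = (\<Sum>j<n. c j * ip M (e j) (e i))" by (rule ip_sum_left) (use assms i in auto)
    also have "\<dots> = (\<Sum>j<n. if j = i then a * c i else 0)" by (rule sum.cong) (use assms i in auto)
    finally show ?thesis using i by simp
  qed
  have "ip M ?f ?f = (\<Sum>j<n. c j * ip M (e j) ?f)" by (rule ip_sum_left) (use assms f in auto)
  also have "\<dots> = (\<Sum>j<n. a * (c j)\<^sup>2)" by (rule sum.cong) (use e in \<open>auto simp: ip_commute[of M _ ?f] power2_eq_square\<close>)
  finally show ?thesis unfolding nm_sq by (simp add: sum_distrib_left)
qed

section \<open>Many frequencies of cubic size\<close>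

context noncritical
begin

text \<open>If there were at most \<open>M\<close> eigenvalues of size \<open>O(M\<^sup>3)\<close>, a combination of the functions
  \<open>sin (2\<pi>kx/L)\<close>, \<open>k \<le> M + 1\<close>, would violate the spectral bound.\<close>

lemma eig_many:
  obtains C where "C >= 1" "!!M. M >= 1 ==> \<exists>e m. eigfam (1 / (C * real M ^ 3)) (M + 1) e m"
proof -
  define b where "b = 2 * pi / L"
  have b: "b > 0" using L_pos by (simp add: b_def)
  \<comment> \<open>From M + 1 <= 2 M and M <= M^3, the symbol b(M+1) + (b(M+1))^3 is at most (8 b^3
    + 2 b) M^3; the factor 2 and the summand 1 make the later inequality strict.\<close>
  define C where "C = 1 + 2 * (8 * b ^ 3 + 2 * b)"
  have C: "C >= 1" using b by (simp add: C_def)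
  have main: "\<exists>e m. eigfam (1 / (C * real M ^ 3)) (M + 1) e m" if M: "M >= 1" for M
  proof -
    define \<epsilon> where "\<epsilon> = 1 / (C * real M ^ 3)"
    have eps: "\<epsilon> > 0" using C M by (simp add: \<epsilon>_def)
    obtain n e m where fam: "eigfam \<epsilon> n e m"
      and comp: "!!h. contL h ==> (!!j. j < n ==> ipL h (e j) = 0) ==> nmL (G0 h) <= \<epsilon> * nmL h"
      using spectral[OF eps] by blast
    note E = eigfamD[OF fam]
    have "n >= M + 1"
    proof (rule ccontr)
      assume "\<not> n >= M + 1"
      then have nM: "n < Suc M" by simp
      define w where "w k = 2 * pi * real (Suc k) / L" for k
      have wb: "w k = b * real (Suc k)" for k by (simp add: w_def b_def)
      define s where "s k x = sin (w k * x)" for k x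
      \<comment> \<open>The image of the sine under w''' + w'. These sines vanish at 0 and L and
        have equal slopes there, so \<open>G0\<close> maps \<open>h k\<close> back to
        \<open>s k\<close>.\<close>
      define h where "h k x = (w k - w k ^ 3) * cos (w k * x)" for k x
      obtain c where c: "\<exists>j\<in>{..<Suc M}. c j ~= 0" "!!i. i < n ==> (\<Sum>k\<in>{..<Suc M}. ipL (h k) (e i) * c k) = 0"
        using nontrivial_solution[of "{..<Suc M}" n "%i k. ipL (h k) (e i)"] nM by auto
      define W where "W x = (\<Sum>k<Suc M. c k * s k x)" for x
      define H where "H x = (\<Sum>k<Suc M. c k * h k x)" for x
      have hc: "contL (h k)" "contL (s k)" for k unfolding h_def[abs_def] s_def[abs_def] by (intro continuous_intros)+
      have Hc: "contL H" unfolding H_def[abs_def] by (intro continuous_intros hc)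
      have Horth: "ipL H (e i) = 0" if "i < n" for i
      proof -
        have "ipL H (e i) = (\<Sum>k<Suc M. c k * ipL (h k) (e i))"
          unfolding H_def[abs_def] by (rule ip_sum_left) (use cont_l2[OF hc(1)] E that in auto)
        then show ?thesis using c(2)[OF that] by (simp add: mult.commute)
      qed
      have WG: "W x = G0 H x" if x: "x \<in> {0..L}" for x
      proof (rule G_unique[OF _ _ _ _ _ x])
        show "c3 L W (%x. \<Sum>k<Suc M. c k * (w k * cos (w k * x))) (%x. \<Sum>k<Suc M. c k * (- (w k)\<^sup>2 * sin (w k * x)))
           (%x. \<Sum>k<Suc M. c k * (- (w k ^ 3) * cos (w k * x)))"
          unfolding c3_def W_def[abs_def] s_def[abs_def]
          by (intro conjI ballI continuous_intros DERIV_sum DERIV_cmult)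
             (rule derivative_eq_intros refl | simp add: power2_eq_square power3_eq_cube)+
        have wL: "w k * L = of_nat (Suc k) * (2 * pi)" for k using L_pos by (simp add: w_def)
        have sL: "sin (w k * L) = 0" "cos (w k * L) = 1" for k
          unfolding wL using sin_npi[of "2 * Suc k"] cos_int_2pin[of "int (Suc k)"] by (simp_all add: mult_ac)
        show "W 0 = 0" by (simp add: W_def s_def)
        show "W L = 0" by (simp add: W_def s_def sL)
        show "(\<Sum>k<Suc M. c k * (w k * cos (w k * L))) = (\<Sum>k<Suc M. c k * (w k * cos (w k * 0)))" by (simp add: sL)
        fix y
        show "(\<Sum>k<Suc M. c k * (- (w k ^ 3) * cos (w k * y))) + (\<Sum>k<Suc M. c k * (w k * cos (w k * y))) = H y"
          unfolding H_def h_def sum.distrib[symmetric] by (rule sum.cong) (auto simp: algebra_simps)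
      qed
      define S where "S = (\<Sum>k<Suc M. (c k)\<^sup>2)"
      have S: "S > 0"
      proof -
        obtain k where "k < Suc M" "c k ~= 0" using c(1) by auto
        then show ?thesis unfolding S_def by (intro sum_pos2[of _ k]) auto
      qed
      have fo: "ipL (s i) (s j) = (if i = j then L / 2 else 0)" "ipL (%x. cos (w i * x)) (%x. cos (w j * x)) = (if i = j then L / 2 else 0)" for i j
        using fourier_orth[OF L_pos, of "Suc i" "Suc j"] by (simp_all add: s_def[abs_def] w_def)
      have nW: "(nmL W)\<^sup>2 = (L / 2) * S" unfolding W_def[abs_def] S_def
        by (rule orthogonal_nm) (use cont_l2[OF hc(2)] fo(1) in auto)
      define D where "D = b * real (Suc M) + (b * real (Suc M)) ^ 3"
      have nH: "(nmL H)\<^sup>2 <= D\<^sup>2 * ((L / 2) * S)"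
      proof -
        have "H = (%x. \<Sum>k<Suc M. (c k * (w k - w k ^ 3)) * cos (w k * x))"
          by (rule ext) (simp add: H_def h_def mult.assoc)
        then have "(nmL H)\<^sup>2 = (nmL (%x. \<Sum>k<Suc M. (c k * (w k - w k ^ 3)) * cos (w k * x)))\<^sup>2" by simp
        also have "\<dots> = (L / 2) * (\<Sum>k<Suc M. (c k * (w k - w k ^ 3))\<^sup>2)"
          by (rule orthogonal_nm) (use fo(2) in \<open>auto intro!: cont_l2 continuous_intros\<close>)
        also have "\<dots> <= (L / 2) * (\<Sum>k<Suc M. D\<^sup>2 * (c k)\<^sup>2)"
        proof (intro mult_left_mono sum_mono)
          fix k assume "k \<in> {..<Suc M}"
          then have wk: "0 <= w k" "w k <= b * real (Suc M)" unfolding wb using b by (auto intro!: mult_left_mono)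
          then have w3: "w k ^ 3 <= (b * real (Suc M)) ^ 3" "0 <= w k ^ 3" by (auto intro: power_mono)
          have "\<bar>w k - w k ^ 3\<bar> <= \<bar>D\<bar>" unfolding D_def using wk w3 by linarith
          then have "(w k - w k ^ 3)\<^sup>2 <= D\<^sup>2" by (simp add: abs_le_square_iff)
          then show "(c k * (w k - w k ^ 3))\<^sup>2 <= D\<^sup>2 * (c k)\<^sup>2"
            unfolding power_mult_distrib by (metis mult.commute mult_right_mono zero_le_power2)
        qed (use L_pos in simp)
        also have "(\<Sum>k<Suc M. D\<^sup>2 * (c k)\<^sup>2) = D\<^sup>2 * S" by (simp only: S_def sum_distrib_left)
        finally show ?thesis by (simp only: mult_ac)
      qed
      have D0: "D >= 0" unfolding D_def using b by simp
      have "nmL W = nmL (G0 H)" by (rule nm_cong_on) (use WG in auto)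
      also have "\<dots> <= \<epsilon> * nmL H" by (rule comp[OF Hc Horth])
      finally have "(nmL W)\<^sup>2 <= (\<epsilon> * nmL H)\<^sup>2" by (rule power_mono) simp
      also have "\<dots> = \<epsilon>\<^sup>2 * (nmL H)\<^sup>2" by (simp add: power_mult_distrib)
      also have "\<dots> <= \<epsilon>\<^sup>2 * (D\<^sup>2 * ((L / 2) * S))" by (intro mult_left_mono nH) simp
      also have "\<dots> = (\<epsilon> * D)\<^sup>2 * ((L / 2) * S)" by (simp add: power_mult_distrib)
      finally have "1 <= (\<epsilon> * D)\<^sup>2" unfolding nW using S L_pos by (simp add: mult_le_cancel_right1)
      moreover have "\<epsilon> * D < 1"
      proof -
        have m1: "real (Suc M) <= 2 * real M" "real M <= real M ^ 3" using M power_increasing[of 1 3 "real M"] by auto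
        have "(b * real (Suc M)) ^ 3 <= (b * (2 * real M)) ^ 3" using m1 b by (intro power_mono mult_left_mono) auto
        then have "(b * real (Suc M)) ^ 3 <= 8 * b ^ 3 * real M ^ 3" by (simp add: power_mult_distrib)
        moreover have "b * real (Suc M) <= b * (2 * real M ^ 3)" using order_trans[OF m1(1)] m1(2) b by (intro mult_left_mono) simp_all
        ultimately have "D <= (8 * b ^ 3 + 2 * b) * real M ^ 3" unfolding D_def by (simp add: algebra_simps)
        also have "\<dots> < C * real M ^ 3" using M b by (intro mult_strict_right_mono) (auto simp: C_def add_pos_pos)
        finally show ?thesis unfolding \<epsilon>_def using C M by (simp add: divide_less_eq)
      qed
      moreover have "\<epsilon> * D >= 0" using eps D0 by simp
      ultimately show False using power_strict_mono[of "\<epsilon> * D" 1 2] by simp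
    qed
    then have "eigfam \<epsilon> (M + 1) e m" using fam unfolding eigfam_def by auto
    then show ?thesis unfolding \<epsilon>_def by blast
  qed
  show ?thesis by (rule that[OF C main])
qed

end

lemma kdv0_sum:
  fixes c :: "nat => real"
  assumes "!!j. j < n ==> kdv0 T L (p j) (p1 j) (p2 j) (p3 j)"
  shows "kdv0 T L (%t x. \<Sum>j<n. c j * p j t x) (%t x. \<Sum>j<n. c j * p1 j t x) (%t x. \<Sum>j<n. c j * p2 j t x) (%t x. \<Sum>j<n. c j * p3 j t x)"
  using assms
proof (induction n)
  case 0
  show ?case using kdv_exp[of T L 0 0] by simp
next
  case (Suc n)
  then show ?case using kdv0_lin[of T L _ _ _ _ "p n" "p1 n" "p2 n" "p3 n" 1 "c n"] by simp
qed

section \<open>Solutions with flat traces and the cost of control\<close>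

context noncritical
begin

text \<open>The real form of an oscillating mode: cos (\<mu> t) e + sin (\<mu> t) \<mu>
  \<open>G0 e\<close>. The factor e is written as an image under \<open>G0\<close> to have three
  derivatives, and both images have equal slopes at 0 and L, so the two traces of the solution
  coincide.\<close>

lemma mode_kdv0:
  assumes e: "contL e" and m: "m > 0" and ev: "!!x. x \<in> {0..L} ==> G0 (G0 e) x = - m\<^sup>2 * e x"
  defines "\<mu> \<equiv> 1 / m"
  shows "kdv0 T L (%t x. cos (\<mu> * t) * (- \<mu>\<^sup>2 * G0 (G0 e) x) + sin (\<mu> * t) * (\<mu> * G0 e x))
    (%t x. cos (\<mu> * t) * (- \<mu>\<^sup>2 * G1 (G0 e) x) + sin (\<mu> * t) * (\<mu> * G1 e x))
    (%t x. cos (\<mu> * t) * (- \<mu>\<^sup>2 * G2 (G0 e) x) + sin (\<mu> * t) * (\<mu> * G2 e x))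
    (%t x. cos (\<mu> * t) * (- \<mu>\<^sup>2 * (G0 e x - G1 (G0 e) x)) + sin (\<mu> * t) * (\<mu> * (e x - G1 e x)))"
proof -
  have c3: "c3 L (G0 e) (G1 e) (G2 e) (%x. e x - G1 e x)" "c3 L (G0 (G0 e)) (G1 (G0 e)) (G2 (G0 e)) (%x. G0 e x - G1 (G0 e) x)"
    using G_c3[OF e] G_c3[OF G0_cont[OF e]] by auto
  have sc: "continuous_on ({0..T} \<times> {0..L}) (%z. f (snd z))" if "contL f" for f :: "real => real"
    by (rule continuous_on_compose2[OF that]) (auto intro!: continuous_intros)
  note cc = sc[OF e] sc[OF c3_cont(1)[OF c3(1)]] sc[OF c3_cont(2)[OF c3(1)]] sc[OF c3_cont(1)[OF c3(2)]] sc[OF c3_cont(2)[OF c3(2)]]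
  show ?thesis unfolding kdv_def case_prod_unfold
  proof (intro conjI ballI)
    fix t x assume x: "x \<in> {0..L}"
    note D1 = c3_deriv[OF c3(1) x] and D2 = c3_deriv[OF c3(2) x]
    show "((%x. cos (\<mu> * t) * (- \<mu>\<^sup>2 * G0 (G0 e) x) + sin (\<mu> * t) * (\<mu> * G0 e x)) has_real_derivative
        cos (\<mu> * t) * (- \<mu>\<^sup>2 * G1 (G0 e) x) + sin (\<mu> * t) * (\<mu> * G1 e x)) (at x within {0..L})"
      "((%x. cos (\<mu> * t) * (- \<mu>\<^sup>2 * G1 (G0 e) x) + sin (\<mu> * t) * (\<mu> * G1 e x)) has_real_derivative
        cos (\<mu> * t) * (- \<mu>\<^sup>2 * G2 (G0 e) x) + sin (\<mu> * t) * (\<mu> * G2 e x)) (at x within {0..L})"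
      "((%x. cos (\<mu> * t) * (- \<mu>\<^sup>2 * G2 (G0 e) x) + sin (\<mu> * t) * (\<mu> * G2 e x)) has_real_derivative
        cos (\<mu> * t) * (- \<mu>\<^sup>2 * (G0 e x - G1 (G0 e) x)) + sin (\<mu> * t) * (\<mu> * (e x - G1 e x))) (at x within {0..L})"
      by (intro DERIV_add DERIV_cmult D1 D2)+
    have ex: "e x = - \<mu>\<^sup>2 * G0 (G0 e) x" using ev[OF x] m by (simp add: \<mu>_def power_divide)
    have "((%t. cos (\<mu> * t) * (- \<mu>\<^sup>2 * G0 (G0 e) x) + sin (\<mu> * t) * (\<mu> * G0 e x)) has_real_derivative
        - sin (\<mu> * t) * \<mu> * (- \<mu>\<^sup>2 * G0 (G0 e) x) + cos (\<mu> * t) * \<mu> * (\<mu> * G0 e x)) (at t within {0..T})"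
      by (rule derivative_eq_intros refl)+ simp
    moreover have "- sin (\<mu> * t) * \<mu> * (- \<mu>\<^sup>2 * G0 (G0 e) x) + cos (\<mu> * t) * \<mu> * (\<mu> * G0 e x)
      = 0 - (cos (\<mu> * t) * (- \<mu>\<^sup>2 * G1 (G0 e) x) + sin (\<mu> * t) * (\<mu> * G1 e x))
        - (cos (\<mu> * t) * (- \<mu>\<^sup>2 * (G0 e x - G1 (G0 e) x)) + sin (\<mu> * t) * (\<mu> * (e x - G1 e x)))"
      unfolding ex[symmetric] by (simp add: algebra_simps power2_eq_square)
    ultimately show "((%t. cos (\<mu> * t) * (- \<mu>\<^sup>2 * G0 (G0 e) x) + sin (\<mu> * t) * (\<mu> * G0 e x)) has_real_derivative
        0 - (cos (\<mu> * t) * (- \<mu>\<^sup>2 * G1 (G0 e) x) + sin (\<mu> * t) * (\<mu> * G1 e x))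
        - (cos (\<mu> * t) * (- \<mu>\<^sup>2 * (G0 e x - G1 (G0 e) x)) + sin (\<mu> * t) * (\<mu> * (e x - G1 e x)))) (at t within {0..T})" by simp
  qed ((intro continuous_intros cc)+ | simp add: G_bc)+
qed

text \<open>With \<open>M + 1\<close> modes of frequency \<open>O(M\<^sup>3)\<close> the trace at \<open>x = 0\<close> can be made to vanish to order \<open>M\<close> at \<open>t = 0\<close>;
  for \<open>M \<approx> T\<^sup>-\<^sup>1\<^sup>/\<^sup>2\<close> Taylor's formula then makes it exponentially small on \<open>[0,T]\<close>.\<close>

lemma flat_solution:
  obtains \<kappa> A where "\<kappa> > 0" "A >= 1" "!!T. 0 < T ==> T <= \<kappa>\<^sup>2 ==>
    \<exists>p p1 p2 p3. kdv0 T L p p1 p2 p3 & nmL (p 0) = 1 & (\<forall>t\<in>{0..T}. p1 t L = p1 t 0 & \<bar>p1 t 0\<bar> <= A * exp (- \<kappa> / sqrt T))"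
proof -
  obtain C where C: "C >= 1" "!!M. M >= 1 ==> \<exists>e m. eigfam (1 / (C * real M ^ 3)) (M + 1) e m"
      using eig_many by blast
  \<comment> \<open>Chosen so that \<Lambda> T <= M e^(-3). Since M^M / M! <= e^M, the Taylor
    remainder then gains e^(-2M), of which one factor e^(-M) pays for the polynomial terms.\<close>
  define \<kappa> where "\<kappa> = sqrt (1 / (C * exp 3))"
  have k: "\<kappa> > 0" "\<kappa>\<^sup>2 = 1 / (C * exp 3)" using C(1) by (simp_all add: \<kappa>_def)
  \<comment> \<open>24 = 2 * 12 from the coefficient bounds and M + 1 <= 2 M, 256 = 4^4 from M^4 <=
    256 e^M, and e from rounding M down.\<close>
  define A where "A = 1 + 24 * 256 * CG * C * exp 1"
  have A: "A >= 1" using CG_nonneg C(1) by (simp add: A_def)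
  have main: "\<exists>p p1 p2 p3. kdv0 T L p p1 p2 p3 & nmL (p 0) = 1 & (\<forall>t\<in>{0..T}. p1 t L = p1 t 0 & \<bar>p1 t 0\<bar> <= A * exp (- \<kappa> / sqrt T))"
    if T: "0 < T" "T <= \<kappa>\<^sup>2" for T
  proof -
    define M where "M = nat \<lfloor>\<kappa> / sqrt T\<rfloor>"
    have kT: "1 <= \<kappa> / sqrt T"
      using real_sqrt_le_mono[OF T(2)] k(1) T(1) by (simp add: le_divide_eq)
    have M: "M >= 1" "real M <= \<kappa> / sqrt T" "\<kappa> / sqrt T - 1 <= real M"
      using kT unfolding M_def by (simp_all add: of_nat_nat le_nat_iff le_floor_iff)
    have M0: "real M >= 1" using M(1) by simp
    have MT: "(real M)\<^sup>2 * T <= \<kappa>\<^sup>2"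
    proof -
      have "(real M)\<^sup>2 <= (\<kappa> / sqrt T)\<^sup>2" using M(2) by (intro power_mono) auto
      also have "\<dots> = \<kappa>\<^sup>2 / T" using T by (simp add: power_divide)
      finally show ?thesis using T by (simp add: le_divide_eq)
    qed
    define \<Lambda> where "\<Lambda> = C * real M ^ 3"
    have Lam: "\<Lambda> > 0" using C(1) M0 by (simp add: \<Lambda>_def)
    obtain e m where fam: "eigfam (1 / \<Lambda>) (M + 1) e m" unfolding \<Lambda>_def using C(2)[OF M(1)] by blast
    have epos: "1 / \<Lambda> > 0" using Lam by simp
    note E = eigfamD[OF fam]
    define \<mu> where "\<mu> j = 1 / m j" for j
    have mp: "m j > 0" if "j < M + 1" for j using E(2)[OF that] epos by linarith
    have mu: "0 < \<mu> j" "\<mu> j <= \<Lambda>" if "j < M + 1" for j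
    proof -
      show "0 < \<mu> j" using mp[OF that] by (simp add: \<mu>_def)
      show "\<mu> j <= \<Lambda>" unfolding \<mu>_def using frac_le[of 1 1 "1 / \<Lambda>" "m j"] E(2)[OF that] epos by simp
    qed
    define a where "a j = - (\<mu> j)\<^sup>2 * G1 (G0 (e j)) 0" for j
    define b where "b j = \<mu> j * G1 (e j) 0" for j
    have L0: "0 \<in> {0..L}" using L_pos by simp
    have ab: "\<bar>a j\<bar> <= 6 * CG * \<Lambda>" "\<bar>b j\<bar> <= 6 * CG * \<Lambda>" if j: "j < M + 1" for j
    proof -
      have ej: "nmL (e j) = 1" using E(4)[OF j j] by (simp add: nm_def)
      have gj: "nmL (G0 (e j)) = m j" by (rule eig_nm_G[OF fam j epos])
      have "\<bar>G1 (e j) 0\<bar> <= 6 * CG" using G_bound(4)[OF E(1)[OF j] L0] ej by simp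
      then have "\<bar>b j\<bar> <= \<Lambda> * (6 * CG)" unfolding b_def abs_mult using mu[OF j] by (intro mult_mono) auto
      then show "\<bar>b j\<bar> <= 6 * CG * \<Lambda>" by (simp add: mult_ac)
      have "\<bar>G1 (G0 (e j)) 0\<bar> <= 6 * CG * m j" using G_bound(4)[OF G0_cont[OF E(1)[OF j]] L0] gj by simp
      then have "\<bar>a j\<bar> <= (\<mu> j)\<^sup>2 * (6 * CG * m j)" unfolding a_def abs_mult by (auto intro: mult_left_mono)
      also have "\<dots> = \<mu> j * (6 * CG)" using mp[OF j] by (simp add: \<mu>_def power2_eq_square)
      also have "\<dots> <= \<Lambda> * (6 * CG)" using mu[OF j] CG_nonneg by (intro mult_right_mono) auto
      finally show "\<bar>a j\<bar> <= 6 * CG * \<Lambda>" by (simp add: mult_ac)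
    qed
    \<comment> \<open>The k-th time derivative of the trace of mode j, as a phase shift by k quarter
      periods.\<close>
    define h where "h k j t = \<mu> j ^ k * (a j * cos (\<mu> j * t + real k * (pi / 2)) + b j * sin (\<mu> j * t + real k * (pi / 2)))" for k j t
    have dh: "(h k j has_real_derivative h (Suc k) j t) (at t)" for k j t
    proof -
      have s: "\<mu> j * t + real (Suc k) * (pi / 2) = (\<mu> j * t + real k * (pi / 2)) + pi / 2" by (simp add: algebra_simps add_divide_distrib)
      have "h (Suc k) j t = \<mu> j ^ k * (a j * (- sin (\<mu> j * t + real k * (pi / 2)) * \<mu> j) + b j * (cos (\<mu> j * t + real k * (pi / 2)) * \<mu> j))"
        unfolding h_def s cos_add[of _ "pi / 2"] sin_add[of _ "pi / 2"] by (simp add: algebra_simps)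
      moreover have "(h k j has_real_derivative \<mu> j ^ k * (a j * (- sin (\<mu> j * t + real k * (pi / 2)) * \<mu> j) + b j * (cos (\<mu> j * t + real k * (pi / 2)) * \<mu> j))) (at t)"
        unfolding h_def[abs_def] by (rule derivative_eq_intros refl)+ simp
      ultimately show ?thesis by simp
    qed
    \<comment> \<open>The derivatives of orders 0 to M - 1 at t = 0 are M linear conditions on M + 1
      coefficients.\<close>
    obtain c0 where c0: "\<exists>j\<in>{..<M+1}. c0 j ~= 0" "!!k. k < M ==> (\<Sum>j\<in>{..<M+1}. h k j 0 * c0 j) = 0"
      using nontrivial_solution[of "{..<M+1}" M "%k j. h k j 0"] by auto
    define S where "S = (\<Sum>j<M+1. (c0 j)\<^sup>2)"
    have S: "S > 0"
    proof -
      obtain j where "j < M + 1" "c0 j ~= 0" using c0(1) by auto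
      then show ?thesis unfolding S_def by (intro sum_pos2[of _ j]) auto
    qed
    define c where "c j = c0 j / sqrt S" for j
    have c2: "(\<Sum>j<M+1. (c j)\<^sup>2) = 1"
      unfolding c_def power_divide sum_divide_distrib[symmetric] S_def[symmetric] using S by simp
    have cle: "\<bar>c j\<bar> <= 1" if "j < M + 1" for j
    proof -
      have "(c j)\<^sup>2 <= (\<Sum>j<M+1. (c j)\<^sup>2)" using that by (intro member_le_sum) auto
      then show ?thesis unfolding c2 by (simp add: abs_square_le_1)
    qed
    define F where "F k t = (\<Sum>j<M+1. c j * h k j t)" for k t
    have dF: "(F k has_real_derivative F (Suc k) t) (at t)" for k t
      unfolding F_def[abs_def] by (intro DERIV_sum DERIV_cmult dh)
    have F0: "F k 0 = 0" if "k < M" for k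
    proof -
      have "F k 0 = (\<Sum>j<M+1. h k j 0 * c0 j) / sqrt S" unfolding F_def c_def sum_divide_distrib by (rule sum.cong) auto
      then show ?thesis using c0(2)[OF that] by simp
    qed
    have FM: "\<bar>F M t\<bar> <= (real M + 1) * (\<Lambda> ^ M * (12 * CG * \<Lambda>))" for t
    proof -
      have "\<bar>F M t\<bar> <= (\<Sum>j<M+1. \<bar>c j * h M j t\<bar>)" unfolding F_def by (rule sum_abs)
      also have "\<dots> <= (\<Sum>j<M+1. 1 * (\<Lambda> ^ M * (12 * CG * \<Lambda>)))"
      proof (rule sum_mono)
        fix j assume "j \<in> {..<M+1}"
        then have j: "j < M + 1" by simp
        let ?s = "\<mu> j * t + real M * (pi / 2)"
        have "\<bar>a j * cos ?s + b j * sin ?s\<bar> <= \<bar>a j\<bar> * \<bar>cos ?s\<bar> + \<bar>b j\<bar> * \<bar>sin ?s\<bar>"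
          using abs_triangle_ineq[of "a j * cos ?s" "b j * sin ?s"] by (simp add: abs_mult)
        also have "\<dots> <= \<bar>a j\<bar> * 1 + \<bar>b j\<bar> * 1" by (intro add_mono mult_left_mono) auto
        also have "\<dots> <= 12 * CG * \<Lambda>" using ab[OF j] by simp
        finally have 1: "\<bar>a j * cos ?s + b j * sin ?s\<bar> <= 12 * CG * \<Lambda>" .
        have 2: "\<mu> j ^ M <= \<Lambda> ^ M" using mu[OF j] by (intro power_mono) auto
        have "\<bar>h M j t\<bar> = \<mu> j ^ M * \<bar>a j * cos ?s + b j * sin ?s\<bar>" unfolding h_def abs_mult using mu[OF j] by simp
        also have "\<dots> <= \<Lambda> ^ M * (12 * CG * \<Lambda>)" using 1 2 Lam by (intro mult_mono) auto
        finally show "\<bar>c j * h M j t\<bar> <= 1 * (\<Lambda> ^ M * (12 * CG * \<Lambda>))" unfolding abs_mult using cle[OF j] by (intro mult_mono) auto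
      qed
      finally show ?thesis by (simp add: add.commute)
    qed
    have small: "\<bar>F 0 t\<bar> <= A * exp (- \<kappa> / sqrt T)" if t: "t \<in> {0..T}" for t
    proof (cases "t = 0")
      case True
      then show ?thesis using F0[of 0] M(1) A by simp
    next
      case False
      then have tp: "0 < t" "t <= T" using t by auto
      obtain \<xi> where "F 0 t = (\<Sum>k<M. F k 0 / fact k * t ^ k) + F M \<xi> / fact M * t ^ M"
        using Maclaurin[of t M F "F 0"] tp M(1) dF by auto
      also have "(\<Sum>k<M. F k 0 / fact k * t ^ k) = 0" by (rule sum.neutral) (use F0 in auto)
      finally have "\<bar>F 0 t\<bar> = \<bar>F M \<xi>\<bar> * (t ^ M / fact M)" using tp by (simp add: abs_mult)
      also have "\<dots> <= ((real M + 1) * (\<Lambda> ^ M * (12 * CG * \<Lambda>))) * (T ^ M / fact M)"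
        using FM tp CG_nonneg Lam by (intro mult_mono divide_right_mono power_mono) auto
      also have "\<dots> = (real M + 1) * (12 * CG * \<Lambda>) * ((\<Lambda> * T) ^ M / fact M)" by (simp add: power_mult_distrib)
      also have "\<dots> <= (real M + 1) * (12 * CG * \<Lambda>) * exp (- 2 * real M)"
      proof (rule mult_left_mono)
        have "\<Lambda> * T = (C * real M) * ((real M)\<^sup>2 * T)" by (simp add: \<Lambda>_def power2_eq_square power3_eq_cube)
        also have "\<dots> <= (C * real M) * \<kappa>\<^sup>2" using MT C(1) by (intro mult_left_mono) auto
        also have "\<dots> = real M * exp (- 3)" using C(1) by (simp add: k(2) exp_minus divide_inverse)
        finally have "(\<Lambda> * T) ^ M <= (real M * exp (- 3)) ^ M" using Lam T by (intro power_mono) auto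
        then have "(\<Lambda> * T) ^ M / fact M <= (real M * exp (- 3)) ^ M / fact M" by (rule divide_right_mono) simp
        also have "\<dots> = exp (- 3) ^ M * (real M ^ M / fact M)" by (simp add: power_mult_distrib mult.commute)
        also have "\<dots> <= exp (- 3) ^ M * exp (real M)" by (intro mult_left_mono power_over_fact_le_exp) auto
        also have "\<dots> = exp (- 2 * real M)" by (simp add: exp_of_nat_mult[symmetric] exp_add[symmetric])
        finally show "(\<Lambda> * T) ^ M / fact M <= exp (- 2 * real M)" .
      qed (use CG_nonneg Lam in auto)
      also have "\<dots> <= (2 * real M) * (12 * CG * (C * real M ^ 3)) * exp (- 2 * real M)"
        unfolding \<Lambda>_def using M0 CG_nonneg C(1) by (intro mult_right_mono) auto
      also have "\<dots> = 24 * CG * C * (real M ^ 4 * exp (- 2 * real M))" by (simp add: power3_eq_cube power4_eq_xxxx)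
      also have "\<dots> <= 24 * CG * C * (256 * exp (- real M))"
      proof (rule mult_left_mono)
        have "(real M / 4) ^ 4 <= exp (real M / 4) ^ 4" by (intro power_mono exp_ge_self) auto
        also have "\<dots> = exp (real M)" by (simp add: exp_of_nat_mult[symmetric])
        finally have "real M ^ 4 <= 256 * exp (real M)" by (simp add: power_divide)
        then have "real M ^ 4 * exp (- 2 * real M) <= (256 * exp (real M)) * exp (- 2 * real M)" by (rule mult_right_mono) simp
        also have "\<dots> = 256 * exp (- real M)" by (simp add: exp_add[symmetric] mult.assoc)
        finally show "real M ^ 4 * exp (- 2 * real M) <= 256 * exp (- real M)" .
      qed (use CG_nonneg C(1) in auto)
      also have "\<dots> <= 24 * CG * C * (256 * (exp 1 * exp (- \<kappa> / sqrt T)))"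
        using M(3) CG_nonneg C(1) by (intro mult_left_mono) (auto simp: exp_add[symmetric])
      also have "\<dots> <= A * exp (- \<kappa> / sqrt T)" by (simp add: A_def algebra_simps)
      finally show ?thesis .
    qed
    let ?q = "%j t x. cos (\<mu> j * t) * (- (\<mu> j)\<^sup>2 * G0 (G0 (e j)) x) + sin (\<mu> j * t) * (\<mu> j * G0 (e j) x)"
    let ?q1 = "%j t x. cos (\<mu> j * t) * (- (\<mu> j)\<^sup>2 * G1 (G0 (e j)) x) + sin (\<mu> j * t) * (\<mu> j * G1 (e j) x)"
    let ?q2 = "%j t x. cos (\<mu> j * t) * (- (\<mu> j)\<^sup>2 * G2 (G0 (e j)) x) + sin (\<mu> j * t) * (\<mu> j * G2 (e j) x)"
    let ?q3 = "%j t x. cos (\<mu> j * t) * (- (\<mu> j)\<^sup>2 * (G0 (e j) x - G1 (G0 (e j)) x)) + sin (\<mu> j * t) * (\<mu> j * (e j x - G1 (e j) x))"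
    have q: "kdv0 T L (%t x. \<Sum>j<M+1. c j * ?q j t x) (%t x. \<Sum>j<M+1. c j * ?q1 j t x) (%t x. \<Sum>j<M+1. c j * ?q2 j t x) (%t x. \<Sum>j<M+1. c j * ?q3 j t x)"
      unfolding \<mu>_def by (rule kdv0_sum, rule mode_kdv0) (use E mp in auto)
    have "nmL (%x. \<Sum>j<M+1. c j * ?q j 0 x) = nmL (%x. \<Sum>j<M+1. c j * e j x)"
    proof (rule nm_cong_on, rule sum.cong[OF refl])
      fix x j assume x: "x \<in> {0..L}" and "j \<in> {..<M+1}"
      then have j: "j < M + 1" by simp
      show "c j * ?q j 0 x = c j * e j x" using E(3)[OF j x] mp[OF j] by (simp add: \<mu>_def power_divide)
    qed
    moreover have "(nmL (%x. \<Sum>j<M+1. c j * e j x))\<^sup>2 = 1"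
      unfolding c2[symmetric] by (rule orthonormal_nm) (use E in auto)
    ultimately have n1: "nmL (%x. \<Sum>j<M+1. c j * ?q j 0 x) = 1"
      by (metis abs_of_nonneg nm_nonneg real_sqrt_abs real_sqrt_one)
    have tr: "(\<Sum>j<M+1. c j * ?q1 j t L) = F 0 t" "(\<Sum>j<M+1. c j * ?q1 j t 0) = F 0 t" for t
      unfolding F_def h_def a_def b_def by (simp_all add: G_bc(3) algebra_simps)
    show ?thesis
      by (intro exI conjI ballI, rule q, rule n1) (use tr small in simp_all)
  qed
  show ?thesis by (rule that[OF k(1) A main])
qed

text \<open>The flat solution serves twice: its initial state is \<open>y0\<close> and it is itself
  the test solution. Its traces, of size \<eta>, must then carry the unit norm of \<open>y0\<close>
  by duality, and the trace of the controlled solution at 0 is bounded by 1 plus the norm of the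
  control, so the control has size at least about 1 / \<eta>.\<close>

theorem control_cost_lower:
  obtains Tmax C c where "Tmax > 0" "C > 0" "c > 0" "!!T. 0 < T ==> T < Tmax ==>
    \<exists>y0\<in>H10 L. \<not> (AE x in leb L. y0 x = 0) & (\<forall>u\<in>l2 (leb T). (\<exists>y. kdv_weak_solution L T y0 u y & (AE x in leb L. y T x = 0)) -->
      nm (leb T) u >= C * exp (c / sqrt T) * nmL y0)"
proof -
  obtain \<kappa> A where K: "\<kappa> > 0" "A >= 1" "!!T. 0 < T ==> T <= \<kappa>\<^sup>2 ==>
    \<exists>p p1 p2 p3. kdv0 T L p p1 p2 p3 & nmL (p 0) = 1 & (\<forall>t\<in>{0..T}. p1 t L = p1 t 0 & \<bar>p1 t 0\<bar> <= A * exp (- \<kappa> / sqrt T))"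
    using flat_solution by blast
  \<comment> \<open>The second entry gives \<open>2 * A <= \<kappa> / sqrt T\<close>, hence \<eta>
    <= 1/2, and with A >= 1 also T <= \<kappa>^2; the first makes \<open>sqrt T\<close> at most
    1.\<close>
  define Tmax where "Tmax = min 1 ((\<kappa> / (2 * A))\<^sup>2)"
  have Tm: "Tmax > 0" using K by (simp add: Tmax_def)
  have main: "\<exists>y0\<in>H10 L. \<not> (AE x in leb L. y0 x = 0) & (\<forall>u\<in>l2 (leb T). (\<exists>y. kdv_weak_solution L T y0 u y & (AE x in leb L. y T x = 0)) -->
      nm (leb T) u >= 1 / (4 * A) * exp (\<kappa> / sqrt T) * nmL y0)" if T: "0 < T" "T < Tmax" for T
  proof -
    have T1: "T <= 1" "T <= (\<kappa> / (2 * A))\<^sup>2" using T by (simp_all add: Tmax_def)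
    have "\<kappa> / (2 * A) <= \<kappa> / 1" using K by (intro divide_left_mono) auto
    then have "(\<kappa> / (2 * A))\<^sup>2 <= \<kappa>\<^sup>2" using K by (intro power_mono) auto
    then have T2: "T <= \<kappa>\<^sup>2" using T1 by linarith
    obtain p p1 p2 p3 where p: "kdv0 T L p p1 p2 p3" "nmL (p 0) = 1" "!!t. t \<in> {0..T} ==> p1 t L = p1 t 0"
      "!!t. t \<in> {0..T} ==> \<bar>p1 t 0\<bar> <= A * exp (- \<kappa> / sqrt T)" using K(3)[OF T(1) T2] by blast
    define \<eta> where "\<eta> = A * exp (- \<kappa> / sqrt T)"
    have eta: "\<eta> > 0" using K by (simp add: \<eta>_def)
    have eta2: "\<eta> <= 1 / 2"
    proof -
      have "sqrt T <= \<kappa> / (2 * A)" using real_sqrt_le_mono[OF T1(2)] K by simp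
      then have "2 * A <= \<kappa> / sqrt T" using K T by (simp add: field_simps)
      also have "\<dots> <= exp (\<kappa> / sqrt T)" by (rule exp_ge_self)
      finally have "2 * A * exp (- \<kappa> / sqrt T) <= exp (\<kappa> / sqrt T) * exp (- \<kappa> / sqrt T)" by (rule mult_right_mono) simp
      also have "\<dots> = 1" by (simp add: exp_add[symmetric])
      finally show ?thesis by (simp add: \<eta>_def)
    qed
    have mem: "0 \<in> {0..T}" "T \<in> {0..T}" using T by auto
    have y0l: "p 0 \<in> l2 (leb L)" by (rule cont_l2[OF kdv_cont(2)[OF p(1) mem(1)]])
    have H: "p 0 \<in> H10 L"
      by (rule c1_0_H10[of L "p 0" "p1 0"])
         (use c3_deriv(1)[OF kdv_c3[OF p(1) mem(1)]] kdv_cont(3)[OF p(1) mem(1)] kdv_bdry[OF p(1) mem(1)] L_pos in \<open>auto simp: c1_0_def\<close>)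
    have nz: "\<not> (AE x in leb L. p 0 x = 0)"
    proof
      assume "AE x in leb L. p 0 x = 0"
      then have "nmL (p 0) = nmL (%_. 0)" by (intro nm_AE_cong l2_meas[OF y0l]) auto
      then show False using p(2) by (simp add: nm_def ip_def)
    qed
    note tc = kdv_trace_cont[OF p(1) L_pos]
    have tn: "nm (leb T) (%t. p1 t 0) <= \<eta>"
    proof -
      have "nm (leb T) (%t. p1 t 0) <= sqrt T * \<eta>" by (rule nm_le_sup[OF tc(1)]) (use p(4) T in \<open>auto simp: \<eta>_def\<close>)
      also have "\<dots> <= 1 * \<eta>" using T1 T eta by (intro mult_right_mono) auto
      finally show ?thesis by simp
    qed
    have "nm (leb T) u >= 1 / (4 * A) * exp (\<kappa> / sqrt T) * nmL (p 0)"
      if u: "u \<in> l2 (leb T)" and y: "kdv_weak_solution L T (p 0) u y" "AE x in leb L. y T x = 0" for u y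
    proof -
      obtain y' v where y': "kdv_weak_solution L T (p 0) u y'" "v \<in> l2 (leb T)" "(nm (leb T) v)\<^sup>2 <= (nmL (p 0))\<^sup>2 + (nm (leb T) u)\<^sup>2"
        "!!q q1 q2 q3. kdv0 T L q q1 q2 q3 ==> ipL (y' T) (q T) - ipL (p 0) (q 0) = ip (leb T) u (%t. q1 t L) - ip (leb T) v (%t. q1 t 0)"
        using closure_solution[OF y0l u T(1)] by blast
      \<comment> \<open>The claim concerns every weak solution, while duality is known for the one
        built by closure; uniqueness identifies them at time T.\<close>
      have "AE x in leb L. y T x = y' T x" by (rule weak_solution_unique[OF y(1) y'(1) T(1) mem(2)])
      then have "AE x in leb L. y' T x = 0" using y(2) by eventually_elim simp
      moreover have "y' T \<in> l2 (leb L)" using y'(1) mem by (auto simp: kdv_weak_solution_def XT_def L2_eq)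
      ultimately have z: "ipL (y' T) (p T) = 0"
        unfolding ip_def by (intro integral_eq_zero_AE) (auto elim: eventually_mono)
      have l: "(%t. p1 t 0) \<in> l2 (leb T)" by (rule cont_l2[OF tc(1)])
      have "ip (leb T) u (%t. p1 t L) = ip (leb T) u (%t. p1 t 0)" by (rule ip_cong_on) (use p(3) in auto)
      then have "1 = ip (leb T) v (%t. p1 t 0) - ip (leb T) u (%t. p1 t 0)"
        \<comment> \<open>Duality with the test solution p, where the final term vanishes and the
          initial term is |p(0)|^2 = 1.\<close>
        using y'(4)[OF p(1)] z p(2) nm_sq[of "leb L" "p 0"] by simp
      also have "\<dots> <= nm (leb T) v * nm (leb T) (%t. p1 t 0) + nm (leb T) u * nm (leb T) (%t. p1 t 0)"
        using ip_le_nm[OF y'(2) l] ip_le_nm[OF u l] by linarith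
      also have "\<dots> <= (1 + nm (leb T) u) * \<eta> + nm (leb T) u * \<eta>"
      proof (intro add_mono mult_mono tn)
        have "(nm (leb T) v)\<^sup>2 <= 1\<^sup>2 + (nm (leb T) u)\<^sup>2" using y'(3) p(2) by simp
        then show "nm (leb T) v <= 1 + nm (leb T) u" by (rule sqrt_add_le[rotated 2]) auto
      qed auto
      finally have "1 <= \<eta> + 2 * (\<eta> * nm (leb T) u)" by (simp add: algebra_simps)
      then have "1 <= 4 * (\<eta> * nm (leb T) u)" using eta2 by linarith
      then have "1 * exp (\<kappa> / sqrt T) <= 4 * (\<eta> * nm (leb T) u) * exp (\<kappa> / sqrt T)" by (rule mult_right_mono) simp
      also have "\<dots> = 4 * A * nm (leb T) u * (exp (- \<kappa> / sqrt T) * exp (\<kappa> / sqrt T))" by (simp add: \<eta>_def mult_ac)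
      also have "exp (- \<kappa> / sqrt T) * exp (\<kappa> / sqrt T) = 1" by (simp add: exp_add[symmetric])
      finally have "exp (\<kappa> / sqrt T) <= 4 * A * nm (leb T) u" by simp
      then show ?thesis using K(2) p(2) by (simp add: divide_le_eq mult_ac)
    qed
    then show ?thesis using H nz by blast
  qed
  show ?thesis by (rule that[OF Tm _ K(1) main]) (use K in auto)
qed

end

theorem theorem1p1:
  fixes L :: real
  assumes "L > 0" and "L \<notin> critical_lengths"
  shows
    "(\<forall>T0>0. \<exists>c1>0. \<exists>C1>0. \<forall>T. 0 < T \<and> T < T0 \<longrightarrow>
       (\<forall>y0\<in>L2 {0<..<L}. \<exists>u\<in>L2 {0<..<T}.
          (\<exists>y. kdv_weak_solution L T y0 u y \<and> (AE x in lebesgue_on {0<..<L}. y T x = 0)) \<and>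
          L2_norm {0<..<T} u \<le> C1 * exp (c1 / T powr (1/2)) * L2_norm {0<..<L} y0))
     \<and>
     (\<exists>Tmax>0. \<forall>T0. 0 < T0 \<and> T0 < Tmax \<longrightarrow>
       (\<exists>c2>0. \<exists>C2>0. \<forall>T. 0 < T \<and> T < T0 \<longrightarrow>
          (\<exists>y0\<in>H10 L. \<not> (AE x in lebesgue_on {0<..<L}. y0 x = 0) \<and>
             (\<forall>u\<in>L2 {0<..<T}.
                (\<exists>y. kdv_weak_solution L T y0 u y \<and> (AE x in lebesgue_on {0<..<L}. y T x = 0)) \<longrightarrow>
                L2_norm {0<..<T} u \<ge> C2 * exp (c2 / T powr (1/2)) * L2_norm {0<..<L} y0))))"
proof -
  interpret noncritical L by unfold_locales (use assms in auto)
  show ?thesis unfolding L2_eq L2_norm_eq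
  proof (intro conjI allI impI)
    fix T0 :: real assume T0: "T0 > 0"
    obtain C c where C: "C > 0" "c > 0" "!!T y0. 0 < T ==> T < T0 ==> y0 \<in> l2 (leb L) ==>
      \<exists>u\<in>l2 (leb T). (\<exists>y. kdv_weak_solution L T y0 u y & (AE x in leb L. y T x = 0)) & nm (leb T) u <= C * exp (c / sqrt T) * nm (leb L) y0"
      using null_control[OF T0] by blast
    show "\<exists>c1>0. \<exists>C1>0. \<forall>T. 0 < T & T < T0 --> (\<forall>y0\<in>l2 (leb L). \<exists>u\<in>l2 (leb T).
          (\<exists>y. kdv_weak_solution L T y0 u y & (AE x in leb L. y T x = 0)) &
          nm (leb T) u <= C1 * exp (c1 / T powr (1/2)) * nm (leb L) y0)"
      by (rule exI[of _ c], rule conjI[OF C(2)], rule exI[of _ C], rule conjI[OF C(1)])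
         (use C(3) in \<open>auto simp: powr_half_sqrt\<close>)
  next
    obtain Tmax C c where C: "Tmax > 0" "C > 0" "c > 0" "!!T. 0 < T ==> T < Tmax ==>
      \<exists>y0\<in>H10 L. \<not> (AE x in leb L. y0 x = 0) & (\<forall>u\<in>l2 (leb T). (\<exists>y. kdv_weak_solution L T y0 u y & (AE x in leb L. y T x = 0)) -->
        nm (leb T) u >= C * exp (c / sqrt T) * nm (leb L) y0)"
      using control_cost_lower by blast
    show "\<exists>Tmax>0. \<forall>T0. 0 < T0 & T0 < Tmax --> (\<exists>c2>0. \<exists>C2>0. \<forall>T. 0 < T & T < T0 -->
          (\<exists>y0\<in>H10 L. \<not> (AE x in leb L. y0 x = 0) & (\<forall>u\<in>l2 (leb T).
             (\<exists>y. kdv_weak_solution L T y0 u y & (AE x in leb L. y T x = 0)) -->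
             nm (leb T) u >= C2 * exp (c2 / T powr (1/2)) * nm (leb L) y0)))"
    proof (rule exI[of _ Tmax], rule conjI[OF C(1)], intro allI impI, rule exI[of _ c], rule conjI[OF C(3)],
        rule exI[of _ C], rule conjI[OF C(2)], intro allI impI)
      fix T0 T assume "0 < T0 & T0 < Tmax" "0 < T & T < T0"
      then have T: "0 < T" "T < Tmax" by auto
      show "\<exists>y0\<in>H10 L. \<not> (AE x in leb L. y0 x = 0) & (\<forall>u\<in>l2 (leb T).
             (\<exists>y. kdv_weak_solution L T y0 u y & (AE x in leb L. y T x = 0)) -->
             nm (leb T) u >= C * exp (c / T powr (1/2)) * nm (leb L) y0)"
        using C(4)[OF T] T(1) by (simp add: powr_half_sqrt)
    qed
  qed
qed

end
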